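(* Let $n\ge 2$, $0<r_1<r_2<\infty$, and let $\mathcal{A}(r_1,r_2)=\mathbb{B}_{r_2}^{n+1}\setminus\mathbb{B}_{r_1}^{n+1}$ be the $(n+1)$-dimensional annulus with the Euclidean metric. Let $\Sigma^n\hookrightarrow\mathcal{A}(r_1,r_2)$ be a compact immersed free boundary minimal hypersurface. Assume that $$|A|^2\le\frac{n^2}{4r_2^2}$$ on $\Sigma$. Then: 1) If $n=2$, $\Sigma^n\hookrightarrow\mathcal{A}(r_1,r_2)$ is a totally geodesic annulus. 2) If $n\ge3$ and $r_1^2<\frac{4(n-1)}{n^2}r_2^2$, $\Sigma^n\hookrightarrow\mathcal{A}(r_1,r_2)$ is a totally geodesic annulus. 3) If $n\ge 3$ and $r_1^2=\frac{4(n-1)}{n^2}r_2^2$, then either $\Sigma^n\hookrightarrow\mathcal{A}(r_1,r_2)$ is a totally geodesic annulus or $\Sigma^n$ is a trunk of a cone whose support cone is the cone over a Clifford torus in $\mathbb{S}^n$.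
   Context: $\mathbb{B}_r^{n+1}$ is the Euclidean ball of radius $r$ centred at the origin of $\mathbb{R}^{n+1}$; the boundary of the annulus consists of the two spheres of radii $r_1$ and $r_2$. $|A|^2$ is the squared norm of the second fundamental form of $\Sigma$. "Free boundary" means that $\partial\Sigma\subset\partial\mathcal{A}(r_1,r_2)$ and $\Sigma$ meets $\partial\mathcal{A}(r_1,r_2)$ orthogonally along $\partial\Sigma$. For a hypersurface $\Gamma^{n-1}\subset\mathbb{S}^n$ of the unit sphere, the cone over $\Gamma$ is $C_\Gamma=\{\lambda y: y\in\Gamma,\ \lambda\in(0,\infty)\}$, and its trunk in the annulus is $C_\Gamma\cap\mathcal{A}(r_1,r_2)$. The Clifford tori in $\mathbb{S}^n$ ($n\ge3$) are, up to rigid motion, $\mathbb{T}_{m,n}=\mathbb{S}^m_{\lambda_1}\times\mathbb{S}^{(n-1)-m}_{\lambda_2}$ with radii $\lambda_1=\sqrt{m/(n-1)}$, $\lambda_2=\sqrt{((n-1)-m)/(n-1)}$, $1\le m\le n-2$. *)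

theory Defs
  imports "HOL-Analysis.Analysis"
begin

section \<open>Smooth maps\<close>

text \<open>On an open set \<open>W\<close>, \<open>Ck_on k f W\<close> says that \<open>f\<close> is \<open>k\<close> times continuously
  differentiable: in finite dimension this may be tested on the directional derivatives
  \<open>x \<mapsto> Df(x) v\<close>.\<close>

fun Ck_on :: "nat \<Rightarrow> ('a::euclidean_space \<Rightarrow> 'b::euclidean_space) \<Rightarrow> 'a set \<Rightarrow> bool" where
  "Ck_on 0 f W \<longleftrightarrow> continuous_on W f"
| "Ck_on (Suc k) f W \<longleftrightarrow>
     (\<forall>x\<in>W. f differentiable (at x)) \<and>
     (\<forall>v. Ck_on k (\<lambda>x. frechet_derivative f (at x) v) W)"

text \<open>Smoothness on an arbitrary set: local extendability to a smooth map on an open set.\<close>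

definition smooth_on :: "'a::euclidean_space set \<Rightarrow> ('a \<Rightarrow> 'b::euclidean_space) \<Rightarrow> bool" where
  "smooth_on S f \<longleftrightarrow>
     (\<forall>x\<in>S. \<exists>W g. open W \<and> x \<in> W \<and> (\<forall>k. Ck_on k g W) \<and> (\<forall>y\<in>W \<inter> S. g y = f y))"


section \<open>Compact manifolds with boundary\<close>

text \<open>The model half-space \<open>{x. 0 \<le> x\<^sub>i}\<close>; which coordinate \<open>i\<close> is singled out is immaterial.\<close>

definition bd_coord :: "'n::finite" where
  "bd_coord = (SOME i. True)"

definition half_space :: "(real ^ 'n) set" where
  "half_space = {x. 0 \<le> x $ bd_coord}"

type_synonym ('p, 'n) chart = "'p set \<times> ('p \<Rightarrow> real ^ 'n)"

text \<open>A chart \<open>(U, \<phi>)\<close> is a homeomorphism of an open set \<open>U\<close> of the manifold onto a relatively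
  open subset of the half-space; its inverse is \<open>inv_into U \<phi>\<close>.\<close>

definition chart_on :: "'p topology \<Rightarrow> ('p, 'n::finite) chart \<Rightarrow> bool" where
  "chart_on X = (\<lambda>(U, \<phi>). openin X U \<and> openin (top_of_set half_space) (\<phi> ` U) \<and>
     homeomorphic_map (subtopology X U) (top_of_set (\<phi> ` U)) \<phi>)"

definition smooth_atlas :: "'p topology \<Rightarrow> ('p, 'n::finite) chart set \<Rightarrow> bool" where
  "smooth_atlas X \<A> \<longleftrightarrow>
     (\<forall>c\<in>\<A>. chart_on X c) \<and> (\<Union>(U, \<phi>)\<in>\<A>. U) = topspace X \<and>
     (\<forall>(U, \<phi>)\<in>\<A>. \<forall>(V, \<theta>)\<in>\<A>. smooth_on (\<phi> ` (U \<inter> V)) (\<theta> \<circ> inv_into U \<phi>))"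

definition manifold_with_boundary :: "'p topology \<Rightarrow> ('p, 'n::finite) chart set \<Rightarrow> bool" where
  "manifold_with_boundary X \<A> \<longleftrightarrow>
     Hausdorff_space X \<and> second_countable X \<and> smooth_atlas X \<A>"

definition manifold_boundary :: "('p, 'n::finite) chart set \<Rightarrow> 'p set" where
  "manifold_boundary \<A> = {p. \<exists>(U, \<phi>)\<in>\<A>. p \<in> U \<and> \<phi> p $ bd_coord = 0}"


section \<open>Local geometry of a parametrized hypersurface\<close>

text \<open>Here \<open>\<psi>\<close> is defined on a relatively open subset \<open>S\<close> of the half-space. Derivatives are taken
  within \<open>S\<close>, so that they make sense, and are unique, at boundary points too.\<close>

definition pderiv_within ::
  "(real ^ 'n::finite) set \<Rightarrow> (real ^ 'n \<Rightarrow> real ^ 'k::finite) \<Rightarrow> 'n \<Rightarrow> real ^ 'n \<Rightarrow> real ^ 'k" where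
  "pderiv_within S \<psi> i x = frechet_derivative \<psi> (at x within S) (axis i 1)"

definition metric_matrix ::
  "(real ^ 'n::finite) set \<Rightarrow> (real ^ 'n \<Rightarrow> real ^ 'k::finite) \<Rightarrow> real ^ 'n \<Rightarrow> real ^ 'n ^ 'n" where
  "metric_matrix S \<psi> x = (\<chi> i j. pderiv_within S \<psi> i x \<bullet> pderiv_within S \<psi> j x)"

text \<open>In codimension one the unit normal is determined up to sign. No continuous choice (hence no
  orientability) is needed: all the conditions below are insensitive to the sign.\<close>

definition unit_normal ::
  "(real ^ 'n::finite) set \<Rightarrow> (real ^ 'n \<Rightarrow> real ^ 'k::finite) \<Rightarrow> real ^ 'n \<Rightarrow> real ^ 'k" where
  "unit_normal S \<psi> x = (SOME \<nu>. norm \<nu> = 1 \<and> (\<forall>i. orthogonal (pderiv_within S \<psi> i x) \<nu>))"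

definition second_form ::
  "(real ^ 'n::finite) set \<Rightarrow> (real ^ 'n \<Rightarrow> real ^ 'k::finite) \<Rightarrow> real ^ 'n \<Rightarrow> real ^ 'n ^ 'n" where
  "second_form S \<psi> x =
     (\<chi> i j. pderiv_within S (pderiv_within S \<psi> i) j x \<bullet> unit_normal S \<psi> x)"

text \<open>\<open>H = g\<^sup>i\<^sup>j h\<^sub>i\<^sub>j\<close> and \<open>|A|\<^sup>2 = g\<^sup>i\<^sup>k g\<^sup>j\<^sup>l h\<^sub>i\<^sub>j h\<^sub>k\<^sub>l\<close>.\<close>

definition mean_curvature ::
  "(real ^ 'n::finite) set \<Rightarrow> (real ^ 'n \<Rightarrow> real ^ 'k::finite) \<Rightarrow> real ^ 'n \<Rightarrow> real" where
  "mean_curvature S \<psi> x =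
     (let G = matrix_inv (metric_matrix S \<psi> x); h = second_form S \<psi> x
      in \<Sum>i\<in>UNIV. \<Sum>j\<in>UNIV. G $ i $ j * h $ i $ j)"

definition second_form_sqnorm ::
  "(real ^ 'n::finite) set \<Rightarrow> (real ^ 'n \<Rightarrow> real ^ 'k::finite) \<Rightarrow> real ^ 'n \<Rightarrow> real" where
  "second_form_sqnorm S \<psi> x =
     (let G = matrix_inv (metric_matrix S \<psi> x); h = second_form S \<psi> x
      in \<Sum>i\<in>UNIV. \<Sum>j\<in>UNIV. \<Sum>k\<in>UNIV. \<Sum>l\<in>UNIV.
           G $ i $ k * G $ j $ l * h $ i $ j * h $ k $ l)"


section \<open>Immersed hypersurfaces\<close>

text \<open>A property of (domain, local parametrization, point), imposed at every point of the
  manifold in every chart of the atlas.\<close>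

definition in_all_charts ::
  "('p, 'n::finite) chart set \<Rightarrow> ('p \<Rightarrow> real ^ 'k::finite) \<Rightarrow> 'p set \<Rightarrow>
     ((real ^ 'n) set \<Rightarrow> (real ^ 'n \<Rightarrow> real ^ 'k) \<Rightarrow> real ^ 'n \<Rightarrow> bool) \<Rightarrow> bool" where
  "in_all_charts \<A> F N P \<longleftrightarrow>
     (\<forall>(U, \<phi>)\<in>\<A>. \<forall>p\<in>U \<inter> N. P (\<phi> ` U) (F \<circ> inv_into U \<phi>) (\<phi> p))"

definition smooth_immersion ::
  "('p, 'n::finite) chart set \<Rightarrow> ('p \<Rightarrow> real ^ 'k::finite) \<Rightarrow> bool" where
  "smooth_immersion \<A> F \<longleftrightarrow>
     (\<forall>(U, \<phi>)\<in>\<A>. smooth_on (\<phi> ` U) (F \<circ> inv_into U \<phi>)) \<and>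
     in_all_charts \<A> F UNIV (\<lambda>S \<psi> x. inj (frechet_derivative \<psi> (at x within S)))"

definition annulus :: "real \<Rightarrow> real \<Rightarrow> (real ^ 'k::finite) set" where
  "annulus r1 r2 = cball 0 r2 - ball 0 r1"

definition compact_immersed_hypersurface ::
  "(real ^ 'k::finite) set \<Rightarrow> 'p topology \<Rightarrow> ('p, 'n::finite) chart set \<Rightarrow> ('p \<Rightarrow> real ^ 'k) \<Rightarrow> bool"
  where
  "compact_immersed_hypersurface N X \<A> F \<longleftrightarrow>
     CARD('k) = CARD('n) + 1 \<and>
     manifold_with_boundary X \<A> \<and> compact_space X \<and> connected_space X \<and> topspace X \<noteq> {} \<and>
     smooth_immersion \<A> F \<and> F ` topspace X \<subseteq> N"

text \<open>The boundary of the annulus consists of spheres centred at the origin, so that its normal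
  line at \<open>\<psi> x\<close> is spanned by \<open>\<psi> x\<close>.\<close>

definition free_boundary ::
  "real \<Rightarrow> real \<Rightarrow> ('p, 'n::finite) chart set \<Rightarrow> ('p \<Rightarrow> real ^ 'k::finite) \<Rightarrow> bool" where
  "free_boundary r1 r2 \<A> F \<longleftrightarrow>
     F ` manifold_boundary \<A> \<subseteq> frontier (annulus r1 r2) \<and>
     in_all_charts \<A> F (manifold_boundary \<A>) (\<lambda>S \<psi> x. orthogonal (unit_normal S \<psi> x) (\<psi> x))"

definition minimal :: "('p, 'n::finite) chart set \<Rightarrow> ('p \<Rightarrow> real ^ 'k::finite) \<Rightarrow> bool" where
  "minimal \<A> F \<longleftrightarrow> in_all_charts \<A> F UNIV (\<lambda>S \<psi> x. mean_curvature S \<psi> x = 0)"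

definition second_form_sqnorm_le ::
  "('p, 'n::finite) chart set \<Rightarrow> ('p \<Rightarrow> real ^ 'k::finite) \<Rightarrow> real \<Rightarrow> bool" where
  "second_form_sqnorm_le \<A> F c \<longleftrightarrow>
     in_all_charts \<A> F UNIV (\<lambda>S \<psi> x. second_form_sqnorm S \<psi> x \<le> c)"

definition totally_geodesic :: "('p, 'n::finite) chart set \<Rightarrow> ('p \<Rightarrow> real ^ 'k::finite) \<Rightarrow> bool" where
  "totally_geodesic \<A> F \<longleftrightarrow> in_all_charts \<A> F UNIV (\<lambda>S \<psi> x. second_form S \<psi> x = 0)"

text \<open>The immersion need not be injective: for \<open>n = 2\<close> a finite covering of a flat annulus is again
  a free boundary minimal immersion of an annulus. Hence the flat annulus is the image of \<open>F\<close>,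
  while \<open>X\<close> is separately required to be an \<open>n\<close>-dimensional annulus.\<close>

definition totally_geodesic_annulus ::
  "real \<Rightarrow> real \<Rightarrow> 'p topology \<Rightarrow> ('p, 'n::finite) chart set \<Rightarrow> ('p \<Rightarrow> real ^ 'k::finite) \<Rightarrow> bool"
  where
  "totally_geodesic_annulus r1 r2 X \<A> F \<longleftrightarrow>
     totally_geodesic \<A> F \<and>
     X homeomorphic_space top_of_set (annulus r1 r2 :: (real ^ 'n) set) \<and>
     (\<exists>a. a \<noteq> 0 \<and> F ` topspace X = {x. a \<bullet> x = 0} \<inter> annulus r1 r2)"


section \<open>Cones over Clifford tori\<close>

definition cone_over :: "(real ^ 'k::finite) set \<Rightarrow> (real ^ 'k) set" where
  "cone_over \<Gamma> = {t *\<^sub>R y | t y. y \<in> \<Gamma> \<and> 0 < t}"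

text \<open>With \<open>CARD('k) = n + 1\<close>, the coordinates in \<open>I\<close> span the factor \<open>\<real>\<^sup>m\<^sup>+\<^sup>1\<close> that contains the sphere
  of dimension \<open>m\<close>, and the other coordinates span \<open>\<real>\<^sup>n\<^sup>-\<^sup>m\<close>, which contains the sphere of dimension
  \<open>(n - 1) - m\<close>.\<close>

definition clifford_torus :: "(real ^ 'k::finite) set \<Rightarrow> bool" where
  "clifford_torus \<Gamma> \<longleftrightarrow>
     (\<exists>(n::nat) m (I :: 'k set) (Q :: real ^ 'k \<Rightarrow> real ^ 'k).
        CARD('k) = n + 1 \<and> 1 \<le> m \<and> m + 2 \<le> n \<and> card I = m + 1 \<and>
        orthogonal_transformation Q \<and>
        \<Gamma> = Q ` {x. sqrt (\<Sum>i\<in>I. (x $ i)\<^sup>2) = sqrt (real m / (real n - 1)) \<and>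
                    sqrt (\<Sum>i\<in>-I. (x $ i)\<^sup>2) = sqrt ((real n - 1 - real m) / (real n - 1))})"

definition clifford_cone_trunk ::
  "real \<Rightarrow> real \<Rightarrow> 'p topology \<Rightarrow> ('p \<Rightarrow> real ^ 'k::finite) \<Rightarrow> bool" where
  "clifford_cone_trunk r1 r2 X F \<longleftrightarrow>
     (\<exists>\<Gamma>. clifford_torus \<Gamma> \<and> F ` topspace X = cone_over \<Gamma> \<inter> annulus r1 r2)"

end

theory Submission
  imports Defs
begin

text \<open>Let \<open>\<nu>\<close> be a local unit normal. The support function \<open>u = \<langle>x, \<nu>\<rangle>\<close> satisfies \<open>\<Delta>u = - |A|\<^sup>2 u\<close> and
  vanishes on the boundary, and the pinching makes \<open>exp (- n |x|\<^sup>2 / (4 r\<^sub>2\<^sup>2))\<close> a positive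
  supersolution of the same equation; hence \<open>u = 0\<close> and \<open>\<Sigma>\<close> is a piece of a cone.

  On a minimal cone \<open>f = |A|\<^sup>2 |x|\<^sup>2\<close> is constant along rays, so evaluating the pinching at the inner
  sphere gives \<open>f \<le> n\<^sup>2 r\<^sub>1\<^sup>2 / (4 r\<^sub>2\<^sup>2) \<le> n - 1\<close>, while Simons' identity gives
  \<open>\<Delta>f \<ge> 2 |A|\<^sup>2 (n - 1 - f)\<close>. By the strong maximum principle
  \<open>f = 0\<close> or \<open>f = n - 1\<close>.

  If \<open>f = 0\<close> then \<open>\<nu>\<close> is constant up to sign and \<open>\<Sigma>\<close> covers a flat annulus. This covering is
  trivial for \<open>n \<ge> 3\<close>, and for \<open>n = 2\<close> its total space is again an annulus.

  If \<open>f = n - 1\<close> then equality in Simons' identity determines \<open>\<nabla>A\<close>, and it follows that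
  \<open>T = |x| A + |x|\<^sup>-\<^sup>1 (x \<otimes> \<nu> + \<nu> \<otimes> x) + \<kappa> \<nu> \<otimes> \<nu>\<close> is a constant matrix with \<open>T\<^sup>2 = \<kappa> T + 1\<close> and
  \<open>tr T = \<kappa>\<close>. The cone is the quadric \<open>\<langle>x, T x\<rangle> = 0\<close>, and the two eigenvalues and their
  multiplicities identify it as the cone over a Clifford torus.\<close>

section \<open>Smooth functions on open sets\<close>

text \<open>The constant in the pinching hypothesis is a maximum. For
  \<open>exp (- c |x|^2 / 2)\<close> the supersolution inequality on |x| \<le> r2 follows from |A|^2
  \<le> c n - c^2 r2^2, and the right side is largest at c = n / (2 r2^2), with value n^2 / (4
  r2^2). The threshold 4 (n - 1) / n^2 is the condition n^2 r1^2 / (4 r2^2) < n - 1; for n = 2 it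
  reads r1 < r2.

  The hypersurface need be neither orientable nor embedded, so \<nu> exists only locally and up to
  sign. Global functions are therefore built from |A|^2 and u^2, and locally constant objects that
  change sign with \<nu> are glued up to sign only. Derivatives on a patch are taken along the
  tangential projections of the ambient basis vectors: tensors become arrays of ambient components,
  free of Christoffel symbols and comparable between charts.

  The curvature computations take place at interior points. The free boundary condition controls u
  near the boundary; for |A|^2 |x|^2, whose boundary behaviour is not prescribed, penalty terms that
  blow up at the spheres keep the maxima inside.\<close>

definition Cinf_on :: "('a::euclidean_space \<Rightarrow> 'b::euclidean_space) \<Rightarrow> 'a set \<Rightarrow> bool" where
  "Cinf_on f W \<longleftrightarrow> (\<forall>k. Ck_on k f W)"

text \<open>\<open>Ck_on\<close> differentiates at points of \<open>W\<close> in the full space.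
  Only for open \<open>W\<close> do the values on \<open>W\<close> determine these derivatives,
  which is why the closure lemmas below carry \<open>open W\<close>.\<close>

lemma Ck_on_cong_imp:
  assumes "open W" "\<And>x. x \<in> W \<Longrightarrow> f x = g x" "Ck_on k f W"
  shows "Ck_on k g W"
  using assms(2,3)
proof (induction k arbitrary: f g)
  case 0
  then show ?case using continuous_on_cong by force
next
  case (Suc k)
  have d: "g differentiable (at x)" if "x \<in> W" for x
  proof -
    have "f differentiable (at x)" using Suc.prems that by auto
    then obtain f' where "(f has_derivative f') (at x)" unfolding differentiable_def by blast
    from has_derivative_transform_within_open[OF this assms(1) that Suc.prems(1)]
    show ?thesis unfolding differentiable_def by blast
  qed
  have "frechet_derivative f (at x) = frechet_derivative g (at x)" if "x \<in> W" for x
  proof (rule frechet_derivative_transform_within_open[OF _ assms(1) that Suc.prems(1)])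
    show "f differentiable (at x)" using Suc.prems(2) that by simp
  qed
  then have eq: "frechet_derivative f (at x) v = frechet_derivative g (at x) v" if "x \<in> W" for x v
    using that by simp
  have "Ck_on k (\<lambda>x. frechet_derivative g (at x) v) W" for v
  proof (rule Suc.IH[OF eq])
    show "Ck_on k (\<lambda>x. frechet_derivative f (at x) v) W" using Suc.prems(2) by simp
  qed
  with d show ?case by simp
qed

lemma Ck_on_SucD:
  assumes "Ck_on (Suc k) f W"
  shows "x \<in> W \<Longrightarrow> (f has_derivative frechet_derivative f (at x)) (at x)"
    and "Ck_on k (\<lambda>x. frechet_derivative f (at x) v) W"
  using assms frechet_derivative_works by auto

lemma Ck_on_Suc_imp: "Ck_on (Suc k) f W \<Longrightarrow> Ck_on k f W"
proof (induction k arbitrary: f)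
  case 0
  then show ?case
    by (auto intro!: continuous_at_imp_continuous_on differentiable_imp_continuous_within)
next
  case (Suc k)
  then show ?case by (metis Ck_on.simps(2))
qed

lemma Ck_on_subset: "Ck_on k f W \<Longrightarrow> V \<subseteq> W \<Longrightarrow> Ck_on k f V"
  by (induction k arbitrary: f) (auto intro: continuous_on_subset)

lemma Ck_on_local:
  assumes "\<And>x. x \<in> W \<Longrightarrow> \<exists>V. open V \<and> x \<in> V \<and> Ck_on k f V"
  shows "Ck_on k f W"
  using assms
proof (induction k arbitrary: f)
  case 0
  have "continuous (at x) f" if x: "x \<in> W" for x
    by (metis "0" Ck_on.simps(1) continuous_on_interior interior_open x)
  then show ?case by (auto intro: continuous_at_imp_continuous_on)
next
  case (Suc k)
  have "f differentiable (at x)" if "x \<in> W" for x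
    using Suc.prems[OF that] by auto
  moreover have "Ck_on k (\<lambda>x. frechet_derivative f (at x) v) W" for v
  proof (rule Suc.IH)
    fix x assume "x \<in> W"
    from Suc.prems[OF this] show "\<exists>V. open V \<and> x \<in> V \<and> Ck_on k (\<lambda>x. frechet_derivative f (at x) v) V"
      by auto
  qed
  ultimately show ?case by simp
qed

lemma Cinf_on_differentiable: "Cinf_on f W \<Longrightarrow> x \<in> W \<Longrightarrow> f differentiable (at x)"
  unfolding Cinf_on_def by (metis Ck_on.simps(2))

lemma Cinf_on_deriv [intro]: "Cinf_on f W \<Longrightarrow> Cinf_on (\<lambda>x. frechet_derivative f (at x) v) W"
  unfolding Cinf_on_def by (metis Ck_on.simps(2))

lemma Cinf_on_has_derivative:
  "Cinf_on f W \<Longrightarrow> x \<in> W \<Longrightarrow> (f has_derivative frechet_derivative f (at x)) (at x)"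
  using Cinf_on_differentiable frechet_derivative_works by blast

lemma Cinf_on_continuous: "Cinf_on f W \<Longrightarrow> continuous_on W f"
  unfolding Cinf_on_def by (metis Ck_on.simps(1))

lemma Cinf_on_cong:
  "open W \<Longrightarrow> (\<And>x. x \<in> W \<Longrightarrow> f x = g x) \<Longrightarrow> Cinf_on f W \<longleftrightarrow> Cinf_on g W"
  unfolding Cinf_on_def by (metis Ck_on_cong_imp)

lemma Cinf_on_cong_imp:
  "open W \<Longrightarrow> Cinf_on f W \<Longrightarrow> (\<And>x. x \<in> W \<Longrightarrow> g x = f x) \<Longrightarrow> Cinf_on g W"
  unfolding Cinf_on_def by (metis Ck_on_cong_imp)

lemma Cinf_on_subset: "Cinf_on f W \<Longrightarrow> V \<subseteq> W \<Longrightarrow> Cinf_on f V"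
  unfolding Cinf_on_def by (metis Ck_on_subset)

lemma Cinf_on_local:
  "(\<And>x. x \<in> W \<Longrightarrow> \<exists>V. open V \<and> x \<in> V \<and> Cinf_on f V) \<Longrightarrow> Cinf_on f W"
  unfolding Cinf_on_def by (metis Ck_on_local)

section \<open>Closure properties of smooth functions\<close>

lemma Ck_on_const [simp]: "Ck_on k (\<lambda>x. c) W"
  by (induction k arbitrary: c) auto

lemma Cinf_on_const [simp, intro]: "Cinf_on (\<lambda>x. c) W"
  by (simp add: Cinf_on_def)

lemma Ck_on_bounded_linear:
  assumes "bounded_linear h" "open W" "Ck_on k f W"
  shows "Ck_on k (\<lambda>x. h (f x)) W"
  using assms(3)
proof (induction k arbitrary: f)
  case 0
  then show ?case using assms(1) bounded_linear.continuous_on by auto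
next
  case (Suc k)
  have hd: "((\<lambda>x. h (f x)) has_derivative (\<lambda>v. h (frechet_derivative f (at x) v))) (at x)" if "x \<in> W" for x
    by (intro bounded_linear.has_derivative[OF assms(1)] Ck_on_SucD(1)[OF Suc.prems that])
  have fd: "frechet_derivative (\<lambda>x. h (f x)) (at x) v = h (frechet_derivative f (at x) v)" if "x \<in> W" for x v
    by (simp add: frechet_derivative_at[OF hd[OF that], symmetric])
  have "Ck_on k (\<lambda>x. frechet_derivative (\<lambda>x. h (f x)) (at x) v) W" for v
    by (rule Ck_on_cong_imp[OF assms(2) fd[symmetric] Suc.IH[OF Ck_on_SucD(2)[OF Suc.prems]]])
  then show ?case using hd unfolding differentiable_def Ck_on.simps by blast
qed

lemma Cinf_on_bounded_linear:
  "bounded_linear h \<Longrightarrow> open W \<Longrightarrow> Cinf_on f W \<Longrightarrow> Cinf_on (\<lambda>x. h (f x)) W"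
  by (simp add: Cinf_on_def Ck_on_bounded_linear)

lemma Ck_on_add:
  assumes "open W" "Ck_on k f W" "Ck_on k g W"
  shows "Ck_on k (\<lambda>x. f x + g x) W"
  using assms(2,3)
proof (induction k arbitrary: f g)
  case 0
  then show ?case by (auto intro: continuous_on_add)
next
  case (Suc k)
  have hd: "((\<lambda>x. f x + g x) has_derivative
      (\<lambda>v. frechet_derivative f (at x) v + frechet_derivative g (at x) v)) (at x)" if "x \<in> W" for x
    by (intro has_derivative_add Ck_on_SucD(1)[OF Suc.prems(1) that] Ck_on_SucD(1)[OF Suc.prems(2) that])
  have fd: "frechet_derivative (\<lambda>x. f x + g x) (at x) v
      = frechet_derivative f (at x) v + frechet_derivative g (at x) v" if "x \<in> W" for x v
    by (simp add: frechet_derivative_at[OF hd[OF that], symmetric])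
  have "Ck_on k (\<lambda>x. frechet_derivative (\<lambda>x. f x + g x) (at x) v) W" for v
    by (rule Ck_on_cong_imp[OF assms(1) fd[symmetric]
          Suc.IH[OF Ck_on_SucD(2)[OF Suc.prems(1)] Ck_on_SucD(2)[OF Suc.prems(2)]]])
  then show ?case using hd unfolding differentiable_def Ck_on.simps by blast
qed

lemma Cinf_on_add [intro]:
  "open W \<Longrightarrow> Cinf_on f W \<Longrightarrow> Cinf_on g W \<Longrightarrow> Cinf_on (\<lambda>x. f x + g x) W"
  by (simp add: Cinf_on_def Ck_on_add)

lemma Cinf_on_uminus [intro]: "open W \<Longrightarrow> Cinf_on f W \<Longrightarrow> Cinf_on (\<lambda>x. - f x) W"
  by (rule Cinf_on_bounded_linear[OF bounded_linear_minus[OF bounded_linear_ident]])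

lemma Cinf_on_diff [intro]:
  "open W \<Longrightarrow> Cinf_on f W \<Longrightarrow> Cinf_on g W \<Longrightarrow> Cinf_on (\<lambda>x. f x - g x) W"
  using Cinf_on_add[of W f "\<lambda>x. - g x"] Cinf_on_uminus[of W g] by simp

lemma Cinf_on_sum [intro]:
  assumes "open W" "\<And>i. i \<in> I \<Longrightarrow> Cinf_on (f i) W"
  shows "Cinf_on (\<lambda>x. \<Sum>i\<in>I. f i x) W"
  using assms(2) by (induction I rule: infinite_finite_induct) (auto intro: assms(1))

lemma Ck_on_scaleR:
  fixes c :: "'a::euclidean_space \<Rightarrow> real"
  assumes "open W" "Ck_on k c W" "Ck_on k f W"
  shows "Ck_on k (\<lambda>x. c x *\<^sub>R f x) W"
  using assms(2,3)
proof (induction k arbitrary: c f)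
  case 0
  then show ?case by (auto intro: continuous_on_scaleR)
next
  case (Suc k)
  have hd: "((\<lambda>x. c x *\<^sub>R f x) has_derivative
      (\<lambda>v. c x *\<^sub>R frechet_derivative f (at x) v + frechet_derivative c (at x) v *\<^sub>R f x)) (at x)"
    if "x \<in> W" for x
    by (intro has_derivative_scaleR Ck_on_SucD(1)[OF Suc.prems(1) that] Ck_on_SucD(1)[OF Suc.prems(2) that])
  have fd: "frechet_derivative (\<lambda>x. c x *\<^sub>R f x) (at x) v
      = c x *\<^sub>R frechet_derivative f (at x) v + frechet_derivative c (at x) v *\<^sub>R f x" if "x \<in> W" for x v
    by (simp add: frechet_derivative_at[OF hd[OF that], symmetric])
  have ck: "Ck_on k (\<lambda>x. c x *\<^sub>R frechet_derivative f (at x) v + frechet_derivative c (at x) v *\<^sub>R f x) W"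
    for v
    by (intro Ck_on_add[OF assms(1)] Suc.IH Ck_on_SucD(2)[OF Suc.prems(1)] Ck_on_SucD(2)[OF Suc.prems(2)]
        Ck_on_Suc_imp[OF Suc.prems(1)] Ck_on_Suc_imp[OF Suc.prems(2)])
  have "Ck_on k (\<lambda>x. frechet_derivative (\<lambda>x. c x *\<^sub>R f x) (at x) v) W" for v
    by (rule Ck_on_cong_imp[OF assms(1) fd[symmetric] ck])
  then show ?case using hd unfolding differentiable_def Ck_on.simps by blast
qed

lemma Cinf_on_scaleR [intro]:
  fixes c :: "'a::euclidean_space \<Rightarrow> real"
  shows "open W \<Longrightarrow> Cinf_on c W \<Longrightarrow> Cinf_on f W \<Longrightarrow> Cinf_on (\<lambda>x. c x *\<^sub>R f x) W"
  by (simp add: Cinf_on_def Ck_on_scaleR)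

lemma Cinf_on_mult [intro]:
  fixes c f :: "'a::euclidean_space \<Rightarrow> real"
  shows "open W \<Longrightarrow> Cinf_on c W \<Longrightarrow> Cinf_on f W \<Longrightarrow> Cinf_on (\<lambda>x. c x * f x) W"
  using Cinf_on_scaleR[of W c f] by simp

lemma Cinf_on_prod [intro]:
  fixes f :: "'i \<Rightarrow> 'a::euclidean_space \<Rightarrow> real"
  assumes "open W" "\<And>i. i \<in> I \<Longrightarrow> Cinf_on (f i) W"
  shows "Cinf_on (\<lambda>x. \<Prod>i\<in>I. f i x) W"
  using assms(2) by (induction I rule: infinite_finite_induct) (auto intro: assms(1))

lemma Cinf_on_inner_const [intro]: "open W \<Longrightarrow> Cinf_on f W \<Longrightarrow> Cinf_on (\<lambda>x. f x \<bullet> b) W"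
  by (rule Cinf_on_bounded_linear[OF bounded_linear_inner_left])

lemma Cinf_on_inner [intro]:
  fixes f g :: "'a::euclidean_space \<Rightarrow> 'b::euclidean_space"
  assumes "open W" "Cinf_on f W" "Cinf_on g W"
  shows "Cinf_on (\<lambda>x. f x \<bullet> g x) W"
  by (subst euclidean_inner) (intro Cinf_on_sum Cinf_on_mult Cinf_on_inner_const assms)

lemma Cinf_on_vec_nth [intro]:
  fixes f :: "'a::euclidean_space \<Rightarrow> real ^ 'm"
  shows "open W \<Longrightarrow> Cinf_on f W \<Longrightarrow> Cinf_on (\<lambda>x. f x $ i) W"
  by (rule Cinf_on_bounded_linear[OF bounded_linear_vec_nth])

lemma Cinf_on_ident [simp, intro]: "Cinf_on (\<lambda>x. x) W"
  unfolding Cinf_on_def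
proof
  fix k show "Ck_on k (\<lambda>x. x) W" by (cases k) auto
qed

lemma Cinf_on_vec_lambda [intro]:
  fixes f :: "'m::finite \<Rightarrow> 'a::euclidean_space \<Rightarrow> real"
  assumes "open W" "\<And>i. Cinf_on (f i) W"
  shows "Cinf_on (\<lambda>x. \<chi> i. f i x) W"
proof -
  have "(\<chi> i. f i x) = (\<Sum>i\<in>UNIV. f i x *\<^sub>R axis i 1)" for x
    using basis_expansion[of "\<chi> i. f i x"] by (simp add: scalar_mult_eq_scaleR)
  then show ?thesis by (simp only:) (intro Cinf_on_sum Cinf_on_scaleR Cinf_on_const assms)
qed

text \<open>A bootstrap: the derivative of \<open>g o f\<close> is \<open>g' o f\<close> times that
  of \<open>f\<close>, so regularity of order k passes to order k + 1 as soon as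
  \<open>g' o f\<close> is as regular as \<open>g o f\<close> itself. This fits exp, where g' = g,
  the reciprocal, where g' = - g^2, and the logarithm, where \<open>g' o f\<close> is already known
  to be smooth.\<close>

lemma Cinf_on_real_comp:
  fixes f :: "'a::euclidean_space \<Rightarrow> real"
  assumes W: "open W" and f: "Cinf_on f W"
    and g: "\<And>x. x \<in> W \<Longrightarrow> (g has_real_derivative g' (f x)) (at (f x))"
    and g': "\<And>k. Ck_on k (\<lambda>x. g (f x)) W \<Longrightarrow> Ck_on k (\<lambda>x. g' (f x)) W"
  shows "Cinf_on (\<lambda>x. g (f x)) W"
proof -
  have hd: "((\<lambda>x. g (f x)) has_derivative (\<lambda>v. g' (f x) * frechet_derivative f (at x) v)) (at x)"
    if "x \<in> W" for x
    using has_derivative_compose[OF Cinf_on_has_derivative[OF f that]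
        g[OF that, unfolded has_field_derivative_def]] by (simp add: mult.commute)
  have "Ck_on k (\<lambda>x. g (f x)) W" for k
  proof (induction k)
    case 0
    have "continuous (at x) (\<lambda>x. g (f x))" if "x \<in> W" for x
      using hd[OF that] has_derivative_continuous by blast
    then show ?case by (auto intro!: continuous_at_imp_continuous_on)
  next
    case (Suc k)
    have ck: "Ck_on k (\<lambda>x. g' (f x) *\<^sub>R frechet_derivative f (at x) v) W" for v
      using f by (intro Ck_on_scaleR[OF W] g'[OF Suc] Ck_on_SucD(2)) (simp add: Cinf_on_def del: Ck_on.simps)
    have fd: "frechet_derivative (\<lambda>x. g (f x)) (at x) v = g' (f x) *\<^sub>R frechet_derivative f (at x) v"
      if "x \<in> W" for x v
      using frechet_derivative_at[OF hd[OF that]] by (metis real_scaleR_def)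
    have "Ck_on k (\<lambda>x. frechet_derivative (\<lambda>x. g (f x)) (at x) v) W" for v
      by (rule Ck_on_cong_imp[OF W fd[symmetric] ck])
    then show ?case using hd unfolding differentiable_def Ck_on.simps by blast
  qed
  then show ?thesis by (simp add: Cinf_on_def)
qed

lemma Cinf_on_exp [intro]:
  fixes f :: "'a::euclidean_space \<Rightarrow> real"
  shows "open W \<Longrightarrow> Cinf_on f W \<Longrightarrow> Cinf_on (\<lambda>x. exp (f x)) W"
  by (rule Cinf_on_real_comp[where g = exp and g' = exp]) (auto intro: DERIV_exp)

lemma Cinf_on_inverse [intro]:
  fixes f :: "'a::euclidean_space \<Rightarrow> real"
  assumes "open W" "Cinf_on f W" "\<And>x. x \<in> W \<Longrightarrow> f x \<noteq> 0"
  shows "Cinf_on (\<lambda>x. inverse (f x)) W"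
proof (rule Cinf_on_real_comp[where g = inverse and g' = "\<lambda>t. - (inverse t * inverse t)"])
  fix x assume "x \<in> W"
  then show "(inverse has_real_derivative - (inverse (f x) * inverse (f x))) (at (f x))"
    using DERIV_inverse[of "f x"] assms(3) by (simp add: power2_eq_square numeral_2_eq_2)
next
  fix k assume "Ck_on k (\<lambda>x. inverse (f x)) W"
  then have "Ck_on k (\<lambda>x. - (inverse (f x) *\<^sub>R inverse (f x))) W"
    by (intro Ck_on_bounded_linear[OF bounded_linear_minus[OF bounded_linear_ident] assms(1)]
        Ck_on_scaleR[OF assms(1)])
  then show "Ck_on k (\<lambda>x. - (inverse (f x) * inverse (f x))) W" by simp
qed (use assms in auto)

lemma Cinf_on_divide [intro]:
  fixes f g :: "'a::euclidean_space \<Rightarrow> real"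
  assumes "open W" "Cinf_on f W" "Cinf_on g W" "\<And>x. x \<in> W \<Longrightarrow> g x \<noteq> 0"
  shows "Cinf_on (\<lambda>x. f x / g x) W"
  unfolding divide_inverse by (intro Cinf_on_mult Cinf_on_inverse assms)

lemma Cinf_on_sqrt [intro]:
  fixes f :: "'a::euclidean_space \<Rightarrow> real"
  assumes "open W" "Cinf_on f W" "\<And>x. x \<in> W \<Longrightarrow> 0 < f x"
  shows "Cinf_on (\<lambda>x. sqrt (f x)) W"
proof -
  have "Cinf_on (\<lambda>x. exp ((1/2) * ln (f x))) W"
  proof (intro Cinf_on_exp Cinf_on_mult assms Cinf_on_const)
    have "Cinf_on (\<lambda>x. inverse (f x)) W" using assms by (intro Cinf_on_inverse) force+
    then show "Cinf_on (\<lambda>x. ln (f x)) W"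
      using assms
      by (intro Cinf_on_real_comp[where g = ln and g' = inverse]) (auto simp: Cinf_on_def intro: DERIV_ln)
  qed
  then show ?thesis
    using assms by (subst Cinf_on_cong[OF assms(1), of _ "\<lambda>x. exp ((1/2) * ln (f x))"])
      (force simp: powr_half_sqrt[symmetric] powr_def less_imp_le)+
qed

lemma Cinf_on_det [intro]:
  fixes M :: "'a::euclidean_space \<Rightarrow> real ^ 'm ^ 'm"
  assumes "open W" "\<And>i j. Cinf_on (\<lambda>x. M x $ i $ j) W"
  shows "Cinf_on (\<lambda>x. det (M x)) W"
  unfolding det_def by (intro Cinf_on_sum Cinf_on_mult Cinf_on_prod Cinf_on_const assms)

lemma matrix_inv_mult_left:
  fixes M :: "real ^ 'm ^ 'm" assumes "det M \<noteq> 0" shows "matrix_inv M ** M = mat 1"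
  using assms someI_ex[of "\<lambda>A'. M ** A' = mat 1 \<and> A' ** M = mat 1"]
  unfolding invertible_det_nz[symmetric] invertible_def matrix_inv_def by blast

lemma matrix_inv_mult_right:
  fixes M :: "real ^ 'm ^ 'm" assumes "det M \<noteq> 0" shows "M ** matrix_inv M = mat 1"
  using assms someI_ex[of "\<lambda>A'. M ** A' = mat 1 \<and> A' ** M = mat 1"]
  unfolding invertible_det_nz[symmetric] invertible_def matrix_inv_def by blast

text \<open>By Cramer's rule the entries of the inverse are quotients of determinants, hence
  rational functions of the entries of \<open>M\<close>.\<close>

lemma Cinf_on_matrix_inv:
  fixes M :: "'a::euclidean_space \<Rightarrow> real ^ 'm ^ 'm"
  assumes "open W" "\<And>i j. Cinf_on (\<lambda>x. M x $ i $ j) W" "\<And>x. x \<in> W \<Longrightarrow> det (M x) \<noteq> 0"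
  shows "Cinf_on (\<lambda>x. matrix_inv (M x) $ i $ j) W"
proof -
  have eq: "matrix_inv (M x) $ i $ j
      = det (\<chi> a b. if b = i then axis j 1 $ a else M x $ a $ b) / det (M x)" if "x \<in> W" for x
  proof -
    have "M x *v (matrix_inv (M x) *v axis j 1) = axis j 1"
      using matrix_inv_mult_right[OF assms(3)[OF that]]
      by (simp add: matrix_vector_mul_assoc)
    then have "matrix_inv (M x) *v axis j 1
        = (\<chi> k. det (\<chi> a b. if b = k then axis j 1 $ a else M x $ a $ b) / det (M x))"
      by (rule iffD1[OF cramer[OF assms(3)[OF that]]])
    moreover have "(matrix_inv (M x) *v axis j 1) $ i = matrix_inv (M x) $ i $ j"
      by (simp add: matrix_vector_mult_basis column_def)
    ultimately show ?thesis by simp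
  qed
  have "Cinf_on (\<lambda>x. (\<chi> a b. if b = i then axis j 1 $ a else M x $ a $ b) $ a $ b) W" for a b
    using assms(2) by (cases "b = i") auto
  then have "Cinf_on (\<lambda>x. det (\<chi> a b. if b = i then axis j 1 $ a else M x $ a $ b) / det (M x)) W"
    using assms by (intro Cinf_on_divide Cinf_on_det) auto
  then show ?thesis by (rule Cinf_on_cong_imp[OF assms(1)]) (rule eq)
qed

section \<open>Symmetry of second derivatives\<close>

lemma mean_value_line:
  fixes f :: "'a::real_normed_vector \<Rightarrow> real"
  assumes "0 < t" "\<And>s. 0 \<le> s \<Longrightarrow> s \<le> t \<Longrightarrow> f differentiable (at (x + s *\<^sub>R v))"
  shows "\<exists>s>0. s < t \<and> f (x + t *\<^sub>R v) - f x = t * frechet_derivative f (at (x + s *\<^sub>R v)) v"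
proof -
  have hd: "((\<lambda>s. f (x + s *\<^sub>R v)) has_real_derivative frechet_derivative f (at (x + s *\<^sub>R v)) v) (at s)"
    if "0 \<le> s" "s \<le> t" for s
  proof -
    have "((\<lambda>s. x + s *\<^sub>R v) has_derivative (\<lambda>h. h *\<^sub>R v)) (at s)"
      by (auto intro!: derivative_eq_intros)
    moreover have D: "(f has_derivative frechet_derivative f (at (x + s *\<^sub>R v))) (at (x + s *\<^sub>R v))"
      using assms(2) that frechet_derivative_works by blast
    ultimately have "((\<lambda>s. f (x + s *\<^sub>R v)) has_derivative
        (\<lambda>h. frechet_derivative f (at (x + s *\<^sub>R v)) (h *\<^sub>R v))) (at s)"
      using has_derivative_compose by blast
    then show ?thesis
      using linear_cmul[OF has_derivative_linear[OF D]]
      by (simp add: has_field_derivative_def mult.commute[of _ "frechet_derivative f (at (x + s *\<^sub>R v)) v"])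
  qed
  show ?thesis using MVT2[OF assms(1) hd] by simp
qed

text \<open>The mean value theorem is applied to the increment of \<open>f\<close> in direction
  \<open>w\<close>, moving along \<open>v\<close>, and then to the derivative along
  \<open>v\<close>, moving along \<open>w\<close>. This turns the double difference into
  \<open>t * t\<close> times the mixed derivative at a nearby point, where continuity of that
  derivative takes over.\<close>

lemma second_derivative_double_difference:
  fixes f :: "'a::euclidean_space \<Rightarrow> real"
  assumes W: "open W" and f: "Cinf_on f W" and x: "x \<in> W" and e: "0 < e"
  shows "\<exists>d>0. \<forall>t. 0 < t \<and> t < d \<longrightarrow>
    \<bar>f (x + t *\<^sub>R v + t *\<^sub>R w) - f (x + t *\<^sub>R v) - f (x + t *\<^sub>R w) + f x
      - t * t * frechet_derivative (\<lambda>y. frechet_derivative f (at y) v) (at x) w\<bar> \<le> t * t * e"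
proof -
  define g where "g = (\<lambda>y. frechet_derivative f (at y) v)"
  have g: "Cinf_on g W" unfolding g_def using f by auto
  define h where "h = (\<lambda>y. frechet_derivative g (at y) w)"
  have h: "Cinf_on h W" unfolding h_def using g by auto
  then have "isCont h x"
    using W x Cinf_on_continuous continuous_on_eq_continuous_at by blast
  then obtain d1 where d1: "d1 > 0" "\<And>y. dist y x < d1 \<Longrightarrow> \<bar>h y - h x\<bar> < e"
    using e unfolding continuous_at_eps_delta dist_real_def by metis
  obtain d2 where d2: "d2 > 0" "ball x d2 \<subseteq> W" using W x openE by blast
  \<comment> \<open>The divisor keeps \<open>x + s v + r w\<close> in both balls for all s, r <
    \<open>d\<close>; the summand 1 makes it positive even for v = w = 0.\<close>
  define d where "d = min d1 d2 / (norm v + norm w + 1)"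
  have pos: "0 < norm v + norm w + 1" by (smt (verit) norm_ge_zero)
  have d: "d > 0" using d1 d2 pos by (simp add: d_def)
  have near: "dist (x + s *\<^sub>R v + r *\<^sub>R w) x < min d1 d2" if "0 \<le> s" "s < d" "0 \<le> r" "r < d" for s r
  proof -
    have "dist (x + s *\<^sub>R v + r *\<^sub>R w) x = norm (s *\<^sub>R v + r *\<^sub>R w)" by (simp add: dist_norm add.assoc)
    also have "\<dots> \<le> s * norm v + r * norm w"
      using norm_triangle_ineq[of "s *\<^sub>R v" "r *\<^sub>R w"] that by simp
    also have "\<dots> \<le> d * norm v + d * norm w"
      using that by (intro add_mono mult_right_mono) auto
    also have "\<dots> < d * (norm v + norm w + 1)" using d by (simp add: algebra_simps)
    also have "\<dots> = min d1 d2" using pos by (simp add: d_def)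
    finally show ?thesis .
  qed
  then have inW: "x + s *\<^sub>R v + r *\<^sub>R w \<in> W" if "0 \<le> s" "s < d" "0 \<le> r" "r < d" for s r
    using d2(2) that by (force simp: dist_commute)
  show ?thesis
  proof (intro exI[of _ d] conjI d allI impI)
    fix t assume t: "0 < t \<and> t < d"
    define p where "p = (\<lambda>y. f (y + t *\<^sub>R w) - f y)"
    have pd: "(p has_derivative (\<lambda>u. frechet_derivative f (at (y + t *\<^sub>R w)) u - frechet_derivative f (at y) u)) (at y)"
      if "y \<in> W" "y + t *\<^sub>R w \<in> W" for y
    proof -
      have a: "((\<lambda>y. y + t *\<^sub>R w) has_derivative (\<lambda>u. u)) (at y)"
        by (auto intro!: derivative_eq_intros)
      show ?thesis unfolding p_def
        by (intro has_derivative_diff has_derivative_compose[OF a] Cinf_on_has_derivative[OF f] that)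
    qed
    have "\<exists>s>0. s < t \<and> p (x + t *\<^sub>R v) - p x = t * frechet_derivative p (at (x + s *\<^sub>R v)) v"
    proof (rule mean_value_line)
      fix s assume "0 \<le> s" "s \<le> t"
      then show "p differentiable at (x + s *\<^sub>R v)"
        using pd inW[of s 0] inW[of s t] t d unfolding differentiable_def by (auto simp: )
    qed (use t in auto)
    then obtain s where s: "0 < s" "s < t" "p (x + t *\<^sub>R v) - p x = t * frechet_derivative p (at (x + s *\<^sub>R v)) v"
      by blast
    have "frechet_derivative p (at (x + s *\<^sub>R v)) v = g (x + s *\<^sub>R v + t *\<^sub>R w) - g (x + s *\<^sub>R v)"
      using frechet_derivative_at[OF pd, symmetric] inW[of s 0] inW[of s t] s t d by (auto simp: g_def)
    moreover have "\<exists>r>0. r < t \<and> g (x + s *\<^sub>R v + t *\<^sub>R w) - g (x + s *\<^sub>R v)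
        = t * frechet_derivative g (at (x + s *\<^sub>R v + r *\<^sub>R w)) w"
      using inW[of s] s t by (intro mean_value_line Cinf_on_differentiable[OF g]) auto
    then obtain r where r: "0 < r" "r < t"
      "g (x + s *\<^sub>R v + t *\<^sub>R w) - g (x + s *\<^sub>R v) = t * h (x + s *\<^sub>R v + r *\<^sub>R w)"
      unfolding h_def by blast
    ultimately have eq: "p (x + t *\<^sub>R v) - p x = t * t * h (x + s *\<^sub>R v + r *\<^sub>R w)"
      using s(3) by simp
    have "\<bar>h (x + s *\<^sub>R v + r *\<^sub>R w) - h x\<bar> < e"
      using near[of s r] s r t by (intro d1(2)) auto
    then have "\<bar>t * t * h (x + s *\<^sub>R v + r *\<^sub>R w) - t * t * h x\<bar> \<le> t * t * e"
      using t by (simp add: right_diff_distrib[symmetric] abs_mult)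
    then show "\<bar>f (x + t *\<^sub>R v + t *\<^sub>R w) - f (x + t *\<^sub>R v) - f (x + t *\<^sub>R w) + f x
      - t * t * frechet_derivative (\<lambda>y. frechet_derivative f (at y) v) (at x) w\<bar> \<le> t * t * e"
      using eq by (simp add: p_def h_def g_def algebra_simps)
  qed
qed

text \<open>Exchanging \<open>v\<close> and \<open>w\<close> leaves the double difference unchanged,
  so both mixed derivatives approximate the same number; \<open>e\<close> is a third of their
  distance, while the two errors add up to at most 2 \<open>e\<close>.\<close>

lemma second_derivative_symmetric:
  fixes f :: "'a::euclidean_space \<Rightarrow> real"
  assumes W: "open W" and f: "Cinf_on f W" and x: "x \<in> W"
  shows "frechet_derivative (\<lambda>y. frechet_derivative f (at y) v) (at x) w
       = frechet_derivative (\<lambda>y. frechet_derivative f (at y) w) (at x) v" (is "?a = ?b")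
proof (rule ccontr)
  assume ne: "?a \<noteq> ?b"
  define e where "e = \<bar>?a - ?b\<bar> / 3"
  have e: "e > 0" using ne by (simp add: e_def)
  obtain d1 where d1: "d1 > 0" "\<And>t. 0 < t \<and> t < d1 \<Longrightarrow>
    \<bar>f (x + t *\<^sub>R v + t *\<^sub>R w) - f (x + t *\<^sub>R v) - f (x + t *\<^sub>R w) + f x - t * t * ?a\<bar> \<le> t * t * e"
    using second_derivative_double_difference[OF W f x e] by blast
  obtain d2 where d2: "d2 > 0" "\<And>t. 0 < t \<and> t < d2 \<Longrightarrow>
    \<bar>f (x + t *\<^sub>R w + t *\<^sub>R v) - f (x + t *\<^sub>R w) - f (x + t *\<^sub>R v) + f x - t * t * ?b\<bar> \<le> t * t * e"
    using second_derivative_double_difference[OF W f x e] by blast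
  define t where "t = min d1 d2 / 2"
  have t: "0 < t" "t < d1" "t < d2" using d1 d2 by (auto simp: t_def)
  have sw: "x + t *\<^sub>R w + t *\<^sub>R v = x + t *\<^sub>R v + t *\<^sub>R w" by simp
  have "\<bar>t * t * ?a - t * t * ?b\<bar> \<le> t * t * e + t * t * e"
    using d1(2)[of t] d2(2)[of t] t unfolding sw by linarith
  moreover have "t * t * \<bar>?a - ?b\<bar> = \<bar>t * t * ?a - t * t * ?b\<bar>"
    by (simp add: right_diff_distrib[symmetric] abs_mult)
  ultimately have "t * t * \<bar>?a - ?b\<bar> \<le> t * t * e + t * t * e" by linarith
  then have "t * t * \<bar>?a - ?b\<bar> \<le> t * t * (2 * e)" by (simp only: mult_2 distrib_left)
  then have "\<bar>?a - ?b\<bar> \<le> 2 * e" using t by simp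
  then show False using ne by (simp add: e_def)
qed

section \<open>Tangential derivatives on a parametrized hypersurface\<close>

text \<open>A kernel vector \<open>w\<close> of the Gram matrix satisfies
  \<open>L w \<bullet> L w = 0\<close>, hence w = 0 by injectivity.\<close>

lemma gram_det_nonzero:
  fixes L :: "real ^ 'n::finite \<Rightarrow> real ^ 'k::finite"
  assumes L: "linear L" "inj L"
  shows "det (\<chi> i j. L (axis i 1) \<bullet> L (axis j 1) :: real ^ 'n ^ 'n) \<noteq> 0"
proof -
  let ?g = "\<chi> i j. L (axis i 1) \<bullet> L (axis j 1) :: real ^ 'n ^ 'n"
  have "w = 0" if "?g *v w = 0" for w
  proof -
    have Lw: "L w = (\<Sum>j\<in>UNIV. w $ j *\<^sub>R L (axis j 1))"
      by (subst basis_expansion[symmetric, of w]) (simp add: linear_sum[OF L(1)] linear_cmul[OF L(1)] scalar_mult_eq_scaleR)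
    have "L (axis i 1) \<bullet> L w = 0" for i
    proof -
      have "L (axis i 1) \<bullet> L w = (?g *v w) $ i"
        unfolding Lw by (simp add: inner_sum_right matrix_vector_mult_def mult.commute)
      then show ?thesis using that by simp
    qed
    then have "L w \<bullet> L w = 0"
      by (subst (1) Lw) (simp add: inner_sum_left)
    then show "w = 0" using L linear_injective_0 by auto
  qed
  then show ?thesis
    unfolding invertible_det_nz[symmetric] invertible_left_inverse matrix_left_invertible_ker by blast
qed

text \<open>Here codimension one enters: the orthogonal complement of the range of \<open>L\<close>
  has dimension 1, so \<open>\<nu>\<close> spans it.\<close>

lemma normal_line:
  fixes L :: "real ^ 'n::finite \<Rightarrow> real ^ 'k::finite"
  assumes L: "linear L" "inj L" and card: "CARD('k) = CARD('n) + 1"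
    and nu: "\<nu> \<bullet> \<nu> = 1" "\<And>v. L v \<bullet> \<nu> = 0" and z: "\<And>v. L v \<bullet> z = 0"
  shows "z = (z \<bullet> \<nu>) *\<^sub>R \<nu>"
proof -
  define C where "C = {y \<in> UNIV. \<forall>x \<in> range L. orthogonal x y}"
  have "subspace (range L)" using L(1) linear_subspace_image subspace_UNIV by blast
  then have "dim C + dim (range L) = dim (UNIV :: (real ^ 'k) set)"
    unfolding C_def by (intro dim_subspace_orthogonal_to_vectors) auto
  moreover have "dim (range L) = CARD('n)"
    using dim_image_eq[OF L(1), of UNIV] L(2) by simp
  ultimately have dC: "dim C = 1" using card by simp
  have sC: "subspace C" unfolding C_def
    by (auto simp: subspace_def orthogonal_def inner_add_right)
  have "span {\<nu>} \<subseteq> C"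
    by (intro span_minimal sC) (auto simp: C_def orthogonal_def nu)
  moreover have "dim (span {\<nu>}) = 1" using nu(1) by (auto simp: dim_singleton)
  ultimately have "span {\<nu>} = C"
    using sC dC by (intro subspace_dim_equal) auto
  moreover have "z \<in> C" using z by (auto simp: C_def orthogonal_def)
  ultimately obtain c where c: "z = c *\<^sub>R \<nu>"
    by (auto simp: span_singleton)
  then show ?thesis using nu(1) by simp
qed

text \<open>The smooth unit normal is part of the data because \<open>unit_normal\<close> is
  selected point by point and may jump between the two signs. Locally a smooth choice exists by
  \<open>patch_exists\<close>.\<close>

locale patch =
  fixes W :: "(real ^ 'n::finite) set" and \<psi> \<nu> :: "real ^ 'n \<Rightarrow> real ^ 'k::finite"
  assumes open_W: "open W" and card_eq: "CARD('k) = CARD('n) + 1"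
    and psi_smooth: "Cinf_on \<psi> W"
    and immersion: "x \<in> W \<Longrightarrow> inj (frechet_derivative \<psi> (at x))"
    and nu_smooth: "Cinf_on \<nu> W"
    and nu_unit: "x \<in> W \<Longrightarrow> \<nu> x \<bullet> \<nu> x = 1"
    and nu_normal: "x \<in> W \<Longrightarrow> frechet_derivative \<psi> (at x) v \<bullet> \<nu> x = 0"
begin

section \<open>Tangential calculus on a patch\<close>

definition J where "J x = frechet_derivative \<psi> (at x)"

definition g where "g x = (\<chi> i j. J x (axis i 1) \<bullet> J x (axis j 1) :: real ^ 'n ^ 'n)"

text \<open>In matrix form \<open>Y a\<close> is g^{-1} J^T e_a, the vector in the chart whose image
  under \<open>J\<close> is the tangential part of the ambient basis vector e_a; see
  \<open>J_Y\<close>.\<close>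

definition Y where
  "Y a x = (\<chi> i. \<Sum>j\<in>UNIV. matrix_inv (g x) $ i $ j * J x (axis j 1) $ a)"

text \<open>The component in direction e_a of the intrinsic gradient. Having n + 1 such operators on
  an n-dimensional space costs the relation \<open>nu_\<delta>\<close> and a nonzero
  \<open>commutator\<close>.\<close>

definition \<delta> :: "'k \<Rightarrow> (real ^ 'n \<Rightarrow> real) \<Rightarrow> real ^ 'n \<Rightarrow> real" where
  "\<delta> a f x = frechet_derivative f (at x) (Y a x)"

abbreviation xc where "xc b \<equiv> (\<lambda>y. \<psi> y $ b)"
abbreviation nc where "nc b \<equiv> (\<lambda>y. \<nu> y $ b)"

text \<open>The differential of the normal as an ambient matrix, extended by zero in the normal
  direction: minus the second fundamental form with respect to \<open>\<nu>\<close>.\<close>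

definition S where "S a b = \<delta> a (nc b)"

lemma J_linear: "x \<in> W \<Longrightarrow> linear (J x)"
  unfolding J_def using Cinf_on_differentiable[OF psi_smooth] linear_frechet_derivative by blast

lemma J_inj: "x \<in> W \<Longrightarrow> inj (J x)"
  unfolding J_def by (rule immersion)

lemma J_nu: "x \<in> W \<Longrightarrow> J x v \<bullet> \<nu> x = 0"
  unfolding J_def by (rule nu_normal)

lemma det_g: "x \<in> W \<Longrightarrow> det (g x) \<noteq> 0"
  unfolding g_def using gram_det_nonzero[OF J_linear J_inj] .

lemma J_expand: "x \<in> W \<Longrightarrow> J x v = (\<Sum>i\<in>UNIV. v $ i *\<^sub>R J x (axis i 1))"
  by (subst basis_expansion[symmetric, of v])
    (simp add: linear_sum[OF J_linear] linear_cmul[OF J_linear] scalar_mult_eq_scaleR)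

text \<open>Against every tangent vector, \<open>J x (Y a x)\<close> has the same inner product as
  e_a. The difference is therefore normal, and \<open>normal_line\<close> computes it.\<close>

lemma J_Y:
  assumes x: "x \<in> W" shows "J x (Y a x) = axis a 1 - \<nu> x $ a *\<^sub>R \<nu> x"
proof -
  define w where "w = J x (Y a x)"
  have base: "J x (axis m 1) \<bullet> w = J x (axis m 1) $ a" for m
  proof -
    have "J x (axis m 1) \<bullet> w = (\<Sum>i\<in>UNIV. g x $ m $ i * Y a x $ i)"
      unfolding w_def J_expand[OF x, of "Y a x"] by (simp add: inner_sum_right g_def mult.commute)
    also have "\<dots> = (\<Sum>i\<in>UNIV. \<Sum>j\<in>UNIV. g x $ m $ i * matrix_inv (g x) $ i $ j * J x (axis j 1) $ a)"
      by (simp add: Y_def sum_distrib_left mult.assoc)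
    also have "\<dots> = (\<Sum>j\<in>UNIV. (g x ** matrix_inv (g x)) $ m $ j * J x (axis j 1) $ a)"
      by (subst sum.swap) (simp add: matrix_matrix_mult_def sum_distrib_right)
    also have "\<dots> = J x (axis m 1) $ a"
      by (simp add: matrix_inv_mult_right[OF det_g[OF x]] mat_def if_distrib[of "\<lambda>t. t * _"] cong: if_cong)
    finally show ?thesis .
  qed
  have orth: "J x v \<bullet> (axis a 1 - w) = 0" for v
  proof -
    have "J x (axis m 1) \<bullet> (axis a 1 - w) = 0" for m
      using base[of m] by (simp add: inner_diff_right inner_axis)
    then show ?thesis by (subst J_expand[OF x]) (simp add: inner_sum_left)
  qed
  have "axis a 1 - w = ((axis a 1 - w) \<bullet> \<nu> x) *\<^sub>R \<nu> x"
    using normal_line[OF J_linear[OF x] J_inj[OF x] card_eq nu_unit[OF x] J_nu[OF x] orth] .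
  moreover have "(axis a 1 - w) \<bullet> \<nu> x = \<nu> x $ a"
    using J_nu[OF x] by (simp add: inner_diff_left w_def inner_axis' )
  ultimately show ?thesis unfolding w_def by (simp add: algebra_simps)
qed

lemma J_cancel: "x \<in> W \<Longrightarrow> J x v = J x w \<Longrightarrow> v = w"
  using J_inj by (meson injD)

text \<open>The n + 1 vectors \<open>Y c x\<close> are an overcomplete frame of an n-dimensional
  space; \<open>nu_Y\<close> is the one relation among them.\<close>

lemma tangent_expand:
  assumes x: "x \<in> W" shows "v = (\<Sum>c\<in>UNIV. J x v $ c *\<^sub>R Y c x)"
proof (rule J_cancel[OF x])
  have "J x (\<Sum>c\<in>UNIV. J x v $ c *\<^sub>R Y c x) = (\<Sum>c\<in>UNIV. J x v $ c *\<^sub>R (axis c 1 - \<nu> x $ c *\<^sub>R \<nu> x))"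
    by (simp add: linear_sum[OF J_linear[OF x]] linear_cmul[OF J_linear[OF x]] J_Y[OF x])
  also have "\<dots> = J x v - (J x v \<bullet> \<nu> x) *\<^sub>R \<nu> x"
    by (simp add: scaleR_diff_right sum_subtractf inner_vec_def scaleR_sum_left
        basis_expansion[of "J x v", unfolded scalar_mult_eq_scaleR])
  finally show "J x v = J x (\<Sum>c\<in>UNIV. J x v $ c *\<^sub>R Y c x)" using J_nu[OF x] by simp
qed

lemma nu_Y: assumes x: "x \<in> W" shows "(\<Sum>a\<in>UNIV. \<nu> x $ a *\<^sub>R Y a x) = 0"
proof (rule J_cancel[OF x])
  have "J x (\<Sum>c\<in>UNIV. \<nu> x $ c *\<^sub>R Y c x) = (\<Sum>c\<in>UNIV. \<nu> x $ c *\<^sub>R (axis c 1 - \<nu> x $ c *\<^sub>R \<nu> x))"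
    by (simp add: linear_sum[OF J_linear[OF x]] linear_cmul[OF J_linear[OF x]] J_Y[OF x])
  also have "\<dots> = \<nu> x - (\<nu> x \<bullet> \<nu> x) *\<^sub>R \<nu> x"
    by (simp add: scaleR_diff_right sum_subtractf inner_vec_def scaleR_sum_left
        basis_expansion[of "\<nu> x", unfolded scalar_mult_eq_scaleR])
  finally show "J x (\<Sum>a\<in>UNIV. \<nu> x $ a *\<^sub>R Y a x) = J x 0"
    using nu_unit[OF x] linear_0[OF J_linear[OF x]] by simp
qed

lemma J_smooth: "Cinf_on (\<lambda>x. J x v) W"
  unfolding J_def by (rule Cinf_on_deriv[OF psi_smooth])

lemma Y_smooth: "Cinf_on (Y a) W"
proof -
  have "Cinf_on (\<lambda>x. g x $ i $ j) W" for i j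
    unfolding g_def by (simp, intro Cinf_on_inner open_W J_smooth)
  then have "Cinf_on (\<lambda>x. matrix_inv (g x) $ i $ j) W" for i j
    by (intro Cinf_on_matrix_inv open_W det_g)
  then have "Cinf_on (\<lambda>x. \<chi> i. \<Sum>j\<in>UNIV. matrix_inv (g x) $ i $ j * J x (axis j 1) $ a) W"
    by (intro Cinf_on_vec_lambda Cinf_on_sum Cinf_on_mult open_W Cinf_on_vec_nth[OF open_W J_smooth])
  then show ?thesis by (simp add: Y_def[abs_def])
qed

lemma deriv_expand:
  fixes f :: "real ^ 'n \<Rightarrow> real"
  assumes "Cinf_on f W" "x \<in> W"
  shows "frechet_derivative f (at x) v = (\<Sum>i\<in>UNIV. v $ i * frechet_derivative f (at x) (axis i 1))"
proof -
  have L: "linear (frechet_derivative f (at x))"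
    using Cinf_on_differentiable[OF assms] linear_frechet_derivative by blast
  show ?thesis
    by (subst basis_expansion[symmetric, of v]) (simp add: linear_sum[OF L] linear_cmul[OF L] scalar_mult_eq_scaleR)
qed

lemma \<delta>_expand:
  "Cinf_on f W \<Longrightarrow> x \<in> W \<Longrightarrow> \<delta> a f x = (\<Sum>i\<in>UNIV. Y a x $ i * frechet_derivative f (at x) (axis i 1))"
  unfolding \<delta>_def by (rule deriv_expand)

lemma \<delta>_smooth [intro]: assumes "Cinf_on f W" shows "Cinf_on (\<delta> a f) W"
proof -
  have "Cinf_on (\<lambda>x. \<Sum>i\<in>UNIV. Y a x $ i * frechet_derivative f (at x) (axis i 1)) W"
    by (intro Cinf_on_sum Cinf_on_mult Cinf_on_vec_nth open_W Y_smooth Cinf_on_deriv assms)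
  then show ?thesis by (rule Cinf_on_cong_imp[OF open_W]) (rule \<delta>_expand[OF assms])
qed

lemma xc_smooth [intro]: "Cinf_on (xc b) W" by (intro Cinf_on_vec_nth open_W psi_smooth)
lemma nc_smooth [intro]: "Cinf_on (nc b) W" by (intro Cinf_on_vec_nth open_W nu_smooth)
lemma S_smooth [intro]: "Cinf_on (S a b) W" unfolding S_def by auto

lemma \<delta>_cong:
  assumes "Cinf_on f W" "\<And>y. y \<in> W \<Longrightarrow> f y = h y" "x \<in> W"
  shows "\<delta> a h x = \<delta> a f x"
  unfolding \<delta>_def
  using frechet_derivative_transform_within_open[OF Cinf_on_differentiable[OF assms(1,3)] open_W assms(3,2)]
  by simp

lemma \<delta>_const [simp]: "\<delta> a (\<lambda>x. c) x = 0"
  by (simp add: \<delta>_def)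

lemma \<delta>_derivI:
  "(f has_derivative f') (at x) \<Longrightarrow> \<delta> a f x = f' (Y a x)"
  unfolding \<delta>_def using frechet_derivative_at by metis

lemma \<delta>_has:
  "Cinf_on f W \<Longrightarrow> x \<in> W \<Longrightarrow> (f has_derivative frechet_derivative f (at x)) (at x)"
  by (rule Cinf_on_has_derivative)

lemma \<delta>_add:
  "Cinf_on f W \<Longrightarrow> Cinf_on h W \<Longrightarrow> x \<in> W \<Longrightarrow> \<delta> a (\<lambda>y. f y + h y) x = \<delta> a f x + \<delta> a h x"
  by (subst \<delta>_derivI[OF has_derivative_add[OF \<delta>_has[of f x] \<delta>_has[of h x]]]) (auto simp: \<delta>_def)

lemma \<delta>_diff:
  "Cinf_on f W \<Longrightarrow> Cinf_on h W \<Longrightarrow> x \<in> W \<Longrightarrow> \<delta> a (\<lambda>y. f y - h y) x = \<delta> a f x - \<delta> a h x"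
  by (subst \<delta>_derivI[OF has_derivative_diff[OF \<delta>_has[of f x] \<delta>_has[of h x]]]) (auto simp: \<delta>_def)

lemma \<delta>_uminus:
  "Cinf_on f W \<Longrightarrow> x \<in> W \<Longrightarrow> \<delta> a (\<lambda>y. - f y) x = - \<delta> a f x"
  by (subst \<delta>_derivI[OF has_derivative_minus[OF \<delta>_has[of f x]]]) (auto simp: \<delta>_def)

lemma \<delta>_mult:
  "Cinf_on f W \<Longrightarrow> Cinf_on h W \<Longrightarrow> x \<in> W \<Longrightarrow> \<delta> a (\<lambda>y. f y * h y) x = f x * \<delta> a h x + \<delta> a f x * h x"
  by (subst \<delta>_derivI[OF has_derivative_mult[OF \<delta>_has[of f x] \<delta>_has[of h x]]]) (auto simp: \<delta>_def)

lemma \<delta>_sum: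
  assumes "\<And>i. i \<in> I \<Longrightarrow> Cinf_on (f i) W" "x \<in> W"
  shows "\<delta> a (\<lambda>y. \<Sum>i\<in>I. f i y) x = (\<Sum>i\<in>I. \<delta> a (f i) x)"
  by (subst \<delta>_derivI[OF has_derivative_sum[OF \<delta>_has[OF assms]]]) (auto simp: \<delta>_def)

lemma \<delta>_real_comp:
  assumes "Cinf_on f W" "x \<in> W" "(h has_real_derivative h') (at (f x))"
  shows "\<delta> a (\<lambda>y. h (f y)) x = h' * \<delta> a f x"
  by (subst \<delta>_derivI[OF has_derivative_compose[OF \<delta>_has[OF assms(1,2)] assms(3)[unfolded has_field_derivative_def]]])
    (simp add: \<delta>_def)

lemma deriv_via_\<delta>:
  fixes f :: "real ^ 'n \<Rightarrow> real"
  assumes f: "Cinf_on f W" and x: "x \<in> W"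
  shows "frechet_derivative f (at x) v = (\<Sum>c\<in>UNIV. J x v $ c * \<delta> c f x)"
proof -
  have L: "linear (frechet_derivative f (at x))"
    using Cinf_on_differentiable[OF f x] linear_frechet_derivative by blast
  show ?thesis
    by (subst tangent_expand[OF x, of v]) (simp add: linear_sum[OF L] linear_cmul[OF L] \<delta>_def)
qed

lemma \<delta>_xc: assumes x: "x \<in> W" shows "\<delta> a (xc b) x = (if a = b then 1 else 0) - \<nu> x $ a * \<nu> x $ b"
proof -
  have "((xc b) has_derivative (\<lambda>v. J x v $ b)) (at x)"
    unfolding J_def by (intro bounded_linear.has_derivative[OF bounded_linear_vec_nth]
        Cinf_on_has_derivative[OF psi_smooth x])
  from \<delta>_derivI[OF this, of a] J_Y[OF x, of a] show ?thesis by (auto simp: axis_def)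
qed

lemma nu_\<delta>: assumes "Cinf_on f W" "x \<in> W" shows "(\<Sum>a\<in>UNIV. \<nu> x $ a * \<delta> a f x) = 0"
proof -
  have L: "linear (frechet_derivative f (at x))"
    using Cinf_on_differentiable[OF assms] linear_frechet_derivative by blast
  have "(\<Sum>a\<in>UNIV. \<nu> x $ a * \<delta> a f x) = frechet_derivative f (at x) (\<Sum>a\<in>UNIV. \<nu> x $ a *\<^sub>R Y a x)"
    by (simp add: linear_sum[OF L] linear_cmul[OF L] \<delta>_def)
  then show ?thesis using nu_Y[OF assms(2)] linear_0[OF L] by simp
qed

text \<open>Splits off the second derivatives in chart coordinates: their symmetry gives the
  commutator, their sign at a maximum gives \<open>interior_max\<close>.\<close>

lemma \<delta>\<delta>_expand:
  assumes f: "Cinf_on f W" and x: "x \<in> W"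
  shows "\<delta> a (\<delta> b f) x
    = (\<Sum>i\<in>UNIV. \<delta> a (\<lambda>y. Y b y $ i) x * frechet_derivative f (at x) (axis i 1))
    + (\<Sum>i\<in>UNIV. \<Sum>j\<in>UNIV. Y b x $ i * Y a x $ j
        * frechet_derivative (\<lambda>y. frechet_derivative f (at y) (axis i 1)) (at x) (axis j 1))"
proof -
  have sY: "Cinf_on (\<lambda>y. Y b y $ i) W" for i by (intro Cinf_on_vec_nth open_W Y_smooth)
  have sf: "Cinf_on (\<lambda>y. frechet_derivative f (at y) (axis i 1)) W" for i by (rule Cinf_on_deriv[OF f])
  have "\<delta> a (\<delta> b f) x = \<delta> a (\<lambda>y. \<Sum>i\<in>UNIV. Y b y $ i * frechet_derivative f (at y) (axis i 1)) x"
    by (intro \<delta>_cong x Cinf_on_sum Cinf_on_mult open_W sY sf) (simp add: \<delta>_expand[OF f])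
  also have "\<dots> = (\<Sum>i\<in>UNIV. Y b x $ i * \<delta> a (\<lambda>y. frechet_derivative f (at y) (axis i 1)) x
       + \<delta> a (\<lambda>y. Y b y $ i) x * frechet_derivative f (at x) (axis i 1))"
    by (subst \<delta>_sum) (auto intro!: sum.cong \<delta>_mult sY sf x Cinf_on_mult open_W)
  also have "\<dots> = (\<Sum>i\<in>UNIV. \<delta> a (\<lambda>y. Y b y $ i) x * frechet_derivative f (at x) (axis i 1))
    + (\<Sum>i\<in>UNIV. Y b x $ i * \<delta> a (\<lambda>y. frechet_derivative f (at y) (axis i 1)) x)"
    by (simp add: sum.distrib)
  finally show ?thesis
    by (simp add: \<delta>_expand[OF sf x] sum_distrib_left mult.assoc)
qed

text \<open>In the commutator the symmetric second derivatives cancel, so it is differentiation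
  along a vector \<open>Z\<close>. Testing on the coordinate functions identifies the ambient
  components of \<open>Z\<close>, and tangency of its image gives the second claim.\<close>

lemma bracket:
  assumes f: "Cinf_on f W" and x: "x \<in> W"
  shows "\<delta> a (\<delta> b f) x - \<delta> b (\<delta> a f) x
    = (\<Sum>c\<in>UNIV. (\<delta> a (\<delta> b (xc c)) x - \<delta> b (\<delta> a (xc c)) x) * \<delta> c f x)"
    and bracket_tangent:
    "(\<Sum>c\<in>UNIV. (\<delta> a (\<delta> b (xc c)) x - \<delta> b (\<delta> a (xc c)) x) * \<nu> x $ c) = 0"
proof -
  define Z where "Z = (\<chi> i. \<delta> a (\<lambda>y. Y b y $ i) x - \<delta> b (\<lambda>y. Y a y $ i) x)"
  have br: "\<delta> a (\<delta> b h) x - \<delta> b (\<delta> a h) x = frechet_derivative h (at x) Z" if h: "Cinf_on h W" for h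
  proof -
    have "(\<Sum>i\<in>UNIV. \<Sum>j\<in>UNIV. Y b x $ i * Y a x $ j
        * frechet_derivative (\<lambda>y. frechet_derivative h (at y) (axis i 1)) (at x) (axis j 1))
      = (\<Sum>i\<in>UNIV. \<Sum>j\<in>UNIV. Y a x $ i * Y b x $ j
        * frechet_derivative (\<lambda>y. frechet_derivative h (at y) (axis i 1)) (at x) (axis j 1))"
      by (subst sum.swap) (simp add: second_derivative_symmetric[OF open_W h x] mult.commute)
    then show ?thesis
      unfolding \<delta>\<delta>_expand[OF h x] deriv_expand[OF h x, of Z]
      by (simp add: Z_def sum_subtractf left_diff_distrib)
  qed
  have JZ: "J x Z $ c = \<delta> a (\<delta> b (xc c)) x - \<delta> b (\<delta> a (xc c)) x" for c
  proof -
    have "((xc c) has_derivative (\<lambda>v. J x v $ c)) (at x)"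
      unfolding J_def by (intro bounded_linear.has_derivative[OF bounded_linear_vec_nth]
          Cinf_on_has_derivative[OF psi_smooth x])
    then show ?thesis unfolding br[OF xc_smooth] using frechet_derivative_at by metis
  qed
  show "\<delta> a (\<delta> b f) x - \<delta> b (\<delta> a f) x
    = (\<Sum>c\<in>UNIV. (\<delta> a (\<delta> b (xc c)) x - \<delta> b (\<delta> a (xc c)) x) * \<delta> c f x)"
    unfolding br[OF f] JZ[symmetric] by (rule deriv_via_\<delta>[OF f x])
  show "(\<Sum>c\<in>UNIV. (\<delta> a (\<delta> b (xc c)) x - \<delta> b (\<delta> a (xc c)) x) * \<nu> x $ c) = 0"
    using J_nu[OF x, of Z] unfolding JZ[symmetric] by (simp add: inner_vec_def)
qed

lemma nu_sum: "x \<in> W \<Longrightarrow> (\<Sum>b\<in>UNIV. \<nu> x $ b * \<nu> x $ b) = 1"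
  using nu_unit by (simp add: inner_vec_def)

lemma S_nu: assumes x: "x \<in> W" shows "(\<Sum>b\<in>UNIV. \<nu> x $ b * S a b x) = 0"
proof -
  have "\<delta> a (\<lambda>y. \<Sum>b\<in>UNIV. nc b y * nc b y) x = \<delta> a (\<lambda>y. 1) x"
    by (intro \<delta>_cong) (auto simp: nu_sum x)
  moreover have "\<delta> a (\<lambda>y. \<Sum>b\<in>UNIV. nc b y * nc b y) x = (\<Sum>b\<in>UNIV. 2 * (\<nu> x $ b * S a b x))"
    using x by (subst \<delta>_sum) (auto intro!: sum.cong Cinf_on_mult open_W simp: \<delta>_mult nc_smooth S_def)
  ultimately show ?thesis by (simp add: sum_distrib_left[symmetric])
qed

lemma bracket_xc:
  assumes x: "x \<in> W"
  shows "\<delta> a (\<delta> b (xc c)) x - \<delta> b (\<delta> a (xc c)) x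
    = (S b a x - S a b x) * \<nu> x $ c + \<nu> x $ a * S b c x - \<nu> x $ b * S a c x"
proof -
  have "\<delta> a (\<delta> b (xc c)) x = - (\<nu> x $ b * S a c x + S a b x * \<nu> x $ c)" for a b
  proof -
    have "\<delta> a (\<delta> b (xc c)) x = \<delta> a (\<lambda>y. (if b = c then 1 else 0) - nc b y * nc c y) x"
      using x by (intro \<delta>_cong) (auto simp: \<delta>_xc intro!: Cinf_on_diff Cinf_on_mult open_W)
    also have "\<dots> = - (\<nu> x $ b * S a c x + S a b x * \<nu> x $ c)"
      by (subst \<delta>_diff) (auto simp: \<delta>_mult[OF nc_smooth nc_smooth x] S_def x intro!: Cinf_on_mult open_W)
    finally show ?thesis .
  qed
  from this[of a b] this[of b a] show ?thesis by (simp add: algebra_simps)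
qed

text \<open>Tangency of the bracket: contracting its components with \<open>\<nu>\<close> leaves
  only \<open>S b a x - S a b x\<close>, since \<open>S\<close> annihilates \<open>\<nu>\<close> in
  its second index.\<close>

lemma S_sym: assumes x: "x \<in> W" shows "S a b x = S b a x"
proof -
  have "(\<Sum>c\<in>UNIV. ((S b a x - S a b x) * \<nu> x $ c + \<nu> x $ a * S b c x - \<nu> x $ b * S a c x) * \<nu> x $ c) = 0"
    using bracket_tangent[OF xc_smooth x] unfolding bracket_xc[OF x] .
  moreover have "(\<Sum>c\<in>UNIV. ((S b a x - S a b x) * \<nu> x $ c + \<nu> x $ a * S b c x - \<nu> x $ b * S a c x) * \<nu> x $ c)
    = (S b a x - S a b x) * (\<Sum>c\<in>UNIV. \<nu> x $ c * \<nu> x $ c)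
      + \<nu> x $ a * (\<Sum>c\<in>UNIV. \<nu> x $ c * S b c x) - \<nu> x $ b * (\<Sum>c\<in>UNIV. \<nu> x $ c * S a c x)"
    by (simp add: sum_distrib_left sum.distrib[symmetric] sum_subtractf[symmetric] algebra_simps)
  ultimately show ?thesis using S_nu[OF x] nu_sum[OF x] by simp
qed

text \<open>The tangential derivatives fail to commute only by terms that contain
  \<open>\<nu>\<close> and \<open>S\<close>. The Codazzi equation and every curvature term of
  Simons' identity arise from this formula.\<close>

lemma commutator:
  assumes f: "Cinf_on f W" and x: "x \<in> W"
  shows "\<delta> a (\<delta> b f) x = \<delta> b (\<delta> a f) x
    + (\<Sum>c\<in>UNIV. (\<nu> x $ a * S b c x - \<nu> x $ b * S a c x) * \<delta> c f x)"
  using bracket[OF f x, of a b] unfolding bracket_xc[OF x] S_sym[OF x, of b a] by simp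

end

section \<open>Simons' identity for minimal cones\<close>

subsection \<open>Pointwise tensor algebra\<close>

text \<open>One point of a minimal cone: \<open>s\<close> is \<open>S\<close>, \<open>n\<close> the
  normal, \<open>x\<close> the position, and \<open>r2\<close> is the squared distance |x|^2, not an
  outer radius. Both \<open>n\<close> and \<open>x\<close> are null directions of
  \<open>s\<close>.\<close>

locale cone_algebra =
  fixes s :: "'k::finite \<Rightarrow> 'k \<Rightarrow> real" and n x :: "'k \<Rightarrow> real" and r2 :: real
  assumes sym: "s a b = s b a"
    and sn: "(\<Sum>b\<in>UNIV. n b * s a b) = 0"
    and sx: "(\<Sum>b\<in>UNIV. x b * s a b) = 0"
    and nn: "(\<Sum>b\<in>UNIV. n b * n b) = 1"
    and xn: "(\<Sum>b\<in>UNIV. x b * n b) = 0"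
    and xx: "(\<Sum>b\<in>UNIV. x b * x b) = r2"
    and r2_pos: "0 < r2"
    and trace: "(\<Sum>a\<in>UNIV. s a a) = 0"
begin

definition s2 where "s2 a b = (\<Sum>c\<in>UNIV. s a c * s c b)"
definition c2 where "c2 = (\<Sum>a\<in>UNIV. \<Sum>b\<in>UNIV. s a b * s a b)"
definition t3 where "t3 = (\<Sum>a\<in>UNIV. \<Sum>b\<in>UNIV. s a b * s2 a b)"
definition t4 where "t4 = (\<Sum>a\<in>UNIV. \<Sum>b\<in>UNIV. s2 a b * s2 a b)"
text \<open>Let D be the derivative of \<open>s\<close>. Differentiating s n = 0 and s x = 0,
  together with homogeneity along rays, prescribes the contractions of D with \<open>n\<close> and
  \<open>x\<close>. \<open>C\<close> is assembled to have exactly the opposite contractions, so that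
  D + \<open>C\<close> is the free part, tangent to the link of the cone.\<close>

definition C where "C a b d = n b * s2 a d + n d * s2 a b + (x a * s b d + x b * s a d + x d * s a b) / r2"

lemma s2_sym: "s2 a b = s2 b a"
  unfolding s2_def by (simp add: sym mult.commute)

lemma s2_kill:
  assumes "\<And>a. (\<Sum>b\<in>UNIV. u b * s a b) = 0" shows "(\<Sum>b\<in>UNIV. u b * s2 a b) = 0"
proof -
  have "(\<Sum>b\<in>UNIV. u b * s2 a b) = (\<Sum>c\<in>UNIV. s a c * (\<Sum>b\<in>UNIV. u b * s c b))"
    unfolding s2_def sum_distrib_left by (subst sum.swap) (simp add: mult_ac)
  then show ?thesis by (simp add: assms)
qed

lemma s2n: "(\<Sum>b\<in>UNIV. n b * s2 a b) = 0" by (rule s2_kill[OF sn])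
lemma s2x: "(\<Sum>b\<in>UNIV. x b * s2 a b) = 0" by (rule s2_kill[OF sx])

lemma nx: "(\<Sum>b\<in>UNIV. n b * x b) = 0" using xn by (simp add: mult.commute)

lemma C_contract:
  "(\<Sum>a\<in>UNIV. \<Sum>b\<in>UNIV. \<Sum>d\<in>UNIV. T a b d * C a b d)
   = (\<Sum>a\<in>UNIV. \<Sum>d\<in>UNIV. s2 a d * (\<Sum>b\<in>UNIV. n b * T a b d))
   + (\<Sum>a\<in>UNIV. \<Sum>b\<in>UNIV. s2 a b * (\<Sum>d\<in>UNIV. n d * T a b d))
   + ((\<Sum>b\<in>UNIV. \<Sum>d\<in>UNIV. s b d * (\<Sum>a\<in>UNIV. x a * T a b d))
    + (\<Sum>a\<in>UNIV. \<Sum>d\<in>UNIV. s a d * (\<Sum>b\<in>UNIV. x b * T a b d))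
    + (\<Sum>a\<in>UNIV. \<Sum>b\<in>UNIV. s a b * (\<Sum>d\<in>UNIV. x d * T a b d))) / r2"
proof -
  have mid: "(\<Sum>a\<in>UNIV. \<Sum>b\<in>UNIV. \<Sum>d\<in>UNIV. u b * m a d * T a b d)
      = (\<Sum>a\<in>UNIV. \<Sum>d\<in>UNIV. m a d * (\<Sum>b\<in>UNIV. u b * T a b d))" for u :: "'k \<Rightarrow> real" and m
    unfolding sum_distrib_left by (rule sum.cong[OF refl], subst sum.swap) (simp add: mult_ac)
  have last: "(\<Sum>a\<in>UNIV. \<Sum>b\<in>UNIV. \<Sum>d\<in>UNIV. u d * m a b * T a b d)
      = (\<Sum>a\<in>UNIV. \<Sum>b\<in>UNIV. m a b * (\<Sum>d\<in>UNIV. u d * T a b d))" for u :: "'k \<Rightarrow> real" and m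
    unfolding sum_distrib_left by (simp add: mult_ac)
  have first: "(\<Sum>a\<in>UNIV. \<Sum>b\<in>UNIV. \<Sum>d\<in>UNIV. u a * m b d * T a b d)
      = (\<Sum>b\<in>UNIV. \<Sum>d\<in>UNIV. m b d * (\<Sum>a\<in>UNIV. u a * T a b d))" for u :: "'k \<Rightarrow> real" and m
    unfolding sum_distrib_left
    by (subst sum.swap, rule sum.cong[OF refl], subst sum.swap) (simp add: mult_ac)
  have "T a b d * C a b d = n b * s2 a d * T a b d + n d * s2 a b * T a b d
     + (x a * s b d * T a b d + x b * s a d * T a b d + x d * s a b * T a b d) / r2" for a b d
    unfolding C_def by (simp add: field_simps)
  then show ?thesis
    by (simp only: sum.distrib sum_divide_distrib[symmetric] mid last first)
qed

lemma n_C_mid: "(\<Sum>b\<in>UNIV. n b * C a b d) = s2 a d"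
proof -
  have "(\<Sum>b\<in>UNIV. n b * C a b d) = s2 a d * (\<Sum>b\<in>UNIV. n b * n b) + n d * (\<Sum>b\<in>UNIV. n b * s2 a b)
     + (x a * (\<Sum>b\<in>UNIV. n b * s d b) + s a d * (\<Sum>b\<in>UNIV. n b * x b) + x d * (\<Sum>b\<in>UNIV. n b * s a b)) / r2"
    unfolding C_def sum_distrib_left sum_divide_distrib sum.distrib[symmetric]
    by (rule sum.cong[OF refl]) (simp add: sym[of d] field_simps)
  then show ?thesis by (simp add: nn s2n sn nx)
qed

lemma C_sym: "C a b d = C a d b" unfolding C_def by (simp add: sym[of d b] algebra_simps)

lemma n_C_last: "(\<Sum>d\<in>UNIV. n d * C a b d) = s2 a b"
  by (subst C_sym) (rule n_C_mid)

lemma x_C_first: "(\<Sum>a\<in>UNIV. x a * C a b d) = s b d"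
proof -
  have "(\<Sum>a\<in>UNIV. x a * C a b d) = n b * (\<Sum>a\<in>UNIV. x a * s2 a d) + n d * (\<Sum>a\<in>UNIV. x a * s2 a b)
     + (s b d * (\<Sum>a\<in>UNIV. x a * x a) + x b * (\<Sum>a\<in>UNIV. x a * s a d) + x d * (\<Sum>a\<in>UNIV. x a * s a b)) / r2"
    unfolding C_def sum_distrib_left sum_divide_distrib sum.distrib[symmetric]
    by (rule sum.cong[OF refl]) (simp add: field_simps)
  moreover have "(\<Sum>a\<in>UNIV. x a * s a d) = 0" "(\<Sum>a\<in>UNIV. x a * s2 a d) = 0" for d
    using sx[of d] s2x[of d] by (simp_all add: sym[of d] s2_sym[of d])
  ultimately show ?thesis using r2_pos by (simp add: xx)
qed

lemma x_C_mid: "(\<Sum>b\<in>UNIV. x b * C a b d) = s a d"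
proof -
  have "(\<Sum>b\<in>UNIV. x b * C a b d) = s2 a d * (\<Sum>b\<in>UNIV. x b * n b) + n d * (\<Sum>b\<in>UNIV. x b * s2 a b)
     + (x a * (\<Sum>b\<in>UNIV. x b * s d b) + s a d * (\<Sum>b\<in>UNIV. x b * x b) + x d * (\<Sum>b\<in>UNIV. x b * s a b)) / r2"
    unfolding C_def sum_distrib_left sum_divide_distrib sum.distrib[symmetric]
    by (rule sum.cong[OF refl]) (simp add: sym[of d] field_simps)
  then show ?thesis using r2_pos by (simp add: xn xx s2x sx)
qed

lemma x_C_last: "(\<Sum>d\<in>UNIV. x d * C a b d) = s a b"
  by (subst C_sym) (rule x_C_mid)

text \<open>Pythagoras. By \<open>C_contract\<close> an inner product with \<open>C\<close> depends
  only on contractions with \<open>n\<close> and \<open>x\<close>, so the inner product of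
  \<open>D\<close> and \<open>C\<close> is minus the squared norm of \<open>C\<close>, which is 2
  \<open>t4\<close> + 3 \<open>c2\<close> / \<open>r2\<close>.\<close>

lemma B_norm:
  assumes D: "\<And>a d. (\<Sum>b\<in>UNIV. n b * D a b d) = - s2 a d"
    "\<And>a b. (\<Sum>d\<in>UNIV. n d * D a b d) = - s2 a b"
    "\<And>b d. (\<Sum>a\<in>UNIV. x a * D a b d) = - s b d"
    "\<And>a d. (\<Sum>b\<in>UNIV. x b * D a b d) = - s a d"
    "\<And>a b. (\<Sum>d\<in>UNIV. x d * D a b d) = - s a b"
  shows "(\<Sum>a\<in>UNIV. \<Sum>b\<in>UNIV. \<Sum>d\<in>UNIV. (D a b d + C a b d) * (D a b d + C a b d))
    = (\<Sum>a\<in>UNIV. \<Sum>b\<in>UNIV. \<Sum>d\<in>UNIV. D a b d * D a b d) - 2 * t4 - 3 * c2 / r2"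
proof -
  have DC: "(\<Sum>a\<in>UNIV. \<Sum>b\<in>UNIV. \<Sum>d\<in>UNIV. D a b d * C a b d) = - 2 * t4 - 3 * c2 / r2"
    unfolding C_contract D by (simp add: sum_negf t4_def c2_def)
  have CC: "(\<Sum>a\<in>UNIV. \<Sum>b\<in>UNIV. \<Sum>d\<in>UNIV. C a b d * C a b d) = 2 * t4 + 3 * c2 / r2"
    unfolding C_contract[of C] n_C_mid n_C_last x_C_first x_C_mid x_C_last by (simp add: t4_def c2_def)
  have "(\<Sum>a\<in>UNIV. \<Sum>b\<in>UNIV. \<Sum>d\<in>UNIV. (D a b d + C a b d) * (D a b d + C a b d))
    = (\<Sum>a\<in>UNIV. \<Sum>b\<in>UNIV. \<Sum>d\<in>UNIV. D a b d * D a b d)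
    + 2 * (\<Sum>a\<in>UNIV. \<Sum>b\<in>UNIV. \<Sum>d\<in>UNIV. D a b d * C a b d)
    + (\<Sum>a\<in>UNIV. \<Sum>b\<in>UNIV. \<Sum>d\<in>UNIV. C a b d * C a b d)"
    unfolding sum_distrib_left sum.distrib[symmetric]
    by (intro sum.cong refl) (simp add: algebra_simps)
  then show ?thesis unfolding DC CC by simp
qed

lemma trace_s2: "(\<Sum>a\<in>UNIV. s2 a a) = c2"
  unfolding s2_def c2_def by (intro sum.cong refl) (metis sym)

text \<open>The functional that turns the Ricci identity of the equality case into a scalar
  equation: contraction with s \<otimes> s^2. A term with \<open>n\<close> or \<open>x\<close> as a
  factor in one of the four indices vanishes under it, because both are null directions of
  \<open>s\<close> and of \<open>s2\<close>.\<close>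

definition \<Phi> where
  "\<Phi> U = (\<Sum>a\<in>UNIV. \<Sum>b\<in>UNIV. \<Sum>e\<in>UNIV. \<Sum>d\<in>UNIV. s a b * s2 e d * U a e b d)"

lemma \<Phi>_add: "\<Phi> (\<lambda>a e b d. U a e b d + V a e b d) = \<Phi> U + \<Phi> V"
  unfolding \<Phi>_def by (simp add: distrib_left sum.distrib)

lemma \<Phi>_cmult: "\<Phi> (\<lambda>a e b d. c * U a e b d) = c * \<Phi> U"
  unfolding \<Phi>_def sum_distrib_left by (simp add: mult_ac)

lemma \<Phi>_kill_d:
  assumes "\<And>e. (\<Sum>d\<in>UNIV. u d * s2 e d) = 0" shows "\<Phi> (\<lambda>a e b d. u d * V a e b) = 0"
proof -
  have "(\<Sum>d\<in>UNIV. s a b * s2 e d * (u d * V a e b)) = s a b * V a e b * (\<Sum>d\<in>UNIV. u d * s2 e d)" for a b e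
    by (simp add: sum_distrib_left mult_ac)
  then show ?thesis unfolding \<Phi>_def by (simp add: assms)
qed

lemma \<Phi>_kill_e:
  assumes "\<And>d. (\<Sum>e\<in>UNIV. u e * s2 d e) = 0" shows "\<Phi> (\<lambda>a e b d. u e * V a b d) = 0"
proof -
  have "(\<Sum>e\<in>UNIV. \<Sum>d\<in>UNIV. s a b * s2 e d * (u e * V a b d)) = (\<Sum>d\<in>UNIV. s a b * V a b d * (\<Sum>e\<in>UNIV. u e * s2 d e))"
    for a b
    unfolding sum_distrib_left by (subst sum.swap) (simp add: s2_sym mult_ac)
  then show ?thesis unfolding \<Phi>_def by (simp add: assms)
qed

lemma \<Phi>_kill_b:
  assumes "\<And>a. (\<Sum>b\<in>UNIV. u b * s a b) = 0" shows "\<Phi> (\<lambda>a e b d. u b * V a e d) = 0"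
proof -
  have "(\<Sum>b\<in>UNIV. \<Sum>e\<in>UNIV. \<Sum>d\<in>UNIV. s a b * s2 e d * (u b * V a e d))
      = (\<Sum>e\<in>UNIV. \<Sum>d\<in>UNIV. s2 e d * V a e d * (\<Sum>b\<in>UNIV. u b * s a b))" for a
    unfolding sum_distrib_left
    by (subst sum.swap, rule sum.cong[OF refl], subst sum.swap) (simp add: mult_ac)
  then show ?thesis unfolding \<Phi>_def by (simp add: assms)
qed

lemma \<Phi>_kill_a:
  assumes "\<And>b. (\<Sum>a\<in>UNIV. u a * s b a) = 0" shows "\<Phi> (\<lambda>a e b d. u a * V e b d) = 0"
proof -
  have "\<Phi> (\<lambda>a e b d. u a * V e b d) = \<Phi> (\<lambda>a e b d. u b * V e a d)"
    unfolding \<Phi>_def by (subst sum.swap) (simp add: sym)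
  then show ?thesis using \<Phi>_kill_b[OF assms, of "\<lambda>a e d. V e a d"] by simp
qed

text \<open>Exchange the names a with b and e with d, and use the symmetry of \<open>s\<close> and
  \<open>s2\<close>. These two contractions stand on opposite sides in \<open>scalar_ricci\<close>
  and cancel there.\<close>

lemma \<Phi>_swap: "\<Phi> (\<lambda>a e b d. s e b * s2 a d) = \<Phi> (\<lambda>a e b d. s a d * s2 e b)"
proof -
  have "\<Phi> (\<lambda>a e b d. s e b * s2 a d)
      = (\<Sum>b\<in>UNIV. \<Sum>a\<in>UNIV. \<Sum>d\<in>UNIV. \<Sum>e\<in>UNIV. s a b * s2 e d * (s e b * s2 a d))"
    unfolding \<Phi>_def by (rule trans[OF sum.swap], rule sum.cong[OF refl], rule sum.cong[OF refl], rule sum.swap)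
  also have "\<dots> = \<Phi> (\<lambda>a e b d. s a d * s2 e b)"
  proof -
    have e: "s b a * s2 d e * (s d a * s2 b e) = s a b * s2 e d * (s a d * s2 e b)" for a b d e
      by (simp add: sym[of b a] sym[of d a] s2_sym[of d e] s2_sym[of b e])
    show ?thesis unfolding \<Phi>_def e ..
  qed
  finally show ?thesis .
qed

lemma \<Phi>_ss2: "\<Phi> (\<lambda>a e b d. s a b * s2 e d) = c2 * t4"
proof -
  have "\<Phi> (\<lambda>a e b d. s a b * s2 e d) = (\<Sum>a\<in>UNIV. \<Sum>b\<in>UNIV. (s a b * s a b) * t4)"
    unfolding \<Phi>_def t4_def sum_distrib_left by (simp add: mult_ac)
  then show ?thesis by (simp add: sum_distrib_right[symmetric] c2_def)
qed

lemma \<Phi>_s2s: "\<Phi> (\<lambda>a e b d. s e d * s2 a b) = t3 * t3"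
proof -
  have "\<Phi> (\<lambda>a e b d. s e d * s2 a b) = (\<Sum>a\<in>UNIV. \<Sum>b\<in>UNIV. (s a b * s2 a b) * t3)"
    unfolding \<Phi>_def sum_distrib_left t3_def by (simp add: mult_ac)
  then show ?thesis by (simp add: sum_distrib_right[symmetric] t3_def)
qed

lemma s2_sum: "(\<Sum>c\<in>UNIV. s c a * s c b) = s2 a b"
  unfolding s2_def by (simp add: sym[of a])

lemma \<Phi>_ae: "\<Phi> (\<lambda>a e b d. (if a = e then 1 else 0) * s b d) = t4"
proof -
  have "\<Phi> (\<lambda>a e b d. (if a = e then 1 else 0) * s b d)
      = (\<Sum>a\<in>UNIV. \<Sum>b\<in>UNIV. \<Sum>e\<in>UNIV. if a = e then (\<Sum>d\<in>UNIV. s a b * s2 a d * s b d) else 0)"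
    unfolding \<Phi>_def by (intro sum.cong refl) auto
  also have "\<dots> = (\<Sum>a\<in>UNIV. \<Sum>d\<in>UNIV. s2 a d * (\<Sum>b\<in>UNIV. s b a * s b d))"
    unfolding sum_distrib_left
    by (simp, rule sum.cong[OF refl], subst sum.swap) (simp add: sym mult_ac)
  finally show ?thesis by (simp add: s2_sum t4_def)
qed

lemma \<Phi>_ab: "\<Phi> (\<lambda>a e b d. (if a = b then 1 else 0) * s e d) = 0"
proof -
  have "\<Phi> (\<lambda>a e b d. (if a = b then 1 else 0) * s e d)
      = (\<Sum>a\<in>UNIV. \<Sum>b\<in>UNIV. if a = b then s a a * t3 else 0)"
    unfolding \<Phi>_def t3_def sum_distrib_left by (intro sum.cong refl) (auto simp: mult_ac)
  then show ?thesis by (simp add: sum_distrib_right[symmetric] trace)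
qed

lemma \<Phi>_ad: "\<Phi> (\<lambda>a e b d. (if a = d then 1 else 0) * s e b) = t4"
proof -
  have "\<Phi> (\<lambda>a e b d. (if a = d then 1 else 0) * s e b)
      = (\<Sum>a\<in>UNIV. \<Sum>b\<in>UNIV. \<Sum>e\<in>UNIV. \<Sum>d\<in>UNIV. if a = d then s a b * s2 e a * s e b else 0)"
    unfolding \<Phi>_def by (intro sum.cong refl) auto
  also have "\<dots> = (\<Sum>a\<in>UNIV. \<Sum>e\<in>UNIV. s2 a e * (\<Sum>b\<in>UNIV. s b a * s b e))"
    unfolding sum_distrib_left
    by (simp, rule sum.cong[OF refl], subst sum.swap) (simp add: sym s2_sym mult_ac)
  finally show ?thesis by (simp add: s2_sum t4_def)
qed

lemma \<Phi>_eb: "\<Phi> (\<lambda>a e b d. (if e = b then 1 else 0) * s a d) = t4"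
proof -
  have "\<Phi> (\<lambda>a e b d. (if e = b then 1 else 0) * s a d)
      = (\<Sum>a\<in>UNIV. \<Sum>b\<in>UNIV. \<Sum>e\<in>UNIV. if e = b then (\<Sum>d\<in>UNIV. s a b * s2 b d * s a d) else 0)"
    unfolding \<Phi>_def by (intro sum.cong refl) auto
  also have "\<dots> = (\<Sum>b\<in>UNIV. \<Sum>d\<in>UNIV. s2 b d * (\<Sum>a\<in>UNIV. s a b * s a d))"
    unfolding sum_distrib_left
    by (simp, subst sum.swap, rule sum.cong[OF refl], subst sum.swap) (simp add: mult_ac)
  finally show ?thesis by (simp add: s2_sum t4_def)
qed

lemma \<Phi>_ed: "\<Phi> (\<lambda>a e b d. (if e = d then 1 else 0) * s a b) = c2 * c2"
proof -
  have "\<Phi> (\<lambda>a e b d. (if e = d then 1 else 0) * s a b)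
      = (\<Sum>a\<in>UNIV. \<Sum>b\<in>UNIV. (s a b * s a b) * (\<Sum>e\<in>UNIV. \<Sum>d\<in>UNIV. if e = d then s2 e e else 0))"
    unfolding \<Phi>_def sum_distrib_left by (intro sum.cong refl) (auto simp: mult_ac)
  then show ?thesis by (simp add: sum_distrib_right[symmetric] trace_s2 c2_def)
qed

text \<open>The orthogonal projection onto the complement of \<open>n\<close> and \<open>x\<close>,
  that is, the metric of the link of the cone; hence its trace CARD('k) - 2.\<close>

definition K where "K e d = (if e = d then 1 else 0) - n e * n d - x e * x d / r2"

lemma K_contract:
  assumes "\<And>e. (\<Sum>d\<in>UNIV. n d * m e d) = 0" "\<And>e. (\<Sum>d\<in>UNIV. x d * m e d) = 0"
  shows "(\<Sum>e\<in>UNIV. \<Sum>d\<in>UNIV. m e d * K e d) = (\<Sum>e\<in>UNIV. m e e)"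
proof -
  have "(\<Sum>d\<in>UNIV. m e d * K e d) = m e e" for e
  proof -
    have "(\<Sum>d\<in>UNIV. m e d * K e d) = (\<Sum>d\<in>UNIV. (if e = d then m e d else 0))
        - n e * (\<Sum>d\<in>UNIV. n d * m e d) - x e / r2 * (\<Sum>d\<in>UNIV. x d * m e d)"
      unfolding sum_distrib_left sum_subtractf[symmetric]
      by (intro sum.cong refl) (simp add: K_def algebra_simps)
    then show ?thesis by (simp add: assms)
  qed
  then show ?thesis by simp
qed

lemma n_K: "(\<Sum>d\<in>UNIV. n d * K e d) = 0"
proof -
  have "(\<Sum>d\<in>UNIV. n d * K e d) = (\<Sum>d\<in>UNIV. if e = d then n d else 0)
      - n e * (\<Sum>d\<in>UNIV. n d * n d) - x e / r2 * (\<Sum>d\<in>UNIV. n d * x d)"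
    unfolding sum_distrib_left sum_subtractf[symmetric]
    by (intro sum.cong refl) (simp add: K_def algebra_simps)
  then show ?thesis by (simp add: nn nx)
qed

lemma x_K: "(\<Sum>d\<in>UNIV. x d * K e d) = 0"
proof -
  have "(\<Sum>d\<in>UNIV. x d * K e d) = (\<Sum>d\<in>UNIV. if e = d then x d else 0)
      - n e * (\<Sum>d\<in>UNIV. x d * n d) - x e / r2 * (\<Sum>d\<in>UNIV. x d * x d)"
    unfolding sum_distrib_left sum_subtractf[symmetric]
    by (intro sum.cong refl) (simp add: K_def algebra_simps)
  then show ?thesis using r2_pos by (simp add: xn xx)
qed

lemma trace_K: "(\<Sum>e\<in>UNIV. K e e) = real CARD('k) - 2"
proof -
  have "(\<Sum>e\<in>UNIV. K e e) = real CARD('k) - (\<Sum>e\<in>UNIV. n e * n e) - (\<Sum>e\<in>UNIV. x e * x e) / r2"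
    by (simp add: K_def sum_subtractf sum_divide_distrib)
  then show ?thesis using r2_pos by (simp add: nn xx)
qed

text \<open>\<open>s\<close> and \<open>K\<close> are orthogonal as arrays, and t3 / c2 and 1 / r2
  are the coefficients of the orthogonal projection of \<open>s2\<close> onto their span. Hypothesis
  \<open>eq\<close> says that \<open>s2\<close> has the same norm as this projection, so the
  remainder \<open>M\<close> vanishes. On the link \<open>s\<close> thus satisfies a quadratic
  equation and has at most two eigenvalues.\<close>

lemma s2_quadratic:
  assumes dim: "c2 = (real CARD('k) - 2) / r2" and c2: "c2 \<noteq> 0"
    and eq: "c2 * t4 = t3 * t3 + c2 * c2 / r2"
  shows "s2 e d = (t3 / c2) * s e d + K e d / r2"
proof -
  define M where "M e d = c2 * s2 e d - t3 * s e d - (c2 / r2) * K e d" for e d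
  have sK: "(\<Sum>e\<in>UNIV. \<Sum>d\<in>UNIV. s e d * K e d) = 0"
    using K_contract[OF sn sx] trace by simp
  have s2K: "(\<Sum>e\<in>UNIV. \<Sum>d\<in>UNIV. s2 e d * K e d) = c2"
    using K_contract[OF s2n s2x] trace_s2 by simp
  have KK: "(\<Sum>e\<in>UNIV. \<Sum>d\<in>UNIV. K e d * K e d) = real CARD('k) - 2"
    using K_contract[OF n_K x_K] trace_K by simp
  have "(\<Sum>e\<in>UNIV. \<Sum>d\<in>UNIV. M e d * M e d)
    = c2 * c2 * (\<Sum>e\<in>UNIV. \<Sum>d\<in>UNIV. s2 e d * s2 e d) + t3 * t3 * (\<Sum>e\<in>UNIV. \<Sum>d\<in>UNIV. s e d * s e d)
      + (c2 / r2) * (c2 / r2) * (\<Sum>e\<in>UNIV. \<Sum>d\<in>UNIV. K e d * K e d)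
      - 2 * c2 * t3 * (\<Sum>e\<in>UNIV. \<Sum>d\<in>UNIV. s e d * s2 e d)
      - 2 * c2 * (c2 / r2) * (\<Sum>e\<in>UNIV. \<Sum>d\<in>UNIV. s2 e d * K e d)
      + 2 * t3 * (c2 / r2) * (\<Sum>e\<in>UNIV. \<Sum>d\<in>UNIV. s e d * K e d)"
    unfolding sum_distrib_left sum_subtractf[symmetric] sum.distrib[symmetric]
    by (intro sum.cong refl) (simp add: M_def algebra_simps)
  also have "\<dots> = c2 * c2 * t4 + t3 * t3 * c2 + (c2 / r2) * (c2 / r2) * (real CARD('k) - 2)
      - 2 * c2 * t3 * t3 - 2 * c2 * (c2 / r2) * c2"
    unfolding sK s2K KK t4_def[symmetric] c2_def[symmetric] t3_def[symmetric] by simp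
  also have "(c2 / r2) * (c2 / r2) * (real CARD('k) - 2) = c2 * (c2 / r2) * c2"
  proof -
    have k: "real CARD('k) - 2 = c2 * r2" using dim r2_pos by (simp add: field_simps)
    show ?thesis unfolding k using r2_pos by (simp add: field_simps)
  qed
  also have "c2 * c2 * t4 + t3 * t3 * c2 + c2 * (c2 / r2) * c2 - 2 * c2 * t3 * t3 - 2 * c2 * (c2 / r2) * c2
      = c2 * (c2 * t4 - t3 * t3 - c2 * c2 / r2)" by (simp add: algebra_simps)
  also have "\<dots> = 0" using eq by simp
  finally have "(\<Sum>e\<in>UNIV. \<Sum>d\<in>UNIV. M e d * M e d) = 0" .
  then have "M e d * M e d = 0" for e d
    by (subst (asm) sum_nonneg_eq_0_iff, simp, simp add: sum_nonneg)
      (subst (asm) sum_nonneg_eq_0_iff, auto)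
  then have "M e d = 0" by simp
  then show ?thesis using c2 r2_pos by (simp add: M_def field_simps)
qed

end

subsection \<open>The second fundamental form of a minimal patch\<close>

context patch
begin

definition S2 where "S2 a b = (\<lambda>x. \<Sum>c\<in>UNIV. S a c x * S c b x)"
definition c2 where "c2 = (\<lambda>x. \<Sum>a\<in>UNIV. \<Sum>b\<in>UNIV. S a b x * S a b x)"
text \<open>Not the covariant derivative: the plain tangential derivatives of the ambient
  components, which keep the normal components computed in \<open>nu_D_mid\<close>.\<close>

definition D where "D a b d = \<delta> a (S b d)"
text \<open>The Laplace-Beltrami operator: summing over an ambient orthonormal basis takes the
  tangential divergence of the intrinsic gradient.\<close>

definition \<Delta> where "\<Delta> f x = (\<Sum>a\<in>UNIV. \<delta> a (\<delta> a f) x)"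

lemma S2_smooth [intro]: "Cinf_on (S2 a b) W"
  unfolding S2_def by (intro Cinf_on_sum Cinf_on_mult open_W S_smooth)
lemma c2_smooth [intro]: "Cinf_on c2 W"
  unfolding c2_def by (intro Cinf_on_sum Cinf_on_mult open_W S_smooth)
lemma D_smooth [intro]: "Cinf_on (D a b d) W"
  unfolding D_def by auto

lemma D_sym: "x \<in> W \<Longrightarrow> D a b d x = D a d b x"
  unfolding D_def by (intro \<delta>_cong) (auto simp: S_sym)

lemma S_nu': "x \<in> W \<Longrightarrow> (\<Sum>b\<in>UNIV. \<nu> x $ b * S b a x) = 0"
  using S_nu by (simp add: S_sym[of x _ a])

lemma nu_D_mid: assumes x: "x \<in> W" shows "(\<Sum>b\<in>UNIV. \<nu> x $ b * D a b d x) = - S2 a d x"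
proof -
  have "\<delta> a (\<lambda>y. \<Sum>b\<in>UNIV. nc b y * S b d y) x = \<delta> a (\<lambda>y. 0) x"
    by (intro \<delta>_cong) (auto simp: S_nu' x)
  moreover have "\<delta> a (\<lambda>y. \<Sum>b\<in>UNIV. nc b y * S b d y) x = (\<Sum>b\<in>UNIV. \<nu> x $ b * D a b d x + S a b x * S b d x)"
    using x by (subst \<delta>_sum)
      (auto intro!: sum.cong Cinf_on_mult open_W simp: \<delta>_mult[OF nc_smooth S_smooth] D_def S_def[of a])
  ultimately show ?thesis by (simp add: sum.distrib S2_def)
qed

lemma nu_D_last: "x \<in> W \<Longrightarrow> (\<Sum>d\<in>UNIV. \<nu> x $ d * D a b d x) = - S2 a b x"
  using nu_D_mid by (simp add: D_sym[of x a b])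

text \<open>The Codazzi equation; the two terms with \<open>\<nu>\<close> account for the normal
  components that \<open>D\<close> retains.\<close>

lemma codazzi:
  assumes x: "x \<in> W"
  shows "D a b d x = D b a d x + (\<nu> x $ a * S2 b d x - \<nu> x $ b * S2 a d x)"
proof -
  have "(\<Sum>c\<in>UNIV. (\<nu> x $ a * S b c x - \<nu> x $ b * S a c x) * S c d x)
      = \<nu> x $ a * S2 b d x - \<nu> x $ b * S2 a d x"
    by (simp add: S2_def sum_distrib_left left_diff_distrib sum_subtractf mult.assoc)
  then show ?thesis
    using commutator[OF nc_smooth x, of a b d] by (simp add: D_def S_def)
qed

lemma \<delta>_c2: assumes x: "x \<in> W" shows "\<delta> a c2 x = 2 * (\<Sum>b\<in>UNIV. \<Sum>d\<in>UNIV. S b d x * D a b d x)"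
proof -
  have "\<delta> a c2 x = (\<Sum>b\<in>UNIV. \<Sum>d\<in>UNIV. \<delta> a (\<lambda>y. S b d y * S b d y) x)"
    unfolding c2_def using x
    by (subst \<delta>_sum) (auto intro!: sum.cong \<delta>_sum Cinf_on_sum Cinf_on_mult open_W)
  then show ?thesis
    using x by (simp add: \<delta>_mult[OF S_smooth S_smooth] D_def sum_distrib_left)
qed

lemma \<Delta>_mult:
  assumes f: "Cinf_on f W" and h: "Cinf_on h W" and x: "x \<in> W"
  shows "\<Delta> (\<lambda>y. f y * h y) x = f x * \<Delta> h x + 2 * (\<Sum>a\<in>UNIV. \<delta> a f x * \<delta> a h x) + \<Delta> f x * h x"
proof -
  have "\<delta> a (\<delta> a (\<lambda>y. f y * h y)) x
      = f x * \<delta> a (\<delta> a h) x + 2 * (\<delta> a f x * \<delta> a h x) + \<delta> a (\<delta> a f) x * h x" for a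
  proof -
    have "\<delta> a (\<delta> a (\<lambda>y. f y * h y)) x = \<delta> a (\<lambda>y. f y * \<delta> a h y + \<delta> a f y * h y) x"
      using f h x by (intro \<delta>_cong) (auto simp: \<delta>_mult intro!: Cinf_on_add Cinf_on_mult open_W)
    also have "\<dots> = f x * \<delta> a (\<delta> a h) x + 2 * (\<delta> a f x * \<delta> a h x) + \<delta> a (\<delta> a f) x * h x"
      using f h x by (subst \<delta>_add) (auto simp: \<delta>_mult \<delta>_smooth intro!: Cinf_on_mult open_W)
    finally show ?thesis .
  qed
  then show ?thesis unfolding \<Delta>_def by (simp add: sum.distrib sum_distrib_left sum_distrib_right)
qed

lemma \<Delta>_c2:
  assumes x: "x \<in> W"
  shows "\<Delta> c2 x = 2 * (\<Sum>a\<in>UNIV. \<Sum>b\<in>UNIV. \<Sum>d\<in>UNIV. D a b d x * D a b d x)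
    + 2 * (\<Sum>b\<in>UNIV. \<Sum>d\<in>UNIV. S b d x * (\<Sum>a\<in>UNIV. \<delta> a (D a b d) x))"
proof -
  have "\<delta> a (\<delta> a c2) x = 2 * (\<Sum>b\<in>UNIV. \<Sum>d\<in>UNIV. D a b d x * D a b d x)
       + 2 * (\<Sum>b\<in>UNIV. \<Sum>d\<in>UNIV. S b d x * \<delta> a (D a b d) x)" for a
  proof -
    have "\<delta> a (\<delta> a c2) x = \<delta> a (\<lambda>y. \<Sum>b\<in>UNIV. \<Sum>d\<in>UNIV. 2 * (S b d y * D a b d y)) x"
      by (intro \<delta>_cong) (auto simp: \<delta>_c2 sum_distrib_left x intro!: Cinf_on_sum Cinf_on_mult open_W)
    also have "\<dots> = (\<Sum>b\<in>UNIV. \<Sum>d\<in>UNIV. \<delta> a (\<lambda>y. 2 * (S b d y * D a b d y)) x)"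
      using x by (subst \<delta>_sum) (auto intro!: sum.cong \<delta>_sum Cinf_on_sum Cinf_on_mult open_W)
    also have "\<dots> = (\<Sum>b\<in>UNIV. \<Sum>d\<in>UNIV. 2 * (D a b d x * D a b d x) + 2 * (S b d x * \<delta> a (D a b d) x))"
    proof (intro sum.cong refl)
      fix b d
      have "\<delta> a (\<lambda>y. 2 * (S b d y * D a b d y)) x = 2 * \<delta> a (\<lambda>y. S b d y * D a b d y) x"
        using x by (subst \<delta>_mult) (auto intro!: Cinf_on_mult open_W)
      then show "\<delta> a (\<lambda>y. 2 * (S b d y * D a b d y)) x
          = 2 * (D a b d x * D a b d x) + 2 * (S b d x * \<delta> a (D a b d) x)"
        using \<delta>_mult[OF S_smooth D_smooth x, of a b d a b d] by (simp add: D_def[of a b d, symmetric] algebra_simps)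
    qed
    finally show ?thesis by (simp add: sum.distrib sum_distrib_left)
  qed
  moreover have "(\<Sum>a\<in>UNIV. \<Sum>b\<in>UNIV. \<Sum>d\<in>UNIV. S b d x * \<delta> a (D a b d) x)
      = (\<Sum>b\<in>UNIV. \<Sum>d\<in>UNIV. S b d x * (\<Sum>a\<in>UNIV. \<delta> a (D a b d) x))"
    unfolding sum_distrib_left by (subst sum.swap, rule sum.cong[OF refl], rule sum.swap)
  ultimately show ?thesis
    unfolding \<Delta>_def by (simp add: sum.distrib sum_distrib_left[symmetric])
qed

end

locale minimal_patch = patch W \<psi> \<nu>
  for W :: "(real ^ 'n::finite) set" and \<psi> \<nu> :: "real ^ 'n \<Rightarrow> real ^ 'k::finite" +
  assumes minimal: "x \<in> W \<Longrightarrow> (\<Sum>a\<in>UNIV. S a a x) = 0"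
begin

text \<open>This is the equation \<Delta>\<nu> = - |A|^2 \<nu>. Commuting the derivatives moves one
  of them onto the trace, which vanishes by minimality; the quadratic commutator term
  remains.\<close>

lemma div_S: assumes x: "x \<in> W" shows "(\<Sum>a\<in>UNIV. \<delta> a (S a c) x) = - (c2 x * \<nu> x $ c)"
proof -
  have 1: "\<delta> a (S a c) x = \<delta> c (S a a) x + (\<Sum>d\<in>UNIV. (\<nu> x $ a * S c d x - \<nu> x $ c * S a d x) * S d a x)" for a
  proof -
    have "\<delta> a (S a c) x = \<delta> a (S c a) x"
      using D_sym[OF x] by (simp add: D_def)
    then show ?thesis using commutator[OF nc_smooth x, of a c a] by (simp add: S_def)
  qed
  have "(\<Sum>a\<in>UNIV. \<delta> c (S a a) x) = \<delta> c (\<lambda>y. \<Sum>a\<in>UNIV. S a a y) x"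
    using x by (subst \<delta>_sum) auto
  also have "\<dots> = \<delta> c (\<lambda>y. 0) x" by (intro \<delta>_cong) (auto simp: minimal x)
  finally have 2: "(\<Sum>a\<in>UNIV. \<delta> c (S a a) x) = 0" by simp
  have "(\<Sum>a\<in>UNIV. \<Sum>d\<in>UNIV. (\<nu> x $ a * S c d x - \<nu> x $ c * S a d x) * S d a x)
      = (\<Sum>d\<in>UNIV. S c d x * (\<Sum>a\<in>UNIV. \<nu> x $ a * S d a x)) - \<nu> x $ c * c2 x"
  proof -
    have "(\<Sum>a\<in>UNIV. \<Sum>d\<in>UNIV. \<nu> x $ a * S c d x * S d a x) = (\<Sum>d\<in>UNIV. S c d x * (\<Sum>a\<in>UNIV. \<nu> x $ a * S d a x))"
      unfolding sum_distrib_left by (subst sum.swap) (simp add: mult_ac)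
    moreover have "(\<Sum>a\<in>UNIV. \<Sum>d\<in>UNIV. \<nu> x $ c * S a d x * S d a x) = \<nu> x $ c * c2 x"
      unfolding c2_def sum_distrib_left by (intro sum.cong refl) (simp add: S_sym[OF x] mult_ac)
    ultimately show ?thesis by (simp add: left_diff_distrib sum_subtractf)
  qed
  then show ?thesis unfolding 1 sum.distrib 2 by (simp add: S_nu[OF x] mult.commute)
qed

text \<open>The Codazzi equation and the commutator carry the outer derivative inwards until a
  divergence appears, which \<open>div_S\<close> evaluates. Terms with a factor \<nu>_b or \<nu>_d
  are left unevaluated, since they disappear on contraction with \<open>S\<close>.\<close>

lemma lap_S:
  assumes x: "x \<in> W"
  shows "(\<Sum>a\<in>UNIV. \<delta> a (D a b d) x) = - (c2 x * S b d x) - 2 * (\<Sum>c\<in>UNIV. S b c x * S2 c d x)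
    - \<nu> x $ d * \<delta> b c2 x
    - \<nu> x $ b * ((\<Sum>a\<in>UNIV. \<Sum>c\<in>UNIV. S a c x * D c a d x) + (\<Sum>a\<in>UNIV. \<delta> a (S2 a d) x))"
proof -
  have 1: "\<delta> a (D a b d) x = \<delta> a (D b a d) x + (\<nu> x $ a * \<delta> a (S2 b d) x + S a a x * S2 b d x)
      - (\<nu> x $ b * \<delta> a (S2 a d) x + S a b x * S2 a d x)" for a
  proof -
    have "\<delta> a (D a b d) x = \<delta> a (\<lambda>y. D b a d y + (nc a y * S2 b d y - nc b y * S2 a d y)) x"
      by (intro \<delta>_cong) (auto simp: codazzi[of _ a b] x intro!: Cinf_on_add Cinf_on_diff Cinf_on_mult open_W)
    also have "\<dots> = \<delta> a (D b a d) x + (\<delta> a (\<lambda>y. nc a y * S2 b d y) x - \<delta> a (\<lambda>y. nc b y * S2 a d y) x)"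
      using x by (simp add: \<delta>_add \<delta>_diff D_smooth Cinf_on_diff Cinf_on_mult open_W S2_smooth nc_smooth)
    finally show ?thesis
      by (simp add: \<delta>_mult[OF nc_smooth S2_smooth x] S_def)
  qed
  have 2: "\<delta> a (D b a d) x = \<delta> b (\<delta> a (S a d)) x + (\<Sum>c\<in>UNIV. (\<nu> x $ a * S b c x - \<nu> x $ b * S a c x) * D c a d x)" for a
    using commutator[OF S_smooth x, of a b a d] by (simp add: D_def)
  have 3: "(\<Sum>a\<in>UNIV. \<delta> b (\<delta> a (S a d)) x) = - (c2 x * S b d x) - \<nu> x $ d * \<delta> b c2 x"
  proof -
    have "(\<Sum>a\<in>UNIV. \<delta> b (\<delta> a (S a d)) x) = \<delta> b (\<lambda>y. \<Sum>a\<in>UNIV. \<delta> a (S a d) y) x"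
      using x by (subst \<delta>_sum) auto
    also have "\<dots> = \<delta> b (\<lambda>y. - (c2 y * nc d y)) x"
      using x by (intro \<delta>_cong Cinf_on_uminus Cinf_on_mult open_W) (auto simp: div_S)
    also have "\<dots> = - (c2 x * S b d x) - \<nu> x $ d * \<delta> b c2 x"
      using x by (subst \<delta>_uminus) (auto simp: \<delta>_mult[OF c2_smooth nc_smooth] S_def intro!: Cinf_on_mult open_W)
    finally show ?thesis .
  qed
  have 4: "(\<Sum>a\<in>UNIV. \<Sum>c\<in>UNIV. (\<nu> x $ a * S b c x - \<nu> x $ b * S a c x) * D c a d x)
     = - (\<Sum>c\<in>UNIV. S b c x * S2 c d x) - \<nu> x $ b * (\<Sum>a\<in>UNIV. \<Sum>c\<in>UNIV. S a c x * D c a d x)"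
  proof -
    have "(\<Sum>a\<in>UNIV. \<Sum>c\<in>UNIV. \<nu> x $ a * S b c x * D c a d x) = (\<Sum>c\<in>UNIV. S b c x * (\<Sum>a\<in>UNIV. \<nu> x $ a * D c a d x))"
      unfolding sum_distrib_left by (subst sum.swap) (simp add: mult_ac)
    then show ?thesis
      by (simp add: left_diff_distrib sum_subtractf sum_distrib_left mult.assoc nu_D_mid[OF x] sum_negf)
  qed
  have 5: "(\<Sum>a\<in>UNIV. S a b x * S2 a d x) = (\<Sum>c\<in>UNIV. S b c x * S2 c d x)"
    by (simp add: S_sym[OF x, of b])
  have "(\<Sum>a\<in>UNIV. \<delta> a (D a b d) x)
     = (\<Sum>a\<in>UNIV. \<delta> b (\<delta> a (S a d)) x)
     + (\<Sum>a\<in>UNIV. \<Sum>c\<in>UNIV. (\<nu> x $ a * S b c x - \<nu> x $ b * S a c x) * D c a d x)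
     + ((\<Sum>a\<in>UNIV. \<nu> x $ a * \<delta> a (S2 b d) x) + (\<Sum>a\<in>UNIV. S a a x) * S2 b d x)
     - (\<nu> x $ b * (\<Sum>a\<in>UNIV. \<delta> a (S2 a d) x) + (\<Sum>a\<in>UNIV. S a b x * S2 a d x))"
    unfolding 1 2 by (simp add: sum.distrib sum_subtractf sum_distrib_left sum_distrib_right)
  then show ?thesis
    unfolding 3 4 5 nu_\<delta>[OF S2_smooth x] minimal[OF x] by (simp add: algebra_simps)
qed

text \<open>\<open>lap_S\<close> contracted with \<open>S\<close>. The normal components of
  \<open>D\<close> contribute twice the squared norm of \<open>S2\<close> to the squared norm of
  \<open>D\<close>; subtracting them leaves the usual \<Delta>|A|^2 = 2 |\<nabla>A|^2 - 2
  |A|^4.\<close>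

lemma simons:
  assumes x: "x \<in> W"
  shows "\<Delta> c2 x = 2 * (\<Sum>a\<in>UNIV. \<Sum>b\<in>UNIV. \<Sum>d\<in>UNIV. D a b d x * D a b d x)
    - 2 * (c2 x * c2 x) - 4 * (\<Sum>a\<in>UNIV. \<Sum>b\<in>UNIV. S2 a b x * S2 a b x)"
proof -
  define R where "R d = (\<Sum>a\<in>UNIV. \<Sum>c\<in>UNIV. S a c x * D c a d x) + (\<Sum>a\<in>UNIV. \<delta> a (S2 a d) x)" for d :: 'k
  have 0: "(\<Sum>a\<in>UNIV. \<delta> a (D a b d) x) = - (c2 x * S b d x) - 2 * (\<Sum>c\<in>UNIV. S b c x * S2 c d x)
      - \<nu> x $ d * \<delta> b c2 x - \<nu> x $ b * R d" for b d
    unfolding R_def by (rule lap_S[OF x])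
  have 1: "(\<Sum>b\<in>UNIV. \<Sum>d\<in>UNIV. S b d x * (\<nu> x $ d * \<delta> b c2 x)) = 0"
  proof -
    have "(\<Sum>b\<in>UNIV. \<Sum>d\<in>UNIV. S b d x * (\<nu> x $ d * \<delta> b c2 x))
        = (\<Sum>b\<in>UNIV. \<delta> b c2 x * (\<Sum>d\<in>UNIV. \<nu> x $ d * S b d x))"
      by (simp add: sum_distrib_left mult_ac)
    then show ?thesis by (simp add: S_nu[OF x])
  qed
  have 2: "(\<Sum>b\<in>UNIV. \<Sum>d\<in>UNIV. S b d x * (\<nu> x $ b * R d)) = 0"
  proof -
    have "(\<Sum>b\<in>UNIV. \<Sum>d\<in>UNIV. S b d x * (\<nu> x $ b * R d))
        = (\<Sum>d\<in>UNIV. R d * (\<Sum>b\<in>UNIV. \<nu> x $ b * S b d x))"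
      by (subst sum.swap) (simp add: sum_distrib_left mult_ac)
    then show ?thesis by (simp add: S_nu'[OF x])
  qed
  have 3: "(\<Sum>b\<in>UNIV. \<Sum>d\<in>UNIV. S b d x * (\<Sum>c\<in>UNIV. S b c x * S2 c d x))
      = (\<Sum>a\<in>UNIV. \<Sum>b\<in>UNIV. S2 a b x * S2 a b x)"
  proof -
    have "(\<Sum>b\<in>UNIV. \<Sum>d\<in>UNIV. S b d x * (\<Sum>c\<in>UNIV. S b c x * S2 c d x))
        = (\<Sum>d\<in>UNIV. \<Sum>c\<in>UNIV. (\<Sum>b\<in>UNIV. S c b x * S b d x) * S2 c d x)"
      unfolding sum_distrib_left sum_distrib_right
      by (subst sum.swap, rule sum.cong[OF refl], subst sum.swap) (simp add: S_sym[OF x] mult_ac)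
    also have "\<dots> = (\<Sum>c\<in>UNIV. \<Sum>d\<in>UNIV. S2 c d x * S2 c d x)"
      by (subst sum.swap) (simp add: S2_def)
    finally show ?thesis .
  qed
  define S3 where "S3 b d = (\<Sum>c\<in>UNIV. S b c x * S2 c d x)" for b d
  have "(\<Sum>b\<in>UNIV. \<Sum>d\<in>UNIV. S b d x * (\<Sum>a\<in>UNIV. \<delta> a (D a b d) x))
     = - (c2 x * (\<Sum>b\<in>UNIV. \<Sum>d\<in>UNIV. S b d x * S b d x))
      - 2 * (\<Sum>b\<in>UNIV. \<Sum>d\<in>UNIV. S b d x * S3 b d)
      - (\<Sum>b\<in>UNIV. \<Sum>d\<in>UNIV. S b d x * (\<nu> x $ d * \<delta> b c2 x))
      - (\<Sum>b\<in>UNIV. \<Sum>d\<in>UNIV. S b d x * (\<nu> x $ b * R d))"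
    unfolding 0 S3_def[symmetric] sum_distrib_left[of "2::real"] sum_distrib_left[of "c2 x"] sum_negf[symmetric] sum_subtractf[symmetric]
    by (intro sum.cong refl) (simp add: algebra_simps)
  then show ?thesis
    unfolding \<Delta>_c2[OF x] S3_def 1 2 3 by (simp add: c2_def)
qed

end

subsection \<open>Minimal cones\<close>

context patch
begin

definition rr where "rr = (\<lambda>y. \<Sum>b\<in>UNIV. xc b y * xc b y)"

lemma rr_smooth [intro]: "Cinf_on rr W"
  unfolding rr_def by (intro Cinf_on_sum Cinf_on_mult open_W xc_smooth)

lemma rr_inner: "rr x = \<psi> x \<bullet> \<psi> x"
  by (simp add: rr_def inner_vec_def)

lemma \<delta>_rr: assumes x: "x \<in> W" shows "\<delta> a rr x = 2 * (\<psi> x $ a - (\<psi> x \<bullet> \<nu> x) * \<nu> x $ a)"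
proof -
  have "\<delta> a rr x = (\<Sum>b\<in>UNIV. 2 * (\<psi> x $ b * ((if a = b then 1 else 0) - \<nu> x $ a * \<nu> x $ b)))"
    unfolding rr_def using x
    by (subst \<delta>_sum) (auto intro!: sum.cong Cinf_on_mult open_W simp: \<delta>_mult[OF xc_smooth xc_smooth] \<delta>_xc)
  also have "\<dots> = 2 * ((\<Sum>b\<in>UNIV. if a = b then \<psi> x $ b else 0) - \<nu> x $ a * (\<Sum>b\<in>UNIV. \<psi> x $ b * \<nu> x $ b))"
    unfolding sum_distrib_left sum_subtractf[symmetric] by (intro sum.cong refl) (simp add: algebra_simps)
  finally show ?thesis by (simp add: inner_vec_def mult.commute)
qed

end

locale cone_patch = minimal_patch W \<psi> \<nu>
  for W :: "(real ^ 'n::finite) set" and \<psi> \<nu> :: "real ^ 'n \<Rightarrow> real ^ 'k::finite" +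
  assumes cone: "x \<in> W \<Longrightarrow> \<psi> x \<bullet> \<nu> x = 0" and away: "x \<in> W \<Longrightarrow> \<psi> x \<noteq> 0"
begin

lemma rr_pos: "x \<in> W \<Longrightarrow> 0 < rr x"
  unfolding rr_inner using away by simp

lemma xn_sum: "x \<in> W \<Longrightarrow> (\<Sum>b\<in>UNIV. \<psi> x $ b * \<nu> x $ b) = 0"
  using cone by (simp add: inner_vec_def)

text \<open>From differentiating \<open>\<psi> \<bullet> \<nu>\<close> = 0: the radial direction has
  principal curvature zero.\<close>

lemma S_xc: assumes x: "x \<in> W" shows "(\<Sum>b\<in>UNIV. \<psi> x $ b * S a b x) = 0"
proof -
  have "\<delta> a (\<lambda>y. \<Sum>b\<in>UNIV. xc b y * nc b y) x = \<delta> a (\<lambda>y. 0) x"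
    by (intro \<delta>_cong) (auto simp: xn_sum x)
  moreover have "\<delta> a (\<lambda>y. \<Sum>b\<in>UNIV. xc b y * nc b y) x
      = (\<Sum>b\<in>UNIV. \<psi> x $ b * S a b x + ((if a = b then 1 else 0) - \<nu> x $ a * \<nu> x $ b) * \<nu> x $ b)"
    using x by (subst \<delta>_sum)
      (auto intro!: sum.cong Cinf_on_mult open_W simp: \<delta>_mult[OF xc_smooth nc_smooth] S_def \<delta>_xc)
  moreover have "\<dots> = (\<Sum>b\<in>UNIV. \<psi> x $ b * S a b x)"
    by (simp add: sum.distrib sum_subtractf sum_distrib_left[symmetric] nu_sum[OF x] left_diff_distrib mult.assoc
        if_distrib[of "\<lambda>t. t * _"] cong: if_cong)
  ultimately show ?thesis by simp
qed

lemma alg: "x \<in> W \<Longrightarrow> cone_algebra (\<lambda>a b. S a b x) (\<lambda>a. \<nu> x $ a) (\<lambda>a. \<psi> x $ a) (rr x)"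
  by unfold_locales (auto simp: S_sym S_nu S_xc nu_sum xn_sum rr_pos minimal, simp add: rr_def)

lemma alg_c2: "x \<in> W \<Longrightarrow> cone_algebra.c2 (\<lambda>a b. S a b x) = c2 x"
  by (simp add: cone_algebra.c2_def[OF alg] c2_def)

lemma alg_s2: "x \<in> W \<Longrightarrow> cone_algebra.s2 (\<lambda>a b. S a b x) a b = S2 a b x"
  by (simp add: cone_algebra.s2_def[OF alg] S2_def)

lemma x_D_mid: assumes x: "x \<in> W" shows "(\<Sum>b\<in>UNIV. \<psi> x $ b * D a b d x) = - S a d x"
proof -
  have "\<delta> a (\<lambda>y. \<Sum>b\<in>UNIV. xc b y * S b d y) x = \<delta> a (\<lambda>y. 0) x"
    using x by (intro \<delta>_cong) (auto simp: S_xc S_sym[of _ _ d])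
  moreover have "\<delta> a (\<lambda>y. \<Sum>b\<in>UNIV. xc b y * S b d y) x
      = (\<Sum>b\<in>UNIV. \<psi> x $ b * D a b d x + ((if a = b then 1 else 0) - \<nu> x $ a * \<nu> x $ b) * S b d x)"
    using x by (subst \<delta>_sum)
      (auto intro!: sum.cong Cinf_on_mult open_W simp: \<delta>_mult[OF xc_smooth S_smooth] D_def \<delta>_xc)
  ultimately show ?thesis
    by (simp add: sum.distrib sum_subtractf sum_distrib_left[symmetric] S_nu'[OF x] left_diff_distrib mult.assoc
        if_distrib[of "\<lambda>t. t * _"] cong: if_cong)
qed

lemma x_D_last: "x \<in> W \<Longrightarrow> (\<Sum>d\<in>UNIV. \<psi> x $ d * D a b d x) = - S a b x"
  using x_D_mid by (simp add: D_sym[of x a b])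

lemma x_S2: "x \<in> W \<Longrightarrow> (\<Sum>b\<in>UNIV. \<psi> x $ b * S2 a b x) = 0"
  using cone_algebra.s2x[OF alg] by (simp add: alg_s2)

text \<open>Euler's relation: along rays A is homogeneous of degree -1. It is read off from the
  Codazzi equation and the null direction x, without moving along rays.\<close>

lemma x_D_first: assumes x: "x \<in> W" shows "(\<Sum>a\<in>UNIV. \<psi> x $ a * D a b d x) = - S b d x"
proof -
  have "(\<Sum>a\<in>UNIV. \<psi> x $ a * D a b d x)
    = (\<Sum>a\<in>UNIV. \<psi> x $ a * D b a d x) + ((\<Sum>a\<in>UNIV. \<psi> x $ a * \<nu> x $ a) * S2 b d x
       - \<nu> x $ b * (\<Sum>a\<in>UNIV. \<psi> x $ a * S2 d a x))"
    unfolding codazzi[OF x, of _ b] sum_distrib_left sum_distrib_right sum_subtractf[symmetric] sum.distrib[symmetric]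
    by (intro sum.cong refl) (simp add: algebra_simps S2_def S_sym[OF x])
  then show ?thesis by (simp add: x_D_mid[OF x] xn_sum[OF x] x_S2[OF x])
qed

definition C where
  "C a b d = (\<lambda>y. nc b y * S2 a d y + nc d y * S2 a b y
     + (xc a y * S b d y + xc b y * S a d y + xc d y * S a b y) / rr y)"

definition BB where
  "BB x = (\<Sum>a\<in>UNIV. \<Sum>b\<in>UNIV. \<Sum>d\<in>UNIV. (D a b d x + C a b d x) * (D a b d x + C a b d x))"

lemma alg_C: "x \<in> W \<Longrightarrow> cone_algebra.C (\<lambda>a b. S a b x) (\<lambda>a. \<nu> x $ a) (\<lambda>a. \<psi> x $ a) (rr x) a b d = C a b d x"
  by (simp add: cone_algebra.C_def[OF alg] C_def alg_s2)

lemma BB_eq: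
  assumes x: "x \<in> W"
  shows "BB x = (\<Sum>a\<in>UNIV. \<Sum>b\<in>UNIV. \<Sum>d\<in>UNIV. D a b d x * D a b d x)
     - 2 * (\<Sum>a\<in>UNIV. \<Sum>b\<in>UNIV. S2 a b x * S2 a b x) - 3 * c2 x / rr x"
  using cone_algebra.B_norm[OF alg[OF x], of "\<lambda>a b d. D a b d x"]
  by (simp add: BB_def alg_C[OF x] alg_s2[OF x] alg_c2[OF x] cone_algebra.t4_def[OF alg[OF x]]
      nu_D_mid[OF x] nu_D_last[OF x] x_D_first[OF x] x_D_mid[OF x] x_D_last[OF x])

lemma BB_nonneg: "0 \<le> BB x"
  unfolding BB_def by (intro sum_nonneg) simp

lemma \<delta>_rr_cone: "x \<in> W \<Longrightarrow> \<delta> a rr x = 2 * \<psi> x $ a"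
  by (simp add: \<delta>_rr cone)

lemma \<Delta>_rr: assumes x: "x \<in> W" shows "\<Delta> rr x = 2 * real CARD('n)"
proof -
  have "\<delta> a (\<delta> a rr) x = 2 * (1 - \<nu> x $ a * \<nu> x $ a)" for a
  proof -
    have "\<delta> a (\<delta> a rr) x = \<delta> a (\<lambda>y. 2 * xc a y) x"
      by (intro \<delta>_cong) (auto simp: \<delta>_rr_cone x intro!: Cinf_on_mult open_W)
    then show ?thesis using x by (simp add: \<delta>_mult[OF Cinf_on_const xc_smooth] \<delta>_xc)
  qed
  then have "\<Delta> rr x = 2 * (real CARD('k) - 1)"
    by (simp add: \<Delta>_def sum_distrib_left[symmetric] sum_subtractf nu_sum[OF x])
  then show ?thesis using card_eq by simp
qed

lemma radial_c2: assumes x: "x \<in> W" shows "(\<Sum>a\<in>UNIV. \<psi> x $ a * \<delta> a c2 x) = - 2 * c2 x"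
proof -
  have "(\<Sum>a\<in>UNIV. \<psi> x $ a * \<delta> a c2 x) = 2 * (\<Sum>b\<in>UNIV. \<Sum>d\<in>UNIV. S b d x * (\<Sum>a\<in>UNIV. \<psi> x $ a * D a b d x))"
    unfolding \<delta>_c2[OF x] sum_distrib_left
    by (subst sum.swap, rule sum.cong[OF refl], subst sum.swap) (simp add: mult_ac)
  then show ?thesis by (simp add: x_D_first[OF x] c2_def sum_negf)
qed

definition f where "f = (\<lambda>y. c2 y * rr y)"

lemma f_smooth [intro]: "Cinf_on f W"
  unfolding f_def by (intro Cinf_on_mult open_W c2_smooth rr_smooth)

lemma radial_f: assumes x: "x \<in> W" shows "(\<Sum>a\<in>UNIV. \<psi> x $ a * \<delta> a f x) = 0"
proof -
  have "(\<Sum>a\<in>UNIV. \<psi> x $ a * \<delta> a f x)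
      = 2 * c2 x * (\<Sum>a\<in>UNIV. \<psi> x $ a * \<psi> x $ a) + rr x * (\<Sum>a\<in>UNIV. \<psi> x $ a * \<delta> a c2 x)"
    unfolding f_def \<delta>_mult[OF c2_smooth rr_smooth x] \<delta>_rr_cone[OF x] sum_distrib_left sum.distrib[symmetric]
    by (intro sum.cong refl) (simp add: algebra_simps)
  then show ?thesis by (simp add: radial_c2[OF x] rr_def)
qed

text \<open>This is where n - 1 comes from. In units of |A|^2, the forced part of the derivative
  contributes 6, \<Delta>|x|^2 contributes 2 n and the mixed gradient term contributes -8, in total
  2 (n - 1). The rest of Simons' identity gives \<open>BB\<close> and - 2 |A|^2
  \<open>f\<close>.\<close>

lemma \<Delta>_f:
  assumes x: "x \<in> W"
  shows "\<Delta> f x = 2 * rr x * BB x + 2 * c2 x * (real CARD('n) - 1 - f x)"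
proof -
  have "\<Delta> f x = c2 x * (2 * real CARD('n)) + 4 * (\<Sum>a\<in>UNIV. \<psi> x $ a * \<delta> a c2 x) + \<Delta> c2 x * rr x"
    unfolding f_def \<Delta>_mult[OF c2_smooth rr_smooth x] \<Delta>_rr[OF x] \<delta>_rr_cone[OF x]
    by (simp add: sum_distrib_left mult_ac)
  moreover have "(\<Sum>a\<in>UNIV. \<Sum>b\<in>UNIV. \<Sum>d\<in>UNIV. D a b d x * D a b d x)
      = BB x + 2 * (\<Sum>a\<in>UNIV. \<Sum>b\<in>UNIV. S2 a b x * S2 a b x) + 3 * (c2 x / rr x)"
    by (simp add: BB_eq[OF x])
  moreover have "c2 x / rr x * rr x = c2 x" using rr_pos[OF x] by simp
  moreover have "f x = c2 x * rr x" by (simp add: f_def)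
  ultimately show ?thesis
    unfolding radial_c2[OF x] simons[OF x] by algebra
qed

end

subsection \<open>The equality case\<close>

locale rigid_patch = cone_patch W \<psi> \<nu>
  for W :: "(real ^ 'n::finite) set" and \<psi> \<nu> :: "real ^ 'n \<Rightarrow> real ^ 'k::finite" +
  assumes f_const: "x \<in> W \<Longrightarrow> f x = real CARD('n) - 1" and n_ge: "2 \<le> CARD('n)"
begin

lemma c2_eq: "x \<in> W \<Longrightarrow> c2 x = (real CARD('n) - 1) / rr x"
  using f_const[of x] rr_pos[of x] by (simp add: f_def field_simps)

lemma c2_nz: "x \<in> W \<Longrightarrow> c2 x \<noteq> 0"
  using c2_eq n_ge rr_pos by force

text \<open>With \<open>f\<close> constant and equal to n - 1, both \<Delta>\<open>f\<close> and the
  zero-order term of \<open>\<Delta>_f\<close> vanish; what is left is a sum of squares equal to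
  0.\<close>

lemma D_eq: assumes x: "x \<in> W" shows "D a b d x = - C a b d x"
proof -
  have "\<delta> a (\<delta> a f) x = 0" for a
  proof -
    have 0: "\<delta> a f y = 0" if "y \<in> W" for y
    proof -
      have "\<delta> a f y = \<delta> a (\<lambda>_. real CARD('n) - 1) y"
        by (rule \<delta>_cong[OF Cinf_on_const _ that]) (simp add: f_const)
      then show ?thesis by simp
    qed
    have "\<delta> a (\<delta> a f) x = \<delta> a (\<lambda>_. 0) x"
      by (rule \<delta>_cong[OF Cinf_on_const _ x]) (simp add: 0)
    then show ?thesis by simp
  qed
  then have "BB x = 0"
    using \<Delta>_f[OF x] f_const[OF x] rr_pos[OF x] by (simp add: \<Delta>_def)
  then have "(D a b d x + C a b d x) * (D a b d x + C a b d x) = 0" for a b d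
    unfolding BB_def
    by (subst (asm) sum_nonneg_eq_0_iff, simp, simp add: sum_nonneg)
      (subst (asm) sum_nonneg_eq_0_iff, simp, simp add: sum_nonneg,
        subst (asm) sum_nonneg_eq_0_iff, auto)
  then show ?thesis by (simp add: add_eq_0_iff)
qed

definition ir where "ir = (\<lambda>y. inverse (rr y))"

lemma ir_smooth [intro]: "Cinf_on ir W"
  unfolding ir_def using rr_pos by (intro Cinf_on_inverse open_W rr_smooth) force

definition Q where "Q e b d = (\<lambda>y. xc e y * S b d y + xc b y * S e d y + xc d y * S e b y)"

lemma Q_smooth: "Cinf_on (Q e b d) W"
  unfolding Q_def by (intro Cinf_on_add Cinf_on_mult open_W xc_smooth S_smooth)

lemma \<delta>_Q:
  assumes x: "x \<in> W"
  shows "\<delta> a (Q e b d) x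
    = (\<psi> x $ e * D a b d x + ((if a = e then 1 else 0) - \<nu> x $ a * \<nu> x $ e) * S b d x)
    + (\<psi> x $ b * D a e d x + ((if a = b then 1 else 0) - \<nu> x $ a * \<nu> x $ b) * S e d x)
    + (\<psi> x $ d * D a e b x + ((if a = d then 1 else 0) - \<nu> x $ a * \<nu> x $ d) * S e b x)"
  unfolding Q_def using x
  by (simp add: \<delta>_add \<delta>_mult \<delta>_xc D_def Cinf_on_add Cinf_on_mult open_W xc_smooth S_smooth del: mult_minus_left)

lemma \<delta>_D:
  assumes x: "x \<in> W"
  shows "\<delta> a (D e b d) x
    = - (S a b x * S2 e d x + S a d x * S2 e b x + ir x * \<delta> a (Q e b d) x
        + (\<nu> x $ b * \<delta> a (S2 e d) x + \<nu> x $ d * \<delta> a (S2 e b) x + \<delta> a ir x * Q e b d x))"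
proof -
  have "\<delta> a (D e b d) x
      = \<delta> a (\<lambda>y. - (nc b y * S2 e d y + nc d y * S2 e b y + Q e b d y * ir y)) x"
    by (intro \<delta>_cong x Cinf_on_uminus Cinf_on_add Cinf_on_mult open_W nc_smooth S2_smooth Q_smooth ir_smooth)
      (simp add: D_eq C_def Q_def ir_def divide_inverse)
  also have "\<dots> = - (\<delta> a (\<lambda>y. nc b y * S2 e d y) x + \<delta> a (\<lambda>y. nc d y * S2 e b y) x + \<delta> a (\<lambda>y. Q e b d y * ir y) x)"
    using x by (simp add: \<delta>_uminus \<delta>_add Cinf_on_add Cinf_on_mult open_W nc_smooth S2_smooth Q_smooth ir_smooth
        del: minus_add_distrib)
  finally show ?thesis
    by (simp add: \<delta>_mult[OF nc_smooth S2_smooth x] \<delta>_mult[OF Q_smooth ir_smooth x] S_def)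
qed

text \<open>By \<open>D_eq\<close> the first derivatives of A are algebraic in A, x and \<nu>.
  Differentiating once more and inserting the result into the commutation rule for the indices a and
  e gives an algebraic constraint on A. Contraction by \<open>\<Phi>\<close> removes everything that
  contains \<nu> or x, including the derivatives of \<open>S2\<close>, and leaves one equation
  between the power sums of the principal curvatures.\<close>

lemma scalar_ricci:
  assumes x: "x \<in> W"
  shows "cone_algebra.c2 (\<lambda>a b. S a b x) * cone_algebra.t4 (\<lambda>a b. S a b x)
    = cone_algebra.t3 (\<lambda>a b. S a b x) * cone_algebra.t3 (\<lambda>a b. S a b x) + c2 x * c2 x / rr x"
proof -
  interpret al: cone_algebra "\<lambda>a b. S a b x" "\<lambda>a. \<nu> x $ a" "\<lambda>a. \<psi> x $ a" "rr x" by (rule alg[OF x])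
  note s2 = alg_s2[OF x]
  have kn: "(\<Sum>b\<in>UNIV. \<nu> x $ b * S a b x) = 0" "(\<Sum>b\<in>UNIV. \<nu> x $ b * al.s2 a b) = 0"
    "(\<Sum>b\<in>UNIV. \<psi> x $ b * S a b x) = 0" "(\<Sum>b\<in>UNIV. \<psi> x $ b * al.s2 a b) = 0" for a
    using al.sn al.s2n al.sx al.s2x by auto
  note kills = al.\<Phi>_kill_a[OF kn(1)] al.\<Phi>_kill_b[OF kn(1)] al.\<Phi>_kill_d[OF kn(2)] al.\<Phi>_kill_e[OF kn(2)]
    al.\<Phi>_kill_a[OF kn(3)] al.\<Phi>_kill_b[OF kn(3)] al.\<Phi>_kill_d[OF kn(4)] al.\<Phi>_kill_e[OF kn(4)]
  let ?\<nu> = "\<lambda>a. \<nu> x $ a" and ?x = "\<lambda>a. \<psi> x $ a" and ?i = "ir x" and ?s = "\<lambda>a b. S a b x"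
  define V2 where "V2 a e d = \<delta> a (S2 e d) x" for a e d
  define VD where "VD a e d = D a e d x" for a e d
  define iv where "iv a = \<delta> a ir x" for a
  have L1: "al.\<Phi> (\<lambda>a e b d. \<delta> a (D e b d) x)
     = - (al.c2 * al.t4 + al.\<Phi> (\<lambda>a e b d. ?s a d * al.s2 e b) + ?i * (2 * al.t4))"
  proof -
    \<comment> \<open>The terms are sorted so that \<nu> and x stand in front of a factor free of
      their index, the shape that \<open>kills\<close> removes. \<open>V2\<close>, \<open>VD\<close>
      and \<open>iv\<close> hide derivatives whose value is irrelevant because their terms are
      removed.\<close>
    have "(\<lambda>a e b d. \<delta> a (D e b d) x) = (\<lambda>a e b d. (-1) * (?s a b * al.s2 e d + (?s a d * al.s2 e b
        + (?i * ((if a = e then 1 else 0) * ?s b d) + (?i * ((if a = b then 1 else 0) * ?s e d)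
        + (?i * ((if a = d then 1 else 0) * ?s e b)
        + (?x e * (?i * VD a b d) + (?x b * (?i * VD a e d) + (?x d * (?i * VD a e b)
        + (?\<nu> e * (- ?i * ?\<nu> a * ?s b d) + (?\<nu> b * (- ?i * ?\<nu> a * ?s e d) + (?\<nu> d * (- ?i * ?\<nu> a * ?s e b)
        + (?\<nu> b * V2 a e d + (?\<nu> d * V2 a e b
        + (?x e * (iv a * ?s b d) + (?x b * (iv a * ?s e d) + ?x d * (iv a * ?s e b)))))))))))))))))"
      unfolding \<delta>_D[OF x] \<delta>_Q[OF x]
      unfolding s2 V2_def[symmetric] VD_def[symmetric] iv_def[symmetric] Q_def
      by (intro ext) (simp add: algebra_simps)
    then show ?thesis
      by (simp only: al.\<Phi>_cmult al.\<Phi>_add kills al.\<Phi>_ss2 al.\<Phi>_ae al.\<Phi>_ab al.\<Phi>_ad) (simp add: algebra_simps)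
  qed
  have L2: "al.\<Phi> (\<lambda>a e b d. \<delta> e (D a b d) x)
     = - (al.\<Phi> (\<lambda>a e b d. ?s e b * al.s2 a d) + al.t3 * al.t3 + ?i * (2 * al.t4 + al.c2 * al.c2))"
  proof -
    have aeb: "al.\<Phi> (\<lambda>a e b d. (if e = a then 1 else 0) * ?s b d) = al.t4"
      using al.\<Phi>_ae by (simp add: eq_commute)
    have "(\<lambda>a e b d. \<delta> e (D a b d) x) = (\<lambda>a e b d. (-1) * (?s e b * al.s2 a d + (?s e d * al.s2 a b
        + (?i * ((if e = a then 1 else 0) * ?s b d) + (?i * ((if e = b then 1 else 0) * ?s a d)
        + (?i * ((if e = d then 1 else 0) * ?s a b)
        + (?x a * (?i * VD e b d) + (?x b * (?i * VD e a d) + (?x d * (?i * VD e a b)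
        + (?\<nu> e * (- ?i * ?\<nu> a * ?s b d) + (?\<nu> b * (- ?i * ?\<nu> e * ?s a d) + (?\<nu> d * (- ?i * ?\<nu> e * ?s a b)
        + (?\<nu> b * V2 e a d + (?\<nu> d * V2 e a b
        + (?x a * (iv e * ?s b d) + (?x b * (iv e * ?s a d) + ?x d * (iv e * ?s a b)))))))))))))))))"
      unfolding \<delta>_D[OF x] \<delta>_Q[OF x]
      unfolding s2 V2_def[symmetric] VD_def[symmetric] iv_def[symmetric] Q_def
      by (intro ext) (simp add: algebra_simps)
    then show ?thesis
      by (simp only: al.\<Phi>_cmult al.\<Phi>_add kills al.\<Phi>_s2s aeb al.\<Phi>_eb al.\<Phi>_ed) (simp add: algebra_simps)
  qed
  have R: "(\<lambda>a e b d. \<delta> a (D e b d) x) = (\<lambda>a e b d. \<delta> e (D a b d) x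
     + (?\<nu> a * (\<Sum>c\<in>UNIV. S e c x * D c b d x) + ?\<nu> e * (\<Sum>c\<in>UNIV. - (S a c x * D c b d x))))"
  proof (intro ext)
    fix a e b d
    have "\<delta> a (D e b d) x = \<delta> e (D a b d) x + (\<Sum>c\<in>UNIV. (?\<nu> a * S e c x - ?\<nu> e * S a c x) * D c b d x)"
      using commutator[OF S_smooth x, of a e b d] unfolding D_def .
    then show "\<delta> a (D e b d) x = \<delta> e (D a b d) x
     + (?\<nu> a * (\<Sum>c\<in>UNIV. S e c x * D c b d x) + ?\<nu> e * (\<Sum>c\<in>UNIV. - (S a c x * D c b d x)))"
      by (simp add: left_diff_distrib sum_subtractf sum_negf sum_distrib_left mult.assoc)
  qed
  have "al.\<Phi> (\<lambda>a e b d. \<delta> a (D e b d) x) = al.\<Phi> (\<lambda>a e b d. \<delta> e (D a b d) x)"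
    by (subst R) (simp only: al.\<Phi>_add kills)
  then have "al.c2 * al.t4 = al.t3 * al.t3 + ?i * (al.c2 * al.c2)"
    unfolding L1 L2 al.\<Phi>_swap by (simp add: algebra_simps)
  then show ?thesis by (simp add: alg_c2[OF x] ir_def field_simps)
qed

lemma S2_eq:
  assumes x: "x \<in> W"
  shows "S2 e d x = (cone_algebra.t3 (\<lambda>a b. S a b x) / c2 x) * S e d x
    + ((if e = d then 1 else 0) - \<nu> x $ e * \<nu> x $ d - \<psi> x $ e * \<psi> x $ d / rr x) / rr x"
proof -
  interpret al: cone_algebra "\<lambda>a b. S a b x" "\<lambda>a. \<nu> x $ a" "\<lambda>a. \<psi> x $ a" "rr x" by (rule alg[OF x])
  have "al.s2 e d = (al.t3 / al.c2) * S e d x + al.K e d / rr x"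
    using scalar_ricci[OF x] c2_eq[OF x] c2_nz[OF x] card_eq
    by (intro al.s2_quadratic) (simp_all add: alg_c2[OF x])
  then show ?thesis by (simp add: alg_s2[OF x] alg_c2[OF x] al.K_def)
qed

section \<open>The constant matrix of a rigid cone\<close>

definition r where "r = (\<lambda>y. sqrt (rr y))"
definition t3 where "t3 = (\<lambda>y. \<Sum>a\<in>UNIV. \<Sum>b\<in>UNIV. S a b y * S2 a b y)"
text \<open>By \<open>S2_eq\<close> the matrix r S satisfies t^2 = \<kappa> t + 1 on the link. Its
  eigenvalues there are roots of this equation, and the two roots have sum \<open>\<kappa>\<close>
  and product -1.\<close>

definition \<kappa> where "\<kappa> = (\<lambda>y. r y * r y * r y * t3 y / (real CARD('n) - 1))"
text \<open>The extension of r S from the link to the whole space. On the plane with orthonormal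
  basis x / r, \<nu> it has the rows (0, 1) and (1, \<kappa>), a block that satisfies the same
  equation t^2 = \<kappa> t + 1. It is chosen such that T x = r \<nu>, so that the gradient of the
  quadratic form of T is normal to the cone.\<close>

definition T where
  "T a b = (\<lambda>y. r y * S a b y + (xc a y * nc b y + nc a y * xc b y) / r y + \<kappa> y * (nc a y * nc b y))"

lemma alg_t3: "x \<in> W \<Longrightarrow> cone_algebra.t3 (\<lambda>a b. S a b x) = t3 x"
  by (simp add: cone_algebra.t3_def[OF alg] t3_def alg_s2)

lemma r_smooth [intro]: "Cinf_on r W"
  unfolding r_def by (intro Cinf_on_sqrt open_W rr_smooth rr_pos)

lemma r_pos: "x \<in> W \<Longrightarrow> 0 < r x" by (simp add: r_def rr_pos)

lemma r_sq: "x \<in> W \<Longrightarrow> r x * r x = rr x" using rr_pos[of x] by (simp add: r_def)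

lemma t3_smooth [intro]: "Cinf_on t3 W"
  unfolding t3_def by (intro Cinf_on_sum Cinf_on_mult open_W S_smooth S2_smooth)

lemma \<kappa>_smooth [intro]: "Cinf_on \<kappa> W"
  unfolding \<kappa>_def divide_inverse by (intro Cinf_on_mult open_W t3_smooth r_smooth Cinf_on_const)

lemma \<delta>_r: assumes x: "x \<in> W" shows "\<delta> e r x = \<psi> x $ e / r x"
proof -
  have "\<delta> e rr x = \<delta> e (\<lambda>y. r y * r y) x"
    using x by (intro \<delta>_cong Cinf_on_mult open_W r_smooth) (auto simp: r_sq)
  then show ?thesis
    using r_pos[OF x] by (simp add: \<delta>_rr_cone[OF x] \<delta>_mult[OF r_smooth r_smooth x] field_simps)
qed

text \<open>Of the terms of \<open>C\<close> only the one with x_e survives contraction with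
  \<open>S2\<close>; each of the others pairs a null vector with \<open>S2\<close>. So
  \<open>t3\<close> varies only radially, with degree -3, which the factor r^3 in
  \<open>\<kappa>\<close> compensates.\<close>

lemma \<delta>_t3: assumes x: "x \<in> W" shows "\<delta> e t3 x = - 3 * \<psi> x $ e * t3 x / rr x"
proof -
  interpret al: cone_algebra "\<lambda>a b. S a b x" "\<lambda>a. \<nu> x $ a" "\<lambda>a. \<psi> x $ a" "rr x" by (rule alg[OF x])
  define q where "q = (\<Sum>a\<in>UNIV. \<Sum>b\<in>UNIV. S2 a b x * D e a b x)"
  have S2D: "\<delta> e (S2 a b) x = (\<Sum>c\<in>UNIV. S a c x * D e c b x + D e a c x * S c b x)" for a b
    unfolding S2_def using x
    by (subst \<delta>_sum) (auto intro!: sum.cong Cinf_on_mult open_W simp: \<delta>_mult[OF S_smooth S_smooth] D_def)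
  have "\<delta> e t3 x = (\<Sum>a\<in>UNIV. \<Sum>b\<in>UNIV. \<delta> e (\<lambda>y. S a b y * S2 a b y) x)"
    unfolding t3_def using x
    by (subst \<delta>_sum) (auto intro!: sum.cong \<delta>_sum Cinf_on_sum Cinf_on_mult open_W)
  also have "\<dots> = (\<Sum>a\<in>UNIV. \<Sum>b\<in>UNIV. S a b x * \<delta> e (S2 a b) x) + q"
    by (simp add: \<delta>_mult[OF S_smooth S2_smooth x] D_def[symmetric] sum.distrib q_def mult.commute)
  also have "(\<Sum>a\<in>UNIV. \<Sum>b\<in>UNIV. S a b x * \<delta> e (S2 a b) x)
     = (\<Sum>a\<in>UNIV. \<Sum>b\<in>UNIV. \<Sum>c\<in>UNIV. S a b x * S a c x * D e c b x)
     + (\<Sum>a\<in>UNIV. \<Sum>b\<in>UNIV. \<Sum>c\<in>UNIV. S a b x * S c b x * D e a c x)"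
    unfolding S2D sum_distrib_left sum.distrib[symmetric] by (simp add: algebra_simps)
  also have "(\<Sum>a\<in>UNIV. \<Sum>b\<in>UNIV. \<Sum>c\<in>UNIV. S a b x * S c b x * D e a c x) = q"
  proof -
    have "(\<Sum>b\<in>UNIV. \<Sum>c\<in>UNIV. S a b x * S c b x * D e a c x) = (\<Sum>c\<in>UNIV. S2 a c x * D e a c x)" for a
      unfolding S2_def sum_distrib_right by (subst sum.swap) (simp add: S_sym[OF x])
    then show ?thesis by (simp add: q_def)
  qed
  also have "(\<Sum>a\<in>UNIV. \<Sum>b\<in>UNIV. \<Sum>c\<in>UNIV. S a b x * S a c x * D e c b x) = q"
  proof -
    have "(\<Sum>a\<in>UNIV. \<Sum>b\<in>UNIV. \<Sum>c\<in>UNIV. S a b x * S a c x * D e c b x)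
        = (\<Sum>b\<in>UNIV. \<Sum>c\<in>UNIV. (\<Sum>a\<in>UNIV. S b a x * S a c x) * D e b c x)"
      unfolding sum_distrib_right
      by (subst sum.swap, rule sum.cong[OF refl], subst sum.swap)
        (simp add: S_sym[OF x] D_sym[OF x])
    then show ?thesis by (simp add: q_def S2_def)
  qed
  also have "q = - (\<psi> x $ e * t3 x / rr x)"
  proof -
    have "(\<Sum>b\<in>UNIV. S2 a b x * D e a b x) = - \<psi> x $ e / rr x * (\<Sum>b\<in>UNIV. S a b x * S2 a b x)
      - \<nu> x $ a * (\<Sum>b\<in>UNIV. S2 e b x * S2 a b x) - S2 e a x * (\<Sum>b\<in>UNIV. \<nu> x $ b * S2 a b x)
      - \<psi> x $ a / rr x * (\<Sum>b\<in>UNIV. S e b x * S2 a b x) - S e a x / rr x * (\<Sum>b\<in>UNIV. \<psi> x $ b * S2 a b x)" for a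
      unfolding sum_distrib_left sum_subtractf[symmetric]
      by (intro sum.cong refl) (simp add: D_eq[OF x] C_def field_simps add_divide_distrib)
    then have "q = - \<psi> x $ e / rr x * t3 x
       - (\<Sum>a\<in>UNIV. \<nu> x $ a * (\<Sum>b\<in>UNIV. S2 e b x * S2 a b x))
       - (\<Sum>a\<in>UNIV. \<psi> x $ a / rr x * (\<Sum>b\<in>UNIV. S e b x * S2 a b x))"
      using al.s2n al.s2x unfolding alg_s2[OF x]
      by (simp add: q_def t3_def sum_subtractf sum_distrib_left sum_negf)
    moreover have "(\<Sum>a\<in>UNIV. \<nu> x $ a * (\<Sum>b\<in>UNIV. S2 e b x * S2 a b x))
        = (\<Sum>b\<in>UNIV. S2 e b x * (\<Sum>a\<in>UNIV. \<nu> x $ a * S2 b a x))"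
      unfolding sum_distrib_left by (subst sum.swap) (simp add: al.s2_sym[unfolded alg_s2[OF x]] mult_ac)
    moreover have "(\<Sum>a\<in>UNIV. \<psi> x $ a / rr x * (\<Sum>b\<in>UNIV. S e b x * S2 a b x))
        = (\<Sum>b\<in>UNIV. S e b x / rr x * (\<Sum>a\<in>UNIV. \<psi> x $ a * S2 b a x))"
      unfolding sum_distrib_left by (subst sum.swap) (simp add: al.s2_sym[unfolded alg_s2[OF x]] mult_ac)
    ultimately show ?thesis
      using al.s2n al.s2x unfolding alg_s2[OF x] by simp
  qed
  finally show ?thesis by simp
qed

lemma \<delta>_\<kappa>: assumes x: "x \<in> W" shows "\<delta> e \<kappa> x = 0"
proof -
  have "\<delta> e \<kappa> x = \<delta> e (\<lambda>y. inverse (real CARD('n) - 1) * (r y * (r y * (r y * t3 y)))) x"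
    by (simp add: \<kappa>_def divide_inverse mult_ac)
  also have "\<dots> = inverse (real CARD('n) - 1) *
     (r x * (r x * (r x * \<delta> e t3 x + \<delta> e r x * t3 x) + \<delta> e r x * (r x * t3 x)) + \<delta> e r x * (r x * (r x * t3 x)))"
    using x by (simp add: \<delta>_mult Cinf_on_mult open_W r_smooth t3_smooth)
  also have "r x * (r x * (r x * \<delta> e t3 x + \<delta> e r x * t3 x) + \<delta> e r x * (r x * t3 x)) + \<delta> e r x * (r x * (r x * t3 x)) = 0"
    unfolding \<delta>_t3[OF x] \<delta>_r[OF x] r_sq[OF x, symmetric] using r_pos[OF x] by (simp add: field_simps)
  finally show ?thesis by simp
qed

lemma S2_eq': assumes x: "x \<in> W"
  shows "r x * S2 a b x = \<kappa> x * S a b x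
    + ((if a = b then 1 else 0) - \<nu> x $ a * \<nu> x $ b) / r x - \<psi> x $ a * \<psi> x $ b / (r x * r x * r x)"
proof -
  have "t3 x / c2 x = \<kappa> x / r x"
    using r_pos[OF x] n_ge by (simp add: c2_eq[OF x] \<kappa>_def r_sq[OF x, symmetric] field_simps)
  then have S2: "S2 a b x = \<kappa> x / r x * S a b x
    + ((if a = b then 1 else 0) - \<nu> x $ a * \<nu> x $ b - \<psi> x $ a * \<psi> x $ b / rr x) / rr x"
    using S2_eq[OF x, of a b] by (simp add: alg_t3[OF x])
  show ?thesis using r_pos[OF x] by (simp add: S2 r_sq[OF x, symmetric] field_simps)
qed

text \<open>By \<open>D_eq\<close> the derivative of r S contains \<nu>_a r S2_eb and its mirror
  image. Once \<open>S2_eq'\<close> replaces S2, these terms cancel against the derivatives of (x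
  \<otimes> \<nu> + \<nu> \<otimes> x) / r and of \<kappa> \<nu> \<otimes> \<nu>.\<close>

lemma \<delta>_T: assumes x: "x \<in> W" shows "\<delta> e (T a b) x = 0"
proof -
  define irr where "irr = (\<lambda>y. inverse (r y))"
  have irr: "Cinf_on irr W"
    unfolding irr_def using r_pos by (intro Cinf_on_inverse open_W r_smooth) force
  have "\<delta> e (\<lambda>y. r y * irr y) x = \<delta> e (\<lambda>y. 1) x"
    using r_pos by (intro \<delta>_cong Cinf_on_const x) (simp add: irr_def less_imp_neq[THEN not_sym])
  then have "r x * \<delta> e irr x + \<psi> x $ e / r x * irr x = 0"
    by (simp add: \<delta>_mult[OF r_smooth irr x] \<delta>_r[OF x])
  moreover have irrx: "irr x = 1 / r x" by (simp add: irr_def divide_inverse)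
  ultimately have \<delta>_irr: "\<delta> e irr x = - \<psi> x $ e / (r x * r x * r x)"
    using r_pos[OF x] by (simp add: field_simps)
  have rD: "r x * D e a b x = - (\<nu> x $ a * (r x * S2 e b x) + \<nu> x $ b * (r x * S2 e a x)
      + (\<psi> x $ e * S a b x + \<psi> x $ a * S e b x + \<psi> x $ b * S e a x) / r x)"
    using r_pos[OF x] by (simp add: D_eq[OF x] C_def r_sq[OF x, symmetric] field_simps)
  have "\<delta> e (T a b) x = \<delta> e (\<lambda>y. r y * S a b y + (xc a y * nc b y + nc a y * xc b y) * irr y + \<kappa> y * (nc a y * nc b y)) x"
    by (simp add: T_def irr_def divide_inverse)
  also have "\<dots> = (r x * D e a b x + \<psi> x $ e / r x * S a b x)
     + ((\<psi> x $ a * \<nu> x $ b + \<nu> x $ a * \<psi> x $ b) * \<delta> e irr x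
      + ((\<psi> x $ a * S e b x + ((if e = a then 1 else 0) - \<nu> x $ e * \<nu> x $ a) * \<nu> x $ b)
        + (\<nu> x $ a * ((if e = b then 1 else 0) - \<nu> x $ e * \<nu> x $ b) + S e a x * \<psi> x $ b)) * irr x)
     + \<kappa> x * (\<nu> x $ a * S e b x + S e a x * \<nu> x $ b)"
    using x by (simp add: \<delta>_add \<delta>_mult \<delta>_xc \<delta>_r \<delta>_\<kappa> D_def S_def[of e] irr Cinf_on_mult Cinf_on_add open_W
        r_smooth S_smooth xc_smooth nc_smooth \<kappa>_smooth)
  also have "\<dots> = 0"
    unfolding rD S2_eq'[OF x] \<delta>_irr irrx using r_pos[OF x] by (simp add: field_simps)
  finally show ?thesis .
qed

lemma T_smooth [intro]: "Cinf_on (T a b) W"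
  unfolding T_def using r_pos
  by (intro Cinf_on_add Cinf_on_mult Cinf_on_divide open_W r_smooth S_smooth xc_smooth nc_smooth \<kappa>_smooth) force

lemma T_sym: "x \<in> W \<Longrightarrow> T a b x = T b a x"
  by (simp add: T_def S_sym[of x a b] algebra_simps)

lemma T_xc: assumes x: "x \<in> W" shows "(\<Sum>b\<in>UNIV. T a b x * \<psi> x $ b) = r x * \<nu> x $ a"
proof -
  have "(\<Sum>b\<in>UNIV. T a b x * \<psi> x $ b) = r x * (\<Sum>b\<in>UNIV. \<psi> x $ b * S a b x)
     + \<psi> x $ a / r x * (\<Sum>b\<in>UNIV. \<psi> x $ b * \<nu> x $ b) + \<nu> x $ a / r x * rr x
     + \<kappa> x * \<nu> x $ a * (\<Sum>b\<in>UNIV. \<psi> x $ b * \<nu> x $ b)"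
    unfolding rr_def sum_distrib_left sum.distrib[symmetric]
    by (intro sum.cong refl) (simp add: T_def algebra_simps add_divide_distrib)
  then show ?thesis
    using r_pos[OF x] by (simp add: S_xc[OF x] xn_sum[OF x] r_sq[OF x, symmetric])
qed

lemma T_nc: assumes x: "x \<in> W" shows "(\<Sum>b\<in>UNIV. T a b x * \<nu> x $ b) = \<psi> x $ a / r x + \<kappa> x * \<nu> x $ a"
proof -
  have "(\<Sum>b\<in>UNIV. T a b x * \<nu> x $ b) = r x * (\<Sum>b\<in>UNIV. \<nu> x $ b * S a b x)
     + \<psi> x $ a / r x * (\<Sum>b\<in>UNIV. \<nu> x $ b * \<nu> x $ b) + \<nu> x $ a / r x * (\<Sum>b\<in>UNIV. \<psi> x $ b * \<nu> x $ b)
     + \<kappa> x * \<nu> x $ a * (\<Sum>b\<in>UNIV. \<nu> x $ b * \<nu> x $ b)"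
    unfolding sum_distrib_left sum.distrib[symmetric]
    by (intro sum.cong refl) (simp add: T_def algebra_simps add_divide_distrib)
  then show ?thesis by (simp add: S_nu[OF x] xn_sum[OF x] nu_sum[OF x])
qed

lemma T_trace: assumes x: "x \<in> W" shows "(\<Sum>a\<in>UNIV. T a a x) = \<kappa> x"
proof -
  have "(\<Sum>a\<in>UNIV. T a a x) = r x * (\<Sum>a\<in>UNIV. S a a x)
     + 2 / r x * (\<Sum>b\<in>UNIV. \<psi> x $ b * \<nu> x $ b) + \<kappa> x * (\<Sum>b\<in>UNIV. \<nu> x $ b * \<nu> x $ b)"
    unfolding sum_distrib_left sum.distrib[symmetric]
    by (intro sum.cong refl) (simp add: T_def algebra_simps)
  then show ?thesis by (simp add: minimal[OF x] xn_sum[OF x] nu_sum[OF x])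
qed

lemma T_square: assumes x: "x \<in> W"
  shows "(\<Sum>c\<in>UNIV. T a c x * T c b x) = \<kappa> x * T a b x + (if a = b then 1 else 0)"
proof -
  have "(\<Sum>c\<in>UNIV. T a c x * T c b x)
     = r x * (\<Sum>c\<in>UNIV. T a c x * S c b x) + \<nu> x $ b / r x * (\<Sum>c\<in>UNIV. T a c x * \<psi> x $ c)
     + (\<psi> x $ b / r x + \<kappa> x * \<nu> x $ b) * (\<Sum>c\<in>UNIV. T a c x * \<nu> x $ c)"
    unfolding sum_distrib_left sum.distrib[symmetric]
    by (intro sum.cong refl) (simp add: T_def[of _ b] algebra_simps add_divide_distrib)
  also have "(\<Sum>c\<in>UNIV. T a c x * S c b x) = r x * S2 a b x"
  proof -
    have "(\<Sum>c\<in>UNIV. T a c x * S c b x) = r x * S2 a b x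
      + \<psi> x $ a / r x * (\<Sum>c\<in>UNIV. \<nu> x $ c * S b c x) + \<nu> x $ a / r x * (\<Sum>c\<in>UNIV. \<psi> x $ c * S b c x)
      + \<kappa> x * \<nu> x $ a * (\<Sum>c\<in>UNIV. \<nu> x $ c * S b c x)"
      unfolding S2_def sum_distrib_left sum.distrib[symmetric]
      by (intro sum.cong refl) (simp add: T_def S_sym[OF x, of b] algebra_simps add_divide_distrib)
    then show ?thesis by (simp add: S_nu[OF x] S_xc[OF x])
  qed
  also have "r x * (r x * S2 a b x) + \<nu> x $ b / r x * (\<Sum>c\<in>UNIV. T a c x * \<psi> x $ c)
     + (\<psi> x $ b / r x + \<kappa> x * \<nu> x $ b) * (\<Sum>c\<in>UNIV. T a c x * \<nu> x $ c)
     = \<kappa> x * T a b x + (if a = b then 1 else 0)"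
    unfolding T_xc[OF x] T_nc[OF x] S2_eq'[OF x] using r_pos[OF x]
    by (simp add: T_def field_simps)
  finally show ?thesis .
qed

end

section \<open>Maximum principles\<close>

text \<open>If the second derivative along \<open>v\<close> were positive, the derivative along
  \<open>v\<close>, being 0 at \<open>x\<close>, would be positive just past \<open>x\<close>, and
  the mean value theorem would produce a larger value.\<close>

lemma second_derivative_at_max:
  fixes f :: "'a::euclidean_space \<Rightarrow> real"
  assumes W: "open W" and f: "Cinf_on f W" and x: "x \<in> W" and r: "0 < r"
    and max: "\<And>y. dist y x < r \<Longrightarrow> f y \<le> f x"
  shows "frechet_derivative f (at x) = (\<lambda>v. 0)"
    and "frechet_derivative (\<lambda>y. frechet_derivative f (at y) v) (at x) v \<le> 0"
proof -
  have "eventually (\<lambda>y. f y \<le> f x) (at x)"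
    using r max unfolding eventually_at by blast
  then show D0: "frechet_derivative f (at x) = (\<lambda>v. 0)"
    using has_derivative_local_max[OF Cinf_on_has_derivative[OF f x]] by simp
  define g where "g = (\<lambda>y. frechet_derivative f (at y) v)"
  have g: "Cinf_on g W" unfolding g_def using f by auto
  show "frechet_derivative (\<lambda>y. frechet_derivative f (at y) v) (at x) v \<le> 0"
  proof (rule ccontr)
    assume "\<not> ?thesis"
    then have pos: "0 < frechet_derivative g (at x) v" by (simp add: g_def)
    have a: "((\<lambda>s. x + s *\<^sub>R v) has_derivative (\<lambda>h. h *\<^sub>R v)) (at 0)"
      by (auto intro!: derivative_eq_intros)
    have "(g has_derivative frechet_derivative g (at x)) (at (x + 0 *\<^sub>R v))"
      using Cinf_on_has_derivative[OF g x] by simp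
    from has_derivative_compose[OF a this]
    have "((\<lambda>s. g (x + s *\<^sub>R v)) has_derivative (\<lambda>h. frechet_derivative g (at x) (h *\<^sub>R v))) (at 0)" .
    then have "((\<lambda>s. g (x + s *\<^sub>R v)) has_real_derivative frechet_derivative g (at x) v) (at 0)"
      using linear_cmul[OF has_derivative_linear[OF Cinf_on_has_derivative[OF g x]]]
      by (simp add: has_field_derivative_def mult.commute[of _ "frechet_derivative g (at x) v"])
    from DERIV_pos_inc_right[OF this pos] obtain d where d: "d > 0"
      "\<And>h. 0 < h \<Longrightarrow> h < d \<Longrightarrow> g x < g (x + h *\<^sub>R v)" by auto
    have gx: "g x = 0" by (simp add: g_def D0)
    obtain e where e: "e > 0" "ball x e \<subseteq> W" using W x openE by blast
    define X where "X = min r e / (norm v + 1)"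
    define t where "t = min d X / 2"
    have nv: "0 < norm v + 1" by (smt (verit) norm_ge_zero)
    then have "0 < X" using r e by (simp add: X_def)
    then have t: "0 < t" "t < d" "t < min r e / (norm v + 1)"
      using d by (auto simp: t_def X_def[symmetric])
    have small: "norm (s *\<^sub>R v) < min r e" if "0 \<le> s" "s \<le> t" for s
    proof -
      have "norm (s *\<^sub>R v) \<le> t * (norm v + 1)"
        using that nv by (simp add: mult_mono)
      also have "\<dots> < min r e" using t(3) nv by (simp add: pos_less_divide_eq)
      finally show ?thesis .
    qed
    have "\<exists>s>0. s < t \<and> f (x + t *\<^sub>R v) - f x = t * frechet_derivative f (at (x + s *\<^sub>R v)) v"
      using small e(2) t(1) by (intro mean_value_line Cinf_on_differentiable[OF f]) (force simp: dist_norm)+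
    then obtain s where s: "0 < s" "s < t" "f (x + t *\<^sub>R v) - f x = t * g (x + s *\<^sub>R v)"
      unfolding g_def by blast
    then have "f (x + t *\<^sub>R v) - f x > 0" using d(2)[of s] t gx by simp
    moreover have "f (x + t *\<^sub>R v) \<le> f x"
      using small[of t] t by (intro max) (simp add: dist_norm)
    ultimately show False by simp
  qed
qed

section \<open>Maximum principles for the Laplacian of a patch\<close>

context patch
begin

lemma \<Delta>_smooth [intro]: "Cinf_on f W \<Longrightarrow> Cinf_on (\<Delta> f) W"
  unfolding \<Delta>_def by (intro Cinf_on_sum open_W \<delta>_smooth)

lemma \<Delta>_add:
  assumes "Cinf_on f W" "Cinf_on h W" "x \<in> W"
  shows "\<Delta> (\<lambda>y. f y + h y) x = \<Delta> f x + \<Delta> h x"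
proof -
  have "\<delta> a (\<delta> a (\<lambda>y. f y + h y)) x = \<delta> a (\<lambda>y. \<delta> a f y + \<delta> a h y) x" for a
    using assms by (intro \<delta>_cong) (auto simp: \<delta>_add intro!: Cinf_on_add open_W)
  then show ?thesis using assms by (simp add: \<Delta>_def \<delta>_add \<delta>_smooth sum.distrib)
qed

lemma \<Delta>_const: "\<Delta> (\<lambda>x. c) x = 0"
proof -
  have "\<delta> a (\<lambda>x. c) = (\<lambda>x. 0)" for a by auto
  then show ?thesis by (simp add: \<Delta>_def)
qed

lemma \<Delta>_cmult:
  assumes "Cinf_on f W" "x \<in> W"
  shows "\<Delta> (\<lambda>y. c * f y) x = c * \<Delta> f x"
  using \<Delta>_mult[OF Cinf_on_const assms, of c] by (simp add: \<Delta>_const)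

lemma interior_max:
  assumes f: "Cinf_on f W" and x: "x \<in> W" and r: "0 < r"
    and max: "\<And>y. dist y x < r \<Longrightarrow> f y \<le> f x"
  shows "\<delta> a f x = 0" and "\<Delta> f x \<le> 0"
proof -
  note D = second_derivative_at_max[OF open_W f x r max]
  show "\<delta> a f x = 0" by (simp add: \<delta>_def D(1))
  have "\<delta> a (\<delta> a f) x \<le> 0" for a
  proof -
    define v where "v = Y a x"
    have sf: "Cinf_on (\<lambda>y. frechet_derivative f (at y) (axis i 1)) W" for i by (rule Cinf_on_deriv[OF f])
    define L where "L = (\<lambda>y. \<Sum>i\<in>UNIV. v $ i * frechet_derivative f (at y) (axis i 1))"
    have L: "Cinf_on L W" unfolding L_def by (intro Cinf_on_sum Cinf_on_mult open_W sf Cinf_on_const)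
    have "frechet_derivative (\<lambda>y. frechet_derivative f (at y) v) (at x) v = \<delta> a L x"
      unfolding \<delta>_def v_def[symmetric]
      using frechet_derivative_transform_within_open[OF Cinf_on_differentiable[OF L x] open_W x, of "\<lambda>y. frechet_derivative f (at y) v"]
      by (simp add: L_def deriv_expand[OF f])
    also have "\<delta> a L x = (\<Sum>i\<in>UNIV. v $ i * \<delta> a (\<lambda>y. frechet_derivative f (at y) (axis i 1)) x)"
      unfolding L_def using x sf by (subst \<delta>_sum) (auto intro!: sum.cong Cinf_on_mult open_W simp: \<delta>_mult)
    also have "\<dots> = (\<Sum>i\<in>UNIV. \<Sum>j\<in>UNIV. Y a x $ i * Y a x $ j
        * frechet_derivative (\<lambda>y. frechet_derivative f (at y) (axis i 1)) (at x) (axis j 1))"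
      by (simp add: \<delta>_expand[OF sf x] v_def sum_distrib_left mult.assoc)
    also have "\<dots> = \<delta> a (\<delta> a f) x"
      unfolding \<delta>\<delta>_expand[OF f x] by (simp add: D(1))
    finally show ?thesis using D(2)[of v] by simp
  qed
  then show "\<Delta> f x \<le> 0" unfolding \<Delta>_def by (simp add: sum_nonpos)
qed

lemma \<delta>_all_zero:
  assumes f: "Cinf_on f W" and x: "x \<in> W" and "\<And>a. \<delta> a f x = 0"
  shows "frechet_derivative f (at x) v = 0"
  unfolding deriv_via_\<delta>[OF f x] by (simp add: assms(3))

lemma \<Delta>_exp:
  assumes q: "Cinf_on q W" and x: "x \<in> W"
  shows "\<delta> a (\<lambda>y. exp (q y)) x = exp (q x) * \<delta> a q x"
    and "\<Delta> (\<lambda>y. exp (q y)) x = exp (q x) * ((\<Sum>a\<in>UNIV. \<delta> a q x * \<delta> a q x) + \<Delta> q x)"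
proof -
  have 1: "\<delta> a (\<lambda>y. exp (q y)) y = exp (q y) * \<delta> a q y" if "y \<in> W" for a y
    by (rule \<delta>_real_comp[OF q that DERIV_exp])
  then show "\<delta> a (\<lambda>y. exp (q y)) x = exp (q x) * \<delta> a q x" using x by blast
  have "\<delta> a (\<delta> a (\<lambda>y. exp (q y))) x = exp (q x) * (\<delta> a q x * \<delta> a q x + \<delta> a (\<delta> a q) x)" for a
  proof -
    have "\<delta> a (\<delta> a (\<lambda>y. exp (q y))) x = \<delta> a (\<lambda>y. exp (q y) * \<delta> a q y) x"
      using q x by (intro \<delta>_cong) (auto simp: 1 intro!: Cinf_on_mult Cinf_on_exp open_W)
    also have "\<dots> = exp (q x) * (\<delta> a q x * \<delta> a q x + \<delta> a (\<delta> a q) x)"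
      using q x by (subst \<delta>_mult) (auto simp: 1 algebra_simps intro!: Cinf_on_exp open_W)
    finally show ?thesis .
  qed
  then show "\<Delta> (\<lambda>y. exp (q y)) x = exp (q x) * ((\<Sum>a\<in>UNIV. \<delta> a q x * \<delta> a q x) + \<Delta> q x)"
    by (simp add: \<Delta>_def sum_distrib_left[symmetric] sum.distrib)
qed

text \<open>The barrier is \<open>exp (-\<alpha> |z - c|\<^sup>2)\<close> on the shell between the radii \<open>\<rho>/2\<close> and \<open>\<rho>\<close>.\<close>

lemma hopf:
  assumes h: "Cinf_on h W" and sub: "\<And>x. x \<in> W \<Longrightarrow> 0 \<le> \<Delta> h x"
    and \<rho>: "0 < \<rho>" and ball: "cball c \<rho> \<subseteq> W" and le: "\<And>x. x \<in> W \<Longrightarrow> h x \<le> M"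
    and less: "\<And>x. dist c x < \<rho> \<Longrightarrow> h x < M" and y: "dist c y = \<rho>"
  shows "h y \<noteq> M"
proof
  assume hy: "h y = M"
  have yW: "y \<in> W" using y ball by auto
  define q where "q = (\<lambda>z. (z - c) \<bullet> (z - c))"
  have q: "Cinf_on q W" unfolding q_def
    by (intro Cinf_on_inner Cinf_on_diff open_W Cinf_on_ident Cinf_on_const)
  have qd: "q z = (dist c z)\<^sup>2" for z
    unfolding q_def power2_norm_eq_inner[symmetric] by (simp add: dist_norm norm_minus_commute)
  have q': "frechet_derivative q (at z) v = 2 * ((z - c) \<bullet> v)" for z v
  proof -
    have "(q has_derivative (\<lambda>v. (z - c) \<bullet> v + v \<bullet> (z - c))) (at z)"
      unfolding q_def by (auto intro!: derivative_eq_intros)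
    then show ?thesis using frechet_derivative_at by (metis (no_types, lifting) inner_commute mult_2)
  qed
  define K where "K = {z. \<rho> / 2 \<le> dist c z \<and> dist c z \<le> \<rho>}"
  have KW: "K \<subseteq> W" using ball by (auto simp: K_def)
  have K: "compact K"
  proof -
    have "K = cball c \<rho> - ball c (\<rho> / 2)" by (auto simp: K_def)
    then show ?thesis by (simp add: compact_diff)
  qed
  have yK: "y \<in> K" using y \<rho> by (simp add: K_def)
  define G where "G z = (\<Sum>a\<in>UNIV. \<delta> a q z * \<delta> a q z)" for z
  have Gs: "Cinf_on G W" unfolding G_def using q by (intro Cinf_on_sum Cinf_on_mult open_W) auto
  \<comment> \<open>\<open>G\<close> is the squared gradient of \<open>q\<close>. It vanishes only
    where the chart derivative 2 (z - c) of \<open>q\<close> does, namely at the centre, which the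
    shell excludes.\<close>
  have G_pos: "0 < G z" if z: "z \<in> K" for z
  proof (rule ccontr)
    assume "\<not> ?thesis"
    moreover have "0 \<le> G z" unfolding G_def by (intro sum_nonneg) simp
    ultimately have "G z = 0" by simp
    then have "\<delta> a q z * \<delta> a q z = 0" for a
      unfolding G_def by (subst (asm) sum_nonneg_eq_0_iff) auto
    then have "frechet_derivative q (at z) (z - c) = 0"
      using z KW q by (intro \<delta>_all_zero) auto
    then show False using z \<rho> unfolding q' by (auto simp: K_def)
  qed
  obtain z0 where z0: "z0 \<in> K" "\<And>z. z \<in> K \<Longrightarrow> G z0 \<le> G z"
    using continuous_attains_inf[OF K _ continuous_on_subset[OF Cinf_on_continuous[OF Gs] KW]] yK by blast
  obtain z1 where z1: "z1 \<in> K" "\<And>z. z \<in> K \<Longrightarrow> \<Delta> q z \<le> \<Delta> q z1"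
    using continuous_attains_sup[OF K _ continuous_on_subset[OF Cinf_on_continuous[OF \<Delta>_smooth[OF q]] KW]] yK by blast
  \<comment> \<open>On the shell \<Delta>\<open>E\<close> has the sign of \<alpha> \<open>G\<close>
    - \<Delta>\<open>q\<close>. Since \<open>G z0\<close> is the minimum of \<open>G\<close> and
    \<open>\<Delta> q z1\<close> the maximum of \<Delta>\<open>q\<close>, this \<alpha> makes the
    difference at least 1.\<close>
  define \<alpha> where "\<alpha> = (\<bar>\<Delta> q z1\<bar> + 1) / G z0"
  have \<alpha>: "0 < \<alpha>" "\<alpha> * G z0 = \<bar>\<Delta> q z1\<bar> + 1"
    using G_pos[OF z0(1)] by (auto simp: \<alpha>_def)
  define E where "E = (\<lambda>z. exp (- \<alpha> * q z))"
  have mq: "Cinf_on (\<lambda>z. - \<alpha> * q z) W" using q by (intro Cinf_on_mult open_W) auto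
  have Es: "Cinf_on E W" unfolding E_def by (intro Cinf_on_exp open_W mq)
  have \<Delta>E: "0 < \<Delta> E z" if z: "z \<in> K" for z
  proof -
    have zW: "z \<in> W" using z KW by auto
    have "\<delta> a (\<lambda>z. - \<alpha> * q z) z = - \<alpha> * \<delta> a q z" for a
      by (subst \<delta>_mult[OF Cinf_on_const q zW]) simp
    then have "\<Delta> E z = exp (- \<alpha> * q z) * ((\<Sum>a\<in>UNIV. (- \<alpha> * \<delta> a q z) * (- \<alpha> * \<delta> a q z)) + \<Delta> (\<lambda>z. - \<alpha> * q z) z)"
      unfolding E_def \<Delta>_exp(2)[OF mq zW] by simp
    also have "\<dots> = exp (- \<alpha> * q z) * (\<alpha> * (\<alpha> * G z - \<Delta> q z))"
      unfolding \<Delta>_cmult[OF q zW] G_def by (simp add: sum_distrib_left algebra_simps)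
    finally have *: "\<Delta> E z = exp (- \<alpha> * q z) * (\<alpha> * (\<alpha> * G z - \<Delta> q z))" .
    have "\<alpha> * G z0 \<le> \<alpha> * G z" using z0(2)[OF z] \<alpha>(1) by simp
    then have "0 < \<alpha> * G z - \<Delta> q z" using \<alpha>(2) z1(2)[OF z] by linarith
    then show ?thesis unfolding * using \<alpha> by simp
  qed
  have Hc: "continuous_on W h" by (rule Cinf_on_continuous[OF h])
  have sph: "compact (sphere c (\<rho> / 2))" "sphere c (\<rho> / 2) \<noteq> {}" "sphere c (\<rho> / 2) \<subseteq> W"
  proof -
    show "sphere c (\<rho> / 2) \<noteq> {}" using \<rho> by simp
    show "sphere c (\<rho> / 2) \<subseteq> W" using ball \<rho> by auto
  qed auto
  obtain z2 where z2: "z2 \<in> sphere c (\<rho> / 2)" "\<And>z. z \<in> sphere c (\<rho> / 2) \<Longrightarrow> h z \<le> h z2"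
    using continuous_attains_sup[OF sph(1,2) continuous_on_subset[OF Hc sph(3)]] by blast
  \<comment> \<open>The gap on the inner sphere. There \<open>E\<close> is at most 1, so adding
    \<epsilon> times the barrier does not exceed \<open>M\<close>; on the outer sphere the barrier
    is 0.\<close>
  define \<epsilon> where "\<epsilon> = M - h z2"
  have \<epsilon>: "0 < \<epsilon>" using less[of z2] z2(1) \<rho> by (simp add: \<epsilon>_def)
  define B where "B z = h z + \<epsilon> * (E z - exp (- \<alpha> * \<rho>\<^sup>2))" for z
  have Bs: "Cinf_on B W" unfolding B_def
    by (intro Cinf_on_add Cinf_on_mult Cinf_on_diff open_W h Es Cinf_on_const)
  have \<Delta>B: "0 < \<Delta> B z" if z: "z \<in> K" for z
  proof -
    have zW: "z \<in> W" using z KW by auto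
    have "B = (\<lambda>z. h z + (\<epsilon> * E z + (- \<epsilon> * exp (- \<alpha> * \<rho>\<^sup>2))))" by (auto simp: B_def algebra_simps)
    then have "\<Delta> B z = \<Delta> (\<lambda>z. h z + (\<epsilon> * E z + (- \<epsilon> * exp (- \<alpha> * \<rho>\<^sup>2)))) z" by metis
    also have "\<dots> = \<Delta> h z + \<Delta> (\<lambda>z. \<epsilon> * E z + (- \<epsilon> * exp (- \<alpha> * \<rho>\<^sup>2))) z"
      by (intro \<Delta>_add h zW Cinf_on_add Cinf_on_mult open_W Es Cinf_on_const)
    also have "\<Delta> (\<lambda>z. \<epsilon> * E z + (- \<epsilon> * exp (- \<alpha> * \<rho>\<^sup>2))) z
        = \<Delta> (\<lambda>z. \<epsilon> * E z) z + \<Delta> (\<lambda>_. - \<epsilon> * exp (- \<alpha> * \<rho>\<^sup>2)) z"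
      by (intro \<Delta>_add zW Cinf_on_mult open_W Es Cinf_on_const)
    also have "\<Delta> (\<lambda>z. \<epsilon> * E z) z = \<epsilon> * \<Delta> E z" by (rule \<Delta>_cmult[OF Es zW])
    also have "\<Delta> (\<lambda>_. - \<epsilon> * exp (- \<alpha> * \<rho>\<^sup>2)) z = 0" by (rule \<Delta>_const)
    finally show ?thesis using sub[OF zW] \<Delta>E[OF z] \<epsilon> by (simp add: add_nonneg_pos)
  qed
  obtain m where m: "m \<in> K" "\<And>z. z \<in> K \<Longrightarrow> B z \<le> B m"
    using continuous_attains_sup[OF K _ continuous_on_subset[OF Cinf_on_continuous[OF Bs] KW]] yK by blast
  have "B m \<le> M"
  proof -
    consider "dist c m = \<rho>" | "dist c m = \<rho> / 2" | "\<rho> / 2 < dist c m" "dist c m < \<rho>"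
      using m(1) by (force simp: K_def)
    then show ?thesis
    proof cases
      case 1
      then have "B m = h m" by (simp add: B_def E_def qd)
      then show ?thesis using le m(1) KW by auto
    next
      case 2
      then have "h m \<le> h z2" using z2 by simp
      moreover have "E m \<le> 1" using \<alpha> by (simp add: E_def qd)
      then have "\<epsilon> * (E m - exp (- \<alpha> * \<rho>\<^sup>2)) \<le> \<epsilon> * 1"
        using \<epsilon> by (intro mult_left_mono) (auto intro: order_trans[of _ "E m"])
      ultimately show ?thesis by (simp add: B_def \<epsilon>_def)
    next
      case 3
      define d where "d = min (dist c m - \<rho> / 2) (\<rho> - dist c m)"
      have "z \<in> K" if "dist z m < d" for z
        using that dist_triangle[of c z m] dist_triangle[of c m z] by (auto simp: K_def d_def dist_commute)
      then have "\<Delta> B m \<le> 0"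
        using 3 m KW by (intro interior_max(2)[OF Bs, of m d]) (auto simp: d_def)
      then show ?thesis using \<Delta>B[OF m(1)] by simp
    qed
  qed
  then have BM: "B z \<le> M" if "z \<in> K" for z using m(2)[OF that] by simp
  have By: "B y = M" using hy y by (simp add: B_def E_def qd)
  obtain e where e: "e > 0" "ball y e \<subseteq> W" using open_W yW openE by blast
  \<comment> \<open>\<open>y\<close> is a maximum of \<open>h\<close> over \<open>W\<close>, so
    \<open>h\<close> contributes nothing to the derivative of \<open>B\<close> at \<open>y\<close>.
    The barrier alone makes \<open>B\<close> increase from \<open>y\<close> towards
    \<open>c\<close>, against \<open>B\<close> \<le> \<open>M\<close> on the shell.\<close>
  have Dh: "frechet_derivative h (at y) = (\<lambda>v. 0)"
    using e le hy by (intro second_derivative_at_max(1)[OF open_W h yW e(1)]) (auto simp: dist_commute subset_iff)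
  have "(B has_derivative (\<lambda>v. 0 + \<epsilon> * (exp (- \<alpha> * q y) * (- \<alpha> * (2 * ((y - c) \<bullet> v)))))) (at y)"
    unfolding B_def E_def
    using Cinf_on_has_derivative[OF h yW] Cinf_on_has_derivative[OF q yW]
    by (auto intro!: derivative_eq_intros simp: Dh q' fun_eq_iff)
  then have DB: "(B has_derivative (\<lambda>v. - (2 * \<alpha> * \<epsilon> * exp (- \<alpha> * q y)) * ((y - c) \<bullet> v))) (at y)"
    by (simp add: mult_ac)
  have a: "((\<lambda>s. y + s *\<^sub>R (c - y)) has_derivative (\<lambda>h. h *\<^sub>R (c - y))) (at 0)"
    by (auto intro!: derivative_eq_intros)
  have "(B has_derivative (\<lambda>v. - (2 * \<alpha> * \<epsilon> * exp (- \<alpha> * q y)) * ((y - c) \<bullet> v))) (at (y + 0 *\<^sub>R (c - y)))"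
    using DB by simp
  from has_derivative_compose[OF a this]
  have "((\<lambda>s. B (y + s *\<^sub>R (c - y))) has_real_derivative
      - (2 * \<alpha> * \<epsilon> * exp (- \<alpha> * q y)) * ((y - c) \<bullet> (c - y))) (at 0)"
    unfolding has_field_derivative_def by (rule has_derivative_eq_rhs) (auto simp: fun_eq_iff mult_ac)
  moreover have "0 < - (2 * \<alpha> * \<epsilon> * exp (- \<alpha> * q y)) * ((y - c) \<bullet> (c - y))"
  proof -
    have "(y - c) \<bullet> (c - y) = - q y" by (simp add: q_def inner_diff algebra_simps)
    moreover have "0 < q y" using y \<rho> by (simp add: qd)
    ultimately show ?thesis using \<alpha> \<epsilon> by simp
  qed
  ultimately have "\<exists>d>0. \<forall>h>0. h < d \<longrightarrow> B (y + 0 *\<^sub>R (c - y)) < B (y + (0 + h) *\<^sub>R (c - y))"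
    by (rule DERIV_pos_inc_right)
  then obtain d where d: "d > 0" "\<And>h. 0 < h \<Longrightarrow> h < d \<Longrightarrow> B y < B (y + h *\<^sub>R (c - y))" by auto
  define t where "t = min (d / 2) (1 / 2)"
  have t: "0 < t" "t < d" "t \<le> 1 / 2" using d by (auto simp: t_def)
  have "dist c (y + t *\<^sub>R (c - y)) = (1 - t) * \<rho>"
  proof -
    have "c - (y + t *\<^sub>R (c - y)) = (1 - t) *\<^sub>R (c - y)" by (simp add: algebra_simps)
    then show ?thesis using t y by (simp add: dist_norm)
  qed
  moreover have "(1 - t) * \<rho> \<le> 1 * \<rho>" "(1 / 2) * \<rho> \<le> (1 - t) * \<rho>"
    using t \<rho> by (intro mult_right_mono; simp)+
  ultimately have "y + t *\<^sub>R (c - y) \<in> K" by (simp add: K_def)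
  then show False using BM d(2)[OF t(1,2)] By by fastforce
qed

text \<open>If \<open>h c\<close> < \<open>M\<close> for some \<open>c\<close> near
  \<open>x\<close>, the ball around \<open>c\<close> that reaches exactly to the nearest point of
  the set {h = M} meets that set only on its boundary, which \<open>hopf\<close> forbids.\<close>

lemma strong_maximum_principle:
  assumes h: "Cinf_on h W" and sub: "\<And>x. x \<in> W \<Longrightarrow> 0 \<le> \<Delta> h x"
    and le: "\<And>x. x \<in> W \<Longrightarrow> h x \<le> M" and x: "x \<in> W" "h x = M"
  shows "\<exists>r>0. ball x r \<subseteq> W \<and> (\<forall>z\<in>ball x r. h z = M)"
proof -
  obtain e where e: "e > 0" "ball x e \<subseteq> W" using open_W x openE by blast
  \<comment> \<open>A point \<open>c\<close> within \<open>r\<close> of \<open>x\<close> is closer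
    than \<open>r\<close> to the set {h = M}, so the touching ball around \<open>c\<close> stays in
    the closed ball of radius 2 \<open>r\<close> around \<open>x\<close>, hence in
    \<open>W\<close>.\<close>
  define r where "r = e / 4"
  have r: "r > 0" "cball x (2 * r) \<subseteq> W" using e by (auto simp: r_def)
  have "h c = M" if c: "c \<in> ball x r" for c
  proof (rule ccontr)
    assume nc: "h c \<noteq> M"
    define Z where "Z = {z \<in> cball x (2 * r). h z = M}"
    have "closed Z"
    proof -
      have "Z = cball x (2 * r) \<inter> h -` {M}" by (auto simp: Z_def)
      then show ?thesis
        using continuous_closed_preimage[OF continuous_on_subset[OF Cinf_on_continuous[OF h] r(2)]] by simp
    qed
    moreover have "x \<in> Z" using x r by (simp add: Z_def)
    ultimately obtain y where y: "y \<in> Z" "\<And>z. z \<in> Z \<Longrightarrow> dist c y \<le> dist c z"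
      using distance_attains_inf[of Z c] by blast
    define \<rho> where "\<rho> = dist c y"
    have \<rho>r: "\<rho> < r" using y(2)[OF \<open>x \<in> Z\<close>] c by (simp add: \<rho>_def dist_commute)
    have in2r: "z \<in> cball x (2 * r)" if "dist c z \<le> \<rho>" for z
      using dist_triangle[of x z c] c that \<rho>r by simp
    have \<rho>0: "0 < \<rho>" using nc y(1) by (auto simp: \<rho>_def Z_def)
    have cb: "cball c \<rho> \<subseteq> W" using in2r r(2) by auto
    have lt: "h z < M" if z: "dist c z < \<rho>" for z
    proof -
      have "z \<in> cball x (2 * r)" using in2r z by simp
      moreover have "z \<notin> Z" using y(2)[of z] z by (auto simp: \<rho>_def)
      ultimately show ?thesis using le r(2) by (force simp: Z_def)
    qed
    have "h y \<noteq> M"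
      by (rule hopf[OF h sub \<rho>0 cb le lt \<rho>_def[symmetric]])
    then show False using y(1) by (simp add: Z_def)
  qed
  then show ?thesis using r by (intro exI[of _ r]) auto
qed

end

subsection \<open>Test functions\<close>

context minimal_patch
begin

definition u where "u = (\<lambda>y. \<Sum>b\<in>UNIV. xc b y * nc b y)"

lemma u_smooth [intro]: "Cinf_on u W"
  unfolding u_def by (intro Cinf_on_sum Cinf_on_mult open_W xc_smooth nc_smooth)

lemma u_inner: "u x = \<psi> x \<bullet> \<nu> x" by (simp add: u_def inner_vec_def)

lemma \<delta>_u: assumes x: "x \<in> W" shows "\<delta> a u x = (\<Sum>b\<in>UNIV. \<psi> x $ b * S a b x)"
proof -
  have "\<delta> a u x
      = (\<Sum>b\<in>UNIV. \<psi> x $ b * S a b x + ((if a = b then 1 else 0) - \<nu> x $ a * \<nu> x $ b) * \<nu> x $ b)"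
    unfolding u_def using x by (subst \<delta>_sum)
      (auto intro!: sum.cong Cinf_on_mult open_W simp: \<delta>_mult[OF xc_smooth nc_smooth] S_def \<delta>_xc)
  also have "\<dots> = (\<Sum>b\<in>UNIV. \<psi> x $ b * S a b x)"
    by (simp add: sum.distrib sum_subtractf sum_distrib_left[symmetric] nu_sum[OF x] left_diff_distrib mult.assoc
        if_distrib[of "\<lambda>t. t * _"] cong: if_cong)
  finally show ?thesis .
qed

text \<open>The support function is the Jacobi field of dilations. The components of \<nu> solve the
  same equation by \<open>div_S\<close>, and the derivatives of the position contribute only the
  trace of \<open>S\<close>, which is 0.\<close>

lemma \<Delta>_u: assumes x: "x \<in> W" shows "\<Delta> u x = - c2 x * u x"
proof -
  have "\<delta> a (\<delta> a u) x = (\<Sum>b\<in>UNIV. \<psi> x $ b * \<delta> a (S a b) x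
      + ((if a = b then 1 else 0) - \<nu> x $ a * \<nu> x $ b) * S a b x)" for a
  proof -
    have "\<delta> a (\<delta> a u) x = \<delta> a (\<lambda>y. \<Sum>b\<in>UNIV. xc b y * S a b y) x"
      using x by (intro \<delta>_cong) (auto simp: \<delta>_u intro!: Cinf_on_sum Cinf_on_mult open_W)
    then show ?thesis using x
      by (subst (asm) \<delta>_sum) (auto intro!: sum.cong Cinf_on_mult open_W simp: \<delta>_mult[OF xc_smooth S_smooth] \<delta>_xc)
  qed
  moreover have "(\<Sum>b\<in>UNIV. \<psi> x $ b * \<delta> a (S a b) x
      + ((if a = b then 1 else 0) - \<nu> x $ a * \<nu> x $ b) * S a b x)
      = (\<Sum>b\<in>UNIV. \<psi> x $ b * \<delta> a (S a b) x) + S a a x" for a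
    by (simp add: sum.distrib sum_subtractf sum_distrib_left[symmetric] S_nu[OF x] left_diff_distrib mult.assoc
        if_distrib[of "\<lambda>t. t * _"] cong: if_cong)
  ultimately have "\<Delta> u x = (\<Sum>a\<in>UNIV. \<Sum>b\<in>UNIV. \<psi> x $ b * \<delta> a (S a b) x)"
    by (simp add: \<Delta>_def sum.distrib minimal[OF x])
  also have "\<dots> = (\<Sum>b\<in>UNIV. \<psi> x $ b * (\<Sum>a\<in>UNIV. \<delta> a (S a b) x))"
    by (subst sum.swap) (simp add: sum_distrib_left)
  also have "\<dots> = - c2 x * u x"
    by (simp add: div_S[OF x] u_def sum_distrib_left sum_negf mult_ac)
  finally show ?thesis .
qed

lemma \<delta>_rr_u: "x \<in> W \<Longrightarrow> \<delta> a rr x = 2 * (\<psi> x $ a - u x * \<nu> x $ a)"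
  by (simp add: \<delta>_rr u_inner)

lemma \<Delta>_rr_minimal: assumes x: "x \<in> W" shows "\<Delta> rr x = 2 * real CARD('n)"
proof -
  have "\<delta> a (\<delta> a rr) x = 2 * (1 - \<nu> x $ a * \<nu> x $ a - (u x * S a a x + \<delta> a u x * \<nu> x $ a))" for a
  proof -
    have "\<delta> a (\<delta> a rr) x = \<delta> a (\<lambda>y. 2 * (xc a y - u y * nc a y)) x"
      using x by (intro \<delta>_cong) (auto simp: \<delta>_rr_u intro!: Cinf_on_mult Cinf_on_diff open_W)
    also have "\<dots> = 2 * (\<delta> a (xc a) x - \<delta> a (\<lambda>y. u y * nc a y) x)"
      using x by (simp add: \<delta>_mult[OF Cinf_on_const] \<delta>_diff Cinf_on_diff Cinf_on_mult open_W xc_smooth nc_smooth u_smooth)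
    finally show ?thesis using x by (simp add: \<delta>_mult[OF u_smooth nc_smooth] \<delta>_xc S_def)
  qed
  then have "\<Delta> rr x = 2 * (real CARD('k) - 1 - (u x * (\<Sum>a\<in>UNIV. S a a x) + (\<Sum>a\<in>UNIV. \<nu> x $ a * \<delta> a u x)))"
    by (simp add: \<Delta>_def sum_distrib_left[symmetric] sum_subtractf sum.distrib nu_sum[OF x] mult.commute)
  then show ?thesis using card_eq by (simp add: minimal[OF x] nu_\<delta>[OF u_smooth x])
qed

text \<open>\<open>exp (- c |x|\<^sup>2 / 2)\<close> is a supersolution of the Jacobi equation when \<open>c = n / (2 R)\<close> and
  \<open>|A|\<^sup>2 \<le> n\<^sup>2 / (4 R)\<close>, so the quotient of \<open>u\<close> by it has no positive interior maximum.\<close>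

definition barta where "barta c = (\<lambda>y. u y * exp (c / 2 * rr y))"

lemma barta_smooth [intro]: "Cinf_on (barta c) W"
  unfolding barta_def by (intro Cinf_on_mult Cinf_on_exp open_W u_smooth rr_smooth Cinf_on_const)

text \<open>At a critical point \<Delta> of the quotient is its value times c n - c^2 (|x|^2 - u^2)
  - |A|^2. For c = n / (2 R) the expression c n - c^2 R takes its maximal value n^2 / (4 R), the
  bound on |A|^2, and u > 0 makes the inequality strict.\<close>

lemma no_positive_max:
  assumes x: "x \<in> W" and R: "0 < R" "rr x \<le> R" and A: "c2 x \<le> (real CARD('n))\<^sup>2 / (4 * R)"
    and pos: "0 < u x" and e: "0 < e"
    and max: "\<And>y. dist y x < e \<Longrightarrow> barta (real CARD('n) / (2 * R)) y \<le> barta (real CARD('n) / (2 * R)) x"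
  shows False
proof -
  define n where "n = real CARD('n)"
  define c where "c = n / (2 * R)"
  define q where "q = (\<lambda>y. c / 2 * rr y)"
  have q: "Cinf_on q W" unfolding q_def by (intro Cinf_on_mult open_W rr_smooth Cinf_on_const)
  define \<tau> where "\<tau> a = \<psi> x $ a - u x * \<nu> x $ a" for a
  have \<delta>q: "\<delta> a q x = c * \<tau> a" for a
    unfolding q_def \<delta>_mult[OF Cinf_on_const rr_smooth x] using x by (simp add: \<delta>_rr_u \<tau>_def)
  have \<Delta>q: "\<Delta> q x = c * n"
    unfolding q_def \<Delta>_cmult[OF rr_smooth x] using x by (simp add: \<Delta>_rr_minimal n_def)
  have \<tau>2: "(\<Sum>a\<in>UNIV. \<tau> a * \<tau> a) = rr x - u x * u x"
  proof -
    have "(\<Sum>a\<in>UNIV. \<tau> a * \<tau> a) = rr x - 2 * u x * (\<Sum>a\<in>UNIV. \<psi> x $ a * \<nu> x $ a)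
       + u x * u x * (\<Sum>a\<in>UNIV. \<nu> x $ a * \<nu> x $ a)"
      unfolding rr_def sum_distrib_left sum_subtractf[symmetric] sum.distrib[symmetric]
      by (intro sum.cong refl) (simp add: \<tau>_def algebra_simps)
    then show ?thesis by (simp add: nu_sum[OF x]) (simp add: u_def)
  qed
  have E: "barta c = (\<lambda>y. u y * exp (q y))" by (simp add: barta_def q_def)
  have Es: "Cinf_on (\<lambda>y. exp (q y)) W" by (intro Cinf_on_exp open_W q)
  note m = interior_max[OF barta_smooth x e max, folded n_def, folded c_def]
  have "\<delta> a (barta c) x = exp (q x) * (u x * (c * \<tau> a) + \<delta> a u x)" for a
    unfolding E \<delta>_mult[OF u_smooth Es x] \<Delta>_exp(1)[OF q x] \<delta>q by (simp add: algebra_simps)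
  then have \<delta>u: "\<delta> a u x = - u x * (c * \<tau> a)" for a using m(1)[of a] by simp
  have "\<Delta> (barta c) x = u x * (exp (q x) * ((\<Sum>a\<in>UNIV. (c * \<tau> a) * (c * \<tau> a)) + c * n))
     + 2 * (\<Sum>a\<in>UNIV. (- u x * (c * \<tau> a)) * (exp (q x) * (c * \<tau> a))) - c2 x * u x * exp (q x)"
    unfolding E \<Delta>_mult[OF u_smooth Es x] \<Delta>_exp[OF q x] \<delta>q \<Delta>q \<Delta>_u[OF x] \<delta>u by simp
  also have "\<dots> = exp (q x) * u x * (c * n - c * c * (\<Sum>a\<in>UNIV. \<tau> a * \<tau> a) - c2 x)"
    by (simp add: sum_distrib_left sum_negf algebra_simps)
  finally have L: "\<Delta> (barta c) x = exp (q x) * u x * (c * n - c * c * (rr x - u x * u x) - c2 x)"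
    unfolding \<tau>2 .
  have n: "0 < n" by (simp add: n_def)
  have c: "0 < c" using n R by (simp add: c_def)
  have "c * c * (rr x - u x * u x) < c * c * R"
    using R pos c by (intro mult_strict_left_mono) (auto intro: less_le_trans[of _ "rr x"])
  moreover have "c * c * R = n\<^sup>2 / (4 * R)" "c * n = n\<^sup>2 / (4 * R) + n\<^sup>2 / (4 * R)"
    using R by (simp_all add: c_def power2_eq_square field_simps)
  ultimately have "0 < c * n - c * c * (rr x - u x * u x) - c2 x"
    using A by (simp add: n_def)
  then have "0 < \<Delta> (barta c) x" unfolding L using pos by simp
  then show False using m(2) by simp
qed

end

context cone_patch
begin

lemma radial_rr_zero:
  assumes x: "x \<in> W" shows "\<exists>a. \<delta> a rr x \<noteq> 0"
proof (rule ccontr)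
  assume "\<not> ?thesis"
  then have "\<psi> x $ a = 0" for a using \<delta>_rr_cone[OF x] by simp
  then show False using away[OF x] by (simp add: vec_eq_iff)
qed

lemma \<delta>_inverse:
  assumes "Cinf_on p W" "x \<in> W" "p x \<noteq> 0"
  shows "\<delta> a (\<lambda>y. inverse (p y)) x = - (\<delta> a p x) / (p x)\<^sup>2"
  using \<delta>_real_comp[OF assms(1,2) DERIV_inverse[OF assms(3)]]
  by (simp add: power2_eq_square divide_inverse)

text \<open>Radially \<open>f\<close> has derivative 0 by \<open>radial_f\<close>, while the penalty
  is strictly monotone in |x|, so their difference has no critical point at all.\<close>

lemma no_max_outer:
  assumes x: "x \<in> W" and B: "\<And>y. y \<in> W \<Longrightarrow> rr y < B" and \<epsilon>: "0 < \<epsilon>" and e: "0 < e"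
    and max: "\<And>y. dist y x < e \<Longrightarrow> f y - \<epsilon> * inverse (B - rr y) \<le> f x - \<epsilon> * inverse (B - rr x)"
  shows False
proof -
  define p where "p = (\<lambda>y. B - rr y)"
  have p: "Cinf_on p W" unfolding p_def by (intro Cinf_on_diff open_W rr_smooth Cinf_on_const)
  have pnz: "p y \<noteq> 0" if "y \<in> W" for y using B[OF that] by (simp add: p_def)
  have ip: "Cinf_on (\<lambda>y. inverse (p y)) W" by (intro Cinf_on_inverse open_W p pnz)
  have g: "Cinf_on (\<lambda>y. f y - \<epsilon> * inverse (p y)) W"
    by (intro Cinf_on_diff Cinf_on_mult open_W f_smooth ip Cinf_on_const)
  have "\<delta> a (\<lambda>y. f y - \<epsilon> * inverse (p y)) x = 0" for a
    using max by (intro interior_max(1)[OF g x e]) (simp add: p_def)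
  moreover have "\<delta> a (\<lambda>y. f y - \<epsilon> * inverse (p y)) x = \<delta> a f x - \<epsilon> * (2 * \<psi> x $ a) / (p x)\<^sup>2" for a
  proof -
    have "\<delta> a p x = - (2 * \<psi> x $ a)"
      unfolding p_def using x by (simp add: \<delta>_diff[OF Cinf_on_const rr_smooth] \<delta>_rr_cone)
    moreover have "\<delta> a (\<lambda>y. f y - \<epsilon> * inverse (p y)) x = \<delta> a f x - \<delta> a (\<lambda>y. \<epsilon> * inverse (p y)) x"
      by (intro \<delta>_diff f_smooth x Cinf_on_mult open_W ip Cinf_on_const)
    ultimately show ?thesis
      by (simp add: \<delta>_mult[OF Cinf_on_const ip x] \<delta>_inverse[OF p x pnz[OF x]])
  qed
  ultimately have "\<delta> a f x = (2 * \<epsilon> / (p x)\<^sup>2) * \<psi> x $ a" for a by (simp add: algebra_simps)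
  then have "0 = (\<Sum>a\<in>UNIV. \<psi> x $ a * ((2 * \<epsilon> / (p x)\<^sup>2) * \<psi> x $ a))"
    using radial_f[OF x] by simp
  also have "\<dots> = (2 * \<epsilon> / (p x)\<^sup>2) * rr x"
    unfolding rr_def sum_distrib_left by (intro sum.cong refl) simp
  finally have "0 = (2 * \<epsilon> / (p x)\<^sup>2) * rr x" .
  then show False using \<epsilon> rr_pos[OF x] pnz[OF x] by simp
qed

text \<open>At a critical point the radial derivative of the penalty must vanish, since that of
  \<open>f\<close> does; this happens only on the middle sphere. There \<Delta> of the penalty is
  explicit, and \<Delta>\<open>f\<close> \<ge> 2 |A|^2 (n - 1 - \<open>f\<close>) yields a bound
  that tends to 0 with \<open>\<epsilon>\<close>.\<close>

lemma max_middle: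
  assumes x: "x \<in> W" and AB: "\<And>y. y \<in> W \<Longrightarrow> A < rr y \<and> rr y < B" and \<epsilon>: "0 < \<epsilon>" and e: "0 < e"
    and max: "\<And>y. dist y x < e \<Longrightarrow> f y - \<epsilon> * inverse ((rr y - A) * (B - rr y))
       \<le> f x - \<epsilon> * inverse ((rr x - A) * (B - rr x))"
  shows "rr x = (A + B) / 2"
    and "f x * (real CARD('n) - 1 - f x) \<le> \<epsilon> * (4 * (rr x)\<^sup>2 / ((rr x - A) * (B - rr x))\<^sup>2)"
proof -
  define p where "p = (\<lambda>y. (rr y - A) * (B - rr y))"
  have p: "Cinf_on p W"
    unfolding p_def by (intro Cinf_on_mult Cinf_on_diff open_W rr_smooth Cinf_on_const)
  have ppos: "0 < p y" if "y \<in> W" for y using AB[OF that] by (simp add: p_def)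
  have pnz: "p y \<noteq> 0" if "y \<in> W" for y using ppos[OF that] by simp
  have ip: "Cinf_on (\<lambda>y. inverse (p y)) W" by (intro Cinf_on_inverse open_W p pnz)
  have \<epsilon>ip: "Cinf_on (\<lambda>y. (- \<epsilon>) * inverse (p y)) W"
    by (intro Cinf_on_mult open_W ip Cinf_on_const)
  have g: "Cinf_on (\<lambda>y. f y + (- \<epsilon>) * inverse (p y)) W"
    by (intro Cinf_on_add open_W f_smooth \<epsilon>ip)
  have max': "f y + (- \<epsilon>) * inverse (p y) \<le> f x + (- \<epsilon>) * inverse (p x)" if "dist y x < e" for y
    using max[OF that] by (simp add: p_def)
  note m = interior_max[OF g x e max']
  define w where "w = (\<lambda>y. A + B - 2 * rr y)"
  have w: "Cinf_on w W" unfolding w_def by (intro Cinf_on_diff Cinf_on_mult open_W rr_smooth Cinf_on_const)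
  have \<delta>w: "\<delta> a w y = - 4 * \<psi> y $ a" if y: "y \<in> W" for a y
    unfolding w_def using y
    by (simp add: \<delta>_diff[OF Cinf_on_const] \<delta>_mult[OF Cinf_on_const rr_smooth] \<delta>_rr_cone Cinf_on_mult open_W rr_smooth)
  have \<delta>p: "\<delta> a p y = w y * (2 * \<psi> y $ a)" if y: "y \<in> W" for a y
  proof -
    have "\<delta> a p y = (rr y - A) * \<delta> a (\<lambda>y. B - rr y) y + \<delta> a (\<lambda>y. rr y - A) y * (B - rr y)"
      unfolding p_def by (intro \<delta>_mult y Cinf_on_diff open_W rr_smooth Cinf_on_const)
    then show ?thesis
      using y by (simp add: \<delta>_diff[OF Cinf_on_const rr_smooth] \<delta>_diff[OF rr_smooth Cinf_on_const]
          \<delta>_rr_cone w_def algebra_simps)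
  qed
  define K where "K a = (\<lambda>y. (- 2 * xc a y) * (inverse (p y) * inverse (p y)))" for a
  have K: "Cinf_on (K a) W" for a
    unfolding K_def by (intro Cinf_on_mult open_W ip xc_smooth Cinf_on_const)
  have \<delta>ip: "\<delta> a (\<lambda>y. inverse (p y)) y = w y * K a y" if y: "y \<in> W" for a y
    unfolding \<delta>_inverse[OF p y pnz[OF y]] \<delta>p[OF y]
    by (simp add: K_def power2_eq_square divide_inverse)
  have \<delta>g: "\<delta> a f x = \<epsilon> * (w x * K a x)" for a
    using m(1)[of a] x unfolding \<delta>_add[OF f_smooth \<epsilon>ip x] \<delta>_mult[OF Cinf_on_const ip x] \<delta>ip[OF x] by simp
  have "0 = \<epsilon> * (w x * (\<Sum>a\<in>UNIV. \<psi> x $ a * K a x))"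
    using radial_f[OF x] unfolding \<delta>g by (simp add: sum_distrib_left mult_ac)
  moreover have "(\<Sum>a\<in>UNIV. \<psi> x $ a * K a x) = - 2 * rr x * (inverse (p x))\<^sup>2"
    unfolding rr_def K_def sum_distrib_left sum_distrib_right
    by (intro sum.cong refl) (simp add: power2_eq_square)
  ultimately have w0: "w x = 0" using \<epsilon> rr_pos[OF x] pnz[OF x] by simp
  then show "rr x = (A + B) / 2" by (simp add: w_def)
  \<comment> \<open>The gradient of the reciprocal is \<open>w y * K a y\<close>; as
    \<open>w\<close> vanishes at \<open>x\<close>, only the derivative of \<open>w\<close>
    survives.\<close>
  have "\<delta> a (\<delta> a (\<lambda>y. inverse (p y))) x = 8 * (\<psi> x $ a * \<psi> x $ a) / (p x)\<^sup>2" for a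
  proof -
    have "\<delta> a (\<delta> a (\<lambda>y. inverse (p y))) x = \<delta> a (\<lambda>y. w y * K a y) x"
      using x w K by (intro \<delta>_cong) (auto simp: \<delta>ip intro!: Cinf_on_mult open_W)
    also have "\<dots> = 8 * (\<psi> x $ a * \<psi> x $ a) / (p x)\<^sup>2"
      unfolding \<delta>_mult[OF w K x] w0 \<delta>w[OF x] by (simp add: K_def power2_eq_square divide_inverse)
    finally show ?thesis .
  qed
  then have "\<Delta> (\<lambda>y. inverse (p y)) x = 8 * rr x / (p x)\<^sup>2"
    by (simp add: \<Delta>_def rr_def sum_divide_distrib sum_distrib_left)
  then have "\<Delta> f x - \<epsilon> * (8 * rr x / (p x)\<^sup>2) \<le> 0"
    using m(2) unfolding \<Delta>_add[OF f_smooth \<epsilon>ip x] \<Delta>_cmult[OF ip x] by simp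
  moreover have "2 * c2 x * (real CARD('n) - 1 - f x) \<le> \<Delta> f x"
    unfolding \<Delta>_f[OF x] using rr_pos[OF x] BB_nonneg by simp
  ultimately have "2 * c2 x * (real CARD('n) - 1 - f x) \<le> \<epsilon> * (8 * rr x / (p x)\<^sup>2)" by linarith
  then have "rr x / 2 * (2 * c2 x * (real CARD('n) - 1 - f x)) \<le> rr x / 2 * (\<epsilon> * (8 * rr x / (p x)\<^sup>2))"
    using rr_pos[OF x] by (intro mult_left_mono) auto
  also have "rr x / 2 * (2 * c2 x * (real CARD('n) - 1 - f x)) = f x * (real CARD('n) - 1 - f x)"
    by (simp add: f_def)
  also have "rr x / 2 * (\<epsilon> * (8 * rr x / (p x)\<^sup>2)) = \<epsilon> * (4 * (rr x)\<^sup>2 / (p x)\<^sup>2)"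
    by (simp add: power2_eq_square)
  finally show "f x * (real CARD('n) - 1 - f x) \<le> \<epsilon> * (4 * (rr x)\<^sup>2 / ((rr x - A) * (B - rr x))\<^sup>2)"
    unfolding p_def .
qed

text \<open>As long as \<open>f\<close> \<le> n - 1, the zero-order term in
  \<open>\<Delta>_f\<close> is nonnegative and \<open>f\<close> is subharmonic.\<close>

lemma f_max_spreads:
  assumes le: "\<And>x. x \<in> W \<Longrightarrow> f x \<le> real CARD('n) - 1" and x: "x \<in> W" "f x = real CARD('n) - 1"
  shows "\<exists>r>0. ball x r \<subseteq> W \<and> (\<forall>z\<in>ball x r. f z = real CARD('n) - 1)"
proof (rule strong_maximum_principle[OF f_smooth _ le x])
  fix z assume z: "z \<in> W"
  have "0 \<le> c2 z" unfolding c2_def by (intro sum_nonneg) simp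
  then show "0 \<le> \<Delta> f z"
    unfolding \<Delta>_f[OF z] using rr_pos[OF z] BB_nonneg[of z] le[OF z] by simp
qed

end

section \<open>Existence of patches and change of coordinates\<close>

lemma unit_normal_exists:
  fixes L :: "real ^ 'n::finite \<Rightarrow> real ^ 'k::finite"
  assumes L: "linear L" and card: "CARD('n) < CARD('k)"
  shows "\<exists>\<nu>. norm \<nu> = 1 \<and> (\<forall>v. L v \<bullet> \<nu> = 0)"
proof -
  have "dim (range L) \<le> CARD('n)" using dim_image_le[OF L, of UNIV] by simp
  then have "dim (range L) < DIM(real ^ 'k)" using card by simp
  then obtain z where z: "z \<noteq> 0" "\<And>y. y \<in> span (range L) \<Longrightarrow> orthogonal z y"
    using orthogonal_to_subspace_exists by blast
  then have "L v \<bullet> z = 0" for v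
    using z(2)[OF span_base[of "L v" "range L"]] by (simp add: orthogonal_def inner_commute[of z])
  then show ?thesis using z(1) by (intro exI[of _ "z /\<^sub>R norm z"]) simp
qed

lemma inj_of_gram:
  fixes L :: "real ^ 'n::finite \<Rightarrow> real ^ 'k::finite"
  assumes L: "linear L" and det: "det (\<chi> i j. L (axis i 1) \<bullet> L (axis j 1) :: real ^ 'n ^ 'n) \<noteq> 0"
  shows "inj L"
proof -
  let ?g = "\<chi> i j. L (axis i 1) \<bullet> L (axis j 1) :: real ^ 'n ^ 'n"
  have "v = 0" if "L v = 0" for v
  proof -
    have Lv: "L v = (\<Sum>j\<in>UNIV. v $ j *\<^sub>R L (axis j 1))"
      by (subst basis_expansion[symmetric, of v]) (simp add: linear_sum[OF L] linear_cmul[OF L] scalar_mult_eq_scaleR)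
    have "(?g *v v) $ i = L (axis i 1) \<bullet> L v" for i
      unfolding Lv by (simp add: inner_sum_right matrix_vector_mult_def mult.commute)
    then have "?g *v v = 0" using that by (simp add: vec_eq_iff)
    then show ?thesis
      using det unfolding invertible_det_nz[symmetric] invertible_left_inverse matrix_left_invertible_ker by blast
  qed
  then show ?thesis using linear_injective_0[OF L] by blast
qed

text \<open>A unit normal \<open>n0\<close> at \<open>x0\<close> is kept fixed and its tangential
  part at nearby points is subtracted, using the inverse Gram matrix. The result is smooth, normal
  and nonzero near \<open>x0\<close>, so it can be normalised. Immersion persists because the Gram
  determinant is continuous.\<close>

lemma patch_exists:
  fixes g :: "real ^ 'n::finite \<Rightarrow> real ^ 'k::finite"
  assumes W: "open W" and g: "Cinf_on g W" and x0: "x0 \<in> W"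
    and inj: "inj (frechet_derivative g (at x0))" and card: "CARD('k) = CARD('n) + 1"
  shows "\<exists>r \<nu>. 0 < r \<and> ball x0 r \<subseteq> W \<and> patch (ball x0 r) g \<nu>"
proof -
  define J where "J x = frechet_derivative g (at x)" for x
  have Jl: "linear (J x)" if "x \<in> W" for x
    unfolding J_def using Cinf_on_differentiable[OF g that] linear_frechet_derivative by blast
  have Js: "Cinf_on (\<lambda>x. J x v) W" for v unfolding J_def by (rule Cinf_on_deriv[OF g])
  define m where "m x = (\<chi> i j. J x (axis i 1) \<bullet> J x (axis j 1) :: real ^ 'n ^ 'n)" for x
  have ms: "Cinf_on (\<lambda>x. m x $ i $ j) W" for i j
    unfolding m_def by (simp, intro Cinf_on_inner W Js)
  then have ds: "continuous_on W (\<lambda>x. det (m x))"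
    by (intro Cinf_on_continuous Cinf_on_det W)
  have "det (m x0) \<noteq> 0"
    unfolding m_def using gram_det_nonzero[OF Jl[OF x0]] inj by (simp add: J_def)
  moreover have "open (W \<inter> (\<lambda>x. det (m x)) -` (- {0}))"
    by (intro continuous_open_preimage ds W) auto
  ultimately obtain r1 where r1: "r1 > 0" "ball x0 r1 \<subseteq> W \<inter> (\<lambda>x. det (m x)) -` (- {0})"
    using openE[of "W \<inter> (\<lambda>x. det (m x)) -` (- {0})" x0] x0 by blast
  define V where "V = ball x0 r1"
  have V: "open V" "V \<subseteq> W" "\<And>x. x \<in> V \<Longrightarrow> det (m x) \<noteq> 0" "x0 \<in> V" using r1 by (auto simp: V_def)
  obtain n0 where n0: "norm n0 = 1" "\<And>v. J x0 v \<bullet> n0 = 0"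
    using unit_normal_exists[OF Jl[OF x0]] card by auto
  define P where "P x = (\<Sum>i\<in>UNIV. (\<Sum>j\<in>UNIV. matrix_inv (m x) $ i $ j * (J x (axis j 1) \<bullet> n0)) *\<^sub>R J x (axis i 1))" for x
  have JV: "Cinf_on (\<lambda>x. J x v) V" for v by (rule Cinf_on_subset[OF Js V(2)])
  have iV: "Cinf_on (\<lambda>x. matrix_inv (m x) $ i $ j) V" for i j
    by (intro Cinf_on_matrix_inv V Cinf_on_subset[OF ms V(2)])
  have Ps: "Cinf_on P V" unfolding P_def
    by (intro Cinf_on_sum Cinf_on_scaleR Cinf_on_mult Cinf_on_inner V JV iV Cinf_on_const)
  define N where "N x = n0 - P x" for x
  have Ns: "Cinf_on N V" unfolding N_def by (intro Cinf_on_diff V Ps Cinf_on_const)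
  have N_orth: "J x v \<bullet> N x = 0" if x: "x \<in> V" for x v
  proof -
    have xW: "x \<in> W" using x V by auto
    have "J x (axis l 1) \<bullet> N x = 0" for l
    proof -
      have "J x (axis l 1) \<bullet> P x = (\<Sum>i\<in>UNIV. m x $ l $ i * (\<Sum>j\<in>UNIV. matrix_inv (m x) $ i $ j * (J x (axis j 1) \<bullet> n0)))"
        by (simp add: P_def inner_sum_right m_def mult.commute)
      also have "\<dots> = (\<Sum>j\<in>UNIV. (m x ** matrix_inv (m x)) $ l $ j * (J x (axis j 1) \<bullet> n0))"
        by (simp add: matrix_matrix_mult_def sum_distrib_left sum_distrib_right mult.assoc) (rule sum.swap)
      also have "\<dots> = J x (axis l 1) \<bullet> n0"
        by (simp add: matrix_inv_mult_right[OF V(3)[OF x]] mat_def if_distrib[of "\<lambda>t. t * _"] cong: if_cong)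
      finally show ?thesis by (simp add: N_def inner_diff_right)
    qed
    then show ?thesis
      by (subst basis_expansion[symmetric, of v])
        (simp add: linear_sum[OF Jl[OF xW]] linear_cmul[OF Jl[OF xW]] scalar_mult_eq_scaleR inner_sum_left)
  qed
  have "P x0 = 0" by (simp add: P_def n0)
  then have "N x0 \<bullet> N x0 \<noteq> 0" using n0 by (auto simp: N_def)
  moreover have Nc: "continuous_on V (\<lambda>x. N x \<bullet> N x)"
    by (intro Cinf_on_continuous Cinf_on_inner V Ns)
  then have "open (V \<inter> (\<lambda>x. N x \<bullet> N x) -` (- {0}))"
    by (intro continuous_open_preimage V) auto
  ultimately obtain r where r: "r > 0" "ball x0 r \<subseteq> V \<inter> (\<lambda>x. N x \<bullet> N x) -` (- {0})"
    using openE[of "V \<inter> (\<lambda>x. N x \<bullet> N x) -` (- {0})" x0] V by blast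
  define B where "B = ball x0 r"
  have B: "open B" "B \<subseteq> V" "\<And>x. x \<in> B \<Longrightarrow> N x \<bullet> N x > 0" using r by (auto simp: B_def)
  define \<nu> where "\<nu> x = inverse (sqrt (N x \<bullet> N x)) *\<^sub>R N x" for x
  have NB: "Cinf_on N B" by (rule Cinf_on_subset[OF Ns B(2)])
  have "patch B g \<nu>"
  proof
    show "Cinf_on g B" using g B(2) V(2) by (blast intro: Cinf_on_subset)
    show "Cinf_on \<nu> B" unfolding \<nu>_def
      using B(3) by (intro Cinf_on_scaleR Cinf_on_inverse Cinf_on_sqrt Cinf_on_inner B NB) force+
    fix x assume x: "x \<in> B"
    then have xV: "x \<in> V" "x \<in> W" using B V by auto
    show "inj (frechet_derivative g (at x))"
      using inj_of_gram[OF Jl[OF xV(2)] V(3)[OF xV(1), unfolded m_def]] by (simp add: J_def)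
    show "\<nu> x \<bullet> \<nu> x = 1"
    proof -
      have "\<nu> x \<bullet> \<nu> x = inverse (sqrt (N x \<bullet> N x) * sqrt (N x \<bullet> N x)) * (N x \<bullet> N x)"
        by (simp add: \<nu>_def del: real_sqrt_mult_self)
      then show ?thesis using B(3)[OF x] by simp
    qed
    show "frechet_derivative g (at x) v \<bullet> \<nu> x = 0" for v
      using N_orth[OF xV(1), of v] by (simp add: \<nu>_def J_def)
  qed (use B card in auto)
  then show ?thesis using r V B by (intro exI[of _ r] exI[of _ \<nu>]) (auto simp: B_def)
qed

lemma patch_subset: "patch W \<psi> \<nu> \<Longrightarrow> open V \<Longrightarrow> V \<subseteq> W \<Longrightarrow> patch V \<psi> \<nu>"
  unfolding patch_def by (auto intro: Cinf_on_subset)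

lemma patch_unit_normal:
  assumes p: "patch W \<psi> \<nu>" and x: "x \<in> W" and \<mu>: "norm \<mu> = 1" "\<And>v. frechet_derivative \<psi> (at x) v \<bullet> \<mu> = 0"
  shows "\<mu> = \<nu> x \<or> \<mu> = - \<nu> x"
proof -
  interpret patch W \<psi> \<nu> by (rule p)
  have "\<mu> = (\<mu> \<bullet> \<nu> x) *\<^sub>R \<nu> x"
    using normal_line[OF J_linear[OF x] J_inj[OF x] card_eq nu_unit[OF x] J_nu[OF x]] \<mu>(2) by (simp add: J_def)
  then obtain c where c: "\<mu> = c *\<^sub>R \<nu> x" by blast
  have "norm (\<nu> x) = 1" using nu_unit[OF x] by (simp add: norm_eq_sqrt_inner)
  then have "\<bar>c\<bar> = 1" using \<mu>(1) c by simp
  then show ?thesis using c by (auto simp: abs_if split: if_splits)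
qed

text \<open>Two patches through the same point differ by a change of coordinates \<open>\<tau>\<close>; the shape
  operator, as a matrix in the ambient coordinates, depends on it only through the sign of \<open>\<nu>\<close>.\<close>

lemma patch_change:
  assumes p: "patch W \<psi> \<nu>" and p': "patch W' \<psi>' \<nu>'" and x: "x \<in> W"
    and \<tau>: "\<And>y. y \<in> W \<Longrightarrow> \<tau> differentiable (at y)" "\<And>y. y \<in> W \<Longrightarrow> \<tau> y \<in> W'"
    and eq: "\<And>y. y \<in> W \<Longrightarrow> \<psi> y = \<psi>' (\<tau> y)"
  shows "\<exists>s::real. (s = 1 \<or> s = -1) \<and> \<nu>' (\<tau> x) = s *\<^sub>R \<nu> x \<and> (\<forall>a b. patch.S \<psi>' \<nu>' a b (\<tau> x) = s * patch.S \<psi> \<nu> a b x)"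
proof -
  interpret P: patch W \<psi> \<nu> by (rule p)
  interpret P': patch W' \<psi>' \<nu>' by (rule p')
  define d where "d y = frechet_derivative \<tau> (at y)" for y
  have hd: "(\<tau> has_derivative d y) (at y)" if "y \<in> W" for y
    unfolding d_def using \<tau>(1)[OF that] frechet_derivative_works by blast
  have Jd: "P.J y v = P'.J (\<tau> y) (d y v)" if y: "y \<in> W" for y v
  proof -
    have h2: "((\<lambda>y. \<psi>' (\<tau> y)) has_derivative (\<lambda>v. P'.J (\<tau> y) (d y v))) (at y)"
      unfolding P'.J_def
      by (rule has_derivative_compose[OF hd[OF y] Cinf_on_has_derivative[OF P'.psi_smooth \<tau>(2)[OF y]]])
    have "(\<psi> has_derivative (\<lambda>v. P'.J (\<tau> y) (d y v))) (at y)"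
      by (rule has_derivative_transform_within_open[OF h2 P.open_W y]) (simp add: eq)
    then show ?thesis unfolding P.J_def using frechet_derivative_at by metis
  qed
  have pm: "\<nu>' (\<tau> y) = \<nu> y \<or> \<nu>' (\<tau> y) = - \<nu> y" if y: "y \<in> W" for y
    using P'.nu_unit[OF \<tau>(2)[OF y]] P'.J_nu[OF \<tau>(2)[OF y]] Jd[OF y]
    by (intro patch_unit_normal[OF p y]) (auto simp: norm_eq_sqrt_inner P.J_def)
  define s where "s = \<nu>' (\<tau> x) \<bullet> \<nu> x"
  have s: "s = 1 \<or> s = -1" using pm[OF x] P.nu_unit[OF x] by (auto simp: s_def)
  have sx: "\<nu>' (\<tau> x) = s *\<^sub>R \<nu> x" using pm[OF x] P.nu_unit[OF x] by (auto simp: s_def)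
  have cont: "continuous_on W (\<lambda>y. \<nu>' (\<tau> y) \<bullet> \<nu> y)"
  proof (intro continuous_on_inner Cinf_on_continuous[OF P.nu_smooth])
    have "continuous_on W \<tau>"
      using \<tau>(1) by (meson differentiable_imp_continuous_within continuous_at_imp_continuous_on)
    then show "continuous_on W (\<lambda>y. \<nu>' (\<tau> y))"
      using \<tau>(2) by (intro continuous_on_compose2[OF Cinf_on_continuous[OF P'.nu_smooth]]) auto
  qed
  \<comment> \<open>Near \<open>x\<close> the two normals differ by the constant factor
    \<open>s\<close>, and with a constant factor the relation can be differentiated.\<close>
  define V where "V = W \<inter> (\<lambda>y. \<nu>' (\<tau> y) \<bullet> \<nu> y) -` {t. 0 < s * t}"
  have "open {t. 0 < s * t}" by (intro open_Collect_less continuous_intros)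
  then have V: "open V" unfolding V_def by (intro continuous_open_preimage cont P.open_W)
  have xV: "x \<in> V" using x s by (auto simp: V_def s_def[symmetric])
  have nV: "\<nu> y = s *\<^sub>R \<nu>' (\<tau> y)" if "y \<in> V" for y
    using that pm[of y] P.nu_unit[of y] s by (auto simp: V_def)
  have "P'.S a b (\<tau> x) = s * P.S a b x" for a b
  proof -
    \<comment> \<open>Both sides represent the tangential part of e_a, which does not change when
      the normal changes sign.\<close>
    have dY: "d x (P.Y a x) = P'.Y a (\<tau> x)"
    proof (rule P'.J_cancel[OF \<tau>(2)[OF x]])
      show "P'.J (\<tau> x) (d x (P.Y a x)) = P'.J (\<tau> x) (P'.Y a (\<tau> x))"
        unfolding Jd[OF x, symmetric] P.J_Y[OF x] P'.J_Y[OF \<tau>(2)[OF x]] sx using s by auto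
    qed
    have h1: "((\<lambda>y. s * \<nu>' (\<tau> y) $ b) has_derivative
        (\<lambda>v. s * frechet_derivative (\<lambda>y. \<nu>' y $ b) (at (\<tau> x)) (d x v))) (at x)"
      by (intro has_derivative_mult_right has_derivative_compose[OF hd[OF x]]
          Cinf_on_has_derivative[OF P'.nc_smooth \<tau>(2)[OF x]])
    have "((\<lambda>y. \<nu> y $ b) has_derivative
        (\<lambda>v. s * frechet_derivative (\<lambda>y. \<nu>' y $ b) (at (\<tau> x)) (d x v))) (at x)"
      by (rule has_derivative_transform_within_open[OF h1 V xV]) (simp add: nV)
    from P.\<delta>_derivI[OF this, of a] show ?thesis
      unfolding dY P.S_def P'.S_def P'.\<delta>_def using s by auto
  qed
  then show ?thesis using s sx by blast
qed

section \<open>The curvature quantities in terms of tangential derivatives\<close>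

context patch
begin

abbreviation Gi where "Gi x \<equiv> matrix_inv (g x)"

definition N where "N i x = frechet_derivative \<nu> (at x) (axis i 1)"

definition h where "h i j x = frechet_derivative (\<lambda>y. J y (axis i 1)) (at x) (axis j 1) \<bullet> \<nu> x"

lemma J_N: assumes x: "x \<in> W" shows "J x (axis i 1) \<bullet> N j x = - h i j x"
proof -
  have "((\<lambda>y. J y (axis i 1) \<bullet> \<nu> y) has_derivative
      (\<lambda>v. J x (axis i 1) \<bullet> frechet_derivative \<nu> (at x) v
         + frechet_derivative (\<lambda>y. J y (axis i 1)) (at x) v \<bullet> \<nu> x)) (at x)"
    by (intro has_derivative_inner Cinf_on_has_derivative[OF J_smooth x] Cinf_on_has_derivative[OF nu_smooth x])
  moreover have "((\<lambda>y. J y (axis i 1) \<bullet> \<nu> y) has_derivative (\<lambda>v. 0)) (at x)"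
    by (rule has_derivative_transform_within_open[OF has_derivative_const open_W x]) (simp add: J_nu)
  ultimately have "(\<lambda>v. J x (axis i 1) \<bullet> frechet_derivative \<nu> (at x) v
         + frechet_derivative (\<lambda>y. J y (axis i 1)) (at x) v \<bullet> \<nu> x) = (\<lambda>v. 0)"
    by (rule has_derivative_unique)
  from fun_cong[OF this, of "axis j 1"] show ?thesis by (simp add: N_def h_def)
qed

lemma deriv_component:
  fixes f :: "real ^ 'n \<Rightarrow> real ^ 'k"
  assumes "Cinf_on f W" "y \<in> W"
  shows "frechet_derivative f (at y) v $ a = frechet_derivative (\<lambda>y. f y $ a) (at y) v"
  using frechet_derivative_at[OF bounded_linear.has_derivative[OF bounded_linear_vec_nth
        Cinf_on_has_derivative[OF assms]], of a] by (simp add: fun_eq_iff)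

lemma h_sym: assumes x: "x \<in> W" shows "h i j x = h j i x"
proof -
  have "frechet_derivative (\<lambda>y. J y (axis i 1)) (at x) (axis j 1) $ a
      = frechet_derivative (\<lambda>y. frechet_derivative (xc a) (at y) (axis i 1)) (at x) (axis j 1)" for i j a
  proof -
    have "J y (axis i 1) $ a = frechet_derivative (xc a) (at y) (axis i 1)" if "y \<in> W" for y
      unfolding J_def by (rule deriv_component[OF psi_smooth that])
    from frechet_derivative_transform_within_open[OF Cinf_on_differentiable[OF Cinf_on_vec_nth[OF open_W J_smooth] x] open_W x this]
    show ?thesis unfolding deriv_component[OF J_smooth x] by (rule fun_cong)
  qed
  then have "frechet_derivative (\<lambda>y. J y (axis i 1)) (at x) (axis j 1)
      = frechet_derivative (\<lambda>y. J y (axis j 1)) (at x) (axis i 1)"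
    using second_derivative_symmetric[OF open_W xc_smooth x] by (simp add: vec_eq_iff)
  then show ?thesis by (simp add: h_def)
qed

lemma Gi_sym: assumes x: "x \<in> W" shows "Gi x $ i $ j = Gi x $ j $ i"
proof -
  have gs: "transpose (g x) = g x" by (simp add: g_def transpose_def vec_eq_iff inner_commute)
  have "g x ** transpose (Gi x) = mat 1"
    using arg_cong[OF matrix_inv_mult_left[OF det_g[OF x]], of transpose] gs
    by (simp add: matrix_transpose_mul)
  then have "Gi x ** (g x ** transpose (Gi x)) = Gi x" by simp
  then have "transpose (Gi x) = Gi x"
    by (simp add: matrix_mul_assoc matrix_inv_mult_left[OF det_g[OF x]])
  then show ?thesis by (metis transpose_def vec_lambda_beta)
qed

lemma S_expand: assumes x: "x \<in> W"
  shows "S a b x = (\<Sum>i\<in>UNIV. \<Sum>j\<in>UNIV. Gi x $ i $ j * (J x (axis j 1) $ a * N i x $ b))"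
  unfolding S_def \<delta>_expand[OF nc_smooth x]
  by (simp add: deriv_component[OF nu_smooth x, symmetric] N_def Y_def sum_distrib_right mult.assoc)

lemma trace_S: assumes x: "x \<in> W"
  shows "(\<Sum>a\<in>UNIV. S a a x) = - (\<Sum>i\<in>UNIV. \<Sum>j\<in>UNIV. Gi x $ i $ j * h i j x)"
proof -
  have "(\<Sum>a\<in>UNIV. S a a x) = (\<Sum>i\<in>UNIV. \<Sum>j\<in>UNIV. Gi x $ i $ j * (J x (axis j 1) \<bullet> N i x))"
    unfolding S_expand[OF x] inner_vec_def sum_distrib_left inner_real_def
    by (subst sum.swap, rule sum.cong[OF refl], rule sum.swap)
  then show ?thesis by (simp add: J_N[OF x] sum_negf h_sym[OF x])
qed

lemma S_J: assumes x: "x \<in> W"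
  shows "(\<Sum>a\<in>UNIV. S b a x * J x (axis m 1) $ a) = - (\<Sum>k\<in>UNIV. \<Sum>l\<in>UNIV. Gi x $ k $ l * (J x (axis l 1) $ b * h m k x))"
proof -
  have "(\<Sum>a\<in>UNIV. S b a x * J x (axis m 1) $ a)
      = (\<Sum>k\<in>UNIV. \<Sum>l\<in>UNIV. \<Sum>a\<in>UNIV. Gi x $ k $ l * (J x (axis l 1) $ b * (J x (axis m 1) $ a * N k x $ a)))"
    unfolding S_expand[OF x] sum_distrib_right
    by (subst sum.swap, rule sum.cong[OF refl], subst sum.swap) (simp add: mult_ac)
  also have "\<dots> = (\<Sum>k\<in>UNIV. \<Sum>l\<in>UNIV. Gi x $ k $ l * (J x (axis l 1) $ b * (J x (axis m 1) \<bullet> N k x)))"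
    by (simp add: inner_vec_def sum_distrib_left)
  finally show ?thesis by (simp add: J_N[OF x] sum_negf)
qed

text \<open>One factor \<open>S a b\<close> is rewritten as \<open>S b a\<close>. Expanding first
  one and then the other factor leaves contractions of \<open>J\<close> against \<open>N\<close>,
  and \<open>J_N\<close> turns these into \<open>h\<close>.\<close>

lemma c2_expand: assumes x: "x \<in> W"
  shows "c2 x = (\<Sum>i\<in>UNIV. \<Sum>j\<in>UNIV. \<Sum>k\<in>UNIV. \<Sum>l\<in>UNIV.
     Gi x $ i $ k * Gi x $ j $ l * h i j x * h k l x)"
proof -
  have inner_c2: "(\<Sum>b\<in>UNIV. N i x $ b * (\<Sum>a\<in>UNIV. S b a x * J x (axis m 1) $ a))
      = (\<Sum>k\<in>UNIV. \<Sum>l\<in>UNIV. Gi x $ k $ l * (h m k x * h l i x))" for i m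
  proof -
    have "(\<Sum>b\<in>UNIV. N i x $ b * (\<Sum>a\<in>UNIV. S b a x * J x (axis m 1) $ a))
        = - (\<Sum>k\<in>UNIV. \<Sum>l\<in>UNIV. Gi x $ k $ l * (h m k x * (\<Sum>b\<in>UNIV. J x (axis l 1) $ b * N i x $ b)))"
      unfolding S_J[OF x] sum_distrib_left sum_negf[symmetric] mult_minus_right
      by (subst sum.swap, rule sum.cong[OF refl], subst sum.swap) (simp add: mult_ac)
    also have "\<dots> = - (\<Sum>k\<in>UNIV. \<Sum>l\<in>UNIV. Gi x $ k $ l * (h m k x * (J x (axis l 1) \<bullet> N i x)))"
      by (simp add: inner_vec_def)
    finally show ?thesis by (simp add: J_N[OF x] sum_negf)
  qed
  have "c2 x = (\<Sum>a\<in>UNIV. \<Sum>b\<in>UNIV. S a b x * S b a x)"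
    unfolding c2_def using S_sym[OF x] by (intro sum.cong refl) metis
  also have "\<dots> = (\<Sum>a\<in>UNIV. \<Sum>b\<in>UNIV. \<Sum>i\<in>UNIV. \<Sum>m\<in>UNIV.
      Gi x $ i $ m * (N i x $ b * (S b a x * J x (axis m 1) $ a)))"
    by (subst S_expand[OF x]) (simp add: sum_distrib_left sum_distrib_right mult_ac)
  also have "\<dots> = (\<Sum>i\<in>UNIV. \<Sum>m\<in>UNIV. Gi x $ i $ m * (\<Sum>b\<in>UNIV. N i x $ b * (\<Sum>a\<in>UNIV. S b a x * J x (axis m 1) $ a)))"
  proof -
    have "(\<Sum>a\<in>UNIV. \<Sum>b\<in>UNIV. \<Sum>i\<in>UNIV. \<Sum>m\<in>UNIV. X a b i m) = (\<Sum>i\<in>UNIV. \<Sum>m\<in>UNIV. \<Sum>b\<in>UNIV. \<Sum>a\<in>UNIV. X a b i m)"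
      for X :: "'k \<Rightarrow> 'k \<Rightarrow> 'n \<Rightarrow> 'n \<Rightarrow> real"
    proof -
      have "(\<Sum>a\<in>UNIV. \<Sum>b\<in>UNIV. \<Sum>i\<in>UNIV. \<Sum>m\<in>UNIV. X a b i m)
         = (\<Sum>b\<in>UNIV. \<Sum>a\<in>UNIV. \<Sum>i\<in>UNIV. \<Sum>m\<in>UNIV. X a b i m)" by (rule sum.swap)
      also have "\<dots> = (\<Sum>b\<in>UNIV. \<Sum>i\<in>UNIV. \<Sum>a\<in>UNIV. \<Sum>m\<in>UNIV. X a b i m)"
        by (intro sum.cong refl, rule sum.swap)
      also have "\<dots> = (\<Sum>i\<in>UNIV. \<Sum>b\<in>UNIV. \<Sum>a\<in>UNIV. \<Sum>m\<in>UNIV. X a b i m)" by (rule sum.swap)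
      also have "\<dots> = (\<Sum>i\<in>UNIV. \<Sum>b\<in>UNIV. \<Sum>m\<in>UNIV. \<Sum>a\<in>UNIV. X a b i m)"
        by (rule sum.cong[OF refl], rule sum.cong[OF refl], rule sum.swap)
      also have "\<dots> = (\<Sum>i\<in>UNIV. \<Sum>m\<in>UNIV. \<Sum>b\<in>UNIV. \<Sum>a\<in>UNIV. X a b i m)"
        by (rule sum.cong[OF refl], rule sum.swap)
      finally show ?thesis .
    qed
    then show ?thesis by (simp add: sum_distrib_left)
  qed
  also have "\<dots> = (\<Sum>i\<in>UNIV. \<Sum>m\<in>UNIV. Gi x $ i $ m * (\<Sum>k\<in>UNIV. \<Sum>l\<in>UNIV. Gi x $ k $ l * (h m k x * h l i x)))"
    unfolding inner_c2 ..
  also have "\<dots> = (\<Sum>i\<in>UNIV. \<Sum>m\<in>UNIV. \<Sum>k\<in>UNIV. \<Sum>l\<in>UNIV. Gi x $ i $ m * Gi x $ l $ k * h i l x * h m k x)"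
  proof -
    have "Gi x $ i $ m * (Gi x $ k $ l * (h m k x * h l i x)) = Gi x $ i $ m * Gi x $ l $ k * h i l x * h m k x"
      for i m k l by (simp add: Gi_sym[OF x, of k l] h_sym[OF x, of l i])
    then show ?thesis by (simp only: sum_distrib_left)
  qed
  also have "\<dots> = (\<Sum>i\<in>UNIV. \<Sum>l\<in>UNIV. \<Sum>m\<in>UNIV. \<Sum>k\<in>UNIV. Gi x $ i $ m * Gi x $ l $ k * h i l x * h m k x)"
  proof (rule sum.cong[OF refl])
    fix i
    have "(\<Sum>m\<in>UNIV. \<Sum>k\<in>UNIV. \<Sum>l\<in>UNIV. X m k l) = (\<Sum>l\<in>UNIV. \<Sum>m\<in>UNIV. \<Sum>k\<in>UNIV. X m k l)"
      for X :: "'n \<Rightarrow> 'n \<Rightarrow> 'n \<Rightarrow> real"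
    proof -
      have "(\<Sum>m\<in>UNIV. \<Sum>k\<in>UNIV. \<Sum>l\<in>UNIV. X m k l) = (\<Sum>m\<in>UNIV. \<Sum>l\<in>UNIV. \<Sum>k\<in>UNIV. X m k l)"
        by (rule sum.cong[OF refl], rule sum.swap)
      also have "\<dots> = (\<Sum>l\<in>UNIV. \<Sum>m\<in>UNIV. \<Sum>k\<in>UNIV. X m k l)" by (rule sum.swap)
      finally show ?thesis .
    qed
    then show "(\<Sum>m\<in>UNIV. \<Sum>k\<in>UNIV. \<Sum>l\<in>UNIV. Gi x $ i $ m * Gi x $ l $ k * h i l x * h m k x)
       = (\<Sum>l\<in>UNIV. \<Sum>m\<in>UNIV. \<Sum>k\<in>UNIV. Gi x $ i $ m * Gi x $ l $ k * h i l x * h m k x)" .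
  qed
  finally show ?thesis .
qed

lemma pderiv_within_eq:
  assumes "W \<subseteq> S0" "y \<in> W" shows "pderiv_within S0 \<psi> i y = J y (axis i 1)"
proof -
  have "y \<in> interior S0" by (rule subsetD[OF interior_maximal[OF assms(1) open_W] assms(2)])
  then have "at y within S0 = at y" by (rule at_within_interior)
  then show ?thesis by (simp only: pderiv_within_def J_def)
qed

text \<open>The choice in \<open>unit_normal\<close> can only pick one of the two unit normals, so
  the quantities of the statement agree with those of the patch up to a sign, which may jump from
  point to point.\<close>

lemma unit_normal_eq:
  assumes "W \<subseteq> S0" "x \<in> W" shows "\<exists>s::real. (s = 1 \<or> s = -1) \<and> unit_normal S0 \<psi> x = s *\<^sub>R \<nu> x"
proof -
  let ?P = "\<lambda>\<mu>. norm \<mu> = 1 \<and> (\<forall>i. orthogonal (pderiv_within S0 \<psi> i x) \<mu>)"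
  have "?P (\<nu> x)"
    using nu_unit[OF assms(2)] J_nu[OF assms(2)]
    by (simp add: pderiv_within_eq[OF assms] orthogonal_def norm_eq_sqrt_inner)
  then have P: "?P (unit_normal S0 \<psi> x)" unfolding unit_normal_def by (rule someI)
  have "frechet_derivative \<psi> (at x) v \<bullet> unit_normal S0 \<psi> x = 0" for v
    using P unfolding J_def[symmetric]
    by (subst J_expand[OF assms(2)]) (simp add: inner_sum_left pderiv_within_eq[OF assms] orthogonal_def)
  then have "unit_normal S0 \<psi> x = \<nu> x \<or> unit_normal S0 \<psi> x = - \<nu> x"
    using P by (intro patch_unit_normal[OF patch_axioms assms(2)]) auto
  then show ?thesis by (metis scaleR_minus1_left scaleR_one)
qed

lemma second_form_eq:
  assumes "W \<subseteq> S0" "x \<in> W"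
  shows "\<exists>s::real. (s = 1 \<or> s = -1) \<and> (\<forall>i j. second_form S0 \<psi> x $ i $ j = s * h i j x)"
proof -
  obtain s :: real where s: "s = 1 \<or> s = -1" "unit_normal S0 \<psi> x = s *\<^sub>R \<nu> x"
    using unit_normal_eq[OF assms] by blast
  have "x \<in> interior S0" by (rule subsetD[OF interior_maximal[OF assms(1) open_W] assms(2)])
  then have at: "at x within S0 = at x" by (rule at_within_interior)
  have "pderiv_within S0 (pderiv_within S0 \<psi> i) j x = frechet_derivative (\<lambda>y. J y (axis i 1)) (at x) (axis j 1)" for i j
  proof -
    have "J y (axis i 1) = pderiv_within S0 \<psi> i y" if "y \<in> W" for y
      using pderiv_within_eq[OF assms(1) that] by simp
    from frechet_derivative_transform_within_open[OF Cinf_on_differentiable[OF J_smooth assms(2)] open_W assms(2) this]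
    show ?thesis unfolding pderiv_within_def[of S0 "pderiv_within S0 \<psi> i"] at by simp
  qed
  then show ?thesis using s by (intro exI[of _ s]) (auto simp: second_form_def h_def)
qed

lemma metric_matrix_eq: "W \<subseteq> S0 \<Longrightarrow> x \<in> W \<Longrightarrow> metric_matrix S0 \<psi> x = g x"
  by (simp add: metric_matrix_def g_def pderiv_within_eq)

lemma mean_curvature_zero:
  assumes "W \<subseteq> S0" "x \<in> W" "mean_curvature S0 \<psi> x = 0"
  shows "(\<Sum>a\<in>UNIV. S a a x) = 0"
proof -
  obtain s :: real where s: "s = 1 \<or> s = -1" "\<And>i j. second_form S0 \<psi> x $ i $ j = s * h i j x"
    using second_form_eq[OF assms(1,2)] by blast
  have "mean_curvature S0 \<psi> x = s * (\<Sum>i\<in>UNIV. \<Sum>j\<in>UNIV. Gi x $ i $ j * h i j x)"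
    by (simp add: mean_curvature_def Let_def s(2) metric_matrix_eq[OF assms(1,2)] sum_distrib_left mult_ac)
  then show ?thesis unfolding trace_S[OF assms(2)] using assms(3) s(1) by auto
qed

lemma second_form_sqnorm_eq:
  assumes "W \<subseteq> S0" "x \<in> W" shows "second_form_sqnorm S0 \<psi> x = c2 x"
proof -
  obtain s :: real where s: "s = 1 \<or> s = -1" "\<And>i j. second_form S0 \<psi> x $ i $ j = s * h i j x"
    using second_form_eq[OF assms(1,2)] by blast
  then have "s * s = 1" by auto
  have e: "Gi x $ i $ k * Gi x $ j $ l * (s * h i j x) * (s * h k l x)
      = Gi x $ i $ k * Gi x $ j $ l * h i j x * h k l x" for i j k l
  proof -
    have "Gi x $ i $ k * Gi x $ j $ l * (s * h i j x) * (s * h k l x)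
      = (s * s) * (Gi x $ i $ k * Gi x $ j $ l * h i j x * h k l x)" by (simp only: mult_ac)
    then show ?thesis by (simp add: \<open>s * s = 1\<close>)
  qed
  show ?thesis
    unfolding second_form_sqnorm_def Let_def s(2) metric_matrix_eq[OF assms(1,2)] c2_expand[OF assms(2)] e ..
qed

end

section \<open>Interior and boundary of the hypersurface\<close>

definition open_half_space :: "(real ^ 'n::finite) set" where
  "open_half_space = {x. 0 < x $ bd_coord}"

lemma open_open_half_space: "open open_half_space"
  unfolding open_half_space_def by (intro open_Collect_less continuous_intros)

lemma open_half_space_subset: "open_half_space \<subseteq> half_space"
  by (auto simp: open_half_space_def half_space_def)

lemma convex_half_space:
  "convex (half_space :: (real ^ 'n::finite) set)" "convex (open_half_space :: (real ^ 'n) set)"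
proof -
  have "half_space = {x :: real ^ 'n. inner (axis bd_coord 1) x \<ge> 0}"
    by (auto simp: half_space_def inner_axis')
  then show "convex (half_space :: (real ^ 'n) set)" by (metis convex_halfspace_ge)
  have "open_half_space = {x :: real ^ 'n. inner (axis bd_coord 1) x > 0}"
    by (auto simp: open_half_space_def inner_axis')
  then show "convex (open_half_space :: (real ^ 'n) set)" by (metis convex_halfspace_gt)
qed

lemma open_subset_half_space:
  assumes "open V" "V \<subseteq> half_space" shows "V \<subseteq> open_half_space"
proof
  fix y assume y: "y \<in> V"
  then obtain e where e: "e > 0" "ball y e \<subseteq> V" using assms(1) openE by blast
  have "y - (e / 2) *\<^sub>R axis bd_coord 1 \<in> ball y e" using e by (simp add: dist_norm)
  then have "y - (e / 2) *\<^sub>R axis bd_coord 1 \<in> half_space" using e assms(2) by blast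
  then have "0 \<le> (y - (e / 2) *\<^sub>R axis bd_coord 1) $ bd_coord" by (simp add: half_space_def)
  then show "y \<in> open_half_space" using e by (simp add: open_half_space_def)
qed

text \<open>Even at a boundary point, small positive steps along each coordinate vector stay in the
  half-space, and these determine a linear map.\<close>

lemma half_space_derivative_unique:
  fixes f :: "real ^ 'n::finite \<Rightarrow> 'b::real_normed_vector"
  assumes S: "openin (top_of_set half_space) S" and x: "x \<in> S"
    and f: "(f has_derivative f') (at x within S)" "(f has_derivative f'') (at x within S)"
  shows "f' = f''"
proof (rule frechet_derivative_unique_within[OF f])
  fix i :: "real ^ 'n" and e :: real assume i: "i \<in> Basis" and e: "0 < e"
  obtain T where T: "open T" "S = half_space \<inter> T" using S by (auto simp: openin_open)
  then obtain d where d: "d > 0" "ball x d \<subseteq> T" using x openE by blast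
  define t where "t = min e d / 2"
  have t: "0 < t" "t < e" "t < d" using e d by (auto simp: t_def)
  obtain k where k: "i = axis k 1" using i by (auto simp: Basis_vec_def)
  have "x + t *\<^sub>R i \<in> ball x d" using t by (simp add: dist_norm k)
  moreover have "x + t *\<^sub>R i \<in> half_space" using x T t by (auto simp: half_space_def k axis_def)
  ultimately show "\<exists>t. 0 < \<bar>t\<bar> \<and> \<bar>t\<bar> < e \<and> x + t *\<^sub>R i \<in> S"
    using t T d by (intro exI[of _ t]) auto
qed

lemma smooth_onD:
  assumes "smooth_on S f" "x \<in> S"
  obtains W g where "open W" "x \<in> W" "Cinf_on g W" "\<forall>y\<in>W \<inter> S. g y = f y"
proof -
  have "\<exists>W g. open W \<and> x \<in> W \<and> Cinf_on g W \<and> (\<forall>y\<in>W \<inter> S. g y = f y)"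
    using assms by (simp add: smooth_on_def Cinf_on_def)
  then show thesis using that by blast
qed

lemma Cinf_onI_smooth_on:
  fixes f :: "real ^ 'n::finite \<Rightarrow> 'b::euclidean_space"
  assumes f: "smooth_on S f" and V: "open V" "V \<subseteq> S" shows "Cinf_on f V"
proof (rule Cinf_on_local)
  fix x assume x: "x \<in> V"
  obtain W g where W: "open W" "x \<in> W" "Cinf_on g W" "\<forall>y\<in>W \<inter> S. g y = f y"
    using smooth_onD[OF f subsetD[OF V(2) x]] .
  have "Cinf_on f (V \<inter> W)"
    by (rule Cinf_on_cong_imp[OF _ Cinf_on_subset[OF W(3)]]) (use V W in auto)
  then show "\<exists>Va. open Va \<and> x \<in> Va \<and> Cinf_on f Va" using V W x by (intro exI[of _ "V \<inter> W"]) auto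
qed

lemma smooth_on_continuous: "smooth_on S f \<Longrightarrow> continuous_on S f"
  unfolding continuous_on_eq_continuous_within
proof
  fix x assume f: "smooth_on S f" and x: "x \<in> S"
  obtain W g where W: "open W" "x \<in> W" "Cinf_on g W" "\<forall>y\<in>W \<inter> S. g y = f y"
    using smooth_onD[OF f x] .
  have "continuous (at x) g"
    using Cinf_on_continuous[OF W(3)] W(1,2) by (simp add: continuous_on_eq_continuous_at)
  then have g: "continuous (at x within S) g" by (rule continuous_at_imp_continuous_at_within)
  obtain d where d: "d > 0" "ball x d \<subseteq> W" using W openE by blast
  show "continuous (at x within S) f"
    by (rule continuous_transform_within[OF g d(1) x]) (use W d in \<open>auto simp: dist_commute subset_iff\<close>)
qed

lemma patch_cong:
  assumes p: "patch V g \<nu>" and eq: "\<And>y. y \<in> V \<Longrightarrow> g y = h y" shows "patch V h \<nu>"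
proof -
  interpret P: patch V g \<nu> by (rule p)
  have "frechet_derivative h (at x) = frechet_derivative g (at x)" if "x \<in> V" for x
    using frechet_derivative_transform_within_open[OF Cinf_on_differentiable[OF P.psi_smooth that] P.open_W that eq] by simp
  then show ?thesis
    using P.immersion P.nu_normal P.nu_unit P.nu_smooth P.open_W P.card_eq
      Cinf_on_cong_imp[OF P.open_W P.psi_smooth] eq
    by unfold_locales auto
qed

lemma patch_uminus:
  assumes p: "patch V g \<nu>" shows "patch V g (\<lambda>y. - \<nu> y)"
proof -
  interpret P: patch V g \<nu> by (rule p)
  show ?thesis
    using P.immersion P.nu_normal P.nu_unit P.open_W P.card_eq P.psi_smooth Cinf_on_uminus[OF P.open_W P.nu_smooth]
    by unfold_locales auto
qed

locale fb_minimal =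
  fixes n :: nat and r1 r2 :: real and X :: "'p topology" and \<A> :: "('p, 'n::finite) chart set"
    and F :: "'p \<Rightarrow> real ^ 'k::finite"
  assumes dim_n: "CARD('n) = n" and dim_k: "CARD('k) = n + 1" and n_ge: "2 \<le> n"
    and r1_pos: "0 < r1" and r12: "r1 < r2"
    and hyp: "compact_immersed_hypersurface (annulus r1 r2) X \<A> F"
    and fb: "free_boundary r1 r2 \<A> F"
    and min: "minimal \<A> F"
    and A_le: "second_form_sqnorm_le \<A> F ((real n)\<^sup>2 / (4 * r2\<^sup>2))"
begin

lemma hyps:
  "compact_space X" "connected_space X" "topspace X \<noteq> {}" "Hausdorff_space X"
  "smooth_atlas X \<A>" "smooth_immersion \<A> F" "F ` topspace X \<subseteq> annulus r1 r2"
  using hyp by (auto simp: compact_immersed_hypersurface_def manifold_with_boundary_def)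

lemma card_kn: "CARD('k) = CARD('n) + 1" using dim_n dim_k by simp

abbreviation par where "par U \<phi> \<equiv> F \<circ> inv_into U \<phi>"

definition Xi where "Xi = topspace X - manifold_boundary \<A>"

lemma chart:
  assumes "(U, \<phi>) \<in> \<A>"
  shows chart_open: "openin X U" and chart_img: "openin (top_of_set half_space) (\<phi> ` U)"
    and chart_homeo: "homeomorphic_map (subtopology X U) (top_of_set (\<phi> ` U)) \<phi>"
  using hyps(5) assms by (auto simp: smooth_atlas_def chart_on_def)

lemma chart_sub: "(U, \<phi>) \<in> \<A> \<Longrightarrow> U \<subseteq> topspace X"
  using chart_open openin_subset by blast

lemma chart_half: "(U, \<phi>) \<in> \<A> \<Longrightarrow> \<phi> ` U \<subseteq> half_space"
  using chart_img openin_imp_subset by blast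

lemma chart_exists: "p \<in> topspace X \<Longrightarrow> \<exists>U \<phi>. (U, \<phi>) \<in> \<A> \<and> p \<in> U"
  using hyps(5) by (fastforce simp: smooth_atlas_def)

lemma transition_smooth:
  "(U, \<phi>) \<in> \<A> \<Longrightarrow> (V, \<theta>) \<in> \<A> \<Longrightarrow> smooth_on (\<phi> ` (U \<inter> V)) (\<theta> \<circ> inv_into U \<phi>)"
  using hyps(5) by (fastforce simp: smooth_atlas_def)

lemma par_smooth: "(U, \<phi>) \<in> \<A> \<Longrightarrow> smooth_on (\<phi> ` U) (par U \<phi>)"
  using hyps(6) by (fastforce simp: smooth_immersion_def)

lemma par_immersion:
  "(U, \<phi>) \<in> \<A> \<Longrightarrow> p \<in> U \<Longrightarrow> inj (frechet_derivative (par U \<phi>) (at (\<phi> p) within \<phi> ` U))"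
  using hyps(6) by (fastforce simp: smooth_immersion_def in_all_charts_def)

lemma chart_inj: "(U, \<phi>) \<in> \<A> \<Longrightarrow> inj_on \<phi> U"
  using homeomorphic_imp_injective_map[OF chart_homeo] chart_sub by (simp add: Int_absorb1)

lemma inv_chart: "(U, \<phi>) \<in> \<A> \<Longrightarrow> p \<in> U \<Longrightarrow> inv_into U \<phi> (\<phi> p) = p"
  using chart_inj inv_into_f_f by metis

lemma par_chart: "(U, \<phi>) \<in> \<A> \<Longrightarrow> p \<in> U \<Longrightarrow> par U \<phi> (\<phi> p) = F p"
  by (simp add: inv_chart)

lemma chart_cont: assumes "(U, \<phi>) \<in> \<A>" shows "continuous_map (subtopology X U) euclidean \<phi>"
  using homeomorphic_imp_continuous_map[OF chart_homeo[OF assms]] continuous_map_in_subtopology by blast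

lemma chart_preimage:
  assumes c: "(U, \<phi>) \<in> \<A>" and V: "open V" shows "openin X {p \<in> U. \<phi> p \<in> V}"
proof -
  have "openin (subtopology X U) {p \<in> topspace (subtopology X U). \<phi> p \<in> V}"
    using chart_cont[OF c] V by (intro openin_continuous_map_preimage) auto
  moreover have "topspace (subtopology X U) = U" using chart_sub[OF c] by auto
  ultimately show ?thesis using openin_trans_full chart_open[OF c] by metis
qed

lemma chart_image:
  assumes c: "(U, \<phi>) \<in> \<A>" and N: "openin X N" "N \<subseteq> U" shows "openin (top_of_set half_space) (\<phi> ` N)"
proof -
  have "openin (subtopology X U) N" using N by (auto simp: openin_subtopology)
  then have "openin (top_of_set (\<phi> ` U)) (\<phi> ` N)"
    using homeomorphic_imp_open_map[OF chart_homeo[OF c]] by (auto simp: open_map_def)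
  then show ?thesis using openin_trans chart_img[OF c] by blast
qed

lemma chart_image_interior:
  assumes c: "(U, \<phi>) \<in> \<A>" and N: "openin X N" "N \<subseteq> U" shows "open (\<phi> ` N \<inter> open_half_space)"
proof -
  obtain T where T: "open T" "\<phi> ` N = half_space \<inter> T"
    using chart_image[OF assms] by (auto simp: openin_open)
  then have "\<phi> ` N \<inter> open_half_space = T \<inter> open_half_space" using open_half_space_subset by auto
  then show ?thesis using T open_open_half_space by auto
qed

lemma chart_inv_cont:
  assumes c: "(U, \<phi>) \<in> \<A>" shows "continuous_map (top_of_set (\<phi> ` U)) (subtopology X U) (inv_into U \<phi>)"
proof -
  obtain g where g: "homeomorphic_maps (subtopology X U) (top_of_set (\<phi> ` U)) \<phi> g"
    using chart_homeo[OF c] homeomorphic_map_maps by blast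
  have "continuous_map (top_of_set (\<phi> ` U)) (subtopology X U) g"
    using g by (simp add: homeomorphic_maps_def)
  moreover have "g y = inv_into U \<phi> y" if "y \<in> \<phi> ` U" for y
  proof -
    obtain p where p: "p \<in> U" "y = \<phi> p" using \<open>y \<in> \<phi> ` U\<close> by blast
    then have "g (\<phi> p) = p" using g chart_sub[OF c] by (auto simp: homeomorphic_maps_def)
    then show ?thesis using inv_chart[OF c] p by simp
  qed
  ultimately show ?thesis by (rule continuous_map_eq) simp
qed

text \<open>Being a boundary point does not depend on the chart. If \<open>p\<close> is interior in
  one chart, the transition map takes an open set around its image to an open set by invariance of
  domain. An open subset of the half-space avoids its boundary hyperplane, so \<open>p\<close> is
  interior in the other chart as well.\<close>

lemma interior_iff:
  assumes c: "(U, \<phi>) \<in> \<A>" and p: "p \<in> U" shows "p \<in> Xi \<longleftrightarrow> \<phi> p \<in> open_half_space"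
proof
  assume "p \<in> Xi"
  then have "\<phi> p $ bd_coord \<noteq> 0" using c p by (auto simp: Xi_def manifold_boundary_def)
  then show "\<phi> p \<in> open_half_space"
    using chart_half[OF c] p by (force simp: half_space_def open_half_space_def)
next
  assume pos: "\<phi> p \<in> open_half_space"
  have "p \<notin> manifold_boundary \<A>"
  proof
    assume "p \<in> manifold_boundary \<A>"
    then obtain V \<theta> where V: "(V, \<theta>) \<in> \<A>" "p \<in> V" "\<theta> p $ bd_coord = 0"
      by (auto simp: manifold_boundary_def)
    define W where "W = \<phi> ` (U \<inter> V) \<inter> open_half_space"
    define \<tau> where "\<tau> = \<theta> \<circ> inv_into U \<phi>"
    have W: "open W" unfolding W_def
      using chart_open[OF c] chart_open[OF V(1)] by (intro chart_image_interior[OF c]) auto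
    have "continuous_on W \<tau>" unfolding \<tau>_def
      using smooth_on_continuous[OF transition_smooth[OF c V(1)]] by (rule continuous_on_subset) (auto simp: W_def)
    moreover have "inj_on \<tau> W"
    proof (rule inj_onI)
      fix x y assume xy: "x \<in> W" "y \<in> W" "\<tau> x = \<tau> y"
      then obtain q q' where q: "q \<in> U \<inter> V" "x = \<phi> q" "q' \<in> U \<inter> V" "y = \<phi> q'" by (auto simp: W_def)
      then have "\<theta> q = \<theta> q'" using xy(3) inv_chart[OF c] by (simp add: \<tau>_def)
      then show "x = y" using q chart_inj[OF V(1)] by (auto dest: inj_onD)
    qed
    ultimately have "open (\<tau> ` W)" using W by (intro invariance_of_domain)
    moreover have "\<tau> ` W \<subseteq> half_space"
      using chart_half[OF V(1)] inv_chart[OF c] by (auto simp: W_def \<tau>_def)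
    ultimately have "\<tau> ` W \<subseteq> open_half_space" by (rule open_subset_half_space)
    moreover have "\<theta> p \<in> \<tau> ` W"
      using p V(2) pos inv_chart[OF c p] by (force simp: W_def \<tau>_def)
    ultimately show False using V(3) by (auto simp: open_half_space_def)
  qed
  then show "p \<in> Xi" using chart_sub[OF c] p by (auto simp: Xi_def)
qed

lemma Xi_sub: "Xi \<subseteq> topspace X" by (auto simp: Xi_def)

lemma Xi_open: "openin X Xi"
proof (subst openin_subopen, safe)
  fix p assume p: "p \<in> Xi"
  then obtain U \<phi> where c: "(U, \<phi>) \<in> \<A>" "p \<in> U" using chart_exists Xi_sub by blast
  then show "\<exists>T. openin X T \<and> p \<in> T \<and> T \<subseteq> Xi"
    using chart_preimage[OF c(1) open_open_half_space] interior_iff[OF c(1)] p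
    by (intro exI[of _ "{p \<in> U. \<phi> p \<in> open_half_space}"]) auto
qed

lemma F_continuous: "continuous_map X euclidean F"
proof -
  have "openin X {p \<in> topspace X. F p \<in> V}" if V: "open V" for V
  proof (subst openin_subopen, safe)
    fix p assume p: "p \<in> topspace X" "F p \<in> V"
    then obtain U \<phi> where c: "(U, \<phi>) \<in> \<A>" "p \<in> U" using chart_exists by blast
    have "openin (top_of_set (\<phi> ` U)) (\<phi> ` U \<inter> par U \<phi> -` V)"
      using smooth_on_continuous[OF par_smooth[OF c(1)]] V continuous_openin_preimage_gen by blast
    then obtain T where T: "open T" "\<phi> ` U \<inter> par U \<phi> -` V = \<phi> ` U \<inter> T" by (auto simp: openin_open)
    have iff: "\<phi> q \<in> T \<longleftrightarrow> F q \<in> V" if "q \<in> U" for q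
      using T(2) that par_chart[OF c(1) that] by (metis (no_types, lifting) Int_iff image_eqI vimage_eq)
    show "\<exists>T. openin X T \<and> p \<in> T \<and> T \<subseteq> {p \<in> topspace X. F p \<in> V}"
      using chart_preimage[OF c(1) T(1)] iff c p chart_sub[OF c(1)]
      by (intro exI[of _ "{q \<in> U. \<phi> q \<in> T}"]) auto
  qed
  then show ?thesis by (auto simp: continuous_map_def)
qed

definition ipatch where
  "ipatch U \<phi> W \<nu> \<longleftrightarrow> (U, \<phi>) \<in> \<A> \<and> W \<subseteq> \<phi> ` U \<and> W \<subseteq> open_half_space \<and> patch W (par U \<phi>) \<nu>"

lemma interior_image: "(U, \<phi>) \<in> \<A> \<Longrightarrow> open (\<phi> ` U \<inter> open_half_space)"
  using chart_image_interior chart_open by blast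

lemma ipatch_ball:
  assumes c: "(U, \<phi>) \<in> \<A>" and p: "p \<in> U" "p \<in> Xi"
  shows "\<exists>r \<nu>. 0 < r \<and> ipatch U \<phi> (ball (\<phi> p) r) \<nu>"
proof -
  define O' where "O' = \<phi> ` U \<inter> open_half_space"
  have O: "open O'" "O' \<subseteq> \<phi> ` U" "\<phi> p \<in> O'"
    using interior_image[OF c] interior_iff[OF c p(1)] p by (auto simp: O'_def)
  have "\<phi> p \<in> interior (\<phi> ` U)" using interior_maximal[OF O(2,1)] O(3) by blast
  then have "at (\<phi> p) within \<phi> ` U = at (\<phi> p)" by (rule at_within_interior)
  then have "inj (frechet_derivative (par U \<phi>) (at (\<phi> p)))" using par_immersion[OF c p(1)] by simp
  from patch_exists[OF O(1) Cinf_onI_smooth_on[OF par_smooth[OF c] O(1,2)] O(3) this card_kn]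
  obtain r \<nu> where "0 < r" "ball (\<phi> p) r \<subseteq> O'" "patch (ball (\<phi> p) r) (par U \<phi>) \<nu>" by blast
  then show ?thesis using c by (intro exI[of _ r] exI[of _ \<nu>]) (auto simp: ipatch_def O'_def)
qed

lemma ipatch_change:
  assumes i: "ipatch U \<phi> W \<nu>" and i': "ipatch U' \<phi>' W' \<nu>'"
    and q: "q \<in> U" "q \<in> U'" "\<phi> q \<in> W" "\<phi>' q \<in> W'"
  shows "\<exists>s::real. (s = 1 \<or> s = -1) \<and> \<nu>' (\<phi>' q) = s *\<^sub>R \<nu> (\<phi> q) \<and>
    (\<forall>a b. patch.S (par U' \<phi>') \<nu>' a b (\<phi>' q) = s * patch.S (par U \<phi>) \<nu> a b (\<phi> q))"
proof -
  have c: "(U, \<phi>) \<in> \<A>" "(U', \<phi>') \<in> \<A>" and p: "patch W (par U \<phi>) \<nu>" "patch W' (par U' \<phi>') \<nu>'"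
    using i i' by (auto simp: ipatch_def)
  have oW: "open W" "open W'" using p by (auto simp: patch_def)
  define N where "N = {p \<in> U \<inter> U'. \<phi>' p \<in> W'}"
  define \<tau> where "\<tau> = \<phi>' \<circ> inv_into U \<phi>"
  define V where "V = W \<inter> (\<phi> ` N \<inter> open_half_space)"
  have "N = U \<inter> {p \<in> U'. \<phi>' p \<in> W'}" by (auto simp: N_def)
  then have N: "openin X N" using chart_open[OF c(1)] chart_preimage[OF c(2) oW(2)] by auto
  then have V: "open V" unfolding V_def
    by (intro open_Int oW chart_image_interior[OF c(1)]) (auto simp: N_def)
  have VN: "\<exists>r\<in>N. y = \<phi> r" if "y \<in> V" for y using that by (auto simp: V_def)
  have \<tau>V: "\<tau> y \<in> W'" "par U \<phi> y = par U' \<phi>' (\<tau> y)" if "y \<in> V" for y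
  proof -
    obtain r where r: "r \<in> N" "y = \<phi> r" using VN \<open>y \<in> V\<close> by blast
    then show "\<tau> y \<in> W'" "par U \<phi> y = par U' \<phi>' (\<tau> y)"
      using inv_chart[OF c(1)] inv_chart[OF c(2)] by (auto simp: \<tau>_def N_def)
  qed
  have "Cinf_on \<tau> V" unfolding \<tau>_def
    by (rule Cinf_onI_smooth_on[OF transition_smooth[OF c] V]) (auto simp: V_def N_def)
  then have d: "\<tau> differentiable (at y)" if "y \<in> V" for y using that Cinf_on_differentiable by blast
  have pV: "patch V (par U \<phi>) \<nu>" using patch_subset[OF p(1) V] by (auto simp: V_def)
  have "\<phi> q \<in> V" using q i by (auto simp: V_def N_def ipatch_def)
  note ch = patch_change[of V "par U \<phi>" \<nu> W' "par U' \<phi>'" \<nu>' "\<phi> q" \<tau>, OF pV p(2) this d \<tau>V]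
  have \<tau>q: "\<tau> (\<phi> q) = \<phi>' q" using inv_chart[OF c(1) q(1)] by (simp add: \<tau>_def)
  show ?thesis using ch unfolding \<tau>q .
qed

section \<open>Globally defined |A|^2 and squared support function\<close>

definition chart_at where "chart_at p = (SOME c. c \<in> \<A> \<and> p \<in> fst c)"
text \<open>\<open>csq\<close> and \<open>usq\<close> are |A|^2 and the squared support function,
  computed in an arbitrarily chosen chart; \<open>ipatch_values\<close> shows that the choice does
  not matter. Squaring removes the sign of the normal, which need not be globally
  consistent.\<close>

definition csq where
  "csq p = second_form_sqnorm (snd (chart_at p) ` fst (chart_at p)) (par (fst (chart_at p)) (snd (chart_at p))) (snd (chart_at p) p)"
definition usq where
  "usq p = (unit_normal (snd (chart_at p) ` fst (chart_at p)) (par (fst (chart_at p)) (snd (chart_at p))) (snd (chart_at p) p) \<bullet> F p)\<^sup>2"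

lemma ipatch_values:
  assumes i: "ipatch U \<phi> W \<nu>" and q: "q \<in> U" "\<phi> q \<in> W"
  shows "csq q = patch.c2 (par U \<phi>) \<nu> (\<phi> q)" "usq q = (\<nu> (\<phi> q) \<bullet> F q)\<^sup>2" and ipatch_interior: "q \<in> Xi"
proof -
  have c: "(U, \<phi>) \<in> \<A>" and p: "patch W (par U \<phi>) \<nu>" using i by (auto simp: ipatch_def)
  show qX: "q \<in> Xi" using interior_iff[OF c q(1)] i q by (auto simp: ipatch_def)
  define V \<theta> where V: "V = fst (chart_at q)" "\<theta> = snd (chart_at q)"
  have "\<exists>c. c \<in> \<A> \<and> q \<in> fst c" using c q by auto
  then have "chart_at q \<in> \<A> \<and> q \<in> fst (chart_at q)" unfolding chart_at_def by (rule someI_ex)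
  then have c': "(V, \<theta>) \<in> \<A>" "q \<in> V" by (auto simp: V)
  obtain r \<nu>' where r: "0 < r" "ipatch V \<theta> (ball (\<theta> q) r) \<nu>'"
    using ipatch_ball[OF c' qX] by blast
  interpret P': patch "ball (\<theta> q) r" "par V \<theta>" \<nu>' using r(2) by (simp add: ipatch_def)
  interpret P: patch W "par U \<phi>" \<nu> by (rule p)
  have sub: "ball (\<theta> q) r \<subseteq> \<theta> ` V" "\<theta> q \<in> ball (\<theta> q) r" using r by (auto simp: ipatch_def)
  obtain s :: real where s: "s = 1 \<or> s = -1" "\<nu>' (\<theta> q) = s *\<^sub>R \<nu> (\<phi> q)"
    "\<And>a b. P'.S a b (\<theta> q) = s * P.S a b (\<phi> q)"
    using ipatch_change[OF i r(2) q(1) c'(2) q(2) sub(2)] by blast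
  have "csq q = P'.c2 (\<theta> q)"
    using P'.second_form_sqnorm_eq[OF sub] by (simp add: csq_def V)
  also have "\<dots> = P.c2 (\<phi> q)"
    using s(1) unfolding P'.c2_def P.c2_def s(3) by auto
  finally show "csq q = P.c2 (\<phi> q)" .
  obtain t :: real where t: "t = 1 \<or> t = -1" "unit_normal (\<theta> ` V) (par V \<theta>) (\<theta> q) = t *\<^sub>R \<nu>' (\<theta> q)"
    using P'.unit_normal_eq[OF sub] by blast
  have "usq q = (t * s * (\<nu> (\<phi> q) \<bullet> F q))\<^sup>2"
    unfolding usq_def V[symmetric] t(2) s(2) by simp
  also have "\<dots> = (\<nu> (\<phi> q) \<bullet> F q)\<^sup>2" using s(1) t(1) by auto
  finally show "usq q = (\<nu> (\<phi> q) \<bullet> F q)\<^sup>2" .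
qed

lemma ipatch_minimal:
  assumes i: "ipatch U \<phi> W \<nu>" shows "minimal_patch W (par U \<phi>) \<nu>"
proof -
  have c: "(U, \<phi>) \<in> \<A>" and p: "patch W (par U \<phi>) \<nu>" and W: "W \<subseteq> \<phi> ` U" using i by (auto simp: ipatch_def)
  interpret P: patch W "par U \<phi>" \<nu> by (rule p)
  show ?thesis
  proof
    fix x assume x: "x \<in> W"
    then obtain q where "q \<in> U" "x = \<phi> q" using W by auto
    then have "mean_curvature (\<phi> ` U) (par U \<phi>) x = 0"
      using min c by (fastforce simp: minimal_def in_all_charts_def)
    then show "(\<Sum>a\<in>UNIV. P.S a a x) = 0" by (rule P.mean_curvature_zero[OF W x])
  qed
qed

lemma csq_le: assumes "p \<in> Xi" shows "csq p \<le> (real n)\<^sup>2 / (4 * r2\<^sup>2)"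
proof -
  obtain U \<phi> where c: "(U, \<phi>) \<in> \<A>" "p \<in> U" using chart_exists Xi_sub assms by blast
  then have "\<exists>c. c \<in> \<A> \<and> p \<in> fst c" by auto
  then have "chart_at p \<in> \<A> \<and> p \<in> fst (chart_at p)" unfolding chart_at_def by (rule someI_ex)
  then show ?thesis
    using A_le unfolding second_form_sqnorm_le_def in_all_charts_def csq_def
    by (cases "chart_at p") fastforce
qed

lemma F_annulus: "p \<in> topspace X \<Longrightarrow> r1 \<le> norm (F p) \<and> norm (F p) \<le> r2"
  using hyps(7) by (force simp: annulus_def)

lemma F_inner: "p \<in> topspace X \<Longrightarrow> r1\<^sup>2 \<le> F p \<bullet> F p \<and> F p \<bullet> F p \<le> r2\<^sup>2"
  using F_annulus[of p] r1_pos by (simp add: power2_norm_eq_inner[symmetric] power_mono)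

lemma boundary_radius: "p \<in> topspace X \<Longrightarrow> p \<notin> Xi \<Longrightarrow> norm (F p) = r1 \<or> norm (F p) = r2"
proof -
  assume p: "p \<in> topspace X" "p \<notin> Xi"
  then have "F p \<in> frontier (annulus r1 r2)" using fb by (auto simp: free_boundary_def Xi_def)
  moreover have "{x :: real ^ 'k. r1 < norm x \<and> norm x < r2} \<subseteq> interior (annulus r1 r2)"
    by (rule interior_maximal) (auto simp: annulus_def intro!: open_Collect_conj open_Collect_less continuous_intros)
  ultimately have "\<not> (r1 < norm (F p) \<and> norm (F p) < r2)" by (auto simp: frontier_def)
  then show ?thesis using F_annulus[OF p(1)] by linarith
qed

text \<open>A patch needs an open domain. At a boundary point the local extension \<open>g\<close>
  supplies one, and uniqueness of derivatives within the half-space shows that on the chart image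
  its derivative is that of the parametrization.\<close>

lemma chart_extension:
  assumes c: "(U, \<phi>) \<in> \<A>" and p: "p \<in> U"
  shows "\<exists>W g. open W \<and> \<phi> p \<in> W \<and> Cinf_on g W \<and> (\<forall>y\<in>W \<inter> \<phi> ` U. g y = par U \<phi> y \<and>
     (par U \<phi> has_derivative frechet_derivative g (at y)) (at y within \<phi> ` U) \<and>
     frechet_derivative (par U \<phi>) (at y within \<phi> ` U) = frechet_derivative g (at y))"
proof -
  obtain W g where W: "open W" "\<phi> p \<in> W" "Cinf_on g W" "\<forall>y\<in>W \<inter> \<phi> ` U. g y = par U \<phi> y"
    using smooth_onD[OF par_smooth[OF c] imageI[OF p]] .
  have h: "(par U \<phi> has_derivative frechet_derivative g (at y)) (at y within \<phi> ` U)" if y: "y \<in> W \<inter> \<phi> ` U" for y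
  proof -
    have g: "(g has_derivative frechet_derivative g (at y)) (at y within \<phi> ` U)"
      using Cinf_on_has_derivative[OF W(3)] y has_derivative_at_withinI by blast
    obtain d where d: "d > 0" "ball y d \<subseteq> W" using W y openE by blast
    show ?thesis
      by (rule has_derivative_transform_within[OF g d(1)]) (use y d W in \<open>auto simp: dist_commute subset_iff\<close>)
  qed
  moreover have "frechet_derivative (par U \<phi>) (at y within \<phi> ` U) = frechet_derivative g (at y)" if y: "y \<in> W \<inter> \<phi> ` U" for y
  proof -
    have "(par U \<phi> has_derivative frechet_derivative (par U \<phi>) (at y within \<phi> ` U)) (at y within \<phi> ` U)"
      using h[OF y] frechet_derivative_works differentiable_def by blast
    then show ?thesis
      using half_space_derivative_unique[OF chart_img[OF c]] h[OF y] y by blast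
  qed
  ultimately show ?thesis using W by blast
qed

text \<open>The pointwise chosen normal need not be continuous, so \<open>usq\<close> is compared
  with the continuous function (\<nu> \<bullet> g)^2 of a patch extended across the boundary. The
  two agree at interior points, and the free boundary condition makes the latter vanish at
  \<open>p\<close>.\<close>

lemma usq_boundary:
  assumes p: "p \<in> topspace X" "p \<notin> Xi" and \<epsilon>: "0 < \<epsilon>"
  shows "\<exists>N. openin X N \<and> p \<in> N \<and> (\<forall>q\<in>N \<inter> Xi. usq q < \<epsilon>)"
proof -
  have "p \<in> manifold_boundary \<A>" using p by (simp add: Xi_def)
  then obtain U \<phi> where c: "(U, \<phi>) \<in> \<A>" "p \<in> U" by (auto simp: manifold_boundary_def)
  define S where "S = \<phi> ` U"
  define x where "x = \<phi> p"
  have xS: "x \<in> S" using c by (simp add: x_def S_def)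
  obtain W g where W: "open W" "x \<in> W" "Cinf_on g W" "\<And>y. y \<in> W \<inter> S \<Longrightarrow> g y = par U \<phi> y"
    "\<And>y. y \<in> W \<inter> S \<Longrightarrow> frechet_derivative (par U \<phi>) (at y within S) = frechet_derivative g (at y)"
    using chart_extension[OF c] unfolding x_def S_def by blast
  have Dx: "frechet_derivative (par U \<phi>) (at x within S) = frechet_derivative g (at x)" using W xS by blast
  have inj: "inj (frechet_derivative g (at x))"
    using par_immersion[OF c] unfolding S_def[symmetric] x_def[symmetric] Dx .
  obtain r \<nu> where r: "0 < r" "ball x r \<subseteq> W" "patch (ball x r) g \<nu>"
    using patch_exists[OF W(1,3,2) inj card_kn] by blast
  interpret P: patch "ball x r" g \<nu> by (rule r(3))
  have xr: "x \<in> ball x r" using r by simp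
  let ?P = "\<lambda>\<mu>. norm \<mu> = 1 \<and> (\<forall>i. orthogonal (pderiv_within S (par U \<phi>) i x) \<mu>)"
  have "?P (\<nu> x)"
    using P.nu_unit[OF xr] P.nu_normal[OF xr] by (simp add: pderiv_within_def Dx orthogonal_def norm_eq_sqrt_inner)
  then have un: "?P (unit_normal S (par U \<phi>) x)" unfolding unit_normal_def by (rule someI)
  have "frechet_derivative g (at x) v \<bullet> unit_normal S (par U \<phi>) x = 0" for v
    using un unfolding P.J_def[symmetric]
    by (subst P.J_expand[OF xr]) (simp add: inner_sum_left pderiv_within_def Dx P.J_def orthogonal_def)
  then have "unit_normal S (par U \<phi>) x = \<nu> x \<or> unit_normal S (par U \<phi>) x = - \<nu> x"
    using un by (intro patch_unit_normal[OF r(3) xr]) auto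
  moreover have "orthogonal (unit_normal S (par U \<phi>) x) (par U \<phi> x)"
    using fb c \<open>p \<in> manifold_boundary \<A>\<close> unfolding free_boundary_def in_all_charts_def S_def x_def by fastforce
  ultimately have "\<nu> x \<bullet> g x = 0" using W(4)[of x] W(2) xS by (auto simp: orthogonal_def)
  moreover have "continuous_on (ball x r) (\<lambda>y. (\<nu> y \<bullet> g y)\<^sup>2)"
    by (intro continuous_intros Cinf_on_continuous P.nu_smooth P.psi_smooth)
  then have "open (ball x r \<inter> (\<lambda>y. (\<nu> y \<bullet> g y)\<^sup>2) -` {..<\<epsilon>})"
    by (intro continuous_open_preimage) auto
  moreover define V where "V = ball x r \<inter> (\<lambda>y. (\<nu> y \<bullet> g y)\<^sup>2) -` {..<\<epsilon>}"
  ultimately have V: "open V" "x \<in> V" using xr \<epsilon> by auto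
  have "usq q < \<epsilon>" if q: "q \<in> U" "\<phi> q \<in> V" "q \<in> Xi" for q
  proof -
    define V' where "V' = V \<inter> (S \<inter> open_half_space)"
    have V': "open V'" unfolding V'_def S_def by (intro open_Int V interior_image[OF c(1)])
    have "patch V' g \<nu>" using patch_subset[OF r(3) V'] by (auto simp: V'_def V_def)
    then have "patch V' (par U \<phi>) \<nu>"
      by (rule patch_cong) (use W(4) r(2) in \<open>auto simp: V'_def V_def subset_iff\<close>)
    then have i: "ipatch U \<phi> V' \<nu>" using c by (auto simp: ipatch_def V'_def S_def)
    have "\<phi> q \<in> V'" using q interior_iff[OF c(1) q(1)] by (auto simp: V'_def S_def)
    then have "usq q = (\<nu> (\<phi> q) \<bullet> F q)\<^sup>2" using ipatch_values(2)[OF i q(1)] by blast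
    moreover have "g (\<phi> q) = F q"
      using W(4)[of "\<phi> q"] par_chart[OF c(1) q(1)] q r(2) by (auto simp: V_def S_def)
    ultimately show ?thesis using q(2) by (simp add: V_def)
  qed
  then show ?thesis
    using chart_preimage[OF c(1) V(1)] c(2) V(2)
    by (intro exI[of _ "{q \<in> U. \<phi> q \<in> V}"]) (auto simp: x_def)
qed

end

context fb_minimal
begin

subsection \<open>Topology of the interior\<close>

text \<open>Balls intersected with the open half-space are convex, so every point has arbitrarily
  small neighbourhoods whose interior part is connected and nonempty. Density and connectedness of
  \<open>Xi\<close> rest on this.\<close>

lemma half_ball:
  assumes c: "(U, \<phi>) \<in> \<A>" and p: "p \<in> U" and N: "openin X N" "p \<in> N"
  shows "\<exists>M. openin X M \<and> p \<in> M \<and> M \<subseteq> N \<and> connectedin X (M \<inter> Xi) \<and> M \<inter> Xi \<noteq> {}"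
proof -
  have "openin (top_of_set half_space) (\<phi> ` (N \<inter> U))"
    using N chart_open[OF c] by (intro chart_image[OF c]) auto
  then obtain T where T: "open T" "\<phi> ` (N \<inter> U) = half_space \<inter> T" by (auto simp: openin_open)
  have "\<phi> p \<in> T" using T p N by auto
  then obtain r where r: "r > 0" "ball (\<phi> p) r \<subseteq> T" using T openE by blast
  define M where "M = {q \<in> U. \<phi> q \<in> ball (\<phi> p) r}"
  define H where "H = ball (\<phi> p) r \<inter> open_half_space"
  have HU: "H \<subseteq> \<phi> ` (N \<inter> U)" using T r open_half_space_subset by (auto simp: H_def)
  have MX: "M \<inter> Xi = inv_into U \<phi> ` H"
  proof
    show "M \<inter> Xi \<subseteq> inv_into U \<phi> ` H"
    proof
      fix q assume q: "q \<in> M \<inter> Xi"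
      then have "\<phi> q \<in> H" using interior_iff[OF c] by (auto simp: M_def H_def)
      moreover have "inv_into U \<phi> (\<phi> q) = q" using inv_chart[OF c] q by (auto simp: M_def)
      ultimately show "q \<in> inv_into U \<phi> ` H" by (metis image_eqI)
    qed
    show "inv_into U \<phi> ` H \<subseteq> M \<inter> Xi"
    proof
      fix q assume "q \<in> inv_into U \<phi> ` H"
      then obtain y where y: "y \<in> H" "q = inv_into U \<phi> y" by blast
      then obtain q' where q': "q' \<in> U" "y = \<phi> q'" using HU by blast
      then have "q = q'" using y inv_chart[OF c] by simp
      then show "q \<in> M \<inter> Xi" using q' y interior_iff[OF c] by (auto simp: M_def H_def)
    qed
  qed
  have "connected H" unfolding H_def
    by (intro convex_connected convex_Int convex_ball convex_half_space)
  then have "connectedin (top_of_set (\<phi> ` U)) H" using HU by (auto simp: connectedin_subtopology)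
  then have "connectedin (subtopology X U) (inv_into U \<phi> ` H)"
    using connectedin_continuous_map_image[OF chart_inv_cont[OF c]] by blast
  then have conn: "connectedin X (M \<inter> Xi)" by (simp add: connectedin_subtopology MX)
  have "H \<noteq> {}"
  proof -
    define y where "y = \<phi> p + (r / 2) *\<^sub>R axis bd_coord 1"
    have "0 \<le> \<phi> p $ bd_coord" using chart_half[OF c] p by (auto simp: half_space_def)
    then have "y \<in> H" using r by (auto simp: H_def y_def open_half_space_def dist_norm)
    then show ?thesis by blast
  qed
  then have ne: "M \<inter> Xi \<noteq> {}" by (simp add: MX)
  have "M \<subseteq> N"
  proof
    fix q assume q: "q \<in> M"
    then have "\<phi> q \<in> \<phi> ` (N \<inter> U)" using T r chart_half[OF c] by (auto simp: M_def)
    then show "q \<in> N" using q chart_inj[OF c] by (auto simp: M_def dest: inj_onD)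
  qed
  then show ?thesis
    using chart_preimage[OF c open_ball] conn ne p r by (intro exI[of _ M]) (auto simp: M_def)
qed

lemma Xi_dense: assumes "p \<in> topspace X" "openin X N" "p \<in> N" shows "N \<inter> Xi \<noteq> {}"
proof -
  obtain U \<phi> where c: "(U, \<phi>) \<in> \<A>" "p \<in> U" using chart_exists assms(1) by blast
  from half_ball[OF c assms(2,3)] show ?thesis by blast
qed

lemma Xi_nonempty: "Xi \<noteq> {}"
  using Xi_dense[of _ "topspace X"] hyps(3) by blast

text \<open>The closures of two separating pieces would cover the connected space and hence meet at
  some point; the interior part of a half-ball around that point would then be disconnected.\<close>

lemma Xi_connected:
  assumes V: "openin X V1" "openin X V2" "Xi \<subseteq> V1 \<union> V2" "V1 \<inter> V2 \<inter> Xi = {}" "V1 \<inter> Xi \<noteq> {}"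
  shows "Xi \<subseteq> V1"
proof (rule ccontr)
  assume "\<not> ?thesis"
  then have ne2: "V2 \<inter> Xi \<noteq> {}" using V(3) by blast
  define C1 where "C1 = X closure_of (V1 \<inter> Xi)"
  define C2 where "C2 = X closure_of (V2 \<inter> Xi)"
  have cl: "closedin X C1" "closedin X C2" by (auto simp: C1_def C2_def)
  have "topspace X \<subseteq> C1 \<union> C2"
  proof
    fix p assume p: "p \<in> topspace X"
    have "p \<in> X closure_of Xi"
      using Xi_dense[OF p] p by (auto simp: in_closure_of)
    moreover have "Xi = (V1 \<inter> Xi) \<union> (V2 \<inter> Xi)" using V(3) by blast
    ultimately show "p \<in> C1 \<union> C2" unfolding C1_def C2_def using closure_of_Un by (metis)
  qed
  moreover have "C1 \<inter> C2 = {}"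
  proof (rule ccontr)
    assume "C1 \<inter> C2 \<noteq> {}"
    then obtain p where p: "p \<in> C1" "p \<in> C2" by blast
    have pX: "p \<in> topspace X" using p(1) cl(1) closedin_subset by blast
    obtain U \<phi> where c: "(U, \<phi>) \<in> \<A>" "p \<in> U" using chart_exists pX by blast
    obtain M where M: "openin X M" "p \<in> M" "connectedin X (M \<inter> Xi)"
      using half_ball[OF c chart_open[OF c(1)] c(2)] by blast
    have "M \<inter> (V1 \<inter> Xi) \<noteq> {}" "M \<inter> (V2 \<inter> Xi) \<noteq> {}"
      using p M by (auto simp: C1_def C2_def in_closure_of)
    moreover have "openin X (V1 \<inter> Xi)" "openin X (V2 \<inter> Xi)" using V Xi_open by auto
    ultimately have "\<not> connectedin X (M \<inter> Xi)"
      unfolding connectedin using V(3,4) by blast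
    then show False using M(3) by blast
  qed
  moreover have "V1 \<inter> Xi \<subseteq> C1" "V2 \<inter> Xi \<subseteq> C2"
    unfolding C1_def C2_def by (rule closure_of_subset, use Xi_sub in blast)+
  then have "C1 \<noteq> {}" "C2 \<noteq> {}" using V(5) ne2 by blast+
  ultimately show False
    using hyps(2) cl unfolding connected_space_closedin by blast
qed

text \<open>The normal in the flat case and the matrix T in the rigid case are locally constant but
  defined only up to sign, and a consistent global sign need not exist. The set of points that carry
  \<open>t\<close> or \<open>- t\<close> is open and so is its complement in \<open>Xi\<close>, so
  it is all of \<open>Xi\<close>.\<close>

lemma sign_constant:
  fixes Q :: "'p \<Rightarrow> 'v::real_vector \<Rightarrow> bool"
  assumes ex: "\<And>p. p \<in> Xi \<Longrightarrow> \<exists>t N. openin X N \<and> p \<in> N \<and> (\<forall>q\<in>N \<inter> Xi. Q q t)"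
    and uniq: "\<And>p t t'. p \<in> Xi \<Longrightarrow> Q p t \<Longrightarrow> Q p t' \<Longrightarrow> t' = t \<or> t' = - t"
  shows "\<exists>t. (\<exists>p\<in>Xi. Q p t) \<and> (\<forall>p\<in>Xi. Q p t \<or> Q p (- t))"
proof -
  obtain p0 where p0: "p0 \<in> Xi" using Xi_nonempty by blast
  obtain t N0 where t: "p0 \<in> N0" "\<forall>q\<in>N0 \<inter> Xi. Q q t" using ex[OF p0] by blast
  define Z where "Z = {p \<in> Xi. Q p t \<or> Q p (- t)}"
  have V1: "openin X Z"
  proof (subst openin_subopen, intro ballI)
    fix p assume p: "p \<in> Z"
    then obtain t' N where N: "openin X N" "p \<in> N" "\<forall>q\<in>N \<inter> Xi. Q q t'" using ex unfolding Z_def by blast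
    then have "t' = t \<or> t' = - t"
      using p uniq[of p] unfolding Z_def by (metis (no_types, lifting) IntI mem_Collect_eq minus_minus)
    then have "N \<inter> Xi \<subseteq> Z" using N by (auto simp: Z_def)
    then show "\<exists>T. openin X T \<and> p \<in> T \<and> T \<subseteq> Z"
      using N p Xi_open by (intro exI[of _ "N \<inter> Xi"]) (auto simp: Z_def)
  qed
  have V2: "openin X (Xi - Z)"
  proof (subst openin_subopen, intro ballI)
    fix p assume p: "p \<in> Xi - Z"
    then obtain t' N where N: "openin X N" "p \<in> N" "\<forall>q\<in>N \<inter> Xi. Q q t'" using ex by blast
    have "q \<notin> Z" if q: "q \<in> N \<inter> Xi" for q
    proof
      assume "q \<in> Z"
      then have "t' = t \<or> t' = - t"
        using q N(3) uniq[of q] unfolding Z_def by (metis (no_types, lifting) mem_Collect_eq minus_minus)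
      then show False using N p by (auto simp: Z_def)
    qed
    then show "\<exists>T. openin X T \<and> p \<in> T \<and> T \<subseteq> Xi - Z"
      using N p Xi_open by (intro exI[of _ "N \<inter> Xi"]) auto
  qed
  have "Xi \<subseteq> Z"
    using p0 t by (intro Xi_connected[OF V1 V2]) (auto simp: Z_def)
  then show ?thesis using p0 t by (intro exI[of _ t]) (auto simp: Z_def)
qed

subsection \<open>Maxima over the interior\<close>

lemma Xi_continuous:
  fixes f :: "'p \<Rightarrow> real"
  assumes "\<And>p. p \<in> Xi \<Longrightarrow> \<exists>U \<phi> W g. (U, \<phi>) \<in> \<A> \<and> p \<in> U \<and> \<phi> p \<in> W \<and> open W \<and> continuous_on W g \<and>
     (\<forall>q\<in>U. \<phi> q \<in> W \<longrightarrow> f q = g (\<phi> q))"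
  shows "continuous_map (subtopology X Xi) euclideanreal f"
proof -
  have "openin X {p \<in> Xi. f p \<in> V}" if V: "open V" for V
  proof (subst openin_subopen, safe)
    fix p assume p: "p \<in> Xi" "f p \<in> V"
    obtain U \<phi> W g where c: "(U, \<phi>) \<in> \<A>" "p \<in> U" and W: "\<phi> p \<in> W" "open W" "continuous_on W g"
      "\<forall>q\<in>U. \<phi> q \<in> W \<longrightarrow> f q = g (\<phi> q)" using assms[OF p(1)] by blast
    define W' where "W' = W \<inter> g -` V"
    have "open W'" unfolding W'_def by (intro continuous_open_preimage W V)
    then have "openin X ({q \<in> U. \<phi> q \<in> W'} \<inter> Xi)" using chart_preimage[OF c(1)] Xi_open by blast
    then show "\<exists>T. openin X T \<and> p \<in> T \<and> T \<subseteq> {p \<in> Xi. f p \<in> V}"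
      using p c W by (intro exI[of _ "{q \<in> U. \<phi> q \<in> W'} \<inter> Xi"]) (auto simp: W'_def)
  qed
  moreover have "topspace (subtopology X Xi) = Xi" using Xi_sub by auto
  moreover have "openin (subtopology X Xi) T" if "openin X T" "T \<subseteq> Xi" for T
    using that by (auto simp: openin_subtopology)
  ultimately show ?thesis unfolding continuous_map_def by auto
qed

lemma ipatch_continuous:
  fixes f :: "'p \<Rightarrow> real"
  assumes "\<And>U \<phi> W \<nu>. ipatch U \<phi> W \<nu> \<Longrightarrow> \<exists>g. continuous_on W g \<and> (\<forall>q\<in>U. \<phi> q \<in> W \<longrightarrow> f q = g (\<phi> q))"
  shows "continuous_map (subtopology X Xi) euclideanreal f"
proof (rule Xi_continuous)
  fix p assume p: "p \<in> Xi"
  obtain U \<phi> where c: "(U, \<phi>) \<in> \<A>" "p \<in> U" using chart_exists p Xi_sub by blast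
  obtain r \<nu> where r: "0 < r" "ipatch U \<phi> (ball (\<phi> p) r) \<nu>" using ipatch_ball[OF c p] by blast
  obtain g where "continuous_on (ball (\<phi> p) r) g" "\<forall>q\<in>U. \<phi> q \<in> ball (\<phi> p) r \<longrightarrow> f q = g (\<phi> q)"
    using assms[OF r(2)] by blast
  then show "\<exists>U \<phi> W g. (U, \<phi>) \<in> \<A> \<and> p \<in> U \<and> \<phi> p \<in> W \<and> open W \<and> continuous_on W g \<and>
     (\<forall>q\<in>U. \<phi> q \<in> W \<longrightarrow> f q = g (\<phi> q))"
    using c r(1) by (intro exI[of _ U] exI[of _ \<phi>] exI[of _ "ball (\<phi> p) r"] exI[of _ g]) auto
qed

text \<open>\<open>Xi\<close> is not compact when there is a boundary. The hypothesis keeps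
  \<open>G\<close> below a value that it attains on a neighbourhood of the boundary, so the maximum
  is taken over the compact rest.\<close>

lemma max_attained:
  fixes G :: "'p \<Rightarrow> real"
  assumes G: "continuous_map (subtopology X Xi) euclideanreal G" and q0: "q0 \<in> Xi"
    and bd: "\<And>p. p \<in> topspace X \<Longrightarrow> p \<notin> Xi \<Longrightarrow> \<exists>N. openin X N \<and> p \<in> N \<and> (\<forall>q\<in>N \<inter> Xi. G q < G q0)"
  shows "\<exists>p\<in>Xi. \<forall>q\<in>Xi. G q \<le> G p"
proof -
  define \<N> where "\<N> = \<Union>{N. openin X N \<and> (\<forall>q\<in>N \<inter> Xi. G q < G q0)}"
  define K where "K = topspace X - \<N>"
  have "openin X \<N>" unfolding \<N>_def by (rule openin_Union) blast
  then have "closedin X K" unfolding K_def by blast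
  then have cK: "compactin X K" using closedin_compact_space hyps(1) by blast
  have KX: "K \<subseteq> Xi" using bd by (force simp: K_def \<N>_def)
  have "compactin (subtopology X Xi) K" using cK KX by (simp add: compactin_subtopology)
  then have "compact (G ` K)" using image_compactin[OF _ G] by (simp)
  moreover have q0K: "q0 \<in> K" using q0 Xi_sub by (auto simp: K_def \<N>_def)
  ultimately obtain p where p: "p \<in> K" "\<forall>q\<in>K. G q \<le> G p"
    using compact_attains_sup[of "G ` K"] by blast
  have "G q \<le> G p" if q: "q \<in> Xi" for q
  proof (cases "q \<in> K")
    case False
    then have "G q < G q0" using q Xi_sub by (auto simp: K_def \<N>_def)
    also have "\<dots> \<le> G p" using p q0K by blast
    finally show ?thesis by simp
  qed (use p in blast)
  then show ?thesis using p KX by blast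
qed

lemma ipatch_point:
  assumes "ipatch U \<phi> W \<nu>" "y \<in> W"
  obtains q where "q \<in> U" "q \<in> Xi" "\<phi> q = y" "F q = par U \<phi> y"
proof -
  obtain q where "q \<in> U" "y = \<phi> q" using assms by (auto simp: ipatch_def)
  moreover have "(U, \<phi>) \<in> \<A>" using assms by (simp add: ipatch_def)
  ultimately show thesis using that ipatch_interior[OF assms(1)] assms(2) par_chart by metis
qed

lemma ipatch_at:
  assumes p: "p \<in> Xi"
  obtains U \<phi> r \<nu> where "p \<in> U" "0 < r" "ipatch U \<phi> (ball (\<phi> p) r) \<nu>" "F p = par U \<phi> (\<phi> p)"
proof -
  obtain U \<phi> where c: "(U, \<phi>) \<in> \<A>" "p \<in> U" using chart_exists p Xi_sub by blast
  show thesis using ipatch_ball[OF c p] that c par_chart[OF c] by metis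
qed

section \<open>The hypersurface is a cone\<close>

text \<open>\<open>G\<close> is the square of the quotient \<open>barta\<close>, hence globally
  defined without a choice of normal. Its exponential factor is bounded and \<open>usq\<close> tends
  to 0 at the boundary, so a positive value would lead to an interior maximum, which
  \<open>no_positive_max\<close> excludes.\<close>

lemma usq_zero: assumes "p0 \<in> Xi" shows "usq p0 = 0"
proof (rule ccontr)
  assume nz: "usq p0 \<noteq> 0"
  define c where "c = real n / (2 * r2\<^sup>2)"
  define G where "G q = usq q * exp (c * (F q \<bullet> F q))" for q
  have usq0: "0 \<le> usq q" for q by (simp add: usq_def)
  have c: "0 \<le> c" by (simp add: c_def)
  have G0: "0 < G p0" using nz usq0[of p0] by (simp add: G_def)
  have "\<exists>p\<in>Xi. \<forall>q\<in>Xi. G q \<le> G p"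
  proof (rule max_attained[OF _ assms])
    show "continuous_map (subtopology X Xi) euclideanreal G"
    proof (rule ipatch_continuous)
      fix U \<phi> W \<nu> assume i: "ipatch U \<phi> W \<nu>"
      then interpret P: patch W "par U \<phi>" \<nu> by (simp add: ipatch_def)
      have ch: "(U, \<phi>) \<in> \<A>" using i by (simp add: ipatch_def)
      have "continuous_on W (\<lambda>y. (\<nu> y \<bullet> par U \<phi> y)\<^sup>2 * exp (c * (par U \<phi> y \<bullet> par U \<phi> y)))"
        by (intro continuous_intros Cinf_on_continuous P.nu_smooth P.psi_smooth)
      moreover have "G q = (\<nu> (\<phi> q) \<bullet> par U \<phi> (\<phi> q))\<^sup>2 * exp (c * (par U \<phi> (\<phi> q) \<bullet> par U \<phi> (\<phi> q)))"
        if "q \<in> U" "\<phi> q \<in> W" for q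
        unfolding G_def ipatch_values(2)[OF i that] par_chart[OF ch that(1)] ..
      ultimately show "\<exists>g. continuous_on W g \<and> (\<forall>q\<in>U. \<phi> q \<in> W \<longrightarrow> G q = g (\<phi> q))" by blast
    qed
    fix p assume p: "p \<in> topspace X" "p \<notin> Xi"
    define E where "E = exp (c * r2\<^sup>2)"
    have E: "0 < E" by (simp add: E_def)
    obtain N where N: "openin X N" "p \<in> N" "\<forall>q\<in>N \<inter> Xi. usq q < G p0 / E"
      using usq_boundary[OF p, of "G p0 / E"] G0 E by auto
    have "G q < G p0" if q: "q \<in> N \<inter> Xi" for q
    proof -
      have "exp (c * (F q \<bullet> F q)) \<le> E"
        using F_inner[of q] q Xi_sub c by (auto simp: E_def intro: mult_left_mono)
      then have "G q \<le> usq q * E" unfolding G_def using usq0 by (rule mult_left_mono)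
      also have "\<dots> < G p0" using N(3) q E by (simp add: pos_less_divide_eq)
      finally show ?thesis .
    qed
    then show "\<exists>N. openin X N \<and> p \<in> N \<and> (\<forall>q\<in>N \<inter> Xi. G q < G p0)" using N by blast
  qed
  then obtain p where p: "p \<in> Xi" "\<And>q. q \<in> Xi \<Longrightarrow> G q \<le> G p" by blast
  have "0 < G p" using p(2)[OF assms] G0 by simp
  then have up: "usq p \<noteq> 0" by (auto simp: G_def)
  obtain U \<phi> r \<nu>0 where P0: "p \<in> U" "0 < r" "ipatch U \<phi> (ball (\<phi> p) r) \<nu>0" "F p = par U \<phi> (\<phi> p)" by (rule ipatch_at[OF p(1)])
  define W where "W = ball (\<phi> p) r"
  have pW: "\<phi> p \<in> W" using P0 by (simp add: W_def)
  \<comment> \<open>The sign of the local normal is free, so the support function may be taken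
    positive at \<open>p\<close>. The maximum of the squared quotient is then a maximum of the
    quotient itself.\<close>
  have "\<exists>\<nu>. ipatch U \<phi> W \<nu> \<and> 0 < \<nu> (\<phi> p) \<bullet> F p"
  proof (cases "0 < \<nu>0 (\<phi> p) \<bullet> F p")
    case False
    have "\<nu>0 (\<phi> p) \<bullet> F p \<noteq> 0"
      using up ipatch_values(2)[OF P0(3,1)] P0(2) by simp
    then show ?thesis
      using False P0(3) patch_uminus by (intro exI[of _ "\<lambda>y. - \<nu>0 y"]) (auto simp: ipatch_def W_def)
  qed (use P0 W_def in blast)
  then obtain \<nu> where i: "ipatch U \<phi> W \<nu>" and pos: "0 < \<nu> (\<phi> p) \<bullet> F p" by blast
  interpret M: minimal_patch W "par U \<phi>" \<nu> by (rule ipatch_minimal[OF i])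
  have r2: "0 < r2\<^sup>2" using r1_pos r12 by simp
  have B: "(M.barta c (\<phi> q))\<^sup>2 = G q" if "q \<in> U" "\<phi> q \<in> W" for q
  proof -
    have ch: "(U, \<phi>) \<in> \<A>" using i by (simp add: ipatch_def)
    have "(exp (c / 2 * (F q \<bullet> F q)))\<^sup>2 = exp (c * (F q \<bullet> F q))"
      by (simp add: power2_eq_square exp_add[symmetric])
    then show ?thesis
      unfolding M.barta_def M.u_inner M.rr_inner par_chart[OF ch that(1)] G_def ipatch_values(2)[OF i that]
      by (simp add: power_mult_distrib inner_commute)
  qed
  show False
  proof (rule M.no_positive_max[OF pW r2])
    show "M.rr (\<phi> p) \<le> r2\<^sup>2" using F_inner[of p] p Xi_sub P0(4) by (auto simp: M.rr_inner)
    show "M.c2 (\<phi> p) \<le> (real CARD('n))\<^sup>2 / (4 * r2\<^sup>2)"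
      using csq_le[OF p(1)] ipatch_values(1)[OF i P0(1) pW] dim_n by simp
    show u: "0 < M.u (\<phi> p)" using pos P0(4) by (simp add: M.u_inner inner_commute)
    show "0 < r" by (rule P0(2))
    fix y assume "dist y (\<phi> p) < r"
    then have y: "y \<in> W" by (simp add: W_def dist_commute)
    obtain q where q: "q \<in> U" "q \<in> Xi" "\<phi> q = y" "F q = par U \<phi> y" by (rule ipatch_point[OF i y])
    have "(M.barta c y)\<^sup>2 \<le> (M.barta c (\<phi> p))\<^sup>2"
      using B[OF P0(1) pW] B[OF q(1)] q y p(2)[OF q(2)] by simp
    then have "M.barta c y \<le> M.barta c (\<phi> p)"
      by (rule power2_le_imp_le) (use u in \<open>simp add: M.barta_def\<close>)
    then show "M.barta (real CARD('n) / (2 * r2\<^sup>2)) y \<le> M.barta (real CARD('n) / (2 * r2\<^sup>2)) (\<phi> p)"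
      by (simp add: c_def dim_n)
  qed
qed

lemma ipatch_cone:
  assumes i: "ipatch U \<phi> W \<nu>" shows "cone_patch W (par U \<phi>) \<nu>"
proof -
  interpret M: minimal_patch W "par U \<phi>" \<nu> by (rule ipatch_minimal[OF i])
  show ?thesis
  proof
    fix x assume x: "x \<in> W"
    obtain q where q: "q \<in> U" "q \<in> Xi" "\<phi> q = x" "F q = par U \<phi> x" by (rule ipatch_point[OF i x])
    have "(\<nu> x \<bullet> F q)\<^sup>2 = 0"
      using ipatch_values(2)[OF i q(1)] usq_zero[OF q(2)] q(3) x by simp
    then show "par U \<phi> x \<bullet> \<nu> x = 0" using q(4) by (simp add: inner_commute)
    show "par U \<phi> x \<noteq> 0" using F_annulus[of q] r1_pos q Xi_sub by force
  qed
qed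

text \<open>An interior point of the manifold might a priori touch one of the two spheres. It would
  be an extremum of |x|^2, whose tangential gradient 2 x does not vanish on a cone.\<close>

lemma interior_radius:
  assumes p: "p \<in> Xi" shows "r1\<^sup>2 < F p \<bullet> F p" "F p \<bullet> F p < r2\<^sup>2"
proof -
  obtain U \<phi> r \<nu> where P: "p \<in> U" "0 < r" "ipatch U \<phi> (ball (\<phi> p) r) \<nu>" "F p = par U \<phi> (\<phi> p)" by (rule ipatch_at[OF p])
  interpret C: cone_patch "ball (\<phi> p) r" "par U \<phi>" \<nu> by (rule ipatch_cone[OF P(3)])
  have pW: "\<phi> p \<in> ball (\<phi> p) r" using P by simp
  obtain a where a: "C.\<delta> a C.rr (\<phi> p) \<noteq> 0" using C.radial_rr_zero[OF pW] by blast
  have bounds: "r1\<^sup>2 \<le> C.rr y \<and> C.rr y \<le> r2\<^sup>2" if "dist y (\<phi> p) < r" for y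
  proof -
    have "y \<in> ball (\<phi> p) r" using that by (simp add: dist_commute)
    obtain q where "q \<in> U" "q \<in> Xi" "\<phi> q = y" "F q = par U \<phi> y" by (rule ipatch_point[OF P(3) \<open>y \<in> ball (\<phi> p) r\<close>])
    then show ?thesis using F_inner[of q] Xi_sub by (auto simp: C.rr_inner)
  qed
  have Fp: "F p \<bullet> F p = C.rr (\<phi> p)" using P(4) by (simp add: C.rr_inner)
  show "F p \<bullet> F p < r2\<^sup>2"
  proof (rule ccontr)
    assume "\<not> ?thesis"
    then have "C.\<delta> a C.rr (\<phi> p) = 0"
      using bounds Fp by (intro C.interior_max(1)[OF C.rr_smooth pW P(2)]) fastforce
    then show False using a by simp
  qed
  show "r1\<^sup>2 < F p \<bullet> F p"
  proof (rule ccontr)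
    assume "\<not> ?thesis"
    then have "C.\<delta> a (\<lambda>y. - C.rr y) (\<phi> p) = 0"
      using bounds Fp by (intro C.interior_max(1)[OF Cinf_on_uminus[OF C.open_W C.rr_smooth] pW P(2)]) fastforce
    then show False using a C.\<delta>_uminus[OF C.rr_smooth pW] by simp
  qed
qed

section \<open>The pinching function\<close>

definition fX where "fX p = csq p * (F p \<bullet> F p)"

lemma fX_ipatch:
  assumes i: "ipatch U \<phi> W \<nu>" and q: "q \<in> U" "\<phi> q \<in> W"
  shows "fX q = cone_patch.f (par U \<phi>) \<nu> (\<phi> q)"
proof -
  interpret C: cone_patch W "par U \<phi>" \<nu> by (rule ipatch_cone[OF i])
  have "(U, \<phi>) \<in> \<A>" using i by (simp add: ipatch_def)
  then have "F q = par U \<phi> (\<phi> q)" using par_chart q(1) by metis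
  then show ?thesis unfolding fX_def C.f_def C.rr_inner ipatch_values(1)[OF i q] by simp
qed

lemma csq_nonneg: "p \<in> Xi \<Longrightarrow> 0 \<le> csq p"
proof -
  assume p: "p \<in> Xi"
  obtain U \<phi> r \<nu> where P: "p \<in> U" "0 < r" "ipatch U \<phi> (ball (\<phi> p) r) \<nu>" "F p = par U \<phi> (\<phi> p)" by (rule ipatch_at[OF p])
  interpret M: minimal_patch "ball (\<phi> p) r" "par U \<phi>" \<nu> by (rule ipatch_minimal[OF P(3)])
  have "csq p = M.c2 (\<phi> p)" using ipatch_values(1)[OF P(3,1)] P(2) by simp
  then show ?thesis by (simp add: M.c2_def sum_nonneg)
qed

lemma fX_nonneg: "p \<in> Xi \<Longrightarrow> 0 \<le> fX p"
  by (simp add: fX_def csq_nonneg)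

lemma fX_le: "p \<in> Xi \<Longrightarrow> fX p \<le> (real n)\<^sup>2 / (4 * r2\<^sup>2) * (F p \<bullet> F p)"
  unfolding fX_def by (intro mult_right_mono csq_le) auto

lemma fX_continuous_with:
  fixes h :: "real \<Rightarrow> real"
  assumes h: "continuous_on {r1\<^sup>2<..<r2\<^sup>2} h"
  shows "continuous_map (subtopology X Xi) euclideanreal (\<lambda>q. fX q - h (F q \<bullet> F q))"
proof (rule ipatch_continuous)
  fix U \<phi> W \<nu> assume i: "ipatch U \<phi> W \<nu>"
  interpret C: cone_patch W "par U \<phi>" \<nu> by (rule ipatch_cone[OF i])
  have ch: "(U, \<phi>) \<in> \<A>" using i by (simp add: ipatch_def)
  have "C.rr y \<in> {r1\<^sup>2<..<r2\<^sup>2}" if "y \<in> W" for y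
  proof -
    obtain q where "q \<in> U" "q \<in> Xi" "\<phi> q = y" "F q = par U \<phi> y" by (rule ipatch_point[OF i \<open>y \<in> W\<close>])
    then show ?thesis using interior_radius[of q] by (simp add: C.rr_inner)
  qed
  then have "continuous_on W (\<lambda>y. C.f y - h (C.rr y))"
    by (intro continuous_on_diff continuous_on_compose2[OF h] Cinf_on_continuous C.f_smooth C.rr_smooth) auto
  moreover have "fX q - h (F q \<bullet> F q) = C.f (\<phi> q) - h (C.rr (\<phi> q))" if "q \<in> U" "\<phi> q \<in> W" for q
    using fX_ipatch[OF i that] par_chart[OF ch that(1)] by (simp add: C.rr_inner)
  ultimately show "\<exists>g. continuous_on W g \<and> (\<forall>q\<in>U. \<phi> q \<in> W \<longrightarrow> fX q - h (F q \<bullet> F q) = g (\<phi> q))" by blast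
qed

lemma F_near:
  assumes p: "p \<in> topspace X" and V: "open V" "F p \<bullet> F p \<in> V"
  shows "\<exists>N. openin X N \<and> p \<in> N \<and> (\<forall>q\<in>N. F q \<bullet> F q \<in> V)"
proof -
  have "open {y :: real ^ 'k. y \<bullet> y \<in> V}"
    using open_vimage[OF V(1), of "\<lambda>y :: real ^ 'k. y \<bullet> y"] by (simp add: vimage_def continuous_intros)
  then have "openin X {q \<in> topspace X. F q \<in> {y. y \<bullet> y \<in> V}}"
    by (intro openin_continuous_map_preimage[OF F_continuous]) auto
  then show ?thesis using p V(2) by (intro exI[of _ "{q \<in> topspace X. F q \<in> {y. y \<bullet> y \<in> V}}"]) auto
qed

lemma boundary_radius2:
  "p \<in> topspace X \<Longrightarrow> p \<notin> Xi \<Longrightarrow> F p \<bullet> F p = r1\<^sup>2 \<or> F p \<bullet> F p = r2\<^sup>2"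
  using boundary_radius[of p] by (auto simp: power2_norm_eq_inner[symmetric])

text \<open>\<open>fX\<close> is constant along rays, so it is controlled by its values near the inner sphere; instead
  of following rays, a small radially decreasing term excludes interior maxima.\<close>

lemma fX_le_inner:
  assumes q0: "q0 \<in> Xi" shows "fX q0 \<le> (real n)\<^sup>2 / (4 * r2\<^sup>2) * r1\<^sup>2"
proof (rule ccontr)
  define k where "k = (real n)\<^sup>2 / (4 * r2\<^sup>2)"
  assume "\<not> ?thesis"
  then have gt: "k * r1\<^sup>2 < fX q0" by (simp add: k_def)
  define B where "B = r2\<^sup>2"
  define i0 where "i0 = inverse (B - F q0 \<bullet> F q0)"
  have i0: "0 < i0" using interior_radius[OF q0] by (simp add: i0_def B_def)
  \<comment> \<open>Half of the gap: the penalty at \<open>q0\<close> lowers \<open>fX q0\<close> to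
    the midpoint between it and k r1^2, so \<open>G q0\<close> still exceeds k r1^2, the bound for
    \<open>fX\<close> in the limit at the inner sphere.\<close>
  define \<epsilon> where "\<epsilon> = (fX q0 - k * r1\<^sup>2) / (2 * i0)"
  have \<epsilon>: "0 < \<epsilon>" "\<epsilon> * i0 = (fX q0 - k * r1\<^sup>2) / 2" using gt i0 by (simp_all add: \<epsilon>_def)
  define G where "G q = fX q - \<epsilon> * inverse (B - F q \<bullet> F q)" for q
  have G0: "k * r1\<^sup>2 < G q0" using gt \<epsilon>(2) by (simp add: G_def i0_def[symmetric])
  have k: "0 < k" using n_ge r1_pos r12 by (simp add: k_def)
  have "\<exists>p\<in>Xi. \<forall>q\<in>Xi. G q \<le> G p"
  proof (rule max_attained[OF _ q0])
    show "continuous_map (subtopology X Xi) euclideanreal G"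
      unfolding G_def by (rule fX_continuous_with) (auto intro!: continuous_intros simp: B_def)
    fix p assume p: "p \<in> topspace X" "p \<notin> Xi"
    from boundary_radius2[OF p] show "\<exists>N. openin X N \<and> p \<in> N \<and> (\<forall>q\<in>N \<inter> Xi. G q < G q0)"
    proof
      assume "F p \<bullet> F p = r1\<^sup>2"
      then have m: "F p \<bullet> F p \<in> {t. k * t < G q0}" using G0 by simp
      have o: "open {t. k * t < G q0}" by (intro open_Collect_less continuous_intros)
      from F_near[OF p(1) o m] obtain N where N: "openin X N" "p \<in> N" "\<forall>q\<in>N. k * (F q \<bullet> F q) < G q0"
        by auto
      have "G q < G q0" if q: "q \<in> N \<inter> Xi" for q
      proof -
        have "0 < inverse (B - F q \<bullet> F q)" using interior_radius[of q] q by (simp add: B_def)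
        then have "G q \<le> fX q" using \<epsilon> by (simp add: G_def)
        also have "\<dots> \<le> k * (F q \<bullet> F q)" using fX_le q by (simp add: k_def)
        also have "\<dots> < G q0" using N q by blast
        finally show ?thesis .
      qed
      then show ?thesis using N by blast
    next
      assume eq: "F p \<bullet> F p = r2\<^sup>2"
      \<comment> \<open>Where |x|^2 is within \<open>d\<close> of r2^2, the penalty exceeds |k B - G
        q0| + 1, while \<open>fX\<close> is at most k B.\<close>
      define d where "d = \<epsilon> / (\<bar>k * B - G q0\<bar> + 1)"
      have d: "0 < d" using \<epsilon> by (simp add: d_def add_nonneg_pos)
      have m: "F p \<bullet> F p \<in> {B - d<..}" using d eq by (simp add: B_def)
      from F_near[OF p(1) open_greaterThan m]
      obtain N where N: "openin X N" "p \<in> N" "\<forall>q\<in>N. F q \<bullet> F q \<in> {B - d<..}" by blast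
      have "G q < G q0" if q: "q \<in> N \<inter> Xi" for q
      proof -
        define s where "s = B - F q \<bullet> F q"
        have s: "0 < s" "s < d" using interior_radius[of q] q N by (auto simp: B_def s_def)
        have "\<epsilon> * inverse d < \<epsilon> * inverse s" using s \<epsilon> by simp
        moreover have "\<epsilon> * inverse d = \<bar>k * B - G q0\<bar> + 1" using \<epsilon> by (simp add: d_def)
        moreover have "fX q \<le> k * B"
        proof -
          have "fX q \<le> k * (F q \<bullet> F q)" using fX_le q by (simp add: k_def)
          also have "\<dots> \<le> k * B" using interior_radius[of q] q k by (simp add: B_def)
          finally show ?thesis .
        qed
        ultimately show ?thesis by (simp add: G_def s_def)
      qed
      then show ?thesis using N by blast
    qed
  qed
  then obtain p where p: "p \<in> Xi" "\<And>q. q \<in> Xi \<Longrightarrow> G q \<le> G p" by blast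
  obtain U \<phi> r \<nu> where P: "p \<in> U" "0 < r" "ipatch U \<phi> (ball (\<phi> p) r) \<nu>" "F p = par U \<phi> (\<phi> p)" by (rule ipatch_at[OF p(1)])
  interpret C: cone_patch "ball (\<phi> p) r" "par U \<phi>" \<nu> by (rule ipatch_cone[OF P(3)])
  have pW: "\<phi> p \<in> ball (\<phi> p) r" using P by simp
  have Gy: "\<exists>q\<in>Xi. G q = C.f y - \<epsilon> * inverse (B - C.rr y) \<and> C.rr y < B" if y: "y \<in> ball (\<phi> p) r" for y
  proof -
    obtain q where q: "q \<in> U" "q \<in> Xi" "\<phi> q = y" "F q = par U \<phi> y" by (rule ipatch_point[OF P(3) y])
    then have "G q = C.f y - \<epsilon> * inverse (B - C.rr y)"
      using fX_ipatch[OF P(3) q(1)] y by (simp add: G_def C.rr_inner)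
    then show ?thesis using q interior_radius(2)[OF q(2)] by (auto simp: C.rr_inner B_def)
  qed
  show False
  proof (rule C.no_max_outer[OF pW _ \<epsilon>(1) P(2)])
    show "C.rr y < B" if "y \<in> ball (\<phi> p) r" for y using Gy[OF that] by blast
    fix y assume "dist y (\<phi> p) < r"
    then have "y \<in> ball (\<phi> p) r" by (simp add: dist_commute)
    then obtain q where "q \<in> Xi" "G q = C.f y - \<epsilon> * inverse (B - C.rr y)" using Gy by blast
    moreover have "G p = C.f (\<phi> p) - \<epsilon> * inverse (B - C.rr (\<phi> p))"
      using fX_ipatch[OF P(3,1) pW] P(4) by (simp add: G_def C.rr_inner)
    ultimately show "C.f y - \<epsilon> * inverse (B - C.rr y) \<le> C.f (\<phi> p) - \<epsilon> * inverse (B - C.rr (\<phi> p))"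
      using p(2) by metis
  qed
qed

text \<open>The supremum of \<open>fX\<close> might be approached only at the boundary. Penalised
  maxima, however, lie on the middle sphere, whose preimage \<open>L\<close> is compact. If
  \<open>fX\<close> stayed below n - 1 on \<open>L\<close>, then \<open>fX\<close> (n - 1 -
  \<open>fX\<close>) would be bounded below by a positive number at these maxima, against the bound
  \<epsilon> \<open>C0\<close> for small \<epsilon>.\<close>

lemma fX_max_point:
  assumes q0: "q0 \<in> Xi" "0 < fX q0" and le: "\<And>p. p \<in> Xi \<Longrightarrow> fX p \<le> real n - 1"
  shows "\<exists>p\<in>Xi. fX p = real n - 1"
proof (rule ccontr)
  assume no: "\<not> ?thesis"
  define A where "A = r1\<^sup>2"
  define B where "B = r2\<^sup>2"
  define \<sigma> where "\<sigma> = (A + B) / 2"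
  have AB: "A < B" using r1_pos r12 by (simp add: A_def B_def power_strict_mono)
  define w where "w q = inverse ((F q \<bullet> F q - A) * (B - F q \<bullet> F q))" for q
  have w_pos: "0 < w q" if "q \<in> Xi" for q
    using interior_radius[OF that] by (simp add: w_def A_def B_def)
  \<comment> \<open>The coefficient in \<open>max_middle\<close>, evaluated on the middle sphere
    |x|^2 = \<sigma>.\<close>
  define C0 where "C0 = 4 * \<sigma>\<^sup>2 / ((\<sigma> - A) * (B - \<sigma>))\<^sup>2"
  have key: "\<exists>p\<in>Xi. F p \<bullet> F p = \<sigma> \<and> fX p * (real n - 1 - fX p) \<le> \<epsilon> * C0 \<and> fX q0 - \<epsilon> * w q0 \<le> fX p"
    if \<epsilon>: "0 < \<epsilon>" for \<epsilon>
  proof -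
    define G where "G q = fX q - \<epsilon> * w q" for q
    have "\<exists>p\<in>Xi. \<forall>q\<in>Xi. G q \<le> G p"
    proof (rule max_attained[OF _ q0(1)])
      show "continuous_map (subtopology X Xi) euclideanreal G"
        unfolding G_def w_def
        by (rule fX_continuous_with) (auto intro!: continuous_intros simp: A_def B_def)
      fix p assume p: "p \<in> topspace X" "p \<notin> Xi"
      define P where "P t = (t - A) * (B - t)" for t :: real
      define d where "d = \<epsilon> / (\<bar>real n - 1 - G q0\<bar> + 1)"
      have d: "0 < d" using \<epsilon> by (simp add: d_def add_nonneg_pos)
      have "P (F p \<bullet> F p) = 0" using boundary_radius2[OF p] by (auto simp: P_def A_def B_def)
      then have m: "F p \<bullet> F p \<in> {t. P t < d}" using d by simp
      have o: "open {t. P t < d}" unfolding P_def by (intro open_Collect_less continuous_intros)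
      from F_near[OF p(1) o m] obtain N where N: "openin X N" "p \<in> N" "\<forall>q\<in>N. P (F q \<bullet> F q) < d"
        by auto
      have "G q < G q0" if q: "q \<in> N \<inter> Xi" for q
      proof -
        define s where "s = P (F q \<bullet> F q)"
        have s: "0 < s" "s < d" using interior_radius[of q] q N by (auto simp: A_def B_def P_def s_def)
        have "\<epsilon> * inverse d < \<epsilon> * inverse s" using s \<epsilon> by simp
        moreover have "\<epsilon> * inverse d = \<bar>real n - 1 - G q0\<bar> + 1" using \<epsilon> by (simp add: d_def)
        moreover have "fX q \<le> real n - 1" using le q by blast
        ultimately show ?thesis by (simp add: G_def w_def s_def P_def)
      qed
      then show "\<exists>N. openin X N \<and> p \<in> N \<and> (\<forall>q\<in>N \<inter> Xi. G q < G q0)" using N by blast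
    qed
    then obtain p where p: "p \<in> Xi" "\<And>q. q \<in> Xi \<Longrightarrow> G q \<le> G p" by blast
    obtain U \<phi> r \<nu> where P: "p \<in> U" "0 < r" "ipatch U \<phi> (ball (\<phi> p) r) \<nu>" "F p = par U \<phi> (\<phi> p)" by (rule ipatch_at[OF p(1)])
    interpret C: cone_patch "ball (\<phi> p) r" "par U \<phi>" \<nu> by (rule ipatch_cone[OF P(3)])
    have pW: "\<phi> p \<in> ball (\<phi> p) r" using P by simp
    have Gy: "\<exists>q\<in>Xi. G q = C.f y - \<epsilon> * inverse ((C.rr y - A) * (B - C.rr y)) \<and> A < C.rr y \<and> C.rr y < B"
      if y: "y \<in> ball (\<phi> p) r" for y
    proof -
      obtain q where q: "q \<in> U" "q \<in> Xi" "\<phi> q = y" "F q = par U \<phi> y" by (rule ipatch_point[OF P(3) y])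
      then have "G q = C.f y - \<epsilon> * inverse ((C.rr y - A) * (B - C.rr y))"
        using fX_ipatch[OF P(3) q(1)] y by (simp add: G_def w_def C.rr_inner)
      then show ?thesis using q interior_radius[OF q(2)] by (auto simp: C.rr_inner A_def B_def)
    qed
    have Gp: "G p = C.f (\<phi> p) - \<epsilon> * inverse ((C.rr (\<phi> p) - A) * (B - C.rr (\<phi> p)))"
      using fX_ipatch[OF P(3,1) pW] P(4) by (simp add: G_def w_def C.rr_inner)
    have ABy: "A < C.rr y \<and> C.rr y < B" if "y \<in> ball (\<phi> p) r" for y using Gy[OF that] by blast
    have mx: "C.f y - \<epsilon> * inverse ((C.rr y - A) * (B - C.rr y))
       \<le> C.f (\<phi> p) - \<epsilon> * inverse ((C.rr (\<phi> p) - A) * (B - C.rr (\<phi> p)))" if "dist y (\<phi> p) < r" for y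
    proof -
      have "y \<in> ball (\<phi> p) r" using that by (simp add: dist_commute)
      then obtain q where "q \<in> Xi" "G q = C.f y - \<epsilon> * inverse ((C.rr y - A) * (B - C.rr y))" using Gy by blast
      then show ?thesis using p(2) Gp by metis
    qed
    note m = C.max_middle[OF pW ABy \<epsilon> P(2) mx]
    have rr: "C.rr (\<phi> p) = F p \<bullet> F p" "C.f (\<phi> p) = fX p"
      using P(4) fX_ipatch[OF P(3,1) pW] by (simp_all add: C.rr_inner)
    have "F p \<bullet> F p = \<sigma>" using m(1) by (simp add: rr \<sigma>_def)
    moreover have "fX p * (real n - 1 - fX p) \<le> \<epsilon> * C0"
      using m(2) unfolding rr \<open>F p \<bullet> F p = \<sigma>\<close> dim_n C0_def .
    moreover have "fX q0 - \<epsilon> * w q0 \<le> fX p"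
      using p(2)[OF q0(1)] w_pos[OF p(1)] \<epsilon> unfolding G_def
      by (smt (verit) mult_pos_pos)
    ultimately show ?thesis using p(1) by blast
  qed
  define L where "L = {p \<in> topspace X. F p \<bullet> F p = \<sigma>}"
  have LX: "L \<subseteq> Xi" using boundary_radius2 AB by (force simp: L_def \<sigma>_def A_def B_def)
  have "closedin X {p \<in> topspace X. F p \<in> {y. y \<bullet> y = \<sigma>}}"
    by (rule closedin_continuous_map_preimage[OF F_continuous])
      (simp add: closed_Collect_eq continuous_intros)
  then have "compactin X L" using closedin_compact_space[OF hyps(1)] by (simp add: L_def)
  then have "compactin (subtopology X Xi) L" using LX by (simp add: compactin_subtopology)
  moreover have "continuous_map (subtopology X Xi) euclideanreal fX"
    using fX_continuous_with[of "\<lambda>_. 0"] by simp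
  ultimately have "compact (fX ` L)" using image_compactin by force
  moreover have "L \<noteq> {}" using key[of 1] Xi_sub by (auto simp: L_def)
  ultimately obtain m where m: "m \<in> L" "\<And>p. p \<in> L \<Longrightarrow> fX p \<le> fX m"
    using compact_attains_sup[of "fX ` L"] by blast
  define g where "g = real n - 1 - fX m"
  have g: "0 < g" using m(1) LX le no by (force simp: g_def less_le)
  have C0: "0 \<le> C0" by (simp add: C0_def)
  \<comment> \<open>The first bound keeps \<open>fX\<close> at the penalised maximum above half of
    \<open>fX q0\<close>; the second makes \<epsilon> \<open>C0\<close> smaller than
    \<open>g\<close> times that half.\<close>
  define \<epsilon> where "\<epsilon> = min (fX q0 / (2 * w q0)) (g * fX q0 / (4 * (C0 + 1)))"
  have \<epsilon>: "0 < \<epsilon>" using q0 w_pos[OF q0(1)] g C0 by (simp add: \<epsilon>_def)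
  obtain p where p: "p \<in> Xi" "F p \<bullet> F p = \<sigma>" "fX p * (real n - 1 - fX p) \<le> \<epsilon> * C0" "fX q0 - \<epsilon> * w q0 \<le> fX p"
    using key[OF \<epsilon>] by blast
  have "\<epsilon> * w q0 \<le> fX q0 / (2 * w q0) * w q0"
    using w_pos[OF q0(1)] by (intro mult_right_mono) (auto simp: \<epsilon>_def)
  then have half: "fX q0 / 2 \<le> fX p" using p(4) w_pos[OF q0(1)] by simp
  have "g \<le> real n - 1 - fX p" using m(2)[of p] p Xi_sub by (auto simp: g_def L_def)
  then have "fX q0 / 2 * g \<le> fX p * (real n - 1 - fX p)"
    using half q0(2) g by (intro mult_mono) auto
  also have "\<dots> \<le> \<epsilon> * C0" by (rule p(3))
  also have "\<dots> < \<epsilon> * (2 * (C0 + 1))" using \<epsilon> C0 by simp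
  also have "\<dots> \<le> g * fX q0 / (4 * (C0 + 1)) * (2 * (C0 + 1))"
    using C0 by (intro mult_right_mono) (auto simp: \<epsilon>_def)
  also have "\<dots> = fX q0 / 2 * g" using C0 by (simp add: field_simps)
  finally show False by simp
qed

text \<open>The set where the maximal value n - 1 is taken is open by \<open>f_max_spreads\<close>
  and closed in \<open>Xi\<close> by continuity, and \<open>Xi\<close> is connected.\<close>

lemma fX_rigid:
  assumes le: "\<And>p. p \<in> Xi \<Longrightarrow> fX p \<le> real n - 1" and p0: "p0 \<in> Xi" "fX p0 = real n - 1" and p: "p \<in> Xi"
  shows "fX p = real n - 1"
proof -
  define Z where "Z = {p \<in> Xi. fX p = real n - 1}"
  have fc: "continuous_map (subtopology X Xi) euclideanreal fX"
    using fX_continuous_with[of "\<lambda>_. 0"] by simp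
  have Z: "openin X Z"
  proof (subst openin_subopen, intro ballI)
    fix p assume "p \<in> Z"
    then have p: "p \<in> Xi" "fX p = real n - 1" by (auto simp: Z_def)
    obtain U \<phi> r \<nu> where P: "p \<in> U" "0 < r" "ipatch U \<phi> (ball (\<phi> p) r) \<nu>" "F p = par U \<phi> (\<phi> p)" by (rule ipatch_at[OF p(1)])
    interpret C: cone_patch "ball (\<phi> p) r" "par U \<phi>" \<nu> by (rule ipatch_cone[OF P(3)])
    have pW: "\<phi> p \<in> ball (\<phi> p) r" using P by simp
    have Cle: "C.f y \<le> real CARD('n) - 1" if "y \<in> ball (\<phi> p) r" for y
    proof -
      obtain q where q: "q \<in> U" "q \<in> Xi" "\<phi> q = y" "F q = par U \<phi> y"
        by (rule ipatch_point[OF P(3) \<open>y \<in> ball (\<phi> p) r\<close>])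
      have "C.f y = fX q" using fX_ipatch[OF P(3) q(1)] that q(3) by simp
      then show ?thesis using le[OF q(2)] dim_n by simp
    qed
    have Cp: "C.f (\<phi> p) = real CARD('n) - 1" using p fX_ipatch[OF P(3,1) pW] dim_n by simp
    obtain e where e: "e > 0" "ball (\<phi> p) e \<subseteq> ball (\<phi> p) r" "\<forall>z\<in>ball (\<phi> p) e. C.f z = real CARD('n) - 1"
      using C.f_max_spreads[OF Cle pW Cp] by blast
    have ch: "(U, \<phi>) \<in> \<A>" using P(3) by (simp add: ipatch_def)
    have "{q \<in> U. \<phi> q \<in> ball (\<phi> p) e} \<subseteq> Z"
    proof
      fix q assume q: "q \<in> {q \<in> U. \<phi> q \<in> ball (\<phi> p) e}"
      then have q': "q \<in> U" "\<phi> q \<in> ball (\<phi> p) r" using e(2) by auto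
      then show "q \<in> Z"
        using q e(3) fX_ipatch[OF P(3) q'] ipatch_interior[OF P(3) q'] dim_n by (simp add: Z_def)
    qed
    then show "\<exists>T. openin X T \<and> p \<in> T \<and> T \<subseteq> Z"
      using chart_preimage[OF ch open_ball] P(1) e(1)
      by (intro exI[of _ "{q \<in> U. \<phi> q \<in> ball (\<phi> p) e}"]) auto
  qed
  have "openin (subtopology X Xi) {q \<in> topspace (subtopology X Xi). fX q \<in> - {real n - 1}}"
    by (rule openin_continuous_map_preimage[OF fc]) auto
  moreover have "{q \<in> topspace (subtopology X Xi). fX q \<in> - {real n - 1}} = Xi - Z"
    using Xi_sub by (auto simp: Z_def)
  ultimately have "openin X (Xi - Z)" using openin_trans_full Xi_open by metis
  then have "Xi \<subseteq> Z"
    using p0 by (intro Xi_connected[OF Z]) (auto simp: Z_def)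
  then show ?thesis using p by (auto simp: Z_def)
qed

end

section \<open>Quadratic cones over Clifford tori\<close>

lemma coordinate_subspace_punctured_connected:
  fixes I :: "'k::finite set"
  assumes "2 \<le> card I"
  shows "connected ({x :: real ^ 'k. \<forall>i. i \<notin> I \<longrightarrow> x $ i = 0} - {0})"
proof (rule connected_punctured_convex)
  let ?V = "{x :: real ^ 'k. \<forall>i. i \<notin> I \<longrightarrow> x $ i = 0}"
  have sub: "subspace ?V" by (auto simp: subspace_def)
  then show "convex ?V" by (rule subspace_imp_convex)
  obtain J where "J \<subseteq> I" "card J = 2" using assms obtain_subset_with_card_n by metis
  then obtain i j where ij: "i \<in> I" "j \<in> I" "i \<noteq> j" by (auto simp: card_2_iff)
  have ne: "axis i (1::real) \<noteq> axis j 1" using ij by (simp add: axis_eq_axis)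
  have "independent {axis i (1::real), axis j 1}"
    using ij by (intro pairwise_orthogonal_independent)
      (auto simp: pairwise_def orthogonal_def inner_axis_axis)
  moreover have "{axis i (1::real), axis j 1} \<subseteq> ?V" using ij by (auto simp: axis_def)
  ultimately have "card {axis i (1::real), axis j 1} \<le> dim ?V" by (intro independent_card_le_dim)
  then have "2 \<le> dim ?V" using ne by simp
  then show "aff_dim ?V \<noteq> 1" using aff_dim_subspace[OF sub] by simp
qed

text \<open>Orthonormal bases of \<open>E\<close> and \<open>E'\<close> together are indexed by the
  coordinates; \<open>I\<close> records the coordinates whose axes are sent into
  \<open>E\<close>.\<close>

lemma adapted_rotation:
  fixes E E' :: "(real ^ 'k::finite) set"
  assumes E: "subspace E" "subspace E'" and orth: "\<And>x y. x \<in> E \<Longrightarrow> y \<in> E' \<Longrightarrow> x \<bullet> y = 0"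
    and dim: "dim E + dim E' = CARD('k)"
  shows "\<exists>(I :: 'k set) (Q :: real ^ 'k \<Rightarrow> real ^ 'k). orthogonal_transformation Q \<and> (\<forall>i. Q (axis i 1) \<in> (if i \<in> I then E else E'))"
proof -
  obtain B where B: "B \<subseteq> E" "pairwise orthogonal B" "\<And>x. x \<in> B \<Longrightarrow> norm x = 1" "independent B" "card B = dim E" "span B = E"
    using orthonormal_basis_subspace[OF E(1)] by blast
  obtain B' where B': "B' \<subseteq> E'" "pairwise orthogonal B'" "\<And>x. x \<in> B' \<Longrightarrow> norm x = 1" "independent B'" "card B' = dim E'" "span B' = E'"
    using orthonormal_basis_subspace[OF E(2)] by blast
  have fin: "finite B" "finite B'" using B(4) B'(4) independent_imp_finite by auto
  have disj: "B \<inter> B' = {}"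
  proof (rule ccontr)
    assume "B \<inter> B' \<noteq> {}"
    then obtain x where x: "x \<in> B" "x \<in> B'" by blast
    then have "x \<bullet> x = 0" using orth B(1) B'(1) by blast
    then show False using B(3)[OF x(1)] by simp
  qed
  have "card (B \<union> B') = CARD('k)" using disj fin B(5) B'(5) dim by (simp add: card_Un_disjoint)
  then obtain \<beta> :: "'k \<Rightarrow> real ^ 'k" where \<beta>: "bij_betw \<beta> UNIV (B \<union> B')"
    using finite_same_card_bij[of "UNIV :: 'k set" "B \<union> B'"] fin by auto
  have \<beta>B: "\<beta> i \<in> B \<union> B'" for i using \<beta> by (auto simp: bij_betw_def)
  have ip: "\<beta> i \<bullet> \<beta> j = (if i = j then 1 else 0)" for i j
  proof (cases "i = j")
    case True
    then show ?thesis using \<beta>B[of i] B(3) B'(3) by (auto simp: norm_eq_1)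
  next
    case False
    then have "\<beta> i \<noteq> \<beta> j" using \<beta> by (auto simp: bij_betw_def dest: injD)
    moreover have "x \<bullet> y = 0" if "x \<in> B \<union> B'" "y \<in> B \<union> B'" "x \<noteq> y" for x y
      using that B(1,2) B'(1,2) orth
      by (auto simp: pairwise_def orthogonal_def) (metis inner_commute subsetD)+
    ultimately show ?thesis using \<beta>B False by simp
  qed
  define Q where "Q x = (\<Sum>i\<in>UNIV. x $ i *\<^sub>R \<beta> i)" for x :: "real ^ 'k"
  have "linear Q" unfolding Q_def
    by (intro linearI) (simp_all add: scaleR_add_left sum.distrib scaleR_sum_right)
  moreover have "Q v \<bullet> Q w = v \<bullet> w" for v w
    unfolding Q_def inner_vec_def[of v w] by (simp add: inner_sum_left inner_sum_right ip if_distrib mult.commute cong: if_cong)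
  ultimately have "orthogonal_transformation Q" by (simp add: orthogonal_transformation_def)
  moreover have "Q (axis i 1) = \<beta> i" for i
    unfolding Q_def by (simp add: axis_def if_distrib[of "\<lambda>t. t *\<^sub>R _"] cong: if_cong)
  ultimately show ?thesis
    using \<beta>B B(1) B'(1) by (intro exI[of _ "{i. \<beta> i \<in> B}"] exI[of _ Q]) auto
qed

text \<open>A punctured subspace of dimension at least 2 is connected, and the cone is the
  continuous image of a product of two of them: \<open>\<Psi>\<close> rescales \<open>v\<close> so
  that its length becomes l times that of \<open>u\<close>.\<close>

lemma coordinate_cone_connected:
  fixes I :: "'k::finite set"
  assumes I: "2 \<le> card I" "2 \<le> card (- I)" and l: "0 < l"
  shows "connected {x :: real ^ 'k. x \<noteq> 0 \<and> (\<Sum>i\<in>-I. (x $ i)\<^sup>2) = l\<^sup>2 * (\<Sum>i\<in>I. (x $ i)\<^sup>2)}"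
proof -
  define V1 where "V1 = {x :: real ^ 'k. \<forall>i. i \<notin> I \<longrightarrow> x $ i = 0} - {0}"
  define V2 where "V2 = {x :: real ^ 'k. \<forall>i. i \<notin> - I \<longrightarrow> x $ i = 0} - {0}"
  define \<Psi> where "\<Psi> = (\<lambda>(u, v). u + (l * norm u / norm v) *\<^sub>R v :: real ^ 'k)"
  have "connected (V1 \<times> V2)" unfolding V1_def V2_def
    by (intro connected_Times coordinate_subspace_punctured_connected I)
  moreover have "continuous_on (V1 \<times> V2) \<Psi>"
    unfolding \<Psi>_def split_def by (intro continuous_intros) (auto simp: V2_def)
  ultimately have conn: "connected (\<Psi> ` (V1 \<times> V2))" by (rule connected_continuous_image[rotated])
  have split: "(norm x)\<^sup>2 = (\<Sum>i\<in>I. (x $ i)\<^sup>2) + (\<Sum>i\<in>-I. (x $ i)\<^sup>2)" for x :: "real ^ 'k"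
  proof -
    have "(norm x)\<^sup>2 = (\<Sum>i\<in>I \<union> - I. (x $ i)\<^sup>2)"
      unfolding power2_norm_eq_inner inner_vec_def by (simp add: power2_eq_square)
    also have "\<dots> = (\<Sum>i\<in>I. (x $ i)\<^sup>2) + (\<Sum>i\<in>-I. (x $ i)\<^sup>2)"
      by (rule sum.union_disjoint) auto
    finally show ?thesis .
  qed
  have n1: "(norm u)\<^sup>2 = (\<Sum>i\<in>I. (u $ i)\<^sup>2)" if "u \<in> V1" for u
    using that split[of u] by (simp add: V1_def)
  have n2: "(norm v)\<^sup>2 = (\<Sum>i\<in>-I. (v $ i)\<^sup>2)" if "v \<in> V2" for v
    using that split[of v] by (simp add: V2_def)
  have "\<Psi> ` (V1 \<times> V2) = {x. x \<noteq> 0 \<and> (\<Sum>i\<in>-I. (x $ i)\<^sup>2) = l\<^sup>2 * (\<Sum>i\<in>I. (x $ i)\<^sup>2)}" (is "_ = ?D")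
  proof
    show "\<Psi> ` (V1 \<times> V2) \<subseteq> ?D"
    proof clarify
      fix u v assume u: "u \<in> V1" and v: "v \<in> V2"
      define x where "x = \<Psi> (u, v)"
      have xI: "x $ i = u $ i" if "i \<in> I" for i using that v by (simp add: x_def \<Psi>_def V2_def)
      have xJ: "x $ i = (l * norm u / norm v) * v $ i" if "i \<in> - I" for i
        using that u by (simp add: x_def \<Psi>_def V1_def)
      have sI: "(\<Sum>i\<in>I. (x $ i)\<^sup>2) = (norm u)\<^sup>2" using n1[OF u] xI by simp
      have "(\<Sum>i\<in>-I. (x $ i)\<^sup>2) = (l * norm u / norm v)\<^sup>2 * (norm v)\<^sup>2"
        unfolding n2[OF v] sum_distrib_left using xJ by (intro sum.cong refl) (simp add: power_mult_distrib power_divide)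
      also have "\<dots> = l\<^sup>2 * (norm u)\<^sup>2" using v by (simp add: V2_def power_mult_distrib power_divide)
      finally have "(\<Sum>i\<in>-I. (x $ i)\<^sup>2) = l\<^sup>2 * (\<Sum>i\<in>I. (x $ i)\<^sup>2)" using sI by simp
      moreover have "x \<noteq> 0"
      proof
        assume "x = 0"
        then have "(norm u)\<^sup>2 = 0" using sI by simp
        then show False using u by (simp add: V1_def)
      qed
      ultimately show "\<Psi> (u, v) \<noteq> 0 \<and> (\<Sum>i\<in>-I. (\<Psi> (u, v) $ i)\<^sup>2) = l\<^sup>2 * (\<Sum>i\<in>I. (\<Psi> (u, v) $ i)\<^sup>2)"
        by (simp add: x_def)
    qed
    show "?D \<subseteq> \<Psi> ` (V1 \<times> V2)"
    proof clarify
      fix x :: "real ^ 'k" assume x: "x \<noteq> 0" "(\<Sum>i\<in>-I. (x $ i)\<^sup>2) = l\<^sup>2 * (\<Sum>i\<in>I. (x $ i)\<^sup>2)"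
      define u where "u = (\<chi> i. if i \<in> I then x $ i else 0)"
      define v where "v = (\<chi> i. if i \<in> I then 0 else x $ i)"
      have sI: "(\<Sum>i\<in>I. (u $ i)\<^sup>2) = (\<Sum>i\<in>I. (x $ i)\<^sup>2)" "(\<Sum>i\<in>-I. (u $ i)\<^sup>2) = 0" by (simp_all add: u_def)
      have sJ: "(\<Sum>i\<in>-I. (v $ i)\<^sup>2) = (\<Sum>i\<in>-I. (x $ i)\<^sup>2)" "(\<Sum>i\<in>I. (v $ i)\<^sup>2) = 0" by (simp_all add: v_def)
      have nu: "(norm u)\<^sup>2 = (\<Sum>i\<in>I. (x $ i)\<^sup>2)" unfolding split[of u] sI by simp
      have nv: "(norm v)\<^sup>2 = l\<^sup>2 * (norm u)\<^sup>2" unfolding split[of v] sJ nu using x(2) by simp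
      then have nvu: "norm v = l * norm u"
        using l by (metis norm_ge_zero mult_nonneg_nonneg less_imp_le power2_eq_imp_eq power_mult_distrib)
      have "u \<noteq> 0"
      proof
        assume "u = 0"
        then have "(norm x)\<^sup>2 = 0" using nu x(2) unfolding split[of x] by simp
        then show False using x(1) by simp
      qed
      then have "v \<noteq> 0" using nvu l by (metis mult_eq_0_iff norm_eq_zero less_irrefl)
      have "l * norm u / norm v = 1" using \<open>v \<noteq> 0\<close> unfolding nvu[symmetric] by simp
      then have "x = \<Psi> (u, v)" by (simp only: \<Psi>_def prod.case scaleR_one) (simp add: vec_eq_iff u_def v_def)
      moreover have "u \<in> V1" "v \<in> V2" using \<open>u \<noteq> 0\<close> \<open>v \<noteq> 0\<close> by (auto simp: V1_def V2_def u_def v_def)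
      ultimately show "x \<in> \<Psi> ` (V1 \<times> V2)" by blast
    qed
  qed
  then show ?thesis using conn by simp
qed

text \<open>The eigenvalues of T are the roots l > 0 > m of t^2 = \<kappa> t + 1, so l m = -1 and l
  + m = \<kappa>. If a and b are their multiplicities, the trace condition becomes l^2 (a - 1) = b -
  1. The quadric is |x_J|^2 = l^2 |x_I|^2 in adapted coordinates, so on the unit sphere the squared
  radii are in the ratio (a - 1) : (b - 1), which is that of a Clifford torus.\<close>

lemma quadric_clifford:
  fixes T :: "real ^ 'k::finite ^ 'k"
  assumes sym: "transpose T = T" and sq: "T ** T = \<kappa> *\<^sub>R T + mat 1" and tr: "trace T = \<kappa>"
    and k: "4 \<le> CARD('k)"
  shows "(\<exists>\<Gamma>. clifford_torus \<Gamma> \<and> cone_over \<Gamma> = {z. z \<noteq> 0 \<and> z \<bullet> (T *v z) = 0})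
    \<and> connected {z. z \<noteq> 0 \<and> z \<bullet> (T *v z) = 0}"
proof -
  define l where "l = (\<kappa> + sqrt (\<kappa>\<^sup>2 + 4)) / 2"
  define m where "m = \<kappa> - l"
  have sq4: "sqrt (\<kappa>\<^sup>2 + 4) * sqrt (\<kappa>\<^sup>2 + 4) = \<kappa>\<^sup>2 + 4" by simp
  have l0: "0 < l"
  proof -
    have "\<bar>\<kappa>\<bar> < sqrt (\<kappa>\<^sup>2 + 4)" by (rule real_less_rsqrt) simp
    then show ?thesis by (simp add: l_def)
  qed
  have lm: "l * m = - 1" "l + m = \<kappa>"
    using sq4 by (simp_all add: l_def m_def field_simps power2_eq_square)
  have m0: "m < 0" using lm(1) l0 by (metis mult_nonneg_nonneg less_imp_le not_less neg_less_0_iff_less zero_less_one not_le)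
  define E where "E = {z. T *v z = l *\<^sub>R z}"
  define E' where "E' = {z. T *v z = m *\<^sub>R z}"
  have sE: "subspace E" "subspace E'"
    by (auto simp: E_def E'_def subspace_def matrix_vector_right_distrib scaleR_add_right
        matrix_vector_mult_scaleR scaleR_left_commute)
  have selfadj: "x \<bullet> (T *v y) = (T *v x) \<bullet> y" for x y
    using dot_lmul_matrix[of x T y] sym by (metis matrix_vector_mul_assoc transpose_matrix_vector)
  have orth: "x \<bullet> y = 0" if "x \<in> E" "y \<in> E'" for x y
  proof -
    have "m * (x \<bullet> y) = l * (x \<bullet> y)" using selfadj[of x y] that by (simp add: E_def E'_def)
    then show ?thesis using l0 m0 by auto
  qed
  have TT: "T *v (T *v z) = \<kappa> *\<^sub>R (T *v z) + z" for z
    using arg_cong[OF sq, of "\<lambda>M. M *v z"]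
    by (simp add: matrix_vector_mul_assoc matrix_vector_mult_add_rdistrib scaleR_matrix_vector_assoc)
  have lmd: "l - m \<noteq> 0" using l0 m0 by simp
  have decomp: "\<exists>u\<in>E. \<exists>v\<in>E'. z = u + v" for z
  proof -
    \<comment> \<open>The spectral projections (T - m) / (l - m) and (l - T) / (l - m), applied to
      \<open>z\<close>.\<close>
    define u where "u = (1 / (l - m)) *\<^sub>R (T *v z - m *\<^sub>R z)"
    define v where "v = (1 / (l - m)) *\<^sub>R (l *\<^sub>R z - T *v z)"
    have k1: "T *v (T *v z) = (l + m) *\<^sub>R (T *v z) - (l * m) *\<^sub>R z" by (simp add: TT lm)
    have "T *v u = l *\<^sub>R u"
      by (simp add: u_def matrix_vector_mult_scaleR matrix_vector_mult_diff_distrib k1 algebra_simps)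
    moreover have "T *v v = m *\<^sub>R v"
      by (simp add: v_def matrix_vector_mult_scaleR matrix_vector_mult_diff_distrib k1 algebra_simps)
    moreover have "z = u + v"
    proof -
      have "u + v = (1 / (l - m)) *\<^sub>R ((l - m) *\<^sub>R z)"
        unfolding u_def v_def scaleR_add_right[symmetric] by (simp add: algebra_simps)
      then show ?thesis using lmd by simp
    qed
    ultimately show ?thesis unfolding E_def E'_def by blast
  qed
  have "dim E + dim E' = CARD('k)"
  proof -
    have "E \<inter> E' = {0}"
    proof -
      have "x = 0" if "x \<in> E" "x \<in> E'" for x using orth[OF that] by simp
      then show ?thesis using sE by (auto simp: subspace_0)
    qed
    then have "dim {x + y |x y. x \<in> E \<and> y \<in> E'} = dim E + dim E'"
      using dim_sums_Int[OF sE] by simp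
    moreover have "{x + y |x y. x \<in> E \<and> y \<in> E'} = UNIV" using decomp by blast
    ultimately show ?thesis by simp
  qed
  then obtain I :: "'k set" and Q :: "real ^ 'k \<Rightarrow> real ^ 'k" where Q: "orthogonal_transformation Q"
    "\<And>i. Q (axis i 1) \<in> (if i \<in> I then E else E')"
    using adapted_rotation[OF sE orth] by blast
  have Ql: "linear Q" "bij Q" using orthogonal_transformation_linear[OF Q(1)] orthogonal_transformation_bij[OF Q(1)] .
  define ev where "ev i = (if i \<in> I then l else m)" for i
  have TQ: "T *v Q (axis i 1) = ev i *\<^sub>R Q (axis i 1)" for i
    using Q(2)[of i] by (simp add: ev_def E_def E'_def split: if_splits)
  have Qip: "Q v \<bullet> Q w = v \<bullet> w" for v w using Q(1) by (simp add: orthogonal_transformation_def)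
  have Qx: "Q x = (\<Sum>i\<in>UNIV. x $ i *\<^sub>R Q (axis i 1))" for x
    by (subst basis_expansion[symmetric, of x]) (simp add: linear_sum[OF Ql(1)] linear_cmul[OF Ql(1)] scalar_mult_eq_scaleR)
  have TQx: "T *v Q x = Q (\<chi> i. ev i * x $ i)" for x
    unfolding Qx[of x] Qx[of "\<chi> i. ev i * x $ i"]
    by (simp add: linear_sum[OF matrix_vector_mul_linear] matrix_vector_mult_scaleR TQ mult.commute)
  define SI where "SI x = (\<Sum>i\<in>I. (x $ i)\<^sup>2)" for x :: "real ^ 'k"
  define SJ where "SJ x = (\<Sum>i\<in>-I. (x $ i)\<^sup>2)" for x :: "real ^ 'k"
  have quad: "Q x \<bullet> (T *v Q x) = l * SI x + m * SJ x" for x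
  proof -
    have "Q x \<bullet> (T *v Q x) = (\<Sum>i\<in>I \<union> - I. ev i * (x $ i)\<^sup>2)"
      unfolding TQx Qip unfolding inner_vec_def by (simp add: power2_eq_square mult_ac)
    also have "\<dots> = (\<Sum>i\<in>I. ev i * (x $ i)\<^sup>2) + (\<Sum>i\<in>-I. ev i * (x $ i)\<^sup>2)"
      by (rule sum.union_disjoint) auto
    finally show ?thesis by (simp add: SI_def SJ_def ev_def sum_distrib_left)
  qed
  define a where "a = card I"
  define b where "b = card (- I)"
  have ab: "a + b = CARD('k)" unfolding a_def b_def by (metis Compl_eq_Diff_UNIV card_Diff_subset card_mono finite le_add_diff_inverse subset_UNIV)
  have "l * a + m * b = \<kappa>"
  proof -
    have tQ: "transpose (matrix Q) ** matrix Q = mat 1"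
      using Q(1) orthogonal_transformation_matrix[of Q] by (simp add: orthogonal_matrix)
    have mQ: "matrix Q ** transpose (matrix Q) = mat 1" using tQ matrix_left_right_inverse by blast
    have "trace T = trace (T ** (matrix Q ** transpose (matrix Q)))" by (simp add: mQ)
    also have "\<dots> = trace (transpose (matrix Q) ** (T ** matrix Q))"
      by (simp add: matrix_mul_assoc) (metis matrix_mul_assoc trace_mul_sym)
    also have "\<dots> = (\<Sum>i\<in>UNIV. Q (axis i 1) \<bullet> (T *v Q (axis i 1)))"
    proof -
      have "(transpose (matrix Q) ** (T ** matrix Q)) $ i $ i = Q (axis i 1) \<bullet> (T *v Q (axis i 1))" for i
        by (simp add: matrix_matrix_mult_def transpose_def matrix_def inner_vec_def matrix_vector_mult_def)
      then show ?thesis by (simp add: trace_def)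
    qed
    also have "\<dots> = (\<Sum>i\<in>I \<union> - I. ev i)" by (simp add: TQ Qip)
    also have "\<dots> = (\<Sum>i\<in>I. ev i) + (\<Sum>i\<in>-I. ev i)" by (rule sum.union_disjoint) auto
    finally show ?thesis using tr by (simp add: a_def b_def ev_def mult.commute)
  qed
  \<comment> \<open>The trace is l a + m b, and it equals \<kappa> = l + m.\<close>
  then have "l * (real a - 1) + m * (real b - 1) = 0" using lm(2) by (simp add: algebra_simps)
  then have "l * (l * (real a - 1)) + (l * m) * (real b - 1) = 0" by (simp add: algebra_simps) (metis distrib_left mult_zero_right add.commute)
  then have lab: "l\<^sup>2 * (real a - 1) = real b - 1" by (simp add: lm(1) power2_eq_square)
  have l2: "0 < l\<^sup>2" using l0 by simp
  \<comment> \<open>By l^2 (a - 1) = b - 1 the numbers a - 1 and b - 1 have the same sign or vanish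
    together; a + b \<ge> 4 leaves only the positive case. Thus neither eigenspace is
    degenerate.\<close>
  have "2 \<le> a"
  proof (rule ccontr)
    assume "\<not> 2 \<le> a"
    then consider "a = 0" | "a = 1" by linarith
    then show False
    proof cases
      case 1 then show False using lab l2 ab k by simp
    next
      case 2 then show False using lab ab k by simp
    qed
  qed
  moreover have "2 \<le> b"
  proof -
    have "0 < real b - 1" using lab l2 \<open>2 \<le> a\<close> by (metis mult_pos_pos diff_gt_0_iff_gt of_nat_1 of_nat_less_iff Suc_1 Suc_le_lessD One_nat_def)
    then show ?thesis by linarith
  qed
  ultimately have ab2: "2 \<le> card I" "2 \<le> card (- I)" by (auto simp: a_def b_def)
  define D where "D = {x :: real ^ 'k. x \<noteq> 0 \<and> SJ x = l\<^sup>2 * SI x}"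
  have Q0: "Q x = 0 \<longleftrightarrow> x = 0" for x using Qip[of x x] by (metis inner_eq_zero_iff)
  have D: "{z. z \<noteq> 0 \<and> z \<bullet> (T *v z) = 0} = Q ` D"
  proof -
    have iff: "l * SI x + m * SJ x = 0 \<longleftrightarrow> SJ x = l\<^sup>2 * SI x" for x
    proof -
      have "l * (l * SI x + m * SJ x) = l\<^sup>2 * SI x + (l * m) * SJ x" by (simp add: power2_eq_square algebra_simps)
      then have "l * (l * SI x + m * SJ x) = l\<^sup>2 * SI x - SJ x" by (simp add: lm(1))
      then show ?thesis using l0 by (metis eq_iff_diff_eq_0 less_irrefl mult_eq_0_iff)
    qed
    show ?thesis
    proof
      show "{z. z \<noteq> 0 \<and> z \<bullet> (T *v z) = 0} \<subseteq> Q ` D"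
      proof
        fix z assume z: "z \<in> {z. z \<noteq> 0 \<and> z \<bullet> (T *v z) = 0}"
        obtain x where x: "z = Q x" using Ql(2) by (meson bij_pointE)
        have "x \<in> D" using z unfolding x D_def using quad[of x] iff[of x] Q0[of x] by auto
        then show "z \<in> Q ` D" using x by blast
      qed
      show "Q ` D \<subseteq> {z. z \<noteq> 0 \<and> z \<bullet> (T *v z) = 0}"
      proof clarify
        fix x assume "x \<in> D"
        then show "Q x \<noteq> 0 \<and> Q x \<bullet> (T *v Q x) = 0"
          unfolding quad Q0 iff by (simp add: D_def)
      qed
    qed
  qed
  have "connected D" unfolding D_def SI_def SJ_def by (rule coordinate_cone_connected[OF ab2 l0])
  then have conn: "connected (Q ` D)"
    by (rule connected_continuous_image[rotated]) (rule linear_continuous_on[OF linear_conv_bounded_linear[THEN iffD1, OF Ql(1)]])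
  define n where "n = CARD('k) - 1"
  \<comment> \<open>The sphere in the a-dimensional factor has dimension a - 1, so \<open>mm\<close>
    plays the part of m in the definition of the torus.\<close>
  define mm where "mm = a - 1"
  have nat: "CARD('k) = n + 1" "1 \<le> mm" "mm + 2 \<le> n" "card I = mm + 1"
    using k ab ab2 by (auto simp: n_def mm_def a_def b_def)
  have rn: "real n - 1 = real a + real b - 2" "real mm = real a - 1" "real n - 1 - real mm = real b - 1"
  proof -
    have eq: "n + 1 = a + b" "a = mm + 1" using nat(1,4) ab by (simp_all add: a_def)
    show "real n - 1 = real a + real b - 2" "real mm = real a - 1" "real n - 1 - real mm = real b - 1"
      using arg_cong[OF eq(1), of real] arg_cong[OF eq(2), of real] by simp_all
  qed
  define \<Gamma>0 where "\<Gamma>0 = {x :: real ^ 'k. sqrt (SI x) = sqrt (real mm / (real n - 1)) \<and>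
                    sqrt (SJ x) = sqrt ((real n - 1 - real mm) / (real n - 1))}"
  have cl: "clifford_torus (Q ` \<Gamma>0)"
    unfolding clifford_torus_def \<Gamma>0_def SI_def SJ_def
    using nat Q(1) by (intro exI[of _ n] exI[of _ mm] exI[of _ I] exI[of _ Q] conjI refl)
  have ab1: "0 < real a - 1" "0 < real b - 1" using ab2 by (auto simp: a_def b_def)
  have split: "(norm x)\<^sup>2 = SI x + SJ x" for x :: "real ^ 'k"
  proof -
    have "(norm x)\<^sup>2 = (\<Sum>i\<in>I \<union> - I. (x $ i)\<^sup>2)"
      unfolding power2_norm_eq_inner inner_vec_def by (simp add: power2_eq_square)
    also have "\<dots> = SI x + SJ x" unfolding SI_def SJ_def by (rule sum.union_disjoint) auto
    finally show ?thesis .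
  qed
  have \<Gamma>0: "x \<in> \<Gamma>0 \<longleftrightarrow> norm x = 1 \<and> x \<in> D" for x
  proof -
    have "x \<in> \<Gamma>0 \<longleftrightarrow> SI x = (real a - 1) / (real a + real b - 2) \<and> SJ x = (real b - 1) / (real a + real b - 2)"
      by (simp add: \<Gamma>0_def rn)
    also have "\<dots> \<longleftrightarrow> SI x + SJ x = 1 \<and> SJ x = l\<^sup>2 * SI x"
    proof -
      define A B where "A = real a - 1" and "B = real b - 1"
      have AB: "0 < A" "0 < B" "l\<^sup>2 * A = B" using ab1 lab by (simp_all add: A_def B_def)
      have C: "real a + real b - 2 = A + B" by (simp add: A_def B_def)
      have "SI x = A / (A + B) \<and> SJ x = B / (A + B) \<longleftrightarrow> SI x + SJ x = 1 \<and> SJ x = l\<^sup>2 * SI x"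
      proof
        assume *: "SI x = A / (A + B) \<and> SJ x = B / (A + B)"
        then have "SI x + SJ x = (A + B) / (A + B)" by (simp only: add_divide_distrib)
        moreover have "SJ x = l\<^sup>2 * SI x" using * by (simp flip: AB(3))
        moreover have "A + B \<noteq> 0" using AB by simp
        ultimately show "SI x + SJ x = 1 \<and> SJ x = l\<^sup>2 * SI x" by simp
      next
        assume *: "SI x + SJ x = 1 \<and> SJ x = l\<^sup>2 * SI x"
        have "(A + B) * SI x = A * (SI x + SJ x)" using * by (simp flip: AB(3) add: algebra_simps)
        then have e1: "(A + B) * SI x = A" using * by simp
        have "SI x + SJ x = 1" using * by simp
        then have "(A + B) * SJ x = (A + B) * (1 - SI x)" by simp
        also have "\<dots> = B" using e1 by (simp add: algebra_simps)
        finally have e2: "(A + B) * SJ x = B" .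
        have "A + B \<noteq> 0" using AB by simp
        then show "SI x = A / (A + B) \<and> SJ x = B / (A + B)" using e1 e2 by (simp add: eq_divide_eq mult.commute)
      qed
      then show ?thesis unfolding C A_def B_def .
    qed
    also have "\<dots> \<longleftrightarrow> norm x = 1 \<and> x \<in> D"
    proof -
      have "norm x = 1 \<longleftrightarrow> (norm x)\<^sup>2 = 1" using norm_ge_zero[of x] unfolding power2_eq_1_iff by linarith
      then have "norm x = 1 \<longleftrightarrow> SI x + SJ x = 1" by (simp only: split)
      moreover have "norm x = 1 \<Longrightarrow> x \<noteq> 0" by auto
      ultimately show ?thesis unfolding D_def by auto
    qed
    finally show ?thesis .
  qed
  have scale: "SI (t *\<^sub>R x) = t\<^sup>2 * SI x" "SJ (t *\<^sub>R x) = t\<^sup>2 * SJ x" for t x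
    by (simp_all add: SI_def SJ_def power_mult_distrib sum_distrib_left)
  have Dscale: "t *\<^sub>R x \<in> D" if "x \<in> D" "t \<noteq> 0" for t x
    using that by (simp add: D_def scale)
  have "cone_over (Q ` \<Gamma>0) = Q ` D"
  proof
    show "cone_over (Q ` \<Gamma>0) \<subseteq> Q ` D"
    proof
      fix z assume "z \<in> cone_over (Q ` \<Gamma>0)"
      then obtain t x where tx: "z = t *\<^sub>R Q x" "x \<in> \<Gamma>0" "0 < t" by (auto simp: cone_over_def)
      then have "t *\<^sub>R x \<in> D" using \<Gamma>0 by (intro Dscale) auto
      moreover have "z = Q (t *\<^sub>R x)" using tx(1) linear_cmul[OF Ql(1)] by simp
      ultimately show "z \<in> Q ` D" by blast
    qed
    show "Q ` D \<subseteq> cone_over (Q ` \<Gamma>0)"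
    proof clarify
      fix x assume x: "x \<in> D"
      then have nx: "norm x \<noteq> 0" by (simp add: D_def)
      define y where "y = (1 / norm x) *\<^sub>R x"
      have "y \<in> \<Gamma>0" using Dscale[OF x, of "1 / norm x"] nx unfolding \<Gamma>0 y_def by simp
      moreover have "Q x = norm x *\<^sub>R Q y" using nx by (simp add: y_def linear_cmul[OF Ql(1)])
      ultimately show "Q x \<in> cone_over (Q ` \<Gamma>0)" using nx by (auto simp: cone_over_def intro!: exI[of _ "norm x"])
    qed
  qed
  then show ?thesis using cl conn D by metis
qed

section \<open>The image is a quadratic cone\<close>

text \<open>One form serves both endings: \<open>M\<close> = 0 gives a hyperplane, \<open>a\<close>
  = 0 the quadratic cone.\<close>

definition quad :: "real ^ 'k::finite ^ 'k \<Rightarrow> real ^ 'k \<Rightarrow> real ^ 'k \<Rightarrow> real" where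
  "quad M a z = z \<bullet> (M *v z) + a \<bullet> z"

lemma symmetric_matrix_inner: "transpose M = M \<Longrightarrow> x \<bullet> (M *v y) = y \<bullet> (M *v x)"
  for M :: "real ^ 'k::finite ^ 'k"
  by (metis dot_lmul_matrix inner_commute transpose_matrix_vector)

lemma quad_add:
  fixes M :: "real ^ 'k::finite ^ 'k"
  assumes "transpose M = M"
  shows "quad M a (z + w) = quad M a z + (2 *\<^sub>R (M *v z) + a) \<bullet> w + w \<bullet> (M *v w)"
  using symmetric_matrix_inner[OF assms, of z w]
  by (simp add: quad_def matrix_vector_right_distrib inner_add_left inner_add_right inner_commute)

lemma quad_has_derivative:
  fixes M :: "real ^ 'k::finite ^ 'k"
  assumes M: "transpose M = M"
  shows "(quad M a has_derivative (\<lambda>w. (2 *\<^sub>R (M *v z) + a) \<bullet> w)) (at z)"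
proof -
  have "bounded_linear (\<lambda>v. M *v v)" by simp
  note d = bounded_linear.has_derivative[OF this has_derivative_ident]
  have "(quad M a has_derivative (\<lambda>w. (z \<bullet> (M *v w) + w \<bullet> (M *v z)) + a \<bullet> w)) (at z)"
    unfolding quad_def
    by (intro has_derivative_add has_derivative_inner has_derivative_ident d has_derivative_inner_right)
  then show ?thesis
    using symmetric_matrix_inner[OF M, of z] by (simp add: inner_add_right inner_commute)
qed

lemma quad_continuous: "continuous_on A (quad M a)"
  unfolding quad_def by (intro continuous_intros)

context patch
begin

lemma \<delta>_zero_constant:
  assumes f: "Cinf_on f W" and W: "convex W" and z: "\<And>a x. x \<in> W \<Longrightarrow> \<delta> a f x = 0"
  shows "\<exists>c. \<forall>x\<in>W. f x = c"
proof (rule has_derivative_zero_constant[OF W])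
  fix x assume x: "x \<in> W"
  have "frechet_derivative f (at x) = (\<lambda>h. 0)" using \<delta>_all_zero[OF f x z[OF x]] by blast
  then show "(f has_derivative (\<lambda>h. 0)) (at x within W)"
    using Cinf_on_has_derivative[OF f x] has_derivative_at_withinI by metis
qed

text \<open>The patch lies in the level set; the point is that it fills it locally. Thickening the
  patch by the fixed direction \<nu> x covers a neighbourhood of \<psi> x, by an open mapping
  theorem. Along each segment of the thickening \<open>quad\<close> equals s (c y + s d) with d =
  \<nu> x \<bullet> M \<nu> x, and for small s this vanishes only at s = 0.\<close>

lemma local_level_set:
  assumes x: "x \<in> W" and M: "transpose M = M"
    and zero: "\<And>y. y \<in> W \<Longrightarrow> quad M a (\<psi> y) = 0"
    and grad: "2 *\<^sub>R (M *v \<psi> x) + a \<noteq> 0"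
  shows "\<exists>N. open N \<and> \<psi> x \<in> N \<and> N \<inter> {z. quad M a z = 0} \<subseteq> \<psi> ` W"
proof -
  define G where "G z = 2 *\<^sub>R (M *v z) + a" for z
  define c where "c y = G (\<psi> y) \<bullet> \<nu> x" for y
  define m where "m = \<bar>\<nu> x \<bullet> (M *v \<nu> x)\<bar>"
  have psi': "(\<psi> has_derivative J x) (at x)"
    unfolding J_def by (rule Cinf_on_has_derivative[OF psi_smooth x])
  have "J x v \<bullet> G (\<psi> x) = 0" for v
  proof -
    have d1: "((\<lambda>y. quad M a (\<psi> y)) has_derivative (\<lambda>v. G (\<psi> x) \<bullet> J x v)) (at x)"
      unfolding G_def by (rule has_derivative_compose[OF psi' quad_has_derivative[OF M]])
    have "((\<lambda>y. quad M a (\<psi> y)) has_derivative (\<lambda>v. 0)) (at x)"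
      by (rule has_derivative_transform_within_open[OF has_derivative_const[of 0] open_W x]) (simp add: zero)
    then have "(\<lambda>v. G (\<psi> x) \<bullet> J x v) = (\<lambda>v. 0)" by (rule has_derivative_unique[OF d1])
    then show ?thesis by (metis inner_commute)
  qed
  \<comment> \<open>The gradient of \<open>quad\<close> at \<open>\<psi> x\<close> is normal and
    nonzero, so its component along \<open>\<nu> x\<close> is nonzero.\<close>
  from normal_line[OF J_linear[OF x] J_inj[OF x] card_eq nu_unit[OF x] J_nu[OF x] this]
  have "c x \<noteq> 0" using grad by (auto simp: c_def G_def)
  moreover have cc: "continuous_on W c"
    unfolding c_def G_def
    by (intro continuous_intros continuous_on_compose2[OF matrix_vector_mult_linear_continuous_on[of UNIV M]]
        Cinf_on_continuous[OF psi_smooth]) auto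
  moreover define W' where "W' = W \<inter> (\<lambda>y. \<bar>c y\<bar>) -` {\<bar>c x\<bar> / 2<..}"
  ultimately have W': "open W'" "x \<in> W'"
    using x unfolding W'_def
    by (auto intro!: continuous_open_preimage open_W continuous_on_rabs)
  \<comment> \<open>For |s| < \<open>e\<close> the term s d is smaller than |c x| / 2, hence than |c
    y| on \<open>W'\<close>.\<close>
  define e where "e = \<bar>c x\<bar> / (2 * (m + 1))"
  have m: "0 \<le> m" by (simp add: m_def)
  have e: "0 < e" "e * m < \<bar>c x\<bar> / 2" using \<open>c x \<noteq> 0\<close> m by (auto simp: e_def field_simps)
  define \<Phi> where "\<Phi> = (\<lambda>(y, s). \<psi> y + s *\<^sub>R \<nu> x)"
  \<comment> \<open>A right inverse of the derivative of \<open>\<Phi>\<close> at (x, 0): the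
    tangential part expanded in the frame \<open>Y\<close>, together with the normal
    coordinate.\<close>
  define R where "R z = ((\<Sum>b\<in>UNIV. z $ b *\<^sub>R Y b x), z \<bullet> \<nu> x)" for z
  have d\<Phi>: "(\<Phi> has_derivative (\<lambda>(v, s). J x v + s *\<^sub>R \<nu> x)) (at (x, 0))"
    unfolding \<Phi>_def split_def
    by (auto intro!: derivative_eq_intros has_derivative_compose[of fst fst _ _ \<psi> "J x"] psi' has_derivative_fst has_derivative_ident)
  have R: "bounded_linear R"
    unfolding R_def by (intro bounded_linear_Pair bounded_linear_sum bounded_linear_scaleR_const
      bounded_linear_inner_left bounded_linear_vec_nth)
  have id: "(\<lambda>(v, s). J x v + s *\<^sub>R \<nu> x) \<circ> R = id"
  proof
    fix z
    have "J x (\<Sum>b\<in>UNIV. z $ b *\<^sub>R Y b x) = (\<Sum>b\<in>UNIV. z $ b *\<^sub>R (axis b 1 - \<nu> x $ b *\<^sub>R \<nu> x))"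
      by (simp add: linear_sum[OF J_linear[OF x]] linear_cmul[OF J_linear[OF x]] J_Y[OF x])
    also have "\<dots> = z - (z \<bullet> \<nu> x) *\<^sub>R \<nu> x"
      by (simp add: scaleR_diff_right sum_subtractf inner_vec_def scaleR_sum_left
          basis_expansion[of z, unfolded scalar_mult_eq_scaleR])
    finally show "((\<lambda>(v, s). J x v + s *\<^sub>R \<nu> x) \<circ> R) z = id z" by (simp add: R_def)
  qed
  have cont: "continuous_on (W \<times> UNIV) \<Phi>"
    unfolding \<Phi>_def split_def
    by (intro continuous_intros continuous_on_compose2[OF Cinf_on_continuous[OF psi_smooth]]) auto
  have oT: "open (W' \<times> {- e<..<e})" using W' by (intro open_Times) auto
  have "\<Phi> (x, 0) \<in> interior (\<Phi> ` (W' \<times> {- e<..<e}))"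
  proof (rule sussmann_open_mapping[OF _ cont _ d\<Phi> R id])
    show "open (W \<times> (UNIV :: real set))" using open_W by (intro open_Times) auto
    show "(x, 0) \<in> W \<times> (UNIV :: real set)" using x by simp
    show "W' \<times> {- e<..<e} \<subseteq> W \<times> UNIV" by (auto simp: W'_def)
    show "(x, 0) \<in> interior (W' \<times> {- e<..<e})" using oT W' e by (simp add: interior_open)
  qed
  moreover have "\<Phi> ` (W' \<times> {- e<..<e}) \<inter> {z. quad M a z = 0} \<subseteq> \<psi> ` W"
  proof clarify
    fix y s assume y: "y \<in> W'" and s: "s \<in> {- e<..<e}" and q: "quad M a (\<Phi> (y, s)) = 0"
    have yW: "y \<in> W" using y by (simp add: W'_def)
    have "s * (c y + s * (\<nu> x \<bullet> (M *v \<nu> x))) = 0"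
      using q unfolding \<Phi>_def prod.case quad_add[OF M] zero[OF yW]
      by (simp add: c_def G_def matrix_vector_mult_scaleR algebra_simps)
    moreover have "c y + s * (\<nu> x \<bullet> (M *v \<nu> x)) \<noteq> 0"
    proof
      assume "c y + s * (\<nu> x \<bullet> (M *v \<nu> x)) = 0"
      then have "c y = - (s * (\<nu> x \<bullet> (M *v \<nu> x)))" by linarith
      then have "\<bar>c y\<bar> = \<bar>s\<bar> * m" by (simp add: m_def abs_mult)
      also have "\<dots> \<le> e * m" using s m by (intro mult_right_mono) auto
      finally show False using e(2) y by (simp add: W'_def)
    qed
    ultimately have "s = 0" by simp
    then show "\<Phi> (y, s) \<in> \<psi> ` W" using yW by (simp add: \<Phi>_def)
  qed
  ultimately show ?thesis
    by (intro exI[of _ "interior (\<Phi> ` (W' \<times> {- e<..<e}))"])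
      (use interior_subset in \<open>fastforce simp: \<Phi>_def\<close>)
qed

end

section \<open>The two cases: hyperplane and quadratic cone\<close>

context fb_minimal
begin

text \<open>If \<open>fX\<close> is positive somewhere it attains n - 1. The bound from the inner
  sphere then cannot be smaller than n - 1, so it equals n - 1, and \<open>fX_rigid\<close> spreads
  the value.\<close>

lemma pinching_dichotomy:
  assumes K: "(real n)\<^sup>2 / (4 * r2\<^sup>2) * r1\<^sup>2 \<le> real n - 1"
  shows "(\<forall>p\<in>Xi. fX p = 0) \<or>
    ((real n)\<^sup>2 / (4 * r2\<^sup>2) * r1\<^sup>2 = real n - 1 \<and> (\<forall>p\<in>Xi. fX p = real n - 1))"
proof (cases "\<forall>p\<in>Xi. fX p = 0")
  case False
  then obtain q0 where q0: "q0 \<in> Xi" "0 < fX q0" using fX_nonneg by fastforce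
  have le: "fX p \<le> real n - 1" if "p \<in> Xi" for p using fX_le_inner[OF that] K by linarith
  obtain p where p: "p \<in> Xi" "fX p = real n - 1" using fX_max_point[OF q0 le] by blast
  then have "real n - 1 \<le> (real n)\<^sup>2 / (4 * r2\<^sup>2) * r1\<^sup>2" using fX_le_inner[OF p(1)] by simp
  moreover have "fX q = real n - 1" if "q \<in> Xi" for q by (rule fX_rigid[OF le p that])
  ultimately show ?thesis using K by auto
qed simp

lemma quad_zero_everywhere:
  assumes "\<And>p. p \<in> Xi \<Longrightarrow> quad M a (F p) = 0" and p: "p \<in> topspace X"
  shows "quad M a (F p) = 0"
proof (rule ccontr)
  assume nz: "quad M a (F p) \<noteq> 0"
  have "open {z. quad M a z \<noteq> 0}"
    by (intro open_Collect_neq quad_continuous continuous_intros)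
  then have "openin X {q \<in> topspace X. F q \<in> {z. quad M a z \<noteq> 0}}"
    by (intro openin_continuous_map_preimage[OF F_continuous]) auto
  from Xi_dense[OF p this] nz p assms(1) show False by auto
qed

text \<open>Inside the open annulus the image of the interior is closed, because F(X) is compact and
  boundary points go to the two spheres. It is open by \<open>local_level_set\<close>. The quadric
  there is connected, being radially a product with an interval, so it is covered entirely. Points
  on the spheres are limits along rays.\<close>

lemma quadric_image:
  assumes M: "transpose M = M" and zero: "\<And>p. p \<in> Xi \<Longrightarrow> quad M a (F p) = 0"
    and grad: "\<And>p. p \<in> Xi \<Longrightarrow> 2 *\<^sub>R (M *v F p) + a \<noteq> 0"
    and scale: "\<And>z t. quad M a z = 0 \<Longrightarrow> quad M a (t *\<^sub>R z) = 0"
    and conn: "connected {z. z \<noteq> 0 \<and> quad M a z = 0}"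
  shows "F ` topspace X = {z. quad M a z = 0} \<inter> annulus r1 r2"
proof
  show "F ` topspace X \<subseteq> {z. quad M a z = 0} \<inter> annulus r1 r2"
    using quad_zero_everywhere[OF zero] hyps(7) by auto
  define C where "C = {z. quad M a z = 0 \<and> r1 < norm z \<and> norm z < r2}"
  have Xin: "r1 < norm (F p) \<and> norm (F p) < r2" if "p \<in> Xi" for p
    using interior_radius[OF that] r1_pos r12
    by (simp add: power2_norm_eq_inner[symmetric] power_less_imp_less_base)
  have sub: "F ` Xi \<subseteq> C" using zero Xin by (auto simp: C_def)
  have cpt: "compact (F ` topspace X)"
    using image_compactin[OF _ F_continuous] hyps(1) by (simp add: compact_space_def)
  have "F ` Xi = C \<inter> F ` topspace X"
    using sub Xi_sub boundary_radius by (fastforce simp: C_def)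
  then have cl: "closedin (top_of_set C) (F ` Xi)"
    using cpt compact_imp_closed closedin_closed by metis
  have op: "openin (top_of_set C) (F ` Xi)"
  proof (subst openin_subopen, safe)
    fix p assume p: "p \<in> Xi"
    obtain U \<phi> r \<nu> where P: "p \<in> U" "0 < r" "ipatch U \<phi> (ball (\<phi> p) r) \<nu>" "F p = par U \<phi> (\<phi> p)" by (rule ipatch_at[OF p])
    interpret P: patch "ball (\<phi> p) r" "par U \<phi>" \<nu> using P(3) by (simp add: ipatch_def)
    have pt: "\<exists>q\<in>Xi. par U \<phi> y = F q" if y: "y \<in> ball (\<phi> p) r" for y
    proof -
      obtain q where "q \<in> U" "q \<in> Xi" "\<phi> q = y" "F q = par U \<phi> y" by (rule ipatch_point[OF P(3) y])
      then show ?thesis by metis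
    qed
    have z: "quad M a (par U \<phi> y) = 0" if "y \<in> ball (\<phi> p) r" for y
      using pt[OF that] zero by metis
    have g: "2 *\<^sub>R (M *v par U \<phi> (\<phi> p)) + a \<noteq> 0" using grad[OF p] unfolding P(4) .
    have pW: "\<phi> p \<in> ball (\<phi> p) r" using P by simp
    obtain N where N: "open N" "F p \<in> N" "N \<inter> {z. quad M a z = 0} \<subseteq> par U \<phi> ` ball (\<phi> p) r"
      using P.local_level_set[OF pW M z g] unfolding P(4) by blast
    have "par U \<phi> ` ball (\<phi> p) r \<subseteq> F ` Xi" using pt by blast
    then have "C \<inter> N \<subseteq> F ` Xi" using N(3) by (auto simp: C_def)
    then show "\<exists>T. openin (top_of_set C) T \<and> F p \<in> T \<and> T \<subseteq> F ` Xi"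
      using N(1,2) p sub by (intro exI[of _ "C \<inter> N"]) auto
  qed
  have "connected C"
  proof -
    let ?g = "\<lambda>(z, t). (t / norm z) *\<^sub>R z :: real ^ 'k"
    let ?D = "{z. z \<noteq> 0 \<and> quad M a z = 0} \<times> {r1<..<r2}"
    have "connected (?g ` ?D)"
      by (intro connected_continuous_image connected_Times conn)
        (auto intro!: continuous_intros simp: split_def)
    moreover have "?g ` ?D = C"
    proof
      show "?g ` ?D \<subseteq> C" using scale r1_pos by (auto simp: C_def)
      show "C \<subseteq> ?g ` ?D"
      proof
        fix z assume z: "z \<in> C"
        then have "z \<noteq> 0" using r1_pos by (auto simp: C_def)
        then have "z = ?g (z, norm z)" "(z, norm z) \<in> ?D" using z by (auto simp: C_def)
        then show "z \<in> ?g ` ?D" by (rule image_eqI)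
      qed
    qed
    ultimately show ?thesis by simp
  qed
  then have "F ` Xi = {} \<or> F ` Xi = C" using op cl unfolding connected_clopen by blast
  then have C: "F ` Xi = C" using Xi_nonempty by blast
  show "{z. quad M a z = 0} \<inter> annulus r1 r2 \<subseteq> F ` topspace X"
  proof
    fix z assume z: "z \<in> {z. quad M a z = 0} \<inter> annulus r1 r2"
    then have nz: "r1 \<le> norm z" "norm z \<le> r2" "z \<noteq> 0" using r1_pos by (auto simp: annulus_def)
    define \<rho> where "\<rho> = (r1 + r2) / 2"
    \<comment> \<open>Slides \<open>z\<close> along its ray towards the middle radius \<rho>; for 0
      < u \<le> 1 the point lies strictly between the two spheres.\<close>
    define \<tau> where "\<tau> u = (1 - u) + u * \<rho> / norm z" for u
    define s where "s i = \<tau> (inverse (real (Suc i))) *\<^sub>R z" for i :: nat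
    have "s i \<in> C" for i
    proof -
      define u where "u = inverse (real (Suc i))"
      have u: "0 < u" "u \<le> 1" by (simp_all add: u_def inverse_le_1_iff)
      have "norm (\<tau> u *\<^sub>R z) = \<bar>\<tau> u * norm z\<bar>" by (simp add: abs_mult)
      also have "\<tau> u * norm z = (1 - u) * norm z + u * \<rho>" using nz by (simp add: \<tau>_def field_simps)
      finally have eq: "norm (\<tau> u *\<^sub>R z) = \<bar>(1 - u) * norm z + u * \<rho>\<bar>" .
      have "(1 - u) * r1 + u * r1 < (1 - u) * norm z + u * \<rho>"
        using u nz r12 by (intro add_le_less_mono mult_left_mono mult_strict_left_mono) (auto simp: \<rho>_def)
      moreover have "(1 - u) * norm z + u * \<rho> < (1 - u) * r2 + u * r2"
        using u nz r12 by (intro add_le_less_mono mult_left_mono mult_strict_left_mono) (auto simp: \<rho>_def)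
      ultimately have "r1 < norm (\<tau> u *\<^sub>R z)" "norm (\<tau> u *\<^sub>R z) < r2"
        using r1_pos unfolding eq by (simp_all add: algebra_simps)
      then show ?thesis using scale z unfolding C_def s_def u_def[symmetric] by auto
    qed
    then have "s i \<in> F ` topspace X" for i using C Xi_sub by blast
    moreover have "s \<longlonglongrightarrow> ((1 - 0) + 0 * \<rho> / norm z) *\<^sub>R z"
      unfolding s_def \<tau>_def using nz by (intro tendsto_intros LIMSEQ_inverse_real_of_nat) auto
    then have "s \<longlonglongrightarrow> z" by simp
    ultimately show "z \<in> F ` topspace X"
      using compact_imp_closed[OF cpt] closed_sequentially by blast
  qed
qed

text \<open>Where |A| vanishes the normal of a patch is constant, and \<open>sign_constant\<close>
  yields one vector \<open>a\<close> that is the normal everywhere up to sign. Orthogonality to F is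
  the cone condition, extended to the boundary by density.\<close>

lemma flat_normal:
  assumes f0: "\<And>p. p \<in> Xi \<Longrightarrow> fX p = 0"
  shows "\<exists>a. norm a = 1 \<and> (\<forall>p\<in>topspace X. a \<bullet> F p = 0)"
proof -
  define Q where "Q p t \<longleftrightarrow> (\<exists>U \<phi> W \<nu>. ipatch U \<phi> W \<nu> \<and> p \<in> U \<and> \<phi> p \<in> W \<and> t = \<nu> (\<phi> p))" for p and t :: "real ^ 'k"
  have "\<exists>t. (\<exists>p\<in>Xi. Q p t) \<and> (\<forall>p\<in>Xi. Q p t \<or> Q p (- t))"
  proof (rule sign_constant)
    fix p assume p: "p \<in> Xi"
    obtain U \<phi> r \<nu> where P: "p \<in> U" "0 < r" "ipatch U \<phi> (ball (\<phi> p) r) \<nu>" "F p = par U \<phi> (\<phi> p)" by (rule ipatch_at[OF p])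
    interpret P: patch "ball (\<phi> p) r" "par U \<phi>" \<nu> using P(3) by (simp add: ipatch_def)
    have ch: "(U, \<phi>) \<in> \<A>" using P(3) by (simp add: ipatch_def)
    have S0: "P.S a b y = 0" if y: "y \<in> ball (\<phi> p) r" for a b y
    proof -
      obtain q where q: "q \<in> U" "q \<in> Xi" "\<phi> q = y" "F q = par U \<phi> y" by (rule ipatch_point[OF P(3) y])
      have "F q \<bullet> F q \<noteq> 0" using F_inner[of q] q(2) Xi_sub r1_pos by force
      then have "csq q = 0" using f0[OF q(2)] by (simp add: fX_def)
      then have "P.c2 y = 0" using ipatch_values(1)[OF P(3) q(1)] q(3) y by simp
      then have "(\<Sum>b\<in>UNIV. P.S a b y * P.S a b y) = 0" for a
        unfolding P.c2_def by (subst (asm) sum_nonneg_eq_0_iff) (auto intro: sum_nonneg)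
      from this[of a] show ?thesis by (subst (asm) sum_nonneg_eq_0_iff) auto
    qed
    have "\<exists>c. \<forall>y\<in>ball (\<phi> p) r. \<nu> y $ b = c" for b
      using S0 by (intro P.\<delta>_zero_constant P.nc_smooth convex_ball) (simp add: P.S_def)
    then have c: "\<nu> y = \<nu> (\<phi> p)" if "y \<in> ball (\<phi> p) r" for y
      using that P(2) unfolding vec_eq_iff by (metis centre_in_ball)
    have "Q q (\<nu> (\<phi> p))" if "q \<in> {q \<in> U. \<phi> q \<in> ball (\<phi> p) r}" for q
      unfolding Q_def using that P(3) c
      by (intro exI[of _ U] exI[of _ \<phi>] exI[of _ "ball (\<phi> p) r"] exI[of _ \<nu>]) auto
    then show "\<exists>t N. openin X N \<and> p \<in> N \<and> (\<forall>q\<in>N \<inter> Xi. Q q t)"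
      using chart_preimage[OF ch open_ball, of "\<phi> p" r] P(1,2)
      by (intro exI[of _ "\<nu> (\<phi> p)"] exI[of _ "{q \<in> U. \<phi> q \<in> ball (\<phi> p) r}"]) auto
  next
    fix p t t' assume "Q p t" "Q p t'"
    then obtain U \<phi> W \<nu> U' \<phi>' W' \<nu>' where i: "ipatch U \<phi> W \<nu>" "ipatch U' \<phi>' W' \<nu>'"
      "p \<in> U" "p \<in> U'" "\<phi> p \<in> W" "\<phi>' p \<in> W'" "t = \<nu> (\<phi> p)" "t' = \<nu>' (\<phi>' p)"
      unfolding Q_def by metis
    from ipatch_change[OF i(1-6)] show "t' = t \<or> t' = - t" unfolding i(7,8) by auto
  qed
  then obtain a where a: "\<exists>p\<in>Xi. Q p a" "\<And>p. p \<in> Xi \<Longrightarrow> Q p a \<or> Q p (- a)" by blast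
  have Qa: "norm t = 1 \<and> t \<bullet> F p = 0" if "Q p t" for p t
  proof -
    obtain U \<phi> W \<nu> where i: "ipatch U \<phi> W \<nu>" "p \<in> U" "\<phi> p \<in> W" "t = \<nu> (\<phi> p)"
      using \<open>Q p t\<close> unfolding Q_def by blast
    interpret C: cone_patch W "par U \<phi>" \<nu> by (rule ipatch_cone[OF i(1)])
    have "F p = par U \<phi> (\<phi> p)" using i by (simp add: ipatch_def inv_chart)
    then show ?thesis
      using C.cone[OF i(3)] C.nu_unit[OF i(3)] i(4) by (simp add: inner_commute norm_eq_1)
  qed
  have "quad 0 a (F p) = 0" if "p \<in> topspace X" for p
    by (rule quad_zero_everywhere[OF _ that]) (use a(2) Qa in \<open>force simp: quad_def\<close>)
  moreover have "norm a = 1" using a(1) Qa by blast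
  ultimately show ?thesis by (auto simp: quad_def)
qed

lemma flat_image:
  assumes a: "norm a = 1" "\<And>p. p \<in> topspace X \<Longrightarrow> a \<bullet> F p = 0"
  shows "F ` topspace X = {z. a \<bullet> z = 0} \<inter> annulus r1 r2"
proof -
  have quad: "quad 0 a z = a \<bullet> z" for z by (simp add: quad_def)
  have a0: "a \<noteq> 0" using a(1) by auto
  have t0: "transpose (0 :: real ^ 'k ^ 'k) = 0" by (simp add: transpose_def vec_eq_iff)
  have "{z. z \<noteq> 0 \<and> quad 0 a z = 0} = {z. a \<bullet> z = 0} - {0}" by (auto simp: quad)
  moreover have "connected ({z. a \<bullet> z = 0} - {0})"
  proof (rule connected_punctured_convex)
    show "convex {z. a \<bullet> z = 0}" by (rule convex_hyperplane)
    have "aff_dim {z. a \<bullet> z = 0} = int CARD('k) - 1" using aff_dim_hyperplane[OF a0, of 0] by simp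
    then show "aff_dim {z. a \<bullet> z = 0} \<noteq> 1" using dim_k n_ge by simp
  qed
  ultimately have "F ` topspace X = {z. quad 0 a z = 0} \<inter> annulus r1 r2"
    using a(2) Xi_sub a0 by (intro quadric_image) (auto simp: quad t0)
  then show ?thesis by (simp add: quad)
qed

lemma ipatch_rigid:
  assumes f: "\<And>p. p \<in> Xi \<Longrightarrow> fX p = real n - 1" and i: "ipatch U \<phi> W \<nu>"
  shows "rigid_patch W (par U \<phi>) \<nu>"
proof -
  interpret C: cone_patch W "par U \<phi>" \<nu> by (rule ipatch_cone[OF i])
  show ?thesis
  proof
    fix x assume x: "x \<in> W"
    obtain q where q: "q \<in> U" "q \<in> Xi" "\<phi> q = x" "F q = par U \<phi> x" by (rule ipatch_point[OF i x])
    then show "C.f x = real CARD('n) - 1" using fX_ipatch[OF i q(1)] f[OF q(2)] x dim_n by simp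
  qed (use dim_n n_ge in simp)
qed

text \<open>T is constant on patches by \<open>\<delta>_T\<close>. Reversing \<nu> reverses S and
  \<kappa>, hence T, so \<open>sign_constant\<close> applies. The equation T^2 = (tr T) T + 1 is
  unaffected by the sign, because the trace changes sign as well.\<close>

lemma rigid_matrix:
  assumes f: "\<And>p. p \<in> Xi \<Longrightarrow> fX p = real n - 1"
  shows "\<exists>T. transpose T = T \<and> T ** T = trace T *\<^sub>R T + mat 1 \<and>
    (\<forall>p\<in>Xi. F p \<bullet> (T *v F p) = 0 \<and> T *v F p \<noteq> 0)"
proof -
  note rig = ipatch_rigid[OF f]
  define Q where "Q p T \<longleftrightarrow> (\<exists>U \<phi> W \<nu>. ipatch U \<phi> W \<nu> \<and> p \<in> U \<and> \<phi> p \<in> W \<and>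
     T = (\<chi> a b. rigid_patch.T (par U \<phi>) \<nu> a b (\<phi> p)))" for p and T :: "real ^ 'k ^ 'k"
  have "\<exists>T. (\<exists>p\<in>Xi. Q p T) \<and> (\<forall>p\<in>Xi. Q p T \<or> Q p (- T))"
  proof (rule sign_constant)
    fix p assume p: "p \<in> Xi"
    obtain U \<phi> r \<nu> where P: "p \<in> U" "0 < r" "ipatch U \<phi> (ball (\<phi> p) r) \<nu>" "F p = par U \<phi> (\<phi> p)" by (rule ipatch_at[OF p])
    interpret P: rigid_patch "ball (\<phi> p) r" "par U \<phi>" \<nu> by (rule rig[OF _ P(3)])
    have ch: "(U, \<phi>) \<in> \<A>" using P(3) by (simp add: ipatch_def)
    have "\<exists>c. \<forall>y\<in>ball (\<phi> p) r. P.T a b y = c" for a b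
      by (rule P.\<delta>_zero_constant[OF P.T_smooth convex_ball P.\<delta>_T])
    then have c: "P.T a b y = P.T a b (\<phi> p)" if "y \<in> ball (\<phi> p) r" for a b y
      using that P(2) by (metis centre_in_ball)
    have "Q q (\<chi> a b. P.T a b (\<phi> p))" if "q \<in> {q \<in> U. \<phi> q \<in> ball (\<phi> p) r}" for q
      unfolding Q_def using that P(3) c
      by (intro exI[of _ U] exI[of _ \<phi>] exI[of _ "ball (\<phi> p) r"] exI[of _ \<nu>]) auto
    then show "\<exists>t N. openin X N \<and> p \<in> N \<and> (\<forall>q\<in>N \<inter> Xi. Q q t)"
      using chart_preimage[OF ch open_ball, of "\<phi> p" r] P(1,2)
      by (intro exI[of _ "\<chi> a b. P.T a b (\<phi> p)"] exI[of _ "{q \<in> U. \<phi> q \<in> ball (\<phi> p) r}"]) auto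
  next
    fix p t t' assume "Q p t" "Q p t'"
    then obtain U \<phi> W \<nu> U' \<phi>' W' \<nu>' where i: "ipatch U \<phi> W \<nu>" "ipatch U' \<phi>' W' \<nu>'"
      "p \<in> U" "p \<in> U'" "\<phi> p \<in> W" "\<phi>' p \<in> W'" "t = (\<chi> a b. rigid_patch.T (par U \<phi>) \<nu> a b (\<phi> p))"
      "t' = (\<chi> a b. rigid_patch.T (par U' \<phi>') \<nu>' a b (\<phi>' p))"
      unfolding Q_def by metis
    interpret P: rigid_patch W "par U \<phi>" \<nu> by (rule rig[OF _ i(1)])
    interpret P': rigid_patch W' "par U' \<phi>'" \<nu>' by (rule rig[OF _ i(2)])
    obtain s :: real where s: "s = 1 \<or> s = -1" "\<nu>' (\<phi>' p) = s *\<^sub>R \<nu> (\<phi> p)"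
      "\<And>a b. P'.S a b (\<phi>' p) = s * P.S a b (\<phi> p)"
      using ipatch_change[OF i(1-6)] by blast
    have "(U, \<phi>) \<in> \<A>" "(U', \<phi>') \<in> \<A>" using i by (auto simp: ipatch_def)
    then have x: "par U' \<phi>' (\<phi>' p) = par U \<phi> (\<phi> p)"
      using par_chart i(3,4) by metis
    have r: "P'.r (\<phi>' p) = P.r (\<phi> p)" unfolding P'.r_def P.r_def P'.rr_inner P.rr_inner x ..
    have t3: "P'.t3 (\<phi>' p) = s * P.t3 (\<phi> p)"
      unfolding P'.t3_def P.t3_def P'.S2_def P.S2_def s(3) using s(1)
      by (auto simp: sum_negf)
    have \<kappa>: "P'.\<kappa> (\<phi>' p) = s * P.\<kappa> (\<phi> p)" unfolding P'.\<kappa>_def P.\<kappa>_def r t3 by simp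
    have "P'.T a b (\<phi>' p) = s * P.T a b (\<phi> p)" for a b
      unfolding P'.T_def P.T_def r \<kappa> s(2,3) x using s(1)
      by (auto simp: diff_divide_distrib add_divide_distrib)
    then show "t' = t \<or> t' = - t" using s(1) unfolding i(7,8) by (auto simp: vec_eq_iff)
  qed
  then obtain T where T: "\<exists>p\<in>Xi. Q p T" "\<And>p. p \<in> Xi \<Longrightarrow> Q p T \<or> Q p (- T)" by blast
  have QT: "transpose T = T \<and> T ** T = trace T *\<^sub>R T + mat 1 \<and> F p \<bullet> (T *v F p) = 0 \<and> T *v F p \<noteq> 0"
    if "Q p T" for p T
  proof -
    obtain U \<phi> W \<nu> where i: "ipatch U \<phi> W \<nu>" "p \<in> U" "\<phi> p \<in> W"
      and T: "T = (\<chi> a b. rigid_patch.T (par U \<phi>) \<nu> a b (\<phi> p))"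
      using \<open>Q p T\<close> unfolding Q_def by blast
    interpret P: rigid_patch W "par U \<phi>" \<nu> by (rule rig[OF _ i(1)])
    have Fp: "F p = par U \<phi> (\<phi> p)" using i by (simp add: ipatch_def inv_chart)
    have tr: "trace T = P.\<kappa> (\<phi> p)" unfolding T trace_def using P.T_trace[OF i(3)] by simp
    have TF: "T *v F p = P.r (\<phi> p) *\<^sub>R \<nu> (\<phi> p)"
      unfolding T Fp matrix_vector_mult_def using P.T_xc[OF i(3)] by (simp add: vec_eq_iff)
    have "\<nu> (\<phi> p) \<noteq> 0" using P.nu_unit[OF i(3)] by auto
    then have "T *v F p \<noteq> 0" using P.r_pos[OF i(3)] unfolding TF by simp
    moreover have "F p \<bullet> (T *v F p) = 0" unfolding TF using P.cone[OF i(3)] Fp by simp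
    moreover have "transpose T = T" unfolding T using P.T_sym[OF i(3)] by (simp add: transpose_def vec_eq_iff)
    moreover have "T ** T = trace T *\<^sub>R T + mat 1"
      unfolding tr unfolding T using P.T_square[OF i(3)]
      by (simp add: matrix_matrix_mult_def vec_eq_iff mat_def)
    ultimately show ?thesis by blast
  qed
  have "F p \<bullet> (T *v F p) = 0 \<and> T *v F p \<noteq> 0" if "p \<in> Xi" for p
    using T(2)[OF that]
  proof
    assume "Q p (- T)"
    from QT[OF this] show ?thesis by (simp add: matrix_vector_mult_def vec_eq_iff inner_vec_def sum_negf)
  qed (use QT in blast)
  moreover have "transpose T = T \<and> T ** T = trace T *\<^sub>R T + mat 1" using T(1) QT by blast
  ultimately show ?thesis by blast
qed

lemma rigid_trunk:
  assumes f: "\<And>p. p \<in> Xi \<Longrightarrow> fX p = real n - 1" and n: "3 \<le> n"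
  shows "clifford_cone_trunk r1 r2 X F"
proof -
  obtain T where T: "transpose T = T" "T ** T = trace T *\<^sub>R T + mat 1"
    "\<And>p. p \<in> Xi \<Longrightarrow> F p \<bullet> (T *v F p) = 0 \<and> T *v F p \<noteq> 0"
    using rigid_matrix[OF f] by blast
  have q: "quad T 0 z = z \<bullet> (T *v z)" for z by (simp add: quad_def)
  have k: "4 \<le> CARD('k)" using n dim_k by simp
  obtain \<Gamma> where \<Gamma>: "clifford_torus \<Gamma>" "cone_over \<Gamma> = {z. z \<noteq> 0 \<and> z \<bullet> (T *v z) = 0}"
    and conn: "connected {z. z \<noteq> 0 \<and> z \<bullet> (T *v z) = 0}"
    using quadric_clifford[OF T(1,2) refl k] by blast
  have "F ` topspace X = {z. quad T 0 z = 0} \<inter> annulus r1 r2"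
    using T(3) conn by (intro quadric_image[OF T(1)]) (auto simp: q matrix_vector_mult_scaleR)
  also have "\<dots> = cone_over \<Gamma> \<inter> annulus r1 r2"
    unfolding \<Gamma>(2) using r1_pos by (auto simp: q annulus_def)
  finally show ?thesis using \<Gamma>(1) unfolding clifford_cone_trunk_def by blast
qed

end

section \<open>Coverings of annuli\<close>

text \<open>The number of coordinates of the embedding below depends on a finite subcover and so
  cannot be fixed by a type. Bounded real functions on the naturals form one normed space with room
  for any finite number of coordinates.\<close>

lemma bcontfun_unit_sums:
  obtains \<epsilon> :: "nat \<Rightarrow> nat \<Rightarrow>\<^sub>C real"
  where "\<And>(c :: nat \<Rightarrow> real) I j. finite I \<Longrightarrow> j \<in> I \<Longrightarrow> apply_bcontfun (\<Sum>i\<in>I. c i *\<^sub>R \<epsilon> i) j = c j"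
proof -
  have mem: "(\<lambda>j::nat. if j = i then 1 else 0 :: real) \<in> bcontfun" for i
  proof -
    have "range (\<lambda>j::nat. if j = i then 1 else 0 :: real) \<subseteq> {0..1}" by auto
    then have "bounded (range (\<lambda>j::nat. if j = i then 1 else 0 :: real))"
      using bounded_closed_interval bounded_subset by blast
    then show ?thesis by (auto simp: bcontfun_def)
  qed
  define \<epsilon> :: "nat \<Rightarrow> nat \<Rightarrow>\<^sub>C real" where "\<epsilon> i = Bcontfun (\<lambda>j. if j = i then 1 else 0)" for i
  have app: "apply_bcontfun (\<epsilon> i) j = (if j = i then 1 else 0)" for i j
    unfolding \<epsilon>_def by (simp add: Bcontfun_inverse[OF mem])
  have "apply_bcontfun (\<Sum>i\<in>I. c i *\<^sub>R \<epsilon> i) j = (\<Sum>i\<in>I. c i * (if j = i then 1 else 0))"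
    if "finite I" for c and I :: "nat set" and j
    using that by (induction I) (simp_all add: plus_bcontfun.rep_eq scaleR_bcontfun.rep_eq zero_bcontfun.rep_eq app)
  then have "apply_bcontfun (\<Sum>i\<in>I. c i *\<^sub>R \<epsilon> i) j = c j" if "finite I" "j \<in> I" for c and I :: "nat set" and j
    using that by (simp add: if_distrib cong: if_cong)
  then show thesis using that by blast
qed

text \<open>The covering space theory of the library lives in normed spaces, so a compact space with a
  locally injective map into a normed space is first embedded into a larger one.\<close>

lemma locally_injective_embedding:
  fixes X :: "'p topology" and F :: "'p \<Rightarrow> 'b::topological_space"
  assumes X: "compact_space X" "Hausdorff_space X"
    and inj: "\<And>p. p \<in> topspace X \<Longrightarrow> \<exists>N. openin X N \<and> p \<in> N \<and> inj_on F N"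
  shows "\<exists>e :: 'p \<Rightarrow> nat \<Rightarrow>\<^sub>C real. continuous_map X euclidean e \<and> inj_on (\<lambda>p. (e p, F p)) (topspace X)"
proof -
  have "completely_regular_space X"
    using X compact_Hausdorff_or_regular_imp_normal_space normal_imp_completely_regular_space by blast
  then have ur: "\<exists>f. continuous_map X euclideanreal f \<and> f p = (0::real) \<and> f ` (topspace X - N) \<subseteq> {1}"
    if "openin X N" "p \<in> N" for N p
    using that openin_subset[OF that(1)] unfolding completely_regular_space_def continuous_map_in_subtopology
    by (metis (no_types, lifting) DiffD2 DiffI openin_closedin_eq Diff_Diff_Int Int_absorb1 in_mono)
  have "\<exists>f N. continuous_map X euclideanreal f \<and> f p = (0::real) \<and> f ` (topspace X - N) \<subseteq> {1} \<and> inj_on F N"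
    if "p \<in> topspace X" for p using inj[OF that] ur by metis
  then obtain f N where f: "\<And>p. p \<in> topspace X \<Longrightarrow> continuous_map X euclideanreal (f p) \<and> f p p = (0::real) \<and>
     f p ` (topspace X - N p) \<subseteq> {1} \<and> inj_on F (N p)" by metis
  define M where "M p = {q \<in> topspace X. f p q \<in> {..<1}}" for p
  have M: "openin X (M p)" "p \<in> M p" if "p \<in> topspace X" for p
  proof -
    show "openin X (M p)" unfolding M_def
      using f[OF that] by (intro openin_continuous_map_preimage) auto
    show "p \<in> M p" using f[OF that] that by (simp add: M_def)
  qed
  have "compactin X (topspace X)" using X(1) by (simp add: compact_space_def)
  from compactinD[OF this, of "M ` topspace X"] M
  obtain \<F> where \<F>: "finite \<F>" "\<F> \<subseteq> M ` topspace X" "topspace X \<subseteq> \<Union>\<F>" by blast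
  then obtain D where D: "finite D" "D \<subseteq> topspace X" "\<F> = M ` D"
    using finite_subset_image by metis
  obtain \<iota> :: "'p \<Rightarrow> nat" where \<iota>: "inj_on \<iota> D" using D(1) finite_imp_inj_to_nat_seg by metis
  obtain \<epsilon> :: "nat \<Rightarrow> nat \<Rightarrow>\<^sub>C real" where
    \<epsilon>: "\<And>(c :: nat \<Rightarrow> real) I j. finite I \<Longrightarrow> j \<in> I \<Longrightarrow> apply_bcontfun (\<Sum>i\<in>I. c i *\<^sub>R \<epsilon> i) j = c j"
    using bcontfun_unit_sums by blast
  define e where "e q = (\<Sum>i\<in>\<iota> ` D. f (inv_into D \<iota> i) q *\<^sub>R \<epsilon> i)" for q
  have ev: "apply_bcontfun (e q) (\<iota> d) = f d q" if "d \<in> D" for d q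
    unfolding e_def using \<epsilon>[of "\<iota> ` D" "\<iota> d"] D(1) that \<iota> by simp
  have "continuous_map X euclidean e"
    unfolding e_def
  proof (rule continuous_map_sum)
    fix i assume "i \<in> \<iota> ` D"
    then have "inv_into D \<iota> i \<in> topspace X" using \<iota> D(2) by auto
    then have "continuous_map X euclideanreal (f (inv_into D \<iota> i))" using f by blast
    then have "continuous_map X euclidean ((\<lambda>t. t *\<^sub>R \<epsilon> i) \<circ> f (inv_into D \<iota> i))"
      by (rule continuous_map_compose) (auto intro!: continuous_intros)
    then show "continuous_map X euclidean (\<lambda>q. f (inv_into D \<iota> i) q *\<^sub>R \<epsilon> i)" by (simp add: o_def)
  qed (use D in auto)
  moreover have "inj_on (\<lambda>p. (e p, F p)) (topspace X)"
  proof (rule inj_onI)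
    fix p q assume pq: "p \<in> topspace X" "q \<in> topspace X" "(e p, F p) = (e q, F q)"
    \<comment> \<open>Equality of the coordinates numbered \<open>\<iota> d\<close> forces
      \<open>q\<close> into \<open>N d\<close> as well, since \<open>f d\<close> equals 1 off
      \<open>N d\<close>; on \<open>N d\<close> the map \<open>F\<close> separates points.\<close>
    obtain d where d: "d \<in> D" "p \<in> M d" using \<F>(3) D(3) pq(1) by blast
    have dX: "d \<in> topspace X" using d D(2) by blast
    have lt: "f d p < 1" using d by (simp add: M_def)
    have "f d p = f d q" using ev[OF d(1)] pq(3) by (metis Pair_inject)
    then have "p \<in> N d" "q \<in> N d" using f[OF dX] lt pq by force+
    then show "p = q" using f[OF dX] pq(3) by (auto dest: inj_onD)
  qed
  ultimately show ?thesis by blast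
qed

text \<open>Compactness and local injectivity make every fibre finite. Around its points disjoint
  neighbourhoods \<open>w y\<close> are chosen, on each of which \<open>q\<close> is injective and
  open. A fibre near the given one stays inside their union, because the complement of the union is
  compact and its image can be removed.\<close>

lemma local_homeomorphism_covering_space:
  fixes C :: "'a::metric_space set" and q :: "'a \<Rightarrow> 'b::metric_space"
  assumes C: "compact C" and q: "continuous_on C q" "q ` C = S"
    and loc: "\<And>x. x \<in> C \<Longrightarrow> \<exists>u. openin (top_of_set C) u \<and> x \<in> u \<and> inj_on q u \<and>
      (\<forall>v. openin (top_of_set C) v \<longrightarrow> v \<subseteq> u \<longrightarrow> openin (top_of_set S) (q ` v))"
  shows "covering_space C q S"
proof
  fix x assume x: "x \<in> S"
  obtain u where u: "\<And>y. y \<in> C \<Longrightarrow> openin (top_of_set C) (u y) \<and> y \<in> u y \<and> inj_on q (u y) \<and>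
      (\<forall>v. openin (top_of_set C) v \<longrightarrow> v \<subseteq> u y \<longrightarrow> openin (top_of_set S) (q ` v))"
    using loc by metis
  define D where "D = C \<inter> q -` {x}"
  have "closedin (top_of_set C) D" unfolding D_def
    by (rule continuous_closedin_preimage[OF q(1)]) simp
  then have "compact D" using C closedin_compact by blast
  then have "\<exists>D'\<subseteq>D. finite D' \<and> D \<subseteq> (\<Union>y\<in>D'. u y)"
  proof -
    have "\<exists>V. open V \<and> u y = C \<inter> V" if "y \<in> D" for y
      using u[of y] that by (auto simp: D_def openin_open)
    then obtain V where V: "\<And>y. y \<in> D \<Longrightarrow> open (V y) \<and> u y = C \<inter> V y" by metis
    have "D \<subseteq> (\<Union>y\<in>D. V y)" using V u by (fastforce simp: D_def)
    then obtain D' where "D' \<subseteq> D" "finite D'" "D \<subseteq> (\<Union>y\<in>D'. V y)"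
      using compactE_image[OF \<open>compact D\<close>, of D V] V by blast
    moreover have "D \<subseteq> (\<Union>y\<in>D'. u y)"
    proof
      fix z assume z: "z \<in> D"
      then obtain y where y: "y \<in> D'" "z \<in> V y" using \<open>D \<subseteq> (\<Union>y\<in>D'. V y)\<close> by blast
      then have "u y = C \<inter> V y" using V \<open>D' \<subseteq> D\<close> by blast
      then show "z \<in> (\<Union>y\<in>D'. u y)" using y z by (auto simp: D_def)
    qed
    ultimately show ?thesis by (intro exI[of _ D'] conjI)
  qed
  then obtain D' where D': "D' \<subseteq> D" "finite D'" "D \<subseteq> (\<Union>y\<in>D'. u y)" by blast
  have "D \<subseteq> D'"
  proof
    fix y assume y: "y \<in> D"
    then obtain y' where y': "y' \<in> D'" "y \<in> u y'" using D'(3) by blast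
    then have "y' \<in> C" "q y = q y'" using D'(1) y by (auto simp: D_def)
    then have "y = y'" using u[of y'] y'(2) by (auto dest: inj_onD)
    then show "y \<in> D'" using y' by simp
  qed
  then have fin: "finite D" using D'(2) finite_subset by blast
  have "uniform_discrete A" if "finite A" for A :: "'a set"
    using that by (induction rule: finite_induct) (simp_all add: uniform_discrete_insert)
  from this[OF fin] obtain e where e: "0 < e" "\<And>y y'. y \<in> D \<Longrightarrow> y' \<in> D \<Longrightarrow> dist y y' < e \<Longrightarrow> y = y'"
    unfolding uniform_discrete_def by blast
  define d where "d = e / 2"
  have d: "0 < d" "\<And>y y'. y \<in> D \<Longrightarrow> y' \<in> D \<Longrightarrow> y \<noteq> y' \<Longrightarrow> 2 * d \<le> dist y y'"
    using e unfolding d_def by force+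
  define w where "w y = u y \<inter> ball y d" for y
  have w: "openin (top_of_set C) (w y)" "y \<in> w y" "w y \<subseteq> u y" if "y \<in> D" for y
    using u[of y] that d(1) by (auto simp: w_def D_def intro: openin_Int_open)
  have disj: "w y \<inter> w y' = {}" if "y \<in> D" "y' \<in> D" "y \<noteq> y'" for y y'
  proof (rule ccontr)
    assume "\<not> ?thesis"
    then obtain z where "dist y z < d" "dist y' z < d" by (auto simp: w_def)
    then have "dist y y' < 2 * d" using dist_triangle2[of y y' z] by linarith
    then show False using d(2)[OF that] by simp
  qed
  have Dne: "D \<noteq> {}" using x q(2) by (auto simp: D_def)
  \<comment> \<open>The evenly covered neighbourhood: points hit from every sheet \<open>w y\<close>
    and by nothing outside the sheets.\<close>
  define T where "T = (\<Inter>y\<in>D. q ` w y) - q ` (C - (\<Union>y\<in>D. w y))"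
  have wS: "openin (top_of_set S) (q ` w y)" if "y \<in> D" for y
    using u[of y] w[OF that] that by (auto simp: D_def)
  have "openin (top_of_set C) (\<Union>y\<in>D. w y)" using w by blast
  then have "closedin (top_of_set C) (C - (\<Union>y\<in>D. w y))" by (simp add: closedin_diff)
  then have "compact (C - (\<Union>y\<in>D. w y))" using C closedin_compact by blast
  then have "compact (q ` (C - (\<Union>y\<in>D. w y)))"
    using q(1) by (meson Diff_subset compact_continuous_image continuous_on_subset)
  then have "closedin (top_of_set S) (q ` (C - (\<Union>y\<in>D. w y)))"
    using q(2) by (intro closed_subset compact_imp_closed) auto
  then have T: "openin (top_of_set S) T"
    unfolding T_def using wS fin Dne by (intro openin_diff openin_INT2) auto
  have xT: "x \<in> T"
  proof -
    have "x \<in> q ` w y" if "y \<in> D" for y using w(2)[OF that] that by (force simp: D_def)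
    moreover have "x \<notin> q ` (C - (\<Union>y\<in>D. w y))" using w(2) by (auto simp: D_def)
    ultimately show ?thesis by (simp add: T_def)
  qed
  define v where "v = (\<lambda>y. w y \<inter> q -` T) ` D"
  have wC: "w y \<subseteq> C" if "y \<in> D" for y using w(1)[OF that] openin_imp_subset by blast
  have o: "openin (top_of_set C) (w y \<inter> q -` T)" if "y \<in> D" for y
  proof -
    have "openin (top_of_set C) (C \<inter> q -` T)"
      using q T by (intro continuous_openin_preimage) auto
    then have "openin (top_of_set C) (w y \<inter> (C \<inter> q -` T))" using w(1)[OF that] by blast
    moreover have "w y \<inter> (C \<inter> q -` T) = w y \<inter> q -` T" using wC[OF that] by blast
    ultimately show ?thesis by simp
  qed
  have "\<Union> v = C \<inter> q -` T"
    using wC by (auto simp: v_def T_def)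
  moreover have "pairwise disjnt v"
    using disj by (fastforce simp: v_def pairwise_def disjnt_def)
  moreover have "\<exists>r. homeomorphism (w y \<inter> q -` T) T q r" if y: "y \<in> D" for y
  proof -
    have "T \<subseteq> q ` w y" using y by (auto simp: T_def)
    then have "q ` (w y \<inter> q -` T) = T" by blast
    moreover have "continuous_on (w y \<inter> q -` T) q"
      using q(1) wC[OF y] by (meson continuous_on_subset inf.coboundedI1)
    moreover have "inj_on q (w y \<inter> q -` T)"
      using u[of y] w(3)[OF y] y by (auto simp: D_def intro: inj_on_subset)
    moreover have "openin (top_of_set T) (q ` O')" if "openin (top_of_set (w y \<inter> q -` T)) O'" for O'
    proof -
      have "openin (top_of_set C) O'" using openin_trans[OF that o[OF y]] .
      moreover have O': "O' \<subseteq> w y \<inter> q -` T" using that openin_imp_subset by blast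
      ultimately have "openin (top_of_set S) (q ` O')" using u[of y] w(3)[OF y] y by (auto simp: D_def)
      moreover have "q ` O' \<subseteq> T" using O' by blast
      ultimately show ?thesis using openin_imp_subset[OF T] by (rule openin_subset_trans)
    qed
    ultimately show ?thesis using homeomorphism_injective_open_map by metis
  qed
  ultimately show "\<exists>T. x \<in> T \<and> openin (top_of_set S) T \<and>
     (\<exists>v. \<Union>v = C \<inter> q -` T \<and> (\<forall>u\<in>v. openin (top_of_set C) u) \<and> pairwise disjnt v \<and> (\<forall>u\<in>v. \<exists>r. homeomorphism u T q r))"
    using xT T o by (intro exI[of _ T] conjI exI[of _ v]) (auto simp: v_def)
qed (use q in auto)

text \<open>In dimension at least 3 the annulus is simply connected, being the product of a sphere
  and an interval in polar coordinates. The inclusion lifts to a section \<open>g\<close> through a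
  prescribed point, and by uniqueness of lifts on the connected space \<open>C\<close> the composite
  of \<open>q\<close> and the section is the identity.\<close>

lemma covering_annulus_injective:
  fixes C :: "'a::real_normed_vector set" and q :: "'a \<Rightarrow> 'b::euclidean_space"
  assumes C: "connected C" and dim: "3 \<le> DIM('b)" and r: "0 < r1"
    and cov: "covering_space C q (cball 0 r2 - ball 0 r1)"
  shows "inj_on q C"
proof (rule inj_onI)
  fix x y assume xy: "x \<in> C" "y \<in> C" "q x = q y"
  define U where "U = sphere (0::'b) 1 \<times> {r1..r2}"
  define f where "f = (\<lambda>(z, t). t *\<^sub>R z :: 'b)"
  define P where "P w = ((1 / norm w) *\<^sub>R w, norm w)" for w :: 'b
  have P: "P w \<in> U" "f (P w) = w" if "w \<in> cball 0 r2 - ball 0 r1" for w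
    using that r by (auto simp: P_def U_def f_def)
  have qC: "q z \<in> cball 0 r2 - ball 0 r1" if "z \<in> C" for z
    using covering_space_imp_surjective[OF cov] that by blast
  have "locally path_connected U" unfolding U_def
    by (rule locally_Times[where P = path_connected and Q = path_connected])
      (auto intro: locally_path_connected_sphere convex_imp_locally_path_connected path_connected_Times)
  moreover have "simply_connected U" unfolding U_def
    using dim by (intro simply_connected_Times simply_connected_sphere convex_imp_simply_connected) auto
  moreover have "continuous_on U f" unfolding f_def split_def by (intro continuous_intros)
  moreover have "f \<in> U \<rightarrow> cball 0 r2 - ball 0 r1" using r by (auto simp: f_def U_def)
  ultimately obtain g where g: "continuous_on U g" "g \<in> U \<rightarrow> C" "g (P (q x)) = x" "\<And>y. y \<in> U \<Longrightarrow> q (g y) = f y"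
    using covering_space_lift_strong[OF cov xy(1) P(1)[OF qC[OF xy(1)]], of f] P(2)[OF qC[OF xy(1)]] by metis
  have qc: "continuous_on C q" by (rule covering_space_imp_continuous[OF cov])
  have "continuous_on C (\<lambda>z. P (q z))" unfolding P_def
    by (intro continuous_intros qc) (use qC r in force)
  then have G: "continuous_on C (\<lambda>z. g (P (q z)))"
    by (rule continuous_on_compose2[OF g(1)]) (use P qC in auto)
  have 1: "q \<in> C \<rightarrow> cball 0 r2 - ball 0 r1" using qC by blast
  have 2: "(\<lambda>z. g (P (q z))) \<in> C \<rightarrow> C" using g(2) P(1) qC by blast
  have 3: "q z = q (g (P (q z)))" if "z \<in> C" for z using g(4) P qC[OF that] by metis
  have "g (P (q y)) = y"
    by (rule covering_space_lift_unique[OF cov g(3) qc 1 G 2 3 continuous_on_id _ _ C xy(1,2)]) auto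
  then show "x = y" using g(3) xy(3) by simp
qed

text \<open>A connected compact covering of a planar annulus is the \<open>m\<close>-fold one: the lift \<open>g\<close> of the
  exponential map has a minimal period \<open>2 \<pi> m\<close>, and \<open>exp (Re z + \<i> Im z / m)\<close> has the same fibres as \<open>g\<close>.\<close>

lemma covering_planar_annulus:
  fixes C :: "'a::real_normed_vector set" and q :: "'a \<Rightarrow> complex"
  assumes C: "compact C" "connected C" and r: "0 < r1" "r1 < r2"
    and cov: "covering_space C q (cball 0 r2 - ball 0 r1)"
  shows "\<exists>h. continuous_on C h \<and> h ` C = (cball 0 r2 - ball 0 r1 :: complex set) \<and> inj_on h C"
proof -
  define A where "A = (cball 0 r2 - ball 0 r1 :: complex set)"
  have A_iff: "w \<in> A \<longleftrightarrow> r1 \<le> norm w \<and> norm w \<le> r2" for w by (auto simp: A_def)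
  note cov = cov[folded A_def]
  \<comment> \<open>The closed strip, the universal cover of the annulus under exp.\<close>
  define \<Sigma> where "\<Sigma> = {z. ln r1 \<le> Re z \<and> Re z \<le> ln r2}"
  have S_exp: "z \<in> \<Sigma> \<longleftrightarrow> exp z \<in> A" for z
  proof -
    have "ln r1 \<le> Re z \<longleftrightarrow> r1 \<le> exp (Re z)" using r by (metis exp_le_cancel_iff exp_ln)
    moreover have "Re z \<le> ln r2 \<longleftrightarrow> exp (Re z) \<le> r2" using r by (metis exp_le_cancel_iff exp_ln order_less_trans)
    ultimately show ?thesis by (simp add: \<Sigma>_def A_iff)
  qed
  have "convex \<Sigma>" unfolding \<Sigma>_def
    by (auto intro!: convex_Int convex_halfspace_Re_ge convex_halfspace_Re_le simp: Collect_conj_eq)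
  then have \<Sigma>: "simply_connected \<Sigma>" "locally path_connected \<Sigma>" "connected \<Sigma>"
    by (auto intro: convex_imp_simply_connected convex_imp_locally_path_connected convex_connected)
  have ce: "continuous_on \<Sigma> exp" by (intro continuous_intros)
  have ea: "exp \<in> \<Sigma> \<rightarrow> A" using S_exp by blast
  obtain g where g: "continuous_on \<Sigma> g" "g \<in> \<Sigma> \<rightarrow> C" "\<And>z. z \<in> \<Sigma> \<Longrightarrow> q (g z) = exp z"
    using covering_space_lift[OF cov \<Sigma>(1,2) ce ea] by blast
  define \<tau> where "\<tau> k z = z + 2 * of_int k * of_real pi * \<i>" for k :: int and z :: complex
  have \<tau>\<Sigma>: "\<tau> k z \<in> \<Sigma> \<longleftrightarrow> z \<in> \<Sigma>" for k z by (simp add: \<tau>_def \<Sigma>_def)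
  have exp_eq: "exp z' = exp z \<longleftrightarrow> (\<exists>k. z' = \<tau> k z)" for z z'
    unfolding exp_eq \<tau>_def by (simp add: mult_ac)
  have \<tau>_add: "\<tau> (k + l) z = \<tau> k (\<tau> l z)" for k l z by (simp add: \<tau>_def algebra_simps)
  have \<tau>0: "\<tau> 0 z = z" for z by (simp add: \<tau>_def)
  define P where "P k \<longleftrightarrow> (\<forall>z\<in>\<Sigma>. g (\<tau> k z) = g z)" for k
  \<comment> \<open>Both \<open>g\<close> and its translate are lifts of exp, so agreement at one
    point implies agreement on the connected strip.\<close>
  have agree: "P k" if z: "z \<in> \<Sigma>" "g (\<tau> k z) = g z" for k z
    unfolding P_def
  proof
    fix z' assume z': "z' \<in> \<Sigma>"
    have "continuous_on \<Sigma> (\<lambda>z. \<tau> k z)" unfolding \<tau>_def by (intro continuous_intros)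
    then have c: "continuous_on \<Sigma> (\<lambda>z. g (\<tau> k z))"
      by (rule continuous_on_compose2[OF g(1)]) (use \<tau>\<Sigma> in blast)
    have m: "(\<lambda>z. g (\<tau> k z)) \<in> \<Sigma> \<rightarrow> C" using g(2) \<tau>\<Sigma> by blast
    have e: "exp z = q (g (\<tau> k z))" if "z \<in> \<Sigma>" for z
    proof -
      have "exp (\<tau> k z) = exp z" unfolding exp_eq by blast
      then show ?thesis using g(3)[of "\<tau> k z"] that \<tau>\<Sigma> by simp
    qed
    show "g (\<tau> k z') = g z'"
      by (rule covering_space_lift_unique[OF cov z(2) ce ea c m e g(1,2) g(3)[symmetric] \<Sigma>(3) z(1) z'])
  qed
  have P_diff: "P (k - l)" if "P k" "P l" for k l
    unfolding P_def
  proof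
    fix z assume z: "z \<in> \<Sigma>"
    define z' where "z' = \<tau> (- l) z"
    have z': "z' \<in> \<Sigma>" "\<tau> l z' = z" using z by (simp_all add: z'_def \<tau>\<Sigma> \<tau>_add[symmetric] \<tau>0)
    have "g (\<tau> (k - l) z) = g (\<tau> k z')" unfolding z'_def \<tau>_add[symmetric] by simp
    also have "\<dots> = g (\<tau> l z')" using that z'(1) unfolding P_def by metis
    finally show "g (\<tau> (k - l) z) = g z" using z' by simp
  qed
  have P0: "P 0" by (simp add: P_def \<tau>0)
  have P_neg: "P (- k)" if "P k" for k using P_diff[OF P0 that] by simp
  have P_add: "P (k + l)" if "P k" "P l" for k l using P_diff[OF that(1) P_neg[OF that(2)]] by simp
  have P_mult: "P (c * k)" if "P k" for c k
  proof -
    have "P (int j * k)" for j by (induction j) (use P0 P_add that in \<open>auto simp: distrib_right add.commute\<close>)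
    then show ?thesis using P_neg by (cases c rule: int_cases2) (simp, metis minus_mult_left)
  qed
  \<comment> \<open>The points \<open>y i\<close> all lie in one fibre and accumulate by
    compactness. The sheet \<open>u\<close> around the limit maps injectively, so two of them
    coincide, and \<open>agree\<close> turns this into a period.\<close>
  have "\<exists>m::nat. 0 < m \<and> P (int m)"
  proof -
    define z0 where "z0 = complex_of_real (ln r1)"
    have z0: "z0 \<in> \<Sigma>" using r by (simp add: z0_def \<Sigma>_def)
    define y where "y i = g (\<tau> (int i) z0)" for i
    have yC: "y i \<in> C" "q (y i) = exp z0" for i
    proof -
      have s: "\<tau> (int i) z0 \<in> \<Sigma>" using z0 \<tau>\<Sigma> by blast
      then show "y i \<in> C" using g(2) by (auto simp: y_def)
      have "exp (\<tau> (int i) z0) = exp z0" unfolding exp_eq by blast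
      then show "q (y i) = exp z0" using g(3)[OF s] by (simp add: y_def)
    qed
    obtain l r' where l: "l \<in> C" "strict_mono r'" "(y \<circ> r') \<longlonglongrightarrow> l"
      using C(1) yC(1) unfolding compact_def by metis
    have "q l \<in> A" using covering_space_imp_surjective[OF cov] l(1) by blast
    then obtain T v where T: "q l \<in> T" "\<Union>v = C \<inter> q -` T" "\<forall>u\<in>v. openin (top_of_set C) u"
      "\<forall>u\<in>v. \<exists>s. homeomorphism u T q s"
      using cov unfolding covering_space_def by metis
    then obtain u where u: "u \<in> v" "l \<in> u" using l(1) by blast
    obtain V where V: "open V" "u = C \<inter> V" using T(3) u(1) by (auto simp: openin_open)
    have "\<forall>\<^sub>F i in sequentially. (y \<circ> r') i \<in> V"
      by (rule topological_tendstoD[OF l(3) V(1)]) (use V u in blast)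
    then obtain N where N: "\<And>i. N \<le> i \<Longrightarrow> y (r' i) \<in> V" by (auto simp: eventually_sequentially)
    have "y (r' N) \<in> u" "y (r' (Suc N)) \<in> u" using N V yC by auto
    moreover have "inj_on q u"
      using T(4) u(1) unfolding homeomorphism_def by (metis inj_on_inverseI)
    ultimately have eq: "y (r' (Suc N)) = y (r' N)" using inj_onD yC(2) by metis
    have lt: "r' N < r' (Suc N)" using l(2) by (simp add: strict_mono_def)
    define m where "m = r' (Suc N) - r' N"
    have "\<tau> (int (r' (Suc N))) z0 = \<tau> (int m) (\<tau> (int (r' N)) z0)"
      unfolding \<tau>_add[symmetric] m_def using lt by (simp add: of_nat_diff)
    then have "P (int m)"
      using eq z0 \<tau>\<Sigma> by (intro agree[of "\<tau> (int (r' N)) z0"]) (auto simp: y_def)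
    then show ?thesis using lt by (intro exI[of _ m]) (auto simp: m_def)
  qed
  then obtain m0 where m0: "0 < m0 \<and> P (int m0)" by blast
  define m where "m = (LEAST m::nat. 0 < m \<and> P (int m))"
  have m: "0 < m" "P (int m)" using LeastI[of "\<lambda>m. 0 < m \<and> P (int m)", OF m0] by (simp_all add: m_def)
  have m_le: "m \<le> j" if "0 < j" "P (int j)" for j
    unfolding m_def using that by (intro Least_le) blast
  \<comment> \<open>The periods form a subgroup of the integers, generated by its least positive
    element.\<close>
  have P_iff: "P k \<longleftrightarrow> (\<exists>c. k = c * int m)" for k
  proof
    assume "P k"
    then have "P (k - k div int m * int m)" using P_diff P_mult[OF m(2)] by blast
    then have Pm: "P (k mod int m)" by (simp add: minus_div_mult_eq_mod)
    have "k mod int m = 0"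
    proof (rule ccontr)
      assume nz: "k mod int m \<noteq> 0"
      have b: "0 \<le> k mod int m" "k mod int m < int m" using m(1) by simp_all
      then have "m \<le> nat (k mod int m)" using nz Pm by (intro m_le) auto
      then show False using b by linarith
    qed
    then have "k = (k div int m) * int m" using div_mult_mod_eq[of k "int m"] by simp
    then show "\<exists>c. k = c * int m" by blast
  qed (use P_mult m(2) in blast)
  have g_fib: "g z' = g z \<longleftrightarrow> (\<exists>c. z' = \<tau> (c * int m) z)" if z: "z \<in> \<Sigma>" "z' \<in> \<Sigma>" for z z'
  proof
    assume eq: "g z' = g z"
    then have "exp z' = exp z" using g(3) z by metis
    then obtain k where k: "z' = \<tau> k z" unfolding exp_eq by blast
    then have "P k" using agree[OF z(1)] eq by simp
    then show "\<exists>c. z' = \<tau> (c * int m) z" using k P_iff by auto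
  next
    assume "\<exists>c. z' = \<tau> (c * int m) z"
    then show "g z' = g z" using P_iff z(1) unfolding P_def by blast
  qed
  define k where "k z = exp (Complex (Re z) (Im z / real m))" for z
  have k_fib: "k z' = k z \<longleftrightarrow> (\<exists>c. z' = \<tau> (c * int m) z)" for z z'
    unfolding k_def exp_eq \<tau>_def using m(1)
    by (auto simp: complex_eq_iff field_simps)
  \<comment> \<open>A fundamental rectangle with both horizontal edges kept: it is compact, which
    makes \<open>g\<close> restricted to it a quotient map.\<close>
  define K where "K = cbox (Complex (ln r1) 0) (Complex (ln r2) (2 * pi * real m))"
  have K: "z \<in> K \<longleftrightarrow> z \<in> \<Sigma> \<and> 0 \<le> Im z \<and> Im z \<le> 2 * pi * real m" for z
    by (auto simp: K_def \<Sigma>_def in_cbox_complex_iff)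
  have shift: "\<exists>c. \<tau> (c * int m) z \<in> K" if z: "z \<in> \<Sigma>" for z
  proof -
    define L where "L = 2 * pi * real m"
    have L: "0 < L" using m(1) by (simp add: L_def)
    define c where "c = - \<lfloor>Im z / L\<rfloor>"
    have "Im (\<tau> (c * int m) z) = Im z + of_int c * L" by (simp add: \<tau>_def L_def)
    also have "\<dots> = L * frac (Im z / L)" using L by (simp add: c_def frac_def field_simps)
    finally have "0 \<le> Im (\<tau> (c * int m) z) \<and> Im (\<tau> (c * int m) z) \<le> L"
      using L frac_ge_0[of "Im z / L"] frac_lt_1[of "Im z / L"] by (simp add: mult_left_le)
    then show ?thesis using z \<tau>\<Sigma> by (intro exI[of _ c]) (auto simp: K L_def)
  qed
  have K\<Sigma>: "K \<subseteq> \<Sigma>" using K by blast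
  have gK: "g ` K = g ` \<Sigma>"
  proof
    show "g ` \<Sigma> \<subseteq> g ` K"
    proof clarify
      fix z assume z: "z \<in> \<Sigma>"
      then obtain c where "\<tau> (c * int m) z \<in> K" using shift by blast
      then show "g z \<in> g ` K" using g_fib[OF z, of "\<tau> (c * int m) z"] K\<Sigma> by (metis image_eqI subsetD)
    qed
  qed (use K\<Sigma> in blast)
  have gKc: "compact (g ` K)"
    by (intro compact_continuous_image continuous_on_subset[OF g(1)] K\<Sigma>) (simp add: K_def compact_cbox)
  have gC: "g ` K = C"
  proof -
    have sub: "g ` K \<subseteq> C" using g(2) K\<Sigma> by blast
    have "closedin (top_of_set C) (g ` K)" using gKc sub compact_imp_closed closed_subset by metis
    \<comment> \<open>A branch \<open>\<sigma>\<close> of the logarithm followed by \<open>g\<close>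
      is a local inverse of \<open>q\<close> through \<open>y\<close>. Inside a sheet on which
      \<open>q\<close> is injective, all points near \<open>y\<close> are therefore values of
      \<open>g\<close>.\<close>
    moreover have "openin (top_of_set C) (g ` K)"
    proof (subst openin_subopen, intro ballI)
      fix y assume "y \<in> g ` K"
      then obtain z0 where z0: "z0 \<in> \<Sigma>" "y = g z0" using K\<Sigma> by blast
      define x where "x = exp z0"
      have xA: "x \<in> A" using z0(1) S_exp by (simp add: x_def)
      then obtain T v where T: "x \<in> T" "openin (top_of_set A) T" "\<Union>v = C \<inter> q -` T"
        "\<forall>u\<in>v. openin (top_of_set C) u" "\<forall>u\<in>v. \<exists>s. homeomorphism u T q s"
        using cov unfolding covering_space_def by metis
      have "y \<in> C" "q y = x" using g(2,3) z0 by (auto simp: x_def)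
      then obtain u where u: "u \<in> v" "y \<in> u" using T(1,3) by blast
      have inju: "inj_on q u" using T(5) u(1) unfolding homeomorphism_def by (metis inj_on_inverseI)
      have uo: "openin (top_of_set C) u" using T(4) u(1) by blast
      define \<sigma> where "\<sigma> w = z0 + Ln (w / x)" for w
      define D where "D = A \<inter> (\<lambda>w. w / x) -` ball 1 1"
      have Dp: "w / x \<notin> \<real>\<^sub>\<le>\<^sub>0" "w / x \<noteq> 0" if "w \<in> D" for w
      proof -
        have "dist 1 (w / x) < 1" using that by (simp add: D_def)
        then have "\<bar>Re (1 - w / x)\<bar> < 1" using abs_Re_le_cmod[of "1 - w / x"] by (simp add: dist_norm)
        then have "0 < Re (w / x)" by simp
        then show "w / x \<notin> \<real>\<^sub>\<le>\<^sub>0" "w / x \<noteq> 0" by (auto simp: complex_nonpos_Reals_iff)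
      qed
      have \<sigma>c: "continuous_on D \<sigma>" unfolding \<sigma>_def
        using Dp by (intro continuous_intros) (auto simp: x_def)
      have \<sigma>e: "exp (\<sigma> w) = w" if "w \<in> D" for w
        using Dp[OF that] by (simp add: \<sigma>_def exp_add x_def)
      have \<sigma>\<Sigma>: "\<sigma> w \<in> \<Sigma>" if "w \<in> D" for w
        unfolding S_exp \<sigma>e[OF that] using that by (simp add: D_def)
      have Do: "openin (top_of_set A) D"
        unfolding D_def by (intro continuous_openin_preimage_gen continuous_intros) (auto simp: x_def)
      have gsc: "continuous_on D (\<lambda>w. g (\<sigma> w))"
        by (rule continuous_on_compose2[OF g(1) \<sigma>c]) (use \<sigma>\<Sigma> in blast)
      define D' where "D' = D \<inter> (\<lambda>w. g (\<sigma> w)) -` u"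
      have "(\<lambda>w. g (\<sigma> w)) \<in> D \<rightarrow> C" using g(2) \<sigma>\<Sigma> by blast
      from continuous_openin_preimage[OF gsc this uo] have "openin (top_of_set D) D'" by (simp add: D'_def)
      then have D'o: "openin (top_of_set A) D'" using openin_trans Do by blast
      have "q ` C = A" by (rule covering_space_imp_surjective[OF cov])
      then have "openin (top_of_set C) (C \<inter> q -` D')"
        using covering_space_imp_continuous[OF cov] D'o by (intro continuous_openin_preimage) auto
      then have O: "openin (top_of_set C) (u \<inter> (C \<inter> q -` D'))" using uo by blast
      have "x \<in> D'" using xA z0 u by (simp add: D'_def D_def \<sigma>_def x_def)
      then have yO: "y \<in> u \<inter> (C \<inter> q -` D')" using u \<open>y \<in> C\<close> \<open>q y = x\<close> by blast
      have "u \<inter> (C \<inter> q -` D') \<subseteq> g ` K"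
      proof
        fix y' assume y': "y' \<in> u \<inter> (C \<inter> q -` D')"
        then have w: "q y' \<in> D" "g (\<sigma> (q y')) \<in> u" by (auto simp: D'_def)
        have "q (g (\<sigma> (q y'))) = q y'" using g(3)[OF \<sigma>\<Sigma>[OF w(1)]] \<sigma>e[OF w(1)] by simp
        then have "g (\<sigma> (q y')) = y'" using inj_onD[OF inju _ w(2)] y' by blast
        then show "y' \<in> g ` K" using \<sigma>\<Sigma>[OF w(1)] unfolding gK by (metis image_eqI)
      qed
      then show "\<exists>T. openin (top_of_set C) T \<and> y \<in> T \<and> T \<subseteq> g ` K" using O yO by blast
    qed
    ultimately have "g ` K = {} \<or> g ` K = C" using C(2) unfolding connected_clopen by blast
    moreover have "complex_of_real (ln r1) \<in> \<Sigma>" using r by (simp add: \<Sigma>_def)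
    ultimately show ?thesis using gK by blast
  qed
  have kc: "continuous_on K k"
    unfolding k_def Complex_eq using m(1) by (intro continuous_intros) auto
  have kA: "k ` K = A"
  proof
    have "k z \<in> A" if "z \<in> \<Sigma>" for z
      using that unfolding k_def S_exp[symmetric] by (simp add: \<Sigma>_def)
    then show "k ` K \<subseteq> A" using K\<Sigma> by blast
    show "A \<subseteq> k ` K"
    proof
      fix w assume w: "w \<in> A"
      then have w0: "w \<noteq> 0" using r by (auto simp: A_iff)
      define z where "z = Complex (Re (Ln w)) (real m * Im (Ln w))"
      have "Complex (Re z) (Im z / real m) = Ln w"
        using m(1) by (simp only: z_def complex.sel complex_eq_iff) (simp del: Re_Ln)
      then have kz: "k z = w" unfolding k_def using w0 by simp
      have "Ln w \<in> \<Sigma>" using w w0 by (simp add: S_exp)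
      then have "z \<in> \<Sigma>" by (simp only: z_def \<Sigma>_def mem_Collect_eq complex.sel)
      then obtain c where "\<tau> (c * int m) z \<in> K" using shift by blast
      moreover have "k (\<tau> (c * int m) z) = w" using kz k_fib[of "\<tau> (c * int m) z" z] by auto
      ultimately show "w \<in> k ` K" by blast
    qed
  qed
  \<comment> \<open>\<open>k\<close> is constant on the fibres of \<open>g\<close>, so the choice
    made by \<open>inv_into\<close> does not affect the value; as the fibres are equal,
    \<open>h\<close> is also injective.\<close>
  define h where "h y = k (inv_into K g y)" for y
  have hg: "h (g z) = k z" if z: "z \<in> K" for z
  proof -
    have "inv_into K g (g z) \<in> K" "g (inv_into K g (g z)) = g z"
      using z by (simp_all add: inv_into_into f_inv_into_f)
    then show ?thesis
      unfolding h_def using g_fib[of z "inv_into K g (g z)"] k_fib[of "inv_into K g (g z)" z] z K\<Sigma> by blast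
  qed
  have qm: "quotient_map (top_of_set K) (top_of_set C) g"
    using gC continuous_on_subset[OF g(1) K\<Sigma>]
    by (intro continuous_imp_quotient_map)
      (auto simp: compact_space_subtopology Hausdorff_space_subtopology continuous_map_in_subtopology K_def compact_cbox)
  have "continuous_map (top_of_set K) euclidean (h \<circ> g)"
    using kc hg by (auto simp: o_def intro: continuous_on_eq)
  then have "continuous_map (top_of_set C) euclidean h"
    using continuous_compose_quotient_map[OF qm] by blast
  then have "continuous_on C h" by simp
  moreover have "h ` C = A" using hg kA gC by (metis (no_types, lifting) image_cong image_image)
  moreover have "inj_on h C"
  proof (rule inj_onI)
    fix y y' assume y: "y \<in> C" "y' \<in> C" "h y = h y'"
    then obtain z z' where z: "z \<in> K" "z' \<in> K" "y = g z" "y' = g z'" using gC by blast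
    then have "k z' = k z" using y(3) hg by simp
    moreover have "z \<in> \<Sigma>" "z' \<in> \<Sigma>" using z K\<Sigma> by auto
    ultimately show "y = y'" unfolding z(3,4) using g_fib[of z z'] k_fib[of z' z] by metis
  qed
  ultimately show ?thesis unfolding A_def by blast
qed

section \<open>The flat case\<close>

lemma Cinf_locally_injective:
  fixes g :: "'a::euclidean_space \<Rightarrow> 'b::euclidean_space"
  assumes W: "open W" "x0 \<in> W" and g: "Cinf_on g W" and inj: "inj (frechet_derivative g (at x0))"
  shows "\<exists>r>0. ball x0 r \<subseteq> W \<and> inj_on g (ball x0 r)"
proof -
  have lin: "linear (frechet_derivative g (at x))" if "x \<in> W" for x
    using Cinf_on_differentiable[OF g that] linear_frechet_derivative by blast
  obtain g' where g': "linear g'" "g' \<circ> frechet_derivative g (at x0) = id"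
    using linear_injective_left_inverse[OF lin[OF W(2)] inj] by blast
  have on: "\<exists>d>0. \<forall>x. dist x0 x < d \<longrightarrow>
      onorm (\<lambda>v. frechet_derivative g (at x) v - frechet_derivative g (at x0) v) < e" if e: "0 < e" for e :: real
  proof -
    \<comment> \<open>Dominates the operator norm of the difference and is continuous, because every
      directional derivative is.\<close>
    define E where "E x = (\<Sum>i\<in>Basis. norm (frechet_derivative g (at x) i - frechet_derivative g (at x0) i))" for x
    have "continuous_on W E"
      unfolding E_def by (intro continuous_intros Cinf_on_continuous Cinf_on_deriv g)
    then have "open (W \<inter> E -` {..<e})" by (intro continuous_open_preimage W(1)) auto
    moreover have "x0 \<in> W \<inter> E -` {..<e}" using W(2) e by (simp add: E_def)
    ultimately obtain d where d: "0 < d" "ball x0 d \<subseteq> W \<inter> E -` {..<e}" using openE by blast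
    have "onorm (\<lambda>v. frechet_derivative g (at x) v - frechet_derivative g (at x0) v) < e" if x: "dist x0 x < d" for x
    proof -
      have xW: "x \<in> W" "E x < e" using x d by auto
      have "norm (frechet_derivative g (at x) v - frechet_derivative g (at x0) v) \<le> E x * norm v" for v
      proof -
        let ?h = "\<lambda>v. frechet_derivative g (at x) v - frechet_derivative g (at x0) v"
        have h: "linear ?h" by (rule linear_compose_sub[OF lin[OF xW(1)] lin[OF W(2)]])
        have "f v = (\<Sum>i\<in>Basis. (v \<bullet> i) *\<^sub>R f i)" if f: "linear f" for f :: "'a \<Rightarrow> 'b"
          using arg_cong[OF euclidean_representation[of v], of f] by (simp add: linear_sum[OF f] linear_cmul[OF f])
        from this[OF h] have "?h v = (\<Sum>i\<in>Basis. (v \<bullet> i) *\<^sub>R ?h i)" .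
        then have "norm (?h v) \<le> (\<Sum>i\<in>Basis. norm ((v \<bullet> i) *\<^sub>R ?h i))" by (metis norm_sum)
        also have "\<dots> \<le> (\<Sum>i\<in>Basis. norm v * norm (?h i))"
          by (intro sum_mono) (simp add: Basis_le_norm mult_right_mono)
        also have "\<dots> = E x * norm v" by (simp add: E_def sum_distrib_left mult.commute)
        finally show ?thesis .
      qed
      then have "onorm (\<lambda>v. frechet_derivative g (at x) v - frechet_derivative g (at x0) v) \<le> E x"
        by (rule onorm_le)
      then show ?thesis using xW(2) by simp
    qed
    then show ?thesis using d(1) by blast
  qed
  have "bounded_linear g'" using g'(1) linear_conv_bounded_linear by blast
  from has_derivative_locally_injective[of x0 W g' "\<lambda>x. frechet_derivative g (at x)" g,
      OF W(2,1) this g'(2) Cinf_on_has_derivative[OF g] on]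
  show ?thesis by blast
qed

text \<open>For use with w = |G|^2 at a boundary point, where a parametrization is extended beyond
  the half-space. As \<open>w\<close> is constant on the face x_b = 0 and has nonzero derivative,
  its transverse derivative is nonzero, and \<open>side\<close> fixes the sign. On the far side of
  the face \<open>w\<close> then drops below its boundary value, so the extension leaves the annulus
  there.\<close>

lemma one_sided_barrier:
  fixes w :: "real ^ 'n::finite \<Rightarrow> real"
  assumes W: "open W" "x0 \<in> W" and w: "Cinf_on w W" and b: "x0 $ b = 0"
    and nz: "frechet_derivative w (at x0) v \<noteq> 0"
    and const: "\<And>x. x \<in> W \<Longrightarrow> x $ b = 0 \<Longrightarrow> w x = w x0"
    and side: "\<And>x. x \<in> W \<Longrightarrow> 0 < x $ b \<Longrightarrow> w x0 \<le> w x"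
  shows "\<exists>r>0. ball x0 r \<subseteq> W \<and> (\<forall>x\<in>ball x0 r. x $ b < 0 \<longrightarrow> w x < w x0)"
proof -
  define e where "e = (axis b 1 :: real ^ 'n)"
  define d where "d x = frechet_derivative w (at x) e" for x
  have lin: "linear (frechet_derivative w (at x0))"
    using Cinf_on_differentiable[OF w W(2)] linear_frechet_derivative by blast
  obtain \<rho> where \<rho>: "0 < \<rho>" "ball x0 \<rho> \<subseteq> W" using W openE by blast
  have d0: "d x0 \<noteq> 0"
  proof -
    \<comment> \<open>The component of \<open>v\<close> along the face x_b = 0. There
      \<open>w\<close> is constant, so the nonzero derivative along \<open>v\<close> must come from
      the transverse direction \<open>e\<close>.\<close>
    define v' where "v' = v - (v $ b) *\<^sub>R e"
    have vb: "v' $ b = 0" by (simp add: v'_def e_def)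
    define f where "f t = x0 + t *\<^sub>R v'" for t :: real
    have f: "(f has_derivative (\<lambda>t. t *\<^sub>R v')) (at 0)"
      unfolding f_def by (auto intro!: derivative_eq_intros)
    have "(w has_derivative frechet_derivative w (at x0)) (at (f 0))"
      using Cinf_on_has_derivative[OF w W(2)] by (simp add: f_def)
    from has_derivative_compose[OF f this]
    have d1: "((\<lambda>t. w (f t)) has_derivative (\<lambda>t. frechet_derivative w (at x0) (t *\<^sub>R v'))) (at 0)" .
    have "continuous_on UNIV f" unfolding f_def by (intro continuous_intros)
    then have o: "open (f -` W)" using W(1) open_vimage by blast
    have "((\<lambda>t. w (f t)) has_derivative (\<lambda>t. 0)) (at 0)"
    proof (rule has_derivative_transform_within_open[OF has_derivative_const[of "w x0"] o])
      show "0 \<in> f -` W" using W(2) by (simp add: f_def)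
      show "w x0 = w (f t)" if "t \<in> f -` W" for t
        using const[of "f t"] that b vb by (simp add: f_def)
    qed
    then have "(\<lambda>t. frechet_derivative w (at x0) (t *\<^sub>R v')) = (\<lambda>t. 0)" by (rule has_derivative_unique[OF d1])
    then have "frechet_derivative w (at x0) v' = 0" by (metis scaleR_one)
    moreover have "frechet_derivative w (at x0) v = frechet_derivative w (at x0) v' + v $ b * d x0"
      unfolding d_def v'_def by (simp add: linear_diff[OF lin] linear_cmul[OF lin])
    ultimately show ?thesis using nz by auto
  qed
  have "continuous_on W d" unfolding d_def by (intro Cinf_on_continuous Cinf_on_deriv w)
  then have "open (W \<inter> (\<lambda>x. d x * d x0) -` {0<..})"
    by (intro continuous_open_preimage W(1) continuous_intros) auto
  moreover have "x0 \<in> W \<inter> (\<lambda>x. d x * d x0) -` {0<..}"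
    using W(2) d0 by (simp add: not_less_iff_gr_or_eq) (metis mult_pos_pos mult_neg_neg linorder_neqE_linordered_idom)
  ultimately obtain r where r: "0 < r" "ball x0 r \<subseteq> W \<inter> (\<lambda>x. d x * d x0) -` {0<..}" using openE by blast
  have close: "y \<in> ball x0 r" if "x \<in> ball x0 r" "\<And>i. \<bar>(y - x0) $ i\<bar> \<le> \<bar>(x - x0) $ i\<bar>" for x y
  proof -
    have "norm (y - x0) \<le> norm (x - x0)" using that(2) by (intro norm_le_componentwise_cart) simp
    then show ?thesis using that(1) by (simp add: dist_norm norm_minus_commute)
  qed
  have diff: "w differentiable (at x)" if "x \<in> ball x0 r" for x
    using Cinf_on_differentiable[OF w] r(2) that by blast
  have up: "0 < d x0"
  proof -
    define t where "t = r / 2"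
    have t: "0 < t" "t < r" using r(1) by (simp_all add: t_def)
    have inb: "x0 + s *\<^sub>R e \<in> ball x0 r" if "0 \<le> s" "s \<le> t" for s
      using that t by (simp add: dist_norm e_def)
    obtain s where s: "0 < s" "s < t" "w (x0 + t *\<^sub>R e) - w x0 = t * d (x0 + s *\<^sub>R e)"
      using mean_value_line[OF t(1) diff[OF inb]] unfolding d_def by blast
    have "w x0 \<le> w (x0 + t *\<^sub>R e)"
      using inb[of t] t b r(2) by (intro side) (auto simp: e_def)
    then have "0 \<le> t * d (x0 + s *\<^sub>R e)" using s(3) by linarith
    then have "0 \<le> d (x0 + s *\<^sub>R e)" using t by (simp add: zero_le_mult_iff)
    moreover have "0 < d (x0 + s *\<^sub>R e) * d x0" using r(2) inb[of s] s by auto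
    ultimately show ?thesis by (simp add: zero_less_mult_iff)
  qed
  have "w x < w x0" if x: "x \<in> ball x0 r" "x $ b < 0" for x
  proof -
    define t where "t = - (x $ b)"
    have t: "0 < t" using x by (simp add: t_def)
    have inb: "x + s *\<^sub>R e \<in> ball x0 r" if "0 \<le> s" "s \<le> t" for s
      using that b by (intro close[OF x(1)]) (auto simp: e_def axis_def t_def)
    obtain s where s: "0 < s" "s < t" "w (x + t *\<^sub>R e) - w x = t * d (x + s *\<^sub>R e)"
      using mean_value_line[OF t diff[OF inb]] unfolding d_def by blast
    have "w (x + t *\<^sub>R e) = w x0"
      using inb[of t] t r(2) by (intro const) (auto simp: e_def t_def)
    moreover have "0 < d (x + s *\<^sub>R e) * d x0" using r(2) inb[of s] s by auto
    then have "0 < d (x + s *\<^sub>R e)" using up by (simp add: zero_less_mult_iff)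
    then have "0 < t * d (x + s *\<^sub>R e)" using t by simp
    ultimately show ?thesis using s(3) by linarith
  qed
  then show ?thesis using r by blast
qed

section \<open>Flat hypersurfaces as coverings of a flat annulus\<close>

context fb_minimal
begin

lemma flat_chart:
  assumes flat: "\<And>p. p \<in> topspace X \<Longrightarrow> a \<bullet> F p = 0" and c: "(U, \<phi>) \<in> \<A>" and p: "p \<in> U"
  obtains W g where "open W" "\<phi> p \<in> W" "Cinf_on g W"
    "\<And>y. y \<in> W \<inter> \<phi> ` U \<Longrightarrow> g y = par U \<phi> y"
    "\<And>y. y \<in> W \<inter> \<phi> ` U \<Longrightarrow> frechet_derivative (par U \<phi>) (at y within \<phi> ` U) = frechet_derivative g (at y)"
    "\<And>y v. y \<in> W \<inter> \<phi> ` U \<Longrightarrow> a \<bullet> frechet_derivative g (at y) v = 0"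
proof -
  obtain W g where W: "open W" "\<phi> p \<in> W" "Cinf_on g W"
    "\<And>y. y \<in> W \<inter> \<phi> ` U \<Longrightarrow> g y = par U \<phi> y"
    "\<And>y. y \<in> W \<inter> \<phi> ` U \<Longrightarrow> (par U \<phi> has_derivative frechet_derivative g (at y)) (at y within \<phi> ` U)"
    "\<And>y. y \<in> W \<inter> \<phi> ` U \<Longrightarrow> frechet_derivative (par U \<phi>) (at y within \<phi> ` U) = frechet_derivative g (at y)"
    using chart_extension[OF c p] by blast
  have "a \<bullet> frechet_derivative g (at y) v = 0" if y: "y \<in> W \<inter> \<phi> ` U" for y v
  proof -
    have d1: "((\<lambda>z. a \<bullet> par U \<phi> z) has_derivative (\<lambda>v. a \<bullet> frechet_derivative g (at y) v)) (at y within \<phi> ` U)"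
      by (rule has_derivative_inner_right[OF W(5)[OF y]])
    have zero: "0 = a \<bullet> par U \<phi> z" if "z \<in> \<phi> ` U" for z
      using that flat chart_sub[OF c] inv_chart[OF c] by auto
    have "((\<lambda>z. a \<bullet> par U \<phi> z) has_derivative (\<lambda>v. 0)) (at y within \<phi> ` U)"
      by (rule has_derivative_transform_within[OF has_derivative_const[of 0] zero_less_one]) (use y zero in auto)
    then have "(\<lambda>v. a \<bullet> frechet_derivative g (at y) v) = (\<lambda>v. 0)"
      using half_space_derivative_unique[OF chart_img[OF c] _ d1] y by blast
    then show ?thesis by meson
  qed
  then show thesis using that[of W g] W by blast
qed

text \<open>The second fundamental form is required at boundary points too, where no patch is
  available. Instead \<open>a\<close> is orthogonal to all first and second derivatives within the
  half-space, and the chosen normal is a multiple of \<open>a\<close>.\<close>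

lemma flat_totally_geodesic:
  assumes a: "norm a = 1" and flat: "\<And>p. p \<in> topspace X \<Longrightarrow> a \<bullet> F p = 0"
  shows "totally_geodesic \<A> F"
proof -
  have "second_form (\<phi> ` U) (par U \<phi>) (\<phi> p) = 0" if c: "(U, \<phi>) \<in> \<A>" and p: "p \<in> U" for U \<phi> p
  proof -
    define S where "S = \<phi> ` U"
    define x where "x = \<phi> p"
    obtain W g where W: "open W" "x \<in> W" "Cinf_on g W"
      "\<And>y. y \<in> W \<inter> S \<Longrightarrow> frechet_derivative (par U \<phi>) (at y within S) = frechet_derivative g (at y)"
      "\<And>y v. y \<in> W \<inter> S \<Longrightarrow> a \<bullet> frechet_derivative g (at y) v = 0"
      using flat_chart[OF flat c p] unfolding S_def x_def by metis
    have xS: "x \<in> W \<inter> S" using W(2) p by (simp add: S_def x_def)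
    have lin: "linear (frechet_derivative g (at x))"
      using Cinf_on_differentiable[OF W(3,2)] linear_frechet_derivative by blast
    have inj: "inj (frechet_derivative g (at x))"
      using par_immersion[OF c p] W(4)[OF xS] by (simp add: S_def x_def)
    have pd: "pderiv_within S (par U \<phi>) i y = frechet_derivative g (at y) (axis i 1)" if "y \<in> W \<inter> S" for i y
      using W(4)[OF that] by (simp add: pderiv_within_def)
    let ?P = "\<lambda>\<mu>. norm \<mu> = 1 \<and> (\<forall>i. orthogonal (pderiv_within S (par U \<phi>) i x) \<mu>)"
    have "?P a" using a W(5)[OF xS] pd[OF xS] by (simp add: orthogonal_def inner_commute)
    then have un: "?P (unit_normal S (par U \<phi>) x)" unfolding unit_normal_def by (rule someI)
    have "frechet_derivative g (at x) v \<bullet> unit_normal S (par U \<phi>) x = 0" for v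
      using un by (subst basis_expansion[symmetric, of v])
        (simp add: linear_sum[OF lin] linear_cmul[OF lin] scalar_mult_eq_scaleR inner_sum_left pd[OF xS] orthogonal_def)
    from normal_line[OF lin inj card_kn _ _ this, of a]
    have ua: "unit_normal S (par U \<phi>) x = (unit_normal S (par U \<phi>) x \<bullet> a) *\<^sub>R a"
      using a W(5)[OF xS] by (simp add: inner_commute norm_eq_1)
    have "a \<bullet> pderiv_within S (pderiv_within S (par U \<phi>) i) j x = 0" for i j
    proof -
      define h where "h y = frechet_derivative g (at y) (axis i 1)" for y
      have hW: "(h has_derivative frechet_derivative h (at x)) (at x within S)"
        using Cinf_on_has_derivative[OF _ W(2), of h] Cinf_on_deriv[OF W(3)] has_derivative_at_withinI
        unfolding h_def by blast
      obtain e where e: "0 < e" "ball x e \<subseteq> W" using W(1,2) openE by blast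
      have d: "(pderiv_within S (par U \<phi>) i has_derivative frechet_derivative h (at x)) (at x within S)"
        by (rule has_derivative_transform_within[OF hW e(1)])
          (use xS e pd in \<open>auto simp: h_def dist_commute subset_iff\<close>)
      then have "(pderiv_within S (par U \<phi>) i has_derivative
          frechet_derivative (pderiv_within S (par U \<phi>) i) (at x within S)) (at x within S)"
        using frechet_derivative_works differentiable_def by blast
      then have d1: "((\<lambda>y. a \<bullet> pderiv_within S (par U \<phi>) i y) has_derivative
          (\<lambda>v. a \<bullet> frechet_derivative (pderiv_within S (par U \<phi>) i) (at x within S) v)) (at x within S)"
        by (rule has_derivative_inner_right)
      have "((\<lambda>y. a \<bullet> pderiv_within S (par U \<phi>) i y) has_derivative (\<lambda>v. 0)) (at x within S)"
        by (rule has_derivative_transform_within[OF has_derivative_const[of 0] e(1)])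
          (use xS e pd W(5) in \<open>auto simp: dist_commute subset_iff\<close>)
      then have "(\<lambda>v. a \<bullet> frechet_derivative (pderiv_within S (par U \<phi>) i) (at x within S) v) = (\<lambda>v. 0)"
        using half_space_derivative_unique[OF chart_img[OF c, folded S_def] _ d1] xS by blast
      then show ?thesis unfolding pderiv_within_def[of S "pderiv_within S (par U \<phi>) i"] by meson
    qed
    then have "second_form S (par U \<phi>) x $ i $ j = 0" for i j
      unfolding second_form_def by (subst ua) (simp add: inner_commute)
    then show ?thesis by (simp add: vec_eq_iff S_def x_def)
  qed
  then show ?thesis unfolding totally_geodesic_def in_all_charts_def by blast
qed

text \<open>After the hyperplane is identified with 'b by \<open>L\<close>, the extended
  parametrization \<open>G\<close> is locally injective between spaces of equal dimension, so
  invariance of domain applies. At boundary points \<open>one_sided_barrier\<close> shows that near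
  x0 only points of the half-space are mapped into the annulus. This makes the images open relative
  to the annulus, as the intersection of the annulus with an open set.\<close>

lemma flat_local_homeomorphism:
  fixes L :: "real ^ 'k \<Rightarrow> 'b::euclidean_space"
  assumes flat: "\<And>p. p \<in> topspace X \<Longrightarrow> a \<bullet> F p = 0"
    and L: "linear L" "\<And>z. a \<bullet> z = 0 \<Longrightarrow> norm (L z) = norm z" and dim: "DIM('b) = n"
    and p: "p \<in> topspace X"
  shows "\<exists>N. openin X N \<and> p \<in> N \<and> inj_on (L \<circ> F) N \<and>
    (\<forall>V. openin X V \<longrightarrow> V \<subseteq> N \<longrightarrow> openin (top_of_set (cball 0 r2 - ball 0 r1)) ((L \<circ> F) ` V))"
proof -
  obtain U \<phi> where c: "(U, \<phi>) \<in> \<A>" "p \<in> U" using chart_exists p by blast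
  obtain W g where W: "open W" "\<phi> p \<in> W" "Cinf_on g W"
    "\<And>y. y \<in> W \<inter> \<phi> ` U \<Longrightarrow> g y = par U \<phi> y"
    "\<And>y. y \<in> W \<inter> \<phi> ` U \<Longrightarrow> frechet_derivative (par U \<phi>) (at y within \<phi> ` U) = frechet_derivative g (at y)"
    "\<And>y v. y \<in> W \<inter> \<phi> ` U \<Longrightarrow> a \<bullet> frechet_derivative g (at y) v = 0"
    using flat_chart[OF flat c] by blast
  define x0 where "x0 = \<phi> p"
  define A where "A = (cball 0 r2 - ball 0 r1 :: 'b set)"
  have A_iff: "z \<in> A \<longleftrightarrow> r1 \<le> norm z \<and> norm z \<le> r2" for z by (auto simp: A_def)
  have x0: "x0 \<in> W \<inter> \<phi> ` U" using W(2) c by (simp add: x0_def)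
  define G where "G = (\<lambda>y. L (g y))"
  define DG where "DG v = L (frechet_derivative g (at x0) v)" for v
  have bL: "bounded_linear L" using L(1) linear_conv_bounded_linear by blast
  have Gs: "Cinf_on G W" unfolding G_def by (rule Cinf_on_bounded_linear[OF bL W(1,3)])
  have x0W: "x0 \<in> W" using x0 by simp
  have "(G has_derivative DG) (at x0)"
    unfolding G_def DG_def by (rule bounded_linear.has_derivative[OF bL Cinf_on_has_derivative[OF W(3) x0W]])
  then have fd: "frechet_derivative G (at x0) = DG" using frechet_derivative_at by metis
  have lin: "linear (frechet_derivative g (at x0))"
    using Cinf_on_differentiable[OF W(3) x0W] linear_frechet_derivative by blast
  have linDG: "linear DG" unfolding DG_def using linear_compose[OF lin L(1)] by (simp add: o_def)
  have inj: "inj (frechet_derivative g (at x0))"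
    using par_immersion[OF c] W(5)[OF x0] by (simp add: x0_def)
  have injDG: "inj DG"
  proof -
    have "v = 0" if "DG v = 0" for v
    proof -
      have "norm (frechet_derivative g (at x0) v) = 0"
        using L(2)[OF W(6)[OF x0, of v]] that by (simp add: DG_def)
      then show "v = 0" using inj lin linear_injective_0 by auto
    qed
    then show ?thesis using linear_injective_0[OF linDG] by blast
  qed
  have surjDG: "range DG = UNIV"
  proof -
    have "dim (range DG) = DIM('b)" using dim_image_eq[OF linDG, of UNIV] injDG dim dim_n by simp
    then show ?thesis
      using dim_eq_full[of "range DG"] linear_subspace_image[OF linDG subspace_UNIV] span_eq_iff by metis
  qed
  obtain r0 where r0: "0 < r0" "ball x0 r0 \<subseteq> W" "inj_on G (ball x0 r0)"
    using Cinf_locally_injective[OF W(1) x0W Gs] injDG fd by metis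
  have GF: "G (\<phi> q) = (L \<circ> F) q" "norm ((L \<circ> F) q) = norm (F q)" if "q \<in> U" "\<phi> q \<in> W" for q
  proof -
    show "G (\<phi> q) = (L \<circ> F) q" using W(4)[of "\<phi> q"] that par_chart[OF c(1)] by (simp add: G_def)
    show "norm ((L \<circ> F) q) = norm (F q)" using L(2) flat chart_sub[OF c(1)] that(1) by auto
  qed
  have "\<exists>T. open T \<and> \<phi> ` U = half_space \<inter> T" using chart_img[OF c(1)] by (auto simp: openin_open)
  then obtain T where T: "open T" "\<phi> ` U = half_space \<inter> T" by blast
  define W0 where "W0 = ball x0 r0 \<inter> T"
  have W0: "open W0" "x0 \<in> W0" "W0 \<subseteq> W" "inj_on G W0"
    using T x0 r0 by (auto simp: W0_def intro: inj_on_subset)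
  have "\<exists>r>0. ball x0 r \<subseteq> W0 \<and> (\<forall>x\<in>ball x0 r. G x \<in> A \<longrightarrow> x \<in> half_space)"
  proof (cases "p \<in> Xi")
    case True
    then have "x0 \<in> W0 \<inter> open_half_space" using W0 interior_iff[OF c] by (simp add: x0_def)
    moreover have "open (W0 \<inter> open_half_space)" using W0 open_open_half_space by blast
    ultimately obtain r where "0 < r" "ball x0 r \<subseteq> W0 \<inter> open_half_space" using openE by blast
    then show ?thesis using open_half_space_subset by (intro exI[of _ r]) auto
  next
    case False
    have xb: "x0 $ bd_coord = 0"
      using False interior_iff[OF c] chart_half[OF c(1)] c(2) by (force simp: half_space_def open_half_space_def x0_def)
    define w where "w x = G x \<bullet> G x" for x
    have ws: "Cinf_on w W" unfolding w_def by (intro Cinf_on_inner W(1) Gs)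
    have w0: "w x0 = r1\<^sup>2 \<or> w x0 = r2\<^sup>2"
      using boundary_radius[OF p False] GF[OF c(2) W(2)]
      by (auto simp: w_def x0_def power2_norm_eq_inner[symmetric])
    have lt: "r1\<^sup>2 < r2\<^sup>2" using r1_pos r12 by (simp add: power_strict_mono)
    \<comment> \<open>The width r2^2 - r1^2 prevents \<open>w\<close> at face points from jumping to
      the value on the other sphere.\<close>
    define W1 where "W1 = W0 \<inter> (W \<inter> (\<lambda>x. \<bar>w x - w x0\<bar>) -` {..<r2\<^sup>2 - r1\<^sup>2})"
    have "open (W \<inter> (\<lambda>x. \<bar>w x - w x0\<bar>) -` {..<r2\<^sup>2 - r1\<^sup>2})"
      by (intro continuous_open_preimage W(1) continuous_intros Cinf_on_continuous ws) auto
    then have W1: "open W1" "x0 \<in> W1" using W0 lt x0W by (auto simp: W1_def)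
    have wF: "\<exists>q\<in>topspace X. w x = F q \<bullet> F q \<and> (x $ bd_coord = 0 \<longrightarrow> q \<notin> Xi)"
      if x: "x \<in> W1" "0 \<le> x $ bd_coord" for x
    proof -
      have "x \<in> \<phi> ` U" using x T by (auto simp: half_space_def W1_def W0_def)
      then obtain q where q: "q \<in> U" "x = \<phi> q" by blast
      have "x \<in> W" using x by (simp add: W1_def)
      then have "w x = F q \<bullet> F q" using GF[OF q(1)] q(2) by (simp add: w_def power2_norm_eq_inner[symmetric])
      moreover have "x $ bd_coord = 0 \<longrightarrow> q \<notin> Xi" using interior_iff[OF c(1) q(1)] q(2) by (auto simp: open_half_space_def)
      ultimately show ?thesis using q chart_sub[OF c(1)] by blast
    qed
    have const: "w x = w x0" if x: "x \<in> W1" "x $ bd_coord = 0" for x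
    proof -
      obtain q where "q \<in> topspace X" "w x = F q \<bullet> F q" "q \<notin> Xi" using wF[of x] x by auto
      then have "w x = r1\<^sup>2 \<or> w x = r2\<^sup>2" using boundary_radius2[of q] by simp
      then show ?thesis using w0 x(1) by (auto simp: W1_def)
    qed
    have wb: "r1\<^sup>2 \<le> w x \<and> w x \<le> r2\<^sup>2" if "x \<in> W1" "0 < x $ bd_coord" for x
      using wF[OF that(1)] that(2) F_inner by force
    \<comment> \<open>By surjectivity some direction moves \<open>G\<close> radially; along it the
      derivative of |G|^2 is 2 |G x0|^2 > 0.\<close>
    obtain v where v: "DG v = G x0" using surjDG by (metis UNIV_I imageE)
    have hw: "(w has_derivative (\<lambda>u. G x0 \<bullet> DG u + DG u \<bullet> G x0)) (at x0)"
      unfolding w_def by (intro has_derivative_inner \<open>(G has_derivative DG) (at x0)\<close>)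
    have dw: "frechet_derivative w (at x0) = (\<lambda>u. G x0 \<bullet> DG u + DG u \<bullet> G x0)"
      by (rule frechet_derivative_at[OF hw, symmetric])
    have "0 < w x0" using w0 r1_pos r12 by auto
    then have nz: "frechet_derivative w (at x0) v \<noteq> 0" unfolding dw v by (simp add: w_def)
    have AW: "r1\<^sup>2 \<le> w x \<and> w x \<le> r2\<^sup>2" if "G x \<in> A" for x
      using that r1_pos unfolding A_iff w_def by (simp add: power2_norm_eq_inner[symmetric] power_mono)
    have ws1: "Cinf_on w W1" by (rule Cinf_on_subset[OF ws]) (auto simp: W1_def)
    from w0 obtain r where "0 < r" "ball x0 r \<subseteq> W1" "\<forall>x\<in>ball x0 r. G x \<in> A \<longrightarrow> \<not> x $ bd_coord < 0"
    proof
      assume eq: "w x0 = r1\<^sup>2"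
      obtain r where r: "0 < r" "ball x0 r \<subseteq> W1" "\<forall>x\<in>ball x0 r. x $ bd_coord < 0 \<longrightarrow> w x < w x0"
        using one_sided_barrier[OF W1 ws1 xb nz const] wb eq by metis
      have "\<not> x $ bd_coord < 0" if "x \<in> ball x0 r" "G x \<in> A" for x
        using AW[OF that(2)] bspec[OF r(3) that(1)] eq by linarith
      then show thesis using that[OF r(1,2)] by blast
    next
      \<comment> \<open>At the outer sphere \<open>w\<close> decreases inwards, so the barrier lemma
        is applied to \<open>- w\<close>.\<close>
      assume eq: "w x0 = r2\<^sup>2"
      have nz': "frechet_derivative (\<lambda>x. - w x) (at x0) v \<noteq> 0"
        using nz unfolding dw frechet_derivative_at[OF has_derivative_minus[OF hw], symmetric] by simp
      have "\<exists>r>0. ball x0 r \<subseteq> W1 \<and> (\<forall>x\<in>ball x0 r. x $ bd_coord < 0 \<longrightarrow> - w x < - w x0)"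
        by (rule one_sided_barrier[OF W1 Cinf_on_uminus[OF W1(1) ws1] xb nz']) (use const wb eq in auto)
      then obtain r where r: "0 < r" "ball x0 r \<subseteq> W1" "\<forall>x\<in>ball x0 r. x $ bd_coord < 0 \<longrightarrow> w x0 < w x" by auto
      have "\<not> x $ bd_coord < 0" if "x \<in> ball x0 r" "G x \<in> A" for x
        using AW[OF that(2)] bspec[OF r(3) that(1)] eq by linarith
      then show thesis using that[OF r(1,2)] by blast
    qed
    then show ?thesis by (intro exI[of _ r]) (auto simp: W1_def half_space_def not_less)
  qed
  then obtain r where r: "0 < r" "ball x0 r \<subseteq> W0" "\<And>x. x \<in> ball x0 r \<Longrightarrow> G x \<in> A \<Longrightarrow> x \<in> half_space" by blast
  define N where "N = {q \<in> U. \<phi> q \<in> ball x0 r}"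
  have NW: "q \<in> U" "\<phi> q \<in> W" "\<phi> q \<in> W0" "q \<in> topspace X" if "q \<in> N" for q
    using that r(2) W0(3) chart_sub[OF c(1)] by (auto simp: N_def)
  have "inj_on (L \<circ> F) N"
  proof (rule inj_onI)
    fix q q' assume q: "q \<in> N" "q' \<in> N" "(L \<circ> F) q = (L \<circ> F) q'"
    then have "G (\<phi> q) = G (\<phi> q')" using GF(1)[OF NW(1,2)] by simp
    then have "\<phi> q = \<phi> q'" using inj_onD[OF W0(4) _ NW(3,3)] q by blast
    then show "q = q'" using inj_onD[OF chart_inj[OF c(1)] _ NW(1,1)] q by blast
  qed
  moreover have "openin (top_of_set A) ((L \<circ> F) ` V)" if V: "openin X V" "V \<subseteq> N" for V
  proof -
    have "openin (top_of_set half_space) (\<phi> ` V)"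
      using V by (intro chart_image[OF c(1)]) (auto simp: N_def)
    then obtain T' where T': "open T'" "\<phi> ` V = half_space \<inter> T'" by (auto simp: openin_open)
    define O' where "O' = T' \<inter> ball x0 r"
    have O'W: "O' \<subseteq> W0" using r(2) by (auto simp: O'_def)
    have "open (G ` O')"
    proof (rule invariance_of_domain_gen)
      show "open O'" using T' by (auto simp: O'_def)
      show "continuous_on O' G"
        using O'W W0(3) by (intro continuous_on_subset[OF Cinf_on_continuous[OF Gs]]) auto
      show "inj_on G O'" using W0(4) O'W inj_on_subset by blast
      show "DIM('b) \<le> DIM(real ^ 'n)" using dim dim_n by simp
    qed
    moreover have "(L \<circ> F) ` V = A \<inter> G ` O'"
    proof
      show "(L \<circ> F) ` V \<subseteq> A \<inter> G ` O'"
      proof clarify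
        fix q assume q: "q \<in> V"
        then have qN: "q \<in> N" using V(2) by blast
        have "\<phi> q \<in> O'" using q qN T'(2) by (auto simp: O'_def N_def)
        then have "(L \<circ> F) q \<in> G ` O'" using GF(1)[OF NW(1,2)[OF qN]] by (metis image_eqI)
        moreover have "(L \<circ> F) q \<in> A"
          using GF(2)[OF NW(1,2)[OF qN]] F_annulus[OF NW(4)[OF qN]] unfolding A_iff by simp
        ultimately show "(L \<circ> F) q \<in> A \<inter> G ` O'" by blast
      qed
      show "A \<inter> G ` O' \<subseteq> (L \<circ> F) ` V"
      proof
        fix z assume z: "z \<in> A \<inter> G ` O'"
        then obtain x where x: "x \<in> O'" "z = G x" by blast
        then have "x \<in> half_space" using r(3)[of x] z by (auto simp: O'_def)
        then have "x \<in> \<phi> ` V" using T'(2) x(1) by (auto simp: O'_def)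
        then obtain q where q: "q \<in> V" "x = \<phi> q" by blast
        then have "z = (L \<circ> F) q" using GF(1)[OF NW(1,2)] x(2) V(2) by (metis subsetD)
        then show "z \<in> (L \<circ> F) ` V" using q(1) by blast
      qed
    qed
    ultimately show ?thesis by (metis openin_open)
  qed
  moreover have "openin X N" unfolding N_def by (rule chart_preimage[OF c(1) open_ball])
  moreover have "p \<in> N" using c r(1) by (simp add: N_def x0_def)
  ultimately show ?thesis unfolding A_def by blast
qed

text \<open>\<open>E\<close> pairs the embedding coordinates with L o F, so its image
  \<open>C\<close> is a homeomorphic copy of X in a normed space on which L o F has become the
  projection \<open>snd\<close>. Since only the dimension of the target matters, it can be taken to
  be the complex plane when n = 2.\<close>

lemma flat_covering:
  fixes L :: "real ^ 'k \<Rightarrow> 'b::euclidean_space"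
  assumes a: "norm a = 1" and flat: "\<And>p. p \<in> topspace X \<Longrightarrow> a \<bullet> F p = 0"
    and L: "linear L" "\<And>z. a \<bullet> z = 0 \<Longrightarrow> norm (L z) = norm z" "L ` {z. a \<bullet> z = 0} = UNIV" and dim: "DIM('b) = n"
  shows "\<exists>(E :: 'p \<Rightarrow> (nat \<Rightarrow>\<^sub>C real) \<times> 'b) C. homeomorphic_map X (top_of_set C) E \<and> compact C \<and> connected C \<and>
    covering_space C snd (cball 0 r2 - ball 0 r1)"
proof -
  have loc: "\<exists>N. openin X N \<and> p \<in> N \<and> inj_on (L \<circ> F) N \<and>
    (\<forall>V. openin X V \<longrightarrow> V \<subseteq> N \<longrightarrow> openin (top_of_set (cball 0 r2 - ball 0 r1)) ((L \<circ> F) ` V))"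
    if "p \<in> topspace X" for p
    by (rule flat_local_homeomorphism[OF _ L(1) _ dim that]) (use flat L(2) in auto)
  have "\<exists>N. openin X N \<and> p \<in> N \<and> inj_on (L \<circ> F) N" if "p \<in> topspace X" for p
    using loc[OF that] by blast
  then obtain e :: "'p \<Rightarrow> nat \<Rightarrow>\<^sub>C real" where e: "continuous_map X euclidean e"
    "inj_on (\<lambda>p. (e p, (L \<circ> F) p)) (topspace X)"
    using locally_injective_embedding[OF hyps(1,4), of "L \<circ> F"] by blast
  define E where "E = (\<lambda>p. (e p, (L \<circ> F) p))"
  define C where "C = E ` topspace X"
  define A where "A = (cball 0 r2 - ball 0 r1 :: 'b set)"
  have "continuous_map euclidean euclidean L" using L(1) by (simp add: linear_continuous_on linear_conv_bounded_linear)
  then have LF: "continuous_map X euclidean (L \<circ> F)" by (rule continuous_map_compose[OF F_continuous])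
  have "continuous_map X (prod_topology euclidean euclidean) E"
    unfolding continuous_map_pairwise using e(1) LF by (simp add: E_def o_def)
  then have Ec: "continuous_map X (top_of_set C) E"
    by (simp add: C_def continuous_map_in_subtopology euclidean_product_topology)
  have injE: "inj_on E (topspace X)" using e(2) by (simp only: E_def)
  have Eh: "homeomorphic_map X (top_of_set C) E"
    using injE hyps(1) Ec
    by (intro continuous_imp_homeomorphic_map) (auto simp: C_def Hausdorff_space_subtopology)
  have "compactin (top_of_set C) (E ` topspace X)"
    using image_compactin[OF _ Ec] hyps(1) by (simp add: compact_space_def)
  then have Cc: "compact C" by (simp add: C_def compactin_subtopology)
  have "connectedin (top_of_set C) (E ` topspace X)"
    using connectedin_continuous_map_image[OF Ec] hyps(2) by (simp add: connectedin_topspace)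
  then have Cn: "connected C" by (simp add: C_def connectedin_subtopology)
  have "snd ` C = A"
  proof -
    have "snd ` C = L ` (F ` topspace X)" by (simp add: C_def E_def image_image)
    also have "\<dots> = A"
    proof
      show "L ` (F ` topspace X) \<subseteq> A" using L(2) flat F_annulus by (force simp: A_def)
      show "A \<subseteq> L ` (F ` topspace X)"
      proof
        fix z assume z: "z \<in> A"
        obtain y where y: "a \<bullet> y = 0" "z = L y" using L(3) by (metis (mono_tags, lifting) UNIV_I imageE mem_Collect_eq)
        then have "y \<in> {z. a \<bullet> z = 0} \<inter> annulus r1 r2" using z L(2)[OF y(1)] by (auto simp: A_def annulus_def)
        then show "z \<in> L ` (F ` topspace X)" using flat_image[OF a flat] y(2) by blast
      qed
    qed
    finally show ?thesis .
  qed
  moreover have "\<exists>u. openin (top_of_set C) u \<and> x \<in> u \<and> inj_on snd u \<and>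
      (\<forall>v. openin (top_of_set C) v \<longrightarrow> v \<subseteq> u \<longrightarrow> openin (top_of_set A) (snd ` v))" if x: "x \<in> C" for x
  proof -
    obtain p where p: "p \<in> topspace X" "x = E p" using x by (auto simp: C_def)
    obtain N where N: "openin X N" "p \<in> N" "inj_on (L \<circ> F) N"
      "\<forall>V. openin X V \<longrightarrow> V \<subseteq> N \<longrightarrow> openin (top_of_set A) ((L \<circ> F) ` V)"
      using loc[OF p(1)] unfolding A_def by blast
    have NX: "N \<subseteq> topspace X" by (rule openin_subset[OF N(1)])
    have sE: "snd (E q) = (L \<circ> F) q" for q by (simp add: E_def)
    have "openin (top_of_set C) (E ` N)"
      using homeomorphic_imp_open_map[OF Eh] N(1) by (simp add: open_map_def)
    moreover have "inj_on snd (E ` N)"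
      using N(3) by (auto simp: inj_on_def sE)
    moreover have "openin (top_of_set A) (snd ` v)" if v: "openin (top_of_set C) v" "v \<subseteq> E ` N" for v
    proof -
      define V where "V = {q \<in> topspace X. E q \<in> v}"
      have V: "openin X V" unfolding V_def by (rule openin_continuous_map_preimage[OF Ec v(1)])

      have "V \<subseteq> N"
      proof
        fix q assume q: "q \<in> V"
        then obtain q' where "q' \<in> N" "E q = E q'" using v(2) by (auto simp: V_def)
        then show "q \<in> N" using injE NX q by (metis (mono_tags, lifting) V_def inj_onD mem_Collect_eq subsetD)
      qed
      moreover have "snd ` v = (L \<circ> F) ` V"
      proof -
        have "v = E ` V" using v(2) NX unfolding V_def by blast
        then show ?thesis by (simp add: image_image sE)
      qed
      ultimately show ?thesis using N(4) V by simp
    qed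
    ultimately show ?thesis using N(2) p(2) by (intro exI[of _ "E ` N"]) auto
  qed
  ultimately have "covering_space C snd A"
    by (intro local_homeomorphism_covering_space Cc continuous_intros)
  then show ?thesis using Eh Cc Cn unfolding A_def by (intro exI[of _ E] exI[of _ C]) simp
qed

lemma flat_conclusion:
  assumes f0: "\<And>p. p \<in> Xi \<Longrightarrow> fX p = 0"
  shows "totally_geodesic_annulus r1 r2 X \<A> F"
proof -
  obtain a where a: "norm a = 1" and flat: "\<And>p. p \<in> topspace X \<Longrightarrow> a \<bullet> F p = 0"
    using flat_normal[OF f0] by blast
  have a0: "a \<noteq> 0" using a by auto
  define H where "H = {z. a \<bullet> z = 0}"
  have sH: "subspace H" unfolding H_def by (rule subspace_hyperplane)
  have dH: "dim H = n" unfolding H_def using dim_hyperplane[OF a0] dim_k by simp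
  \<comment> \<open>For n = 2 the annulus is not simply connected and X may be a proper finite
    covering of it, so a homeomorphism other than the projection is used; for n \<ge> 3 the
    projection itself is injective.\<close>
  have "X homeomorphic_space top_of_set (annulus r1 r2 :: (real ^ 'n) set)"
  proof (cases "n = 2")
    case True
    have dc: "dim H = dim (UNIV :: complex set)" using dH True by simp
    obtain L :: "real ^ 'k \<Rightarrow> complex" where L: "linear L" "L ` H = UNIV" "\<And>z. z \<in> H \<Longrightarrow> norm (L z) = norm z"
      using isometry_subspaces[OF sH subspace_UNIV dc] by blast
    have nL: "norm (L z) = norm z" if "a \<bullet> z = 0" for z using L(3) that by (simp add: H_def)
    have d2: "DIM(complex) = n" using True by simp
    obtain E :: "'p \<Rightarrow> (nat \<Rightarrow>\<^sub>C real) \<times> complex" and C where E: "homeomorphic_map X (top_of_set C) E" "compact C" "connected C"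
      "covering_space C snd (cball 0 r2 - ball 0 r1)"
      using flat_covering[OF a flat L(1) nL L(2)[unfolded H_def] d2] by blast
    obtain h :: "(nat \<Rightarrow>\<^sub>C real) \<times> complex \<Rightarrow> complex" where h: "continuous_on C h" "h ` C = cball 0 r2 - ball 0 r1" "inj_on h C"
      using covering_planar_annulus[OF E(2,3) r1_pos r12 E(4)] by blast
    have de: "DIM(complex) = DIM(real ^ 'n)" using True dim_n by simp
    obtain f :: "complex \<Rightarrow> real ^ 'n" and f' where f: "linear f" "linear f'" "\<And>x. norm (f x) = norm x" "\<And>y. norm (f' y) = norm y"
      "\<And>x. f' (f x) = x" "\<And>y. f (f' y) = y"
      using isomorphisms_UNIV_UNIV[OF de] by blast
    have fA: "f ` (cball 0 r2 - ball 0 r1) = annulus r1 r2"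
    proof
      show "f ` (cball 0 r2 - ball 0 r1) \<subseteq> annulus r1 r2" by (auto simp: annulus_def f(3))
      show "annulus r1 r2 \<subseteq> f ` (cball 0 r2 - ball 0 r1)"
      proof
        fix y :: "real ^ 'n" assume "y \<in> annulus r1 r2"
        then have "f' y \<in> cball 0 r2 - ball 0 r1" by (auto simp: annulus_def f(4))
        then show "y \<in> f ` (cball 0 r2 - ball 0 r1)" using f(6) by (metis image_eqI)
      qed
    qed
    have "continuous_on C (f \<circ> h)"
      by (rule continuous_on_compose[OF h(1) linear_continuous_on[OF f(1)[unfolded linear_conv_bounded_linear]]])
    moreover have "(f \<circ> h) ` C = annulus r1 r2" using h(2) fA by (metis image_comp)
    moreover have "inj_on (f \<circ> h) C"
      using h(3) f(5) by (intro comp_inj_on) (metis inj_on_inverseI)+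
    ultimately have "homeomorphic_map (top_of_set C) (top_of_set (annulus r1 r2)) (f \<circ> h)"
      using E(2) by (intro continuous_imp_homeomorphic_map)
        (auto simp: continuous_map_in_subtopology Hausdorff_space_subtopology compact_space_subtopology)
    then show ?thesis
      using E(1) homeomorphic_map_compose homeomorphic_map_imp_homeomorphic_space by blast
  next
    case False
    have dc: "dim H = dim (UNIV :: (real ^ 'n) set)" using dH dim_n by simp
    obtain L :: "real ^ 'k \<Rightarrow> real ^ 'n" where L: "linear L" "L ` H = UNIV" "\<And>z. z \<in> H \<Longrightarrow> norm (L z) = norm z"
      using isometry_subspaces[OF sH subspace_UNIV dc] by blast
    have nL: "norm (L z) = norm z" if "a \<bullet> z = 0" for z using L(3) that by (simp add: H_def)
    have d2: "DIM(real ^ 'n) = n" using dim_n by simp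
    obtain E :: "'p \<Rightarrow> (nat \<Rightarrow>\<^sub>C real) \<times> (real ^ 'n)" and C where E: "homeomorphic_map X (top_of_set C) E" "compact C" "connected C"
      "covering_space C snd (cball 0 r2 - ball 0 r1)"
      using flat_covering[OF a flat L(1) nL L(2)[unfolded H_def] d2] by blast
    have "inj_on snd C"
      using False n_ge d2 by (intro covering_annulus_injective[OF E(3) _ r1_pos E(4)]) simp
    then have "homeomorphic_map (top_of_set C) (top_of_set (annulus r1 r2)) snd"
      using E(2) covering_space_imp_continuous[OF E(4)] covering_space_imp_surjective[OF E(4)]
      by (intro continuous_imp_homeomorphic_map)
        (auto simp: annulus_def continuous_map_in_subtopology Hausdorff_space_subtopology compact_space_subtopology)
    then show ?thesis
      using E(1) homeomorphic_map_compose homeomorphic_map_imp_homeomorphic_space by blast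
  qed
  then show ?thesis
    using flat_totally_geodesic[OF a flat] flat_image[OF a flat] a0
    unfolding totally_geodesic_annulus_def by blast
qed

end

theorem theorem1p4:
  fixes n :: nat and r1 r2 :: real
    and X :: "'p topology"
    and \<A> :: "('p, 'n::finite) chart set"
    and F :: "'p \<Rightarrow> real ^ 'k::finite"
  assumes "CARD('n) = n" and "CARD('k) = n + 1" and "2 \<le> n"
    and "0 < r1" and "r1 < r2"
    and "compact_immersed_hypersurface (annulus r1 r2) X \<A> F"
    and "free_boundary r1 r2 \<A> F"
    and "minimal \<A> F"
    and "second_form_sqnorm_le \<A> F ((real n)\<^sup>2 / (4 * r2\<^sup>2))"
  shows "(n = 2 \<longrightarrow> totally_geodesic_annulus r1 r2 X \<A> F) \<and>
    (3 \<le> n \<and> r1\<^sup>2 < 4 * (real n - 1) / (real n)\<^sup>2 * r2\<^sup>2 \<longrightarrow>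
       totally_geodesic_annulus r1 r2 X \<A> F) \<and>
    (3 \<le> n \<and> r1\<^sup>2 = 4 * (real n - 1) / (real n)\<^sup>2 * r2\<^sup>2 \<longrightarrow>
       totally_geodesic_annulus r1 r2 X \<A> F \<or> clifford_cone_trunk r1 r2 X F)"
proof -
  interpret fb_minimal n r1 r2 X \<A> F
    by (rule fb_minimal.intro) (fact assms)+
  define K where "K = (real n)\<^sup>2 / (4 * r2\<^sup>2) * r1\<^sup>2"
  have r2: "0 < r2\<^sup>2" "r1\<^sup>2 < r2\<^sup>2" using assms(4,5) by (simp_all add: power_strict_mono)
  have n: "0 < (real n)\<^sup>2" using assms(3) by simp
  have lt: "K < real n - 1 \<longleftrightarrow> r1\<^sup>2 < 4 * (real n - 1) / (real n)\<^sup>2 * r2\<^sup>2"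
    and eq: "K = real n - 1 \<longleftrightarrow> r1\<^sup>2 = 4 * (real n - 1) / (real n)\<^sup>2 * r2\<^sup>2"
    using r2(1) n by (simp_all add: K_def field_simps)
  have flat: "totally_geodesic_annulus r1 r2 X \<A> F" if "K < real n - 1"
    using pinching_dichotomy that flat_conclusion unfolding K_def by force
  \<comment> \<open>For n = 2 the number K is r1^2 / r2^2 < 1.\<close>
  have "K < real n - 1" if "n = 2" using r2 that by (simp add: K_def)
  moreover have "totally_geodesic_annulus r1 r2 X \<A> F \<or> clifford_cone_trunk r1 r2 X F"
    if "3 \<le> n" "K = real n - 1"
    using pinching_dichotomy flat_conclusion rigid_trunk that unfolding K_def by force
  ultimately show ?thesis using flat unfolding lt[symmetric] eq[symmetric] by blast
qed

end
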